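(* There is an open dense subset $\mathcal{P}$ of the space of polygons such that every $\gamma\in\mathcal{P}$ has the following properties: (a) $I(\gamma)$ is a piecewise smooth $1$-manifold whose arc components are proper, the aspect ratio function $\rho:I(\gamma)\to(0,\infty)$ is injective in a neighborhood of each smooth point of $I(\gamma)$, and $\rho^{-1}(1)$ consists entirely of smooth points; (b) the only global components of $I(\gamma)$ belong to $G(\gamma)$, i.e. every global component of $I(\gamma)$ is contained in $G(\gamma)$.
   Context: A polygon is a polygonal Jordan loop in $\mathbb{R}^2$, oriented counterclockwise around the region it bounds. For each $N\ge 3$ the space of labeled $N$-gons is topologized as a subset of $\mathbb{R}^{2N}$ by listing vertices; an open dense subset $\mathcal{P}$ of polygons means a family of sets $\mathcal{P}(N)$, $N\ge3$, with $\mathcal{P}(N)$ open and dense in the space of labeled $N$-gons. Rectangles are non-degenerate. $I(\gamma)\subset(\mathbb{R}^2)^4=\mathbb{R}^8$ is the space of labeled rectangles $(R_0,R_1,R_2,R_3)$ with all vertices on $\gamma$, labeled counterclockwise around the rectangle. $G(\gamma)\subset I(\gamma)$ is the subset of gracefully inscribed rectangles: those for which the cyclic order of the vertices along the counterclockwise oriented $\gamma$ is $(R_0,R_1,R_2,R_3)$. The aspect ratio is $\rho(R)=|R_2-R_1|/|R_1-R_0|$. A piecewise smooth $1$-manifold is a topological $1$-manifold (without boundary) that is a smooth curve in $\mathbb{R}^8$ away from a locally finite set of points; the smooth points are those at which it is smooth. An arc component of $I(\gamma)$ is a connected component homeomorphic to an (open) arc; it is proper if, towards each end, the aspect ratio tends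 to $0$ or to $\infty$, the rectangles at each end accumulate on a chord of $\gamma$ (a non-degenerate segment with endpoints on $\gamma$), and the chords at the two ends are distinct. A hyperbolic component is an arc component along which the aspect ratio tends to $0$ towards one end and to $\infty$ towards the other. The group $\mathbb{Z}/4$ acts freely on $I(\gamma)$ by cyclically relabeling vertices; an elliptic component is a connected component of $I(\gamma)$ stabilized (as a set) by the $\mathbb{Z}/4$ action; it is a loop. A component is global if it is hyperbolic or elliptic. *)

theory Defs
  imports "HOL-Analysis.Analysis" "HOL-Complex_Analysis.Winding_Numbers"
begin

section \<open>Polygons\<close>

text \<open>The plane is modelled by the type \<^typ>\<open>complex\<close>. The vertices of an \<open>N\<close>-gon are
  \<open>v 0, \<dots>, v (N - 1)\<close>; on the interval from \<open>i/N\<close> to \<open>(i+1)/N\<close> the loop below traverses the edge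
  from \<open>v i\<close> to its cyclic successor.\<close>

definition polygon_path :: "nat \<Rightarrow> (nat \<Rightarrow> complex) \<Rightarrow> real \<Rightarrow> complex" where
  "polygon_path N v t =
     (let i = nat \<lfloor>real N * t\<rfloor>
      in linepath (v (i mod N)) (v (Suc i mod N)) (frac (real N * t)))"

text \<open>The vertices of a labeled \<open>N\<close>-gon are listed along its orientation, which is counterclockwise
  around the bounded region. Three consecutive vertices are allowed to be collinear.\<close>

definition is_ngon :: "nat \<Rightarrow> (nat \<Rightarrow> complex) \<Rightarrow> bool" where
  "is_ngon N v \<longleftrightarrow>
     simple_path (polygon_path N v) \<and>
     (\<forall>z \<in> inside (path_image (polygon_path N v)). winding_number (polygon_path N v) z = 1)"

definition ngon_space :: "nat \<Rightarrow> (nat \<Rightarrow> complex) topology" where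
  "ngon_space N = subtopology (product_topology (\<lambda>_. euclidean) {..<N}) {v. is_ngon N v}"


section \<open>Inscribed rectangles\<close>

type_synonym quad = "complex \<times> complex \<times> complex \<times> complex"

text \<open>A parallelogram with a right angle at \<open>R\<^sub>1\<close>. The last condition says that
  \<open>det (R\<^sub>1 - R\<^sub>0, R\<^sub>2 - R\<^sub>1) > 0\<close>: the rectangle is non-degenerate and labeled counterclockwise.\<close>

fun is_rectangle :: "quad \<Rightarrow> bool" where
  "is_rectangle (R0, R1, R2, R3) \<longleftrightarrow>
     R3 - R0 = R2 - R1 \<and> (R1 - R0) \<bullet> (R2 - R1) = 0 \<and> Im (cnj (R1 - R0) * (R2 - R1)) > 0"

fun vertices :: "quad \<Rightarrow> complex set" where
  "vertices (R0, R1, R2, R3) = {R0, R1, R2, R3}"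

fun aspect_ratio :: "quad \<Rightarrow> real" where
  "aspect_ratio (R0, R1, R2, R3) = dist R2 R1 / dist R1 R0"

fun relabel :: "quad \<Rightarrow> quad" where
  "relabel (R0, R1, R2, R3) = (R1, R2, R3, R0)"

definition inscribed :: "(real \<Rightarrow> complex) \<Rightarrow> quad set" where
  "inscribed \<gamma> = {R. is_rectangle R \<and> vertices R \<subseteq> path_image \<gamma>}"

text \<open>For a loop \<open>\<gamma>\<close> on \<open>[0,1]\<close>, the function \<open>\<lambda>s. \<gamma> (frac s)\<close> is its 1-periodic extension.\<close>

fun cyclically_ordered :: "(real \<Rightarrow> complex) \<Rightarrow> quad \<Rightarrow> bool" where
  "cyclically_ordered \<gamma> (R0, R1, R2, R3) \<longleftrightarrow>
     (\<exists>s0 s1 s2 s3. s0 < s1 \<and> s1 < s2 \<and> s2 < s3 \<and> s3 < s0 + 1 \<and>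
        R0 = \<gamma> (frac s0) \<and> R1 = \<gamma> (frac s1) \<and> R2 = \<gamma> (frac s2) \<and> R3 = \<gamma> (frac s3))"

definition gracefully_inscribed :: "(real \<Rightarrow> complex) \<Rightarrow> quad set" where
  "gracefully_inscribed \<gamma> = {R \<in> inscribed \<gamma>. cyclically_ordered \<gamma> R}"


section \<open>Piecewise smooth 1-manifolds\<close>

definition topological_1_manifold :: "'a::topological_space set \<Rightarrow> bool" where
  "topological_1_manifold X \<longleftrightarrow>
     (\<forall>x\<in>X. \<exists>U. openin (top_of_set X) U \<and> x \<in> U \<and> U homeomorphic (UNIV :: real set))"

text \<open>\<open>X\<close> is a smooth curve at \<open>x\<close> if a neighborhood of \<open>x\<close> in \<open>X\<close> is the homeomorphic image of the
  line under a smooth regular parametrization \<open>f\<close>; here \<open>D k\<close> is the \<open>k\<close>-th derivative of \<open>f\<close>.\<close>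

definition smooth_point :: "'a::real_normed_vector set \<Rightarrow> 'a \<Rightarrow> bool" where
  "smooth_point X x \<longleftrightarrow>
     x \<in> X \<and>
     (\<exists>U f g D. openin (top_of_set X) U \<and> x \<in> U \<and> homeomorphism (UNIV :: real set) U f g \<and>
        D 0 = f \<and> (\<forall>k t. (D k has_vector_derivative D (Suc k) t) (at t)) \<and>
        (\<forall>t. D (Suc 0) t \<noteq> 0))"

definition piecewise_smooth_1_manifold :: "'a::real_normed_vector set \<Rightarrow> bool" where
  "piecewise_smooth_1_manifold X \<longleftrightarrow>
     topological_1_manifold X \<and>
     (\<exists>F. locally_finite_in (top_of_set X) ((\<lambda>x. {x}) ` F) \<and> (\<forall>x \<in> X - F. smooth_point X x))"


section \<open>Components\<close>

definition arc_component_param :: "quad set \<Rightarrow> quad set \<Rightarrow> (real \<Rightarrow> quad) \<Rightarrow> bool" where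
  "arc_component_param X C f \<longleftrightarrow>
     C \<in> components X \<and> (\<exists>g. homeomorphism {0<..<1} C f g)"

definition arc_component :: "quad set \<Rightarrow> quad set \<Rightarrow> bool" where
  "arc_component X C \<longleftrightarrow> (\<exists>f. arc_component_param X C f)"

text \<open>The rectangles \<open>f t\<close> accumulate on the chord from \<open>a\<close> to \<open>b\<close>: they converge in \<open>\<real>\<^sup>8\<close> to a
  degenerate rectangle whose vertices are the endpoints of the chord.\<close>

definition ends_at_chord ::
  "(real \<Rightarrow> complex) \<Rightarrow> (real \<Rightarrow> quad) \<Rightarrow> real filter \<Rightarrow> complex set \<Rightarrow> bool" where
  "ends_at_chord \<gamma> f F K \<longleftrightarrow>
     (\<exists>a \<in> path_image \<gamma>. \<exists>b \<in> path_image \<gamma>. a \<noteq> b \<and> K = closed_segment a b \<and>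
        (\<exists>L. (f \<longlongrightarrow> L) F \<and> vertices L = {a, b}))"

definition ratio_to_zero :: "(real \<Rightarrow> quad) \<Rightarrow> real filter \<Rightarrow> bool" where
  "ratio_to_zero f F \<longleftrightarrow> ((\<lambda>t. aspect_ratio (f t)) \<longlongrightarrow> 0) F"

definition ratio_to_infinity :: "(real \<Rightarrow> quad) \<Rightarrow> real filter \<Rightarrow> bool" where
  "ratio_to_infinity f F \<longleftrightarrow> filterlim (\<lambda>t. aspect_ratio (f t)) at_top F"

text \<open>The two ends of an arc component are the filters \<open>at_right 0\<close> and \<open>at_left 1\<close> of a
  parametrization by the open unit interval. Neither definition below depends on the
  parametrization, apart from its direction.\<close>

definition proper_arc :: "(real \<Rightarrow> complex) \<Rightarrow> quad set \<Rightarrow> bool" where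
  "proper_arc \<gamma> C \<longleftrightarrow>
     (\<exists>f K K'. arc_component_param (inscribed \<gamma>) C f \<and>
        (ratio_to_zero f (at_right 0) \<or> ratio_to_infinity f (at_right 0)) \<and>
        (ratio_to_zero f (at_left 1) \<or> ratio_to_infinity f (at_left 1)) \<and>
        ends_at_chord \<gamma> f (at_right 0) K \<and> ends_at_chord \<gamma> f (at_left 1) K' \<and> K \<noteq> K')"

definition hyperbolic :: "(real \<Rightarrow> complex) \<Rightarrow> quad set \<Rightarrow> bool" where
  "hyperbolic \<gamma> C \<longleftrightarrow>
     (\<exists>f. arc_component_param (inscribed \<gamma>) C f \<and>
        ratio_to_zero f (at_right 0) \<and> ratio_to_infinity f (at_left 1))"

definition elliptic :: "(real \<Rightarrow> complex) \<Rightarrow> quad set \<Rightarrow> bool" where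
  "elliptic \<gamma> C \<longleftrightarrow> C \<in> components (inscribed \<gamma>) \<and> relabel ` C = C"

definition global_component :: "(real \<Rightarrow> complex) \<Rightarrow> quad set \<Rightarrow> bool" where
  "global_component \<gamma> C \<longleftrightarrow> hyperbolic \<gamma> C \<or> elliptic \<gamma> C"

end

theory Submission
  imports Defs "HOL-Computational_Algebra.Polynomial"
begin

text \<open>
  Write a rectangle as \<open>z, z + w, z + w + r\<i>w, z + r\<i>w\<close> with first vertex \<open>z\<close>, first side \<open>w\<close> and
  aspect ratio \<open>r\<close>. That its vertices lie on the lines of four given edges is a system of four real
  equations, which for fixed \<open>r\<close> is linear in the four real unknowns \<open>(z, w)\<close>. Where its
  determinant, a quadratic polynomial in \<open>r\<close>, does not vanish there is exactly one solution
  \<open>line_rect\<close>, and it is a rational function of \<open>r\<close>. This explains the local structure of the space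
  of inscribed rectangles. If no vertex of the rectangle is a vertex of the polygon, the aspect
  ratio is a smooth coordinate (\<open>smooth_at_non_corner\<close>). If one vertex of the rectangle is a vertex
  \<open>v i\<close> of the polygon, there are two such curves, one for each edge at \<open>v i\<close>. On each of them that
  vertex of the rectangle passes through \<open>v i\<close> with nonzero velocity, so exactly one half of the
  curve consists of inscribed rectangles, and the two halves fit together to a line
  (\<open>corner_local_line\<close>) which is not smooth (\<open>corner_not_smooth\<close>).

  What a generic polygon has to satisfy is therefore: the determinant does not vanish at inscribed
  rectangles, the vertex passes through \<open>v i\<close> with nonzero velocity, inscribed squares avoid the
  vertices of the polygon, and no two vertices of an inscribed rectangle are vertices of the polygon.
  Each of these is implied by the nonvanishing of finitely many explicit functions of the polygon, an
  open condition. For density, one moves the line of a single edge parallel to itself. All edge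
  directions stay fixed and the signed distances to the lines change linearly, so each function
  becomes a polynomial of degree at most two in the displacement, and it suffices to exhibit one
  nonzero coefficient (\<open>generic_ngon_generic\<close>).

  The rectangles towards an end of an arc component accumulate at degenerate rectangles only. A
  degenerate limit is a chord that ends at a vertex of the polygon and is perpendicular to an edge, or joins two
  vertices; there are finitely many of these, so each end converges (\<open>arc_end_limit\<close>). Close to
  such a chord the rectangle is determined by its aspect ratio (\<open>end_unique\<close>). Hence if both ends
  of an arc approached the same chord, a relabeling would carry a rectangle near one end to a
  rectangle near the other one. It would then map the arc to itself. A continuous map of an interval to itself whose
  fourth power is the identity has a fixed point, but relabeling has none.

  Part (b) holds for every polygon. Let \<open>angle s t\<close> be a continuous argument of the direction from
  the point with parameter \<open>s\<close> to the one with parameter \<open>t\<close>, for \<open>s < t < s + 1\<close>. As in Hopf's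
  proof of the Umlaufsatz, \<open>angle t (s + 1) = angle s t + \<pi>\<close> (\<open>angle_swap\<close>). If the vertices of an inscribed
  rectangle occur along the polygon in the order \<open>R\<^sub>0, R\<^sub>3, R\<^sub>2, R\<^sub>1\<close>, the four turning angles,
  measured with this argument, add up to \<open>2\<pi>\<close>, whereas each of them is \<open>-\<pi>/2\<close> modulo \<open>2\<pi>\<close> because
  the rectangle is traversed clockwise. On an elliptic component the four turning angles coincide,
  since they are constant and permuted by relabeling; so each is \<open>\<pi>/2\<close>, which is impossible. On a
  hyperbolic component each turning angle is a sum of two angles with negative sine, one of which is
  small where the aspect ratio is near \<open>0\<close> and the other one where it is near \<open>\<infinity>\<close>. By continuity
  both stay between \<open>-\<pi>\<close> and \<open>0\<close>, so the turning angles are negative, which is impossible too.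
  The remaining cyclic orders are excluded because the cyclic order of three vertices is locally
  constant, and two vertices joined by a very short side have the same position relative to the
  other two (\<open>forward_relabel_of_flat\<close>).
\<close>

section \<open>Polygons as periodic paths\<close>

definition cyc_vertex :: "nat \<Rightarrow> (nat \<Rightarrow> complex) \<Rightarrow> int \<Rightarrow> complex" where
  "cyc_vertex N v k = v (nat (k mod int N))"

definition edge_vec :: "nat \<Rightarrow> (nat \<Rightarrow> complex) \<Rightarrow> int \<Rightarrow> complex" where
  "edge_vec N v k = cyc_vertex N v (k + 1) - cyc_vertex N v k"

text \<open>The periodic extension of the polygon. Parameters on the whole line spare a case distinction
  at the point where the polygon closes up.\<close>

definition periodic_path :: "nat \<Rightarrow> (nat \<Rightarrow> complex) \<Rightarrow> real \<Rightarrow> complex" where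
  "periodic_path N v s =
     cyc_vertex N v \<lfloor>real N * s\<rfloor> + frac (real N * s) *\<^sub>R edge_vec N v \<lfloor>real N * s\<rfloor>"

lemma no_int_in_unit: "0 < (of_int k::real) \<Longrightarrow> of_int k < (1::real) \<Longrightarrow> False"
  by simp

lemma edge_vec_mod [simp]: "edge_vec N v (k mod int N) = edge_vec N v k"
  by (simp add: edge_vec_def cyc_vertex_def mod_simps)

lemma polygon_path_frac:
  assumes "N > 0"
  shows "polygon_path N v (frac s) = periodic_path N v s"
proof -
  have e: "real N * frac s = real N * s - of_int (int N * \<lfloor>s\<rfloor>)"
    by (simp add: frac_def algebra_simps)
  have fl: "\<lfloor>real N * frac s\<rfloor> = \<lfloor>real N * s\<rfloor> - int N * \<lfloor>s\<rfloor>"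
    unfolding e by linarith
  have fr: "frac (real N * frac s) = frac (real N * s)"
    using fl e by (simp add: frac_def)
  have b: "0 \<le> \<lfloor>real N * frac s\<rfloor>" "\<lfloor>real N * frac s\<rfloor> < int N"
    using assms frac_lt_1[of s] by (auto simp: floor_less_iff)
  define i where "i = nat \<lfloor>real N * frac s\<rfloor>"
  have i: "int i = \<lfloor>real N * s\<rfloor> - int N * \<lfloor>s\<rfloor>" "i < N"
    using b fl unfolding i_def by auto
  have m: "nat (\<lfloor>real N * s\<rfloor> mod int N) = i"
  proof -
    have "\<lfloor>real N * s\<rfloor> = int i + int N * \<lfloor>s\<rfloor>" using i by simp
    then have "\<lfloor>real N * s\<rfloor> mod int N = int i mod int N" by simp
    then show ?thesis using i by simp
  qed
  have m1: "nat ((\<lfloor>real N * s\<rfloor> + 1) mod int N) = Suc i mod N"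
  proof -
    have "\<lfloor>real N * s\<rfloor> + 1 = int (Suc i) + int N * \<lfloor>s\<rfloor>" using i by simp
    then have "(\<lfloor>real N * s\<rfloor> + 1) mod int N = (int (Suc i) + int N * \<lfloor>s\<rfloor>) mod int N"
      by (rule arg_cong)
    then have "(\<lfloor>real N * s\<rfloor> + 1) mod int N = int (Suc i) mod int N" by simp
    then show ?thesis by (metis nat_int of_nat_mod)
  qed
  show ?thesis
    unfolding polygon_path_def periodic_path_def edge_vec_def cyc_vertex_def m m1 Let_def fr i_def[symmetric]
    using i by (simp add: linepath_def algebra_simps)
qed

lemma periodic_path_edge:
  assumes "N > 0" "0 \<le> x" "x \<le> 1"
  shows "periodic_path N v ((of_int k + x) / real N) = cyc_vertex N v k + x *\<^sub>R edge_vec N v k"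
proof (cases "x < 1")
  case True
  have "\<lfloor>of_int k + x\<rfloor> = k" using assms True by linarith
  then show ?thesis using assms by (simp add: periodic_path_def frac_def)
next
  case False
  then have "x = 1" using assms by simp
  moreover have "\<lfloor>of_int k + (1::real)\<rfloor> = k + 1" by linarith
  ultimately show ?thesis using assms by (simp add: periodic_path_def frac_def edge_vec_def)
qed

lemma periodic_path_add_1 [simp]:
  assumes "N > 0" shows "periodic_path N v (s + 1) = periodic_path N v s"
  using polygon_path_frac[OF assms, of v "s+1"] polygon_path_frac[OF assms, of v s] by (simp add: frac_def)

lemma periodic_path_add_int [simp]:
  assumes "N > 0" shows "periodic_path N v (s + of_int k) = periodic_path N v s"
  using polygon_path_frac[OF assms, of v "s + of_int k"] polygon_path_frac[OF assms, of v s] by (simp add: frac_def)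

lemma polygon_path_eq_periodic:
  assumes "N > 0" "0 \<le> s" "s \<le> 1"
  shows "polygon_path N v s = periodic_path N v s"
proof (cases "s < 1")
  case True
  then have "frac s = s" using assms by (simp add: frac_eq)
  then show ?thesis using polygon_path_frac[OF assms(1), of v s] by simp
next
  case False
  then have s: "s = 1" using assms by simp
  have "periodic_path N v 1 = polygon_path N v 0"
    using polygon_path_frac[OF assms(1), of v 1] by simp
  also have "\<dots> = polygon_path N v 1" by (simp add: polygon_path_def Let_def linepath_def frac_def)
  finally show ?thesis using s by simp
qed

lemma path_image_polygon:
  assumes "N > 0"
  shows "path_image (polygon_path N v) = range (periodic_path N v)"
proof
  show "path_image (polygon_path N v) \<subseteq> range (periodic_path N v)"
    using polygon_path_eq_periodic[OF assms] by (auto simp: path_image_def)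
  show "range (periodic_path N v) \<subseteq> path_image (polygon_path N v)"
  proof
    fix z assume "z \<in> range (periodic_path N v)"
    then obtain s where "z = periodic_path N v s" by auto
    then have "z = polygon_path N v (frac s)" using polygon_path_frac[OF assms] by simp
    moreover have "frac s \<in> {0..1}" by (simp add: frac_lt_1 less_imp_le)
    ultimately show "z \<in> path_image (polygon_path N v)" unfolding path_image_def by blast
  qed
qed

text \<open>Two parameters at distance at most \<open>1/N\<close> lie on the same edge or on consecutive edges, so
  their chord is a combination of two consecutive edge vectors with nonnegative coefficients.\<close>

lemma periodic_path_diff_near:
  assumes N: "N > 0" and st: "s \<le> t" "real N * (t - s) \<le> 1"
  obtains k x y where "x \<ge> 0" "y \<ge> 0" "x + y = real N * (t - s)"
    "periodic_path N v t - periodic_path N v s = x *\<^sub>R edge_vec N v k + y *\<^sub>R edge_vec N v (k + 1)"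
proof -
  define k where "k = \<lfloor>real N * s\<rfloor>"
  define x where "x = frac (real N * s)"
  have x: "0 \<le> x" "x < 1" "real N * s = of_int k + x"
    unfolding x_def k_def by (auto simp: frac_lt_1) (simp add: frac_def)
  have s: "s = (of_int k + x) / real N" using x N by (simp add: field_simps)
  have nt: "real N * t \<le> of_int k + x + 1" "of_int k + x \<le> real N * t"
    using st x mult_left_mono[OF st(1), of "real N"] by (simp_all add: algebra_simps)
  show ?thesis
  proof (cases "real N * t \<le> of_int k + 1")
    case True
    define y where "y = real N * t - of_int k"
    have y: "0 \<le> y" "y \<le> 1" "t = (of_int k + y) / real N" using True nt x N
      unfolding y_def by (auto simp: field_simps)
    have "periodic_path N v t - periodic_path N v s = (y - x) *\<^sub>R edge_vec N v k + 0 *\<^sub>R edge_vec N v (k+1)"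
      unfolding y(3) unfolding s using periodic_path_edge[OF N] x y by (simp add: algebra_simps)
    moreover have "y - x \<ge> 0" "y - x + 0 = real N * (t - s)"
      using nt x by (auto simp: y_def algebra_simps)
    ultimately show ?thesis using that[of "y - x" 0 k] by simp
  next
    case False
    define y where "y = real N * t - of_int (k + 1)"
    have y: "0 \<le> y" "y \<le> 1" "t = (of_int (k+1) + y) / real N" using False nt x N
      unfolding y_def by (auto simp: field_simps)
    have "periodic_path N v t - periodic_path N v s = (1 - x) *\<^sub>R edge_vec N v k + y *\<^sub>R edge_vec N v (k+1)"
      unfolding y(3) unfolding s using periodic_path_edge[OF N, of y v "k+1"] periodic_path_edge[OF N, of x v k] x y
      by (simp add: algebra_simps edge_vec_def[of _ _ k])
    moreover have "1 - x \<ge> 0" "(1 - x) + y = real N * (t - s)"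
      using nt x by (auto simp: y_def algebra_simps)
    ultimately show ?thesis using that[of "1 - x" y k] y by simp
  qed
qed

lemma norm_periodic_path_le:
  assumes M: "\<And>k. cmod (cyc_vertex N v k) \<le> M" and "N > 0"
  shows "cmod (periodic_path N v s) \<le> M"
proof -
  define x where "x = frac (real N * s)"
  define k where "k = \<lfloor>real N * s\<rfloor>"
  have x: "0 \<le> x" "x \<le> 1" unfolding x_def by (auto simp: frac_lt_1 less_imp_le)
  have "periodic_path N v s = (1 - x) *\<^sub>R cyc_vertex N v k + x *\<^sub>R cyc_vertex N v (k+1)"
    unfolding periodic_path_def edge_vec_def x_def k_def by (simp add: algebra_simps)
  also have "cmod \<dots> \<le> (1 - x) * cmod (cyc_vertex N v k) + x * cmod (cyc_vertex N v (k+1))"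
    using x by (intro norm_triangle_le) simp
  also have "\<dots> \<le> (1 - x) * M + x * M" using x M by (intro add_mono mult_left_mono) auto
  finally show ?thesis by (simp add: algebra_simps)
qed

lemma periodic_path_Lipschitz:
  assumes M: "\<And>k. cmod (cyc_vertex N v k) \<le> M" and N: "N > 0"
  shows "cmod (periodic_path N v t - periodic_path N v s) \<le> 2 * M * real N * \<bar>t - s\<bar>"
proof -
  have M0: "M \<ge> 0" using M[of 0] norm_ge_zero order_trans by blast
  have E: "cmod (edge_vec N v k) \<le> 2 * M" for k
    unfolding edge_vec_def using norm_triangle_ineq4[of "cyc_vertex N v (k+1)" "cyc_vertex N v k"]
      M[of k] M[of "k+1"] by linarith
  have *: "cmod (periodic_path N v t - periodic_path N v s) \<le> 2 * M * real N * (t - s)" if "s \<le> t" for s t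
  proof (cases "real N * (t - s) \<le> 1")
    case True
    from periodic_path_diff_near[OF N that True, of v] obtain k x y where
      xy: "x \<ge> 0" "y \<ge> 0" "x + y = real N * (t - s)"
      and d: "periodic_path N v t - periodic_path N v s = x *\<^sub>R edge_vec N v k + y *\<^sub>R edge_vec N v (k + 1)"
      by metis
    have "cmod (periodic_path N v t - periodic_path N v s)
        \<le> x * cmod (edge_vec N v k) + y * cmod (edge_vec N v (k+1))"
      unfolding d using xy by (intro norm_triangle_le) simp
    also have "\<dots> \<le> x * (2*M) + y * (2*M)" using xy E by (intro add_mono mult_left_mono) auto
    also have "\<dots> = 2 * M * (x + y)" by (simp add: algebra_simps)
    finally show ?thesis unfolding xy by (simp add: algebra_simps)
  next
    case False
    have "cmod (periodic_path N v t - periodic_path N v s) \<le> 2 * M"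
      using norm_triangle_ineq4[of "periodic_path N v t" "periodic_path N v s"]
        norm_periodic_path_le[of N v M t] norm_periodic_path_le[of N v M s] M N by fastforce
    also have "\<dots> \<le> 2 * M * (real N * (t - s))"
      using False M0 mult_left_mono[of 1 "real N * (t - s)" "2 * M"] by simp
    finally show ?thesis by (simp add: algebra_simps)
  qed
  show ?thesis
    using *[of s t] *[of t s] by (cases "s \<le> t") (auto simp: norm_minus_commute)
qed

lemma cyc_vertex_bound:
  assumes "N > 0" "\<And>i. i < N \<Longrightarrow> cmod (v i) \<le> M"
  shows "cmod (cyc_vertex N v k) \<le> M"
  unfolding cyc_vertex_def using assms by (simp add: nat_less_iff)

lemma cyc_vertex_bounded:
  assumes "N > 0" obtains M where "M > 0" "\<And>k. cmod (cyc_vertex N v k) \<le> M"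
proof -
  define M where "M = 1 + (\<Sum>i<N. cmod (v i))"
  have "cmod (v i) \<le> M" if "i < N" for i
    unfolding M_def using member_le_sum[of i "{..<N}" "\<lambda>i. cmod (v i)"] that by simp
  then have "cmod (cyc_vertex N v k) \<le> M" for k using cyc_vertex_bound assms by blast
  moreover have "M > 0" unfolding M_def by (simp add: add_pos_nonneg sum_nonneg)
  ultimately show ?thesis using that by blast
qed

lemma continuous_on_periodic_path:
  assumes "N > 0" shows "continuous_on S (periodic_path N v)"
proof -
  obtain M where M: "M > 0" "\<And>k. cmod (cyc_vertex N v k) \<le> M" using cyc_vertex_bounded[OF assms] by metis
  have "(2*M*real N)-lipschitz_on S (periodic_path N v)"
    using periodic_path_Lipschitz[of N v M] M assms
    by (intro lipschitz_onI) (auto simp: dist_norm)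
  then show ?thesis by (rule lipschitz_on_continuous_on)
qed

lemma continuous_on_periodic_path_compose [continuous_intros]:
  assumes "N > 0" "continuous_on S f" shows "continuous_on S (\<lambda>x. periodic_path N v (f x))"
  using continuous_on_compose2[OF continuous_on_periodic_path[OF assms(1), of UNIV] assms(2)] by simp

lemma simple_polygon_iff:
  assumes "N > 0"
  shows "simple_path (polygon_path N v) \<longleftrightarrow>
     (\<forall>s t. periodic_path N v s = periodic_path N v t \<longrightarrow> frac s = frac t)"
proof
  assume sp: "simple_path (polygon_path N v)"
  show "\<forall>s t. periodic_path N v s = periodic_path N v t \<longrightarrow> frac s = frac t"
  proof (intro allI impI)
    fix s t assume "periodic_path N v s = periodic_path N v t"
    then have "polygon_path N v (frac s) = polygon_path N v (frac t)"
      using polygon_path_frac[OF assms] by simp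
    moreover have "frac s \<in> {0..1}" "frac t \<in> {0..1}" "frac s \<noteq> 1" "frac t \<noteq> 1"
      using frac_lt_1[of s] frac_lt_1[of t] by auto
    ultimately show "frac s = frac t" using sp unfolding simple_path_def loop_free_def by blast
  qed
next
  assume inj: "\<forall>s t. periodic_path N v s = periodic_path N v t \<longrightarrow> frac s = frac t"
  have "path (polygon_path N v)"
    unfolding path_def using continuous_on_periodic_path[OF assms, of "{0..1}" v]
    by (rule continuous_on_eq) (use polygon_path_eq_periodic[OF assms] in auto)
  moreover have "loop_free (polygon_path N v)"
    unfolding loop_free_def
  proof (intro ballI impI)
    fix x y :: real assume xy: "x \<in> {0..1}" "y \<in> {0..1}" "polygon_path N v x = polygon_path N v y"
    then have "periodic_path N v x = periodic_path N v y"
      using polygon_path_eq_periodic[OF assms] by (metis atLeastAtMost_iff)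
    then have "frac x = frac y" using inj by blast
    then have "x - y = of_int (\<lfloor>x\<rfloor> - \<lfloor>y\<rfloor>)" by (simp add: frac_def)
    then obtain k :: int where "x - y = of_int k" by blast
    moreover have "\<bar>x - y\<bar> \<le> 1" using xy by auto
    ultimately have "k = -1 \<or> k = 0 \<or> k = 1" by linarith
    then show "x = y \<or> x = 0 \<and> y = 1 \<or> x = 1 \<and> y = 0"
      using xy \<open>x - y = of_int k\<close> by auto
  qed
  ultimately show "simple_path (polygon_path N v)" by (simp add: simple_path_def)
qed

text \<open>If a convex combination of two consecutive edge vectors vanished, two points at parameter
  distance \<open>1/N\<close> would coincide.\<close>

lemma consecutive_edges_not_opposite:
  assumes N: "N \<ge> 3" and sp: "simple_path (polygon_path N v)"
  shows "0 \<notin> closed_segment (edge_vec N v k) (edge_vec N v (k + 1))"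
proof
  assume "0 \<in> closed_segment (edge_vec N v k) (edge_vec N v (k + 1))"
  then obtain u where u: "0 \<le> u" "u \<le> 1"
     "0 = (1 - u) *\<^sub>R edge_vec N v k + u *\<^sub>R edge_vec N v (k + 1)"
    by (auto simp: closed_segment_def)
  have N0: "N > 0" using N by simp
  define s where "s = (of_int k + u) / real N"
  define t where "t = (of_int (k + 1) + u) / real N"
  have "periodic_path N v s = cyc_vertex N v k + u *\<^sub>R edge_vec N v k"
    unfolding s_def using u periodic_path_edge[OF N0] by simp
  moreover have "periodic_path N v t = cyc_vertex N v (k+1) + u *\<^sub>R edge_vec N v (k+1)"
    unfolding t_def using u periodic_path_edge[OF N0, of u v "k+1"] by simp
  ultimately have "periodic_path N v t - periodic_path N v s
      = (1 - u) *\<^sub>R edge_vec N v k + u *\<^sub>R edge_vec N v (k + 1)"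
    by (simp add: edge_vec_def[of _ _ k] algebra_simps)
  then have "periodic_path N v s = periodic_path N v t" using u(3) by simp
  then have "frac s = frac t" using sp simple_polygon_iff[OF N0] by blast
  moreover have "t = s + 1 / real N" unfolding s_def t_def by (simp add: add_divide_distrib)
  ultimately have "1 / real N = of_int (\<lfloor>t\<rfloor> - \<lfloor>s\<rfloor>)" by (simp add: frac_def)
  moreover have "0 < 1 / real N" "1 / real N < 1" using N by auto
  ultimately show False using no_int_in_unit by metis
qed

text \<open>A simple polygon has no cusps, so its periodic parametrization is bi-Lipschitz for the
  distance of the circle \<open>\<real>/\<int>\<close>. Near the diagonal this is the previous lemma together with
  compactness; away from the diagonal it is injectivity together with compactness.\<close>

lemma periodic_path_lower_bound:
  assumes N: "N \<ge> 3" and sp: "simple_path (polygon_path N v)"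
  obtains c where "c > 0"
    "\<And>s t. s \<le> t \<Longrightarrow> t \<le> s + 1 \<Longrightarrow>
        c * min (t - s) (1 - (t - s)) \<le> cmod (periodic_path N v t - periodic_path N v s)"
proof -
  have N0: "N > 0" using N by simp
  have "\<exists>c>0. \<forall>z\<in>closed_segment (edge_vec N v k) (edge_vec N v (k + 1)). c \<le> cmod z" for k
    using separate_point_closed[OF closed_segment consecutive_edges_not_opposite[OF N sp]]
    by (simp add: dist_norm)
  then obtain c where c: "\<And>k. c k > 0"
    "\<And>k z. z \<in> closed_segment (edge_vec N v k) (edge_vec N v (k + 1)) \<Longrightarrow> c k \<le> cmod z" by metis
  define c1 where "c1 = Min (c ` {0..<int N})"
  have c1: "c1 > 0" unfolding c1_def using N0 c by (subst Min_gr_iff) auto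
  have c1': "c1 \<le> cmod z" if "z \<in> closed_segment (edge_vec N v k) (edge_vec N v (k + 1))" for k z
  proof -
    have "edge_vec N v (k mod int N + 1) = edge_vec N v (k + 1)"
      by (metis edge_vec_mod mod_add_left_eq)
    then have "z \<in> closed_segment (edge_vec N v (k mod int N)) (edge_vec N v (k mod int N + 1))"
      using that by simp
    then have "c (k mod int N) \<le> cmod z" using c by blast
    moreover have "c1 \<le> c (k mod int N)" unfolding c1_def using N0 by (intro Min_le) auto
    ultimately show ?thesis by simp
  qed
  \<comment> \<open>Nonnegative combinations of two consecutive edge vectors cannot cancel.\<close>
  have cone: "c1 * (x + y) \<le> cmod (x *\<^sub>R edge_vec N v k + y *\<^sub>R edge_vec N v (k + 1))"
    if "x \<ge> 0" "y \<ge> 0" for x y k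
  proof (cases "x + y = 0")
    case False
    then have p: "x + y > 0" using that by simp
    define z where "z = (x/(x+y)) *\<^sub>R edge_vec N v k + (y/(x+y)) *\<^sub>R edge_vec N v (k + 1)"
    have "x / (x+y) = 1 - y/(x+y)" using p by (simp add: field_simps)
    then have "z \<in> closed_segment (edge_vec N v k) (edge_vec N v (k + 1))"
      unfolding z_def closed_segment_def using that p by (intro CollectI exI[of _ "y/(x+y)"], simp)
    then have "c1 \<le> cmod z" by (rule c1')
    moreover have "x *\<^sub>R edge_vec N v k + y *\<^sub>R edge_vec N v (k + 1) = (x + y) *\<^sub>R z"
      unfolding z_def scaleR_add_right scaleR_scaleR using p by simp
    ultimately show ?thesis using p by (simp add: mult.commute)
  qed (use that in auto)
  have near: "c1 * (t - s) \<le> cmod (periodic_path N v t - periodic_path N v s)"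
    if st: "s \<le> t" "real N * (t - s) \<le> 1" for s t
  proof -
    from periodic_path_diff_near[OF N0 st, of v] obtain k x y where
      xy: "x \<ge> 0" "y \<ge> 0" "x + y = real N * (t - s)"
      and d: "periodic_path N v t - periodic_path N v s = x *\<^sub>R edge_vec N v k + y *\<^sub>R edge_vec N v (k + 1)"
      by metis
    have "c1 * (real N * (t - s)) \<le> cmod (periodic_path N v t - periodic_path N v s)"
      unfolding d using cone[OF xy(1,2)] xy(3) by simp
    moreover have "1 * (t - s) \<le> real N * (t - s)" using N st by (intro mult_right_mono) auto
    ultimately show ?thesis using c1
      by (smt (verit, best) mult_left_mono mult_cancel_right1)
  qed
  define K where "K = {0..1::real} \<times> {1/real N..1 - 1/real N}"
  define G where "G = (\<lambda>(s,r). periodic_path N v (s + r) - periodic_path N v s)"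
  have "compact (G ` K)"
    unfolding K_def G_def split_beta
    by (intro compact_continuous_image continuous_intros compact_Times compact_Icc N0)
  moreover have "0 \<notin> G ` K"
  proof
    assume "0 \<in> G ` K"
    then obtain s r where sr: "1/real N \<le> r" "r \<le> 1 - 1/real N"
       "periodic_path N v (s + r) = periodic_path N v s" unfolding G_def K_def by auto
    then have "frac (s + r) = frac s" using sp simple_polygon_iff[OF N0] by blast
    then have "r = of_int (\<lfloor>s + r\<rfloor> - \<lfloor>s\<rfloor>)" by (simp add: frac_def)
    moreover have "0 < 1 / real N" using N by auto
    moreover from this have "0 < r" "r < 1" using sr by linarith+
    ultimately show False using no_int_in_unit by metis
  qed
  ultimately obtain c2 where c2: "c2 > 0" "\<And>z. z \<in> G ` K \<Longrightarrow> c2 \<le> cmod z"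
    using separate_point_closed[of "G ` K" 0] compact_imp_closed by (metis dist_0_norm)
  define cc where "cc = min c1 c2"
  have cc: "cc > 0" "cc \<le> c1" "cc \<le> c2" unfolding cc_def using c1 c2 by auto
  have main: "cc * min (t - s) (1 - (t - s)) \<le> cmod (periodic_path N v t - periodic_path N v s)"
    if st: "s \<le> t" "t \<le> s + 1" for s t
  proof -
    consider "real N * (t - s) \<le> 1" | "real N * (s + 1 - t) \<le> 1"
      | "real N * (t - s) > 1" "real N * (s + 1 - t) > 1" by linarith
    then show ?thesis
    proof cases
      case 1
      have "cc * min (t - s) (1 - (t - s)) \<le> c1 * (t - s)" using cc st by (intro mult_mono) auto
      then show ?thesis using near[OF st(1) 1] by linarith
    next
      case 2
      have "cc * min (t - s) (1 - (t - s)) \<le> c1 * (s + 1 - t)" using cc st by (intro mult_mono) auto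
      moreover have "c1 * (s + 1 - t) \<le> cmod (periodic_path N v (s+1) - periodic_path N v t)"
        using near[of t "s+1"] st 2 by auto
      ultimately show ?thesis using N0 by (simp add: norm_minus_commute)
    next
      case 3
      then have r: "1/real N \<le> t - s" "t - s \<le> 1 - 1/real N" using N0 by (auto simp: field_simps)
      have "G (frac s, t - s) \<in> G ` K" unfolding K_def using r frac_lt_1[of s] by auto
      moreover have "G (frac s, t - s) = periodic_path N v t - periodic_path N v s"
        unfolding G_def using periodic_path_add_int[OF N0, of v "frac s + (t - s)" "\<lfloor>s\<rfloor>"]
          periodic_path_add_int[OF N0, of v "frac s" "\<lfloor>s\<rfloor>"] by (simp add: frac_def)
      ultimately have "c2 \<le> cmod (periodic_path N v t - periodic_path N v s)" using c2 by metis
      moreover have "cc * min (t - s) (1 - (t - s)) \<le> c2 * 1" using cc c2 st by (intro mult_mono) auto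
      ultimately show ?thesis by simp
    qed
  qed
  show ?thesis using that[OF cc(1) main] by blast
qed

section \<open>Small perturbations of polygons\<close>

text \<open>Only the coordinates \<open>v i\<close> with \<open>i < N\<close> matter. Working with this filter on all functions avoids
  the extensional functions that represent the points of \<^const>\<open>ngon_space\<close>.\<close>

definition near_ngon :: "nat \<Rightarrow> (nat \<Rightarrow> complex) \<Rightarrow> (nat \<Rightarrow> complex) filter" where
  "near_ngon N v = (INF e\<in>{0<..}. principal {w. \<forall>i<N. dist (w i) (v i) < e})"

lemma eventually_near_ngon:
  "eventually P (near_ngon N v) \<longleftrightarrow> (\<exists>e>0. \<forall>w. (\<forall>i<N. dist (w i) (v i) < e) \<longrightarrow> P w)"
  unfolding near_ngon_def
proof (subst eventually_INF_base)
  fix a b :: real assume "a \<in> {0<..}" "b \<in> {0<..}"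
  then show "\<exists>x\<in>{0<..}. principal {w. \<forall>i<N. dist (w i) (v i) < x}
      \<le> inf (principal {w. \<forall>i<N. dist (w i) (v i) < a}) (principal {w. \<forall>i<N. dist (w i) (v i) < b})"
    by (intro bexI[of _ "min a b"]) auto
qed (auto simp: eventually_principal intro: exI[of _ 1])

lemma tendsto_near_ngon [tendsto_intros]:
  assumes "i < N" shows "((\<lambda>w. w i) \<longlongrightarrow> v i) (near_ngon N v)"
  unfolding tendsto_iff eventually_near_ngon using assms by blast

lemma periodic_path_diff:
  "periodic_path N (\<lambda>i. w i - v i) s = periodic_path N w s - periodic_path N v s"
  by (simp add: periodic_path_def edge_vec_def cyc_vertex_def algebra_simps)

text \<open>The difference of two polygons is again parametrized linearly by its vertices, hence has a
  small Lipschitz constant; the bi-Lipschitz bound of a simple polygon absorbs it. The winding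
  number around one inner point is preserved by the small homotopy.\<close>

lemma is_ngon_near:
  assumes N: "N \<ge> 3" and v: "is_ngon N v"
  shows "eventually (is_ngon N) (near_ngon N v)"
proof -
  have N0: "N > 0" using N by simp
  let ?p = "polygon_path N v"
  have sp: "simple_path ?p" and wn: "\<And>z. z \<in> inside (path_image ?p) \<Longrightarrow> winding_number ?p z = 1"
    using v unfolding is_ngon_def by auto
  have loop: "pathfinish (polygon_path N w) = pathstart (polygon_path N w)" for w
    using polygon_path_eq_periodic[OF N0, of 0 w] polygon_path_eq_periodic[OF N0, of 1 w]
      periodic_path_add_1[OF N0, of w 0] by (simp add: pathfinish_def pathstart_def)
  obtain c where c: "c > 0" "\<And>s t. s \<le> t \<Longrightarrow> t \<le> s + 1 \<Longrightarrow>
        c * min (t - s) (1 - (t - s)) \<le> cmod (periodic_path N v t - periodic_path N v s)"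
    using periodic_path_lower_bound[OF N sp] by blast
  obtain z0 where z0: "z0 \<in> inside (path_image ?p)"
    using Jordan_inside_outside[OF sp loop] by blast
  have "z0 \<notin> path_image ?p" using z0 inside_no_overlap by blast
  then obtain d where d: "d > 0" "\<And>z. z \<in> path_image ?p \<Longrightarrow> d \<le> dist z0 z"
    using separate_point_closed[OF closed_simple_path_image[OF sp]] by blast
  define e where "e = min d (c / (4 * real N))"
  have e: "e > 0" "e \<le> d" "2 * e * real N < c"
  proof -
    have "e \<le> c / (4 * real N)" unfolding e_def by simp
    then have "e * (4 * real N) \<le> c" using N0 by (simp add: field_simps)
    then show "2 * e * real N < c" using c(1) by linarith
  qed (use c d N0 in \<open>auto simp: e_def\<close>)
  have "is_ngon N w" if w: "\<forall>i<N. dist (w i) (v i) < e" for w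
  proof -
    let ?u = "\<lambda>i. w i - v i"
    have ub: "cmod (cyc_vertex N ?u k) \<le> e" for k
      using w by (intro cyc_vertex_bound[OF N0]) (auto simp: dist_norm intro: less_imp_le)
    have ub': "cmod (cyc_vertex N ?u k) < e" for k
    proof -
      have "nat (k mod int N) < N" using N0 by (simp add: nat_less_iff)
      then show ?thesis using w by (simp add: cyc_vertex_def dist_norm)
    qed
    have inj1: False if "0 \<le> s" "s < t" "t < 1" "periodic_path N w s = periodic_path N w t" for s t
    proof -
      have eq: "periodic_path N v t - periodic_path N v s = - (periodic_path N ?u t - periodic_path N ?u s)"
        using that by (simp add: periodic_path_diff)
      have "cmod (periodic_path N ?u t - periodic_path N ?u s) \<le> 2 * e * real N * (t - s)"
        using periodic_path_Lipschitz[of N ?u e t s, OF ub N0] that by simp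
      moreover have "cmod (periodic_path N ?u t - periodic_path N ?u s) \<le> 2 * e * real N * (1 - (t - s))"
        using periodic_path_Lipschitz[of N ?u e t "s+1", OF ub N0] that
        unfolding periodic_path_add_1[OF N0] by (simp add: algebra_simps)
      ultimately have "cmod (periodic_path N ?u t - periodic_path N ?u s)
          \<le> 2 * e * real N * min (t - s) (1 - (t - s))" by (simp add: min_def)
      moreover have "2 * e * real N * min (t - s) (1 - (t - s)) < c * min (t - s) (1 - (t - s))"
        using e that by (intro mult_strict_right_mono) auto
      moreover have "c * min (t - s) (1 - (t - s)) \<le> cmod (periodic_path N v t - periodic_path N v s)"
        using c(2)[of s t] that by simp
      ultimately show False unfolding eq norm_minus_cancel by linarith
    qed
    have spw: "simple_path (polygon_path N w)"
      unfolding simple_polygon_iff[OF N0]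
    proof (intro allI impI)
      fix s t assume "periodic_path N w s = periodic_path N w t"
      then have eq: "periodic_path N w (frac s) = periodic_path N w (frac t)"
        using periodic_path_add_int[OF N0, of w "frac s" "\<lfloor>s\<rfloor>"]
          periodic_path_add_int[OF N0, of w "frac t" "\<lfloor>t\<rfloor>"] by (simp add: frac_def)
      show "frac s = frac t"
        using inj1[of "frac s" "frac t"] inj1[of "frac t" "frac s"] eq frac_lt_1[of s] frac_lt_1[of t]
        by (metis frac_ge_0 linorder_neqE_linordered_idom)
    qed
    have near: "cmod (polygon_path N w t - ?p t) < cmod (?p t - z0)" if t: "t \<in> {0..1}" for t
    proof -
      have eq: "polygon_path N w t - ?p t = periodic_path N ?u t"
        using t polygon_path_eq_periodic[OF N0] by (simp add: periodic_path_diff)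
      define x where "x = frac (real N * t)"
      define k where "k = \<lfloor>real N * t\<rfloor>"
      have x01: "0 \<le> x" "x < 1" unfolding x_def by (auto simp: frac_lt_1)
      have "periodic_path N ?u t = (1 - x) *\<^sub>R cyc_vertex N ?u k + x *\<^sub>R cyc_vertex N ?u (k+1)"
        unfolding periodic_path_def edge_vec_def x_def k_def by (simp add: algebra_simps)
      also have "cmod \<dots> \<le> (1 - x) * cmod (cyc_vertex N ?u k) + x * cmod (cyc_vertex N ?u (k+1))"
        using x01 by (intro norm_triangle_le) simp
      also have "\<dots> < (1 - x) * e + x * e" using x01 ub' ub
        by (intro add_less_le_mono mult_strict_left_mono mult_left_mono) auto
      finally have "cmod (polygon_path N w t - ?p t) < e" unfolding eq by (simp add: algebra_simps)
      also have "e \<le> dist z0 (?p t)" using e(2) d(2)[of "?p t"] t by (force simp: path_image_def)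
      finally show ?thesis by (simp add: dist_norm norm_minus_commute)
    qed
    \<comment> \<open>The orientation: the homotopy from \<open>v\<close> to \<open>w\<close> avoids the inner point \<open>z0\<close>.\<close>
    have "winding_number (polygon_path N w) z0 = winding_number ?p z0"
    proof (rule winding_number_nearby_loops_eq)
      show "path ?p" "path (polygon_path N w)" using sp spw simple_path_imp_path by auto
      show "pathfinish ?p = pathstart ?p" "pathfinish (polygon_path N w) = pathstart (polygon_path N w)"
        by (rule loop)+
    qed (use near in auto)
    then have wz0: "winding_number (polygon_path N w) z0 = 1" using wn z0 by simp
    have "polygon_path N w t \<noteq> z0" if t: "t \<in> {0..1}" for t
      using near[OF t] by (auto simp: norm_minus_commute)
    then have z0w: "z0 \<notin> path_image (polygon_path N w)" by (force simp: path_image_def)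
    have "z0 \<notin> outside (path_image (polygon_path N w))"
      using winding_number_zero_in_outside[OF simple_path_imp_path[OF spw] loop, of z0] wz0 by auto
    then have z0i: "z0 \<in> inside (path_image (polygon_path N w))"
      using z0w inside_Un_outside[of "path_image (polygon_path N w)"] by blast
    have "winding_number (polygon_path N w) z = 1" if "z \<in> inside (path_image (polygon_path N w))" for z
    proof -
      have "winding_number (polygon_path N w) z = winding_number (polygon_path N w) z0"
        by (rule winding_number_eq[OF simple_path_imp_path[OF spw] loop that z0i])
          (use Jordan_inside_outside[OF spw loop] inside_no_overlap in auto)
      then show ?thesis using wz0 by simp
    qed
    then show ?thesis unfolding is_ngon_def using spw by blast
  qed
  then show ?thesis unfolding eventually_near_ngon using e(1) by blast
qed

text \<open>Openness and density among polygons, for a set that may contain functions that are not polygons.\<close>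

definition ngon_generic :: "nat \<Rightarrow> (nat \<Rightarrow> complex) set \<Rightarrow> bool" where
  "ngon_generic N A \<longleftrightarrow>
     (\<forall>v\<in>A. is_ngon N v \<longrightarrow> eventually (\<lambda>w. w \<in> A) (near_ngon N v)) \<and>
     (\<forall>v e. is_ngon N v \<and> e > 0 \<longrightarrow> (\<exists>w\<in>A. is_ngon N w \<and> (\<forall>i<N. dist (w i) (v i) < e)))"

text \<open>A further condition needs to be checked only at polygons that satisfy the earlier ones, because
  a first perturbation provides these.\<close>

lemma ngon_generic_Int:
  assumes N: "N \<ge> 3" and B: "ngon_generic N B"
    and op: "\<And>v. v \<in> B \<Longrightarrow> v \<in> A \<Longrightarrow> is_ngon N v \<Longrightarrow> eventually (\<lambda>w. w \<in> A) (near_ngon N v)"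
    and dn: "\<And>v e. v \<in> B \<Longrightarrow> is_ngon N v \<Longrightarrow> e > 0 \<Longrightarrow> \<exists>w\<in>A. is_ngon N w \<and> (\<forall>i<N. dist (w i) (v i) < e)"
  shows "ngon_generic N (B \<inter> A)"
  unfolding ngon_generic_def
proof (intro conjI ballI impI allI)
  fix v assume "v \<in> B \<inter> A" "is_ngon N v"
  then show "eventually (\<lambda>w. w \<in> B \<inter> A) (near_ngon N v)"
    using B op unfolding ngon_generic_def by (auto intro!: eventually_conj)
next
  fix v and e :: real assume v: "is_ngon N v \<and> e > 0"
  then obtain w where w: "w \<in> B" "is_ngon N w" "\<forall>i<N. dist (w i) (v i) < e/2"
    using B unfolding ngon_generic_def by (meson half_gt_zero)
  have "eventually (\<lambda>w. w \<in> B) (near_ngon N w)" using B w unfolding ngon_generic_def by blast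
  then obtain e' where e': "e' > 0" "\<And>x. (\<forall>i<N. dist (x i) (w i) < e') \<Longrightarrow> x \<in> B"
    unfolding eventually_near_ngon by blast
  have "0 < min e' (e/2)" using e' v by simp
  then obtain x where x: "x \<in> A" "is_ngon N x" "\<forall>i<N. dist (x i) (w i) < min e' (e/2)"
    using dn[OF w(1,2)] by blast
  have "dist (x i) (v i) < e" if "i < N" for i
    using x(3) w(3) that dist_triangle[of "x i" "v i" "w i"] by fastforce
  moreover have "x \<in> B" using e' x by auto
  ultimately show "\<exists>w\<in>B \<inter> A. is_ngon N w \<and> (\<forall>i<N. dist (w i) (v i) < e)" using x by blast
qed

lemma ngon_generic_INT:
  assumes N: "N \<ge> 3" and B: "ngon_generic N B" and E: "finite E"
    and op: "\<And>j v. j \<in> E \<Longrightarrow> v \<in> B \<Longrightarrow> v \<in> A j \<Longrightarrow> is_ngon N v \<Longrightarrow> eventually (\<lambda>w. w \<in> A j) (near_ngon N v)"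
    and dn: "\<And>j v e. j \<in> E \<Longrightarrow> v \<in> B \<Longrightarrow> is_ngon N v \<Longrightarrow> e > 0 \<Longrightarrow>
        \<exists>w\<in>A j. is_ngon N w \<and> (\<forall>i<N. dist (w i) (v i) < e)"
  shows "ngon_generic N (B \<inter> (\<Inter>j\<in>E. A j))"
  using E op dn
proof (induction E rule: finite_induct)
  case empty
  then show ?case using B by simp
next
  case (insert j E)
  have "ngon_generic N ((B \<inter> (\<Inter>j\<in>E. A j)) \<inter> A j)"
  proof (rule ngon_generic_Int[OF N])
    show "ngon_generic N (B \<inter> (\<Inter>j\<in>E. A j))" using insert by simp
  qed (use insert.prems in auto)
  then show ?case by (simp add: Int_ac)
qed

lemma ngon_generic_UNIV: "ngon_generic N UNIV"
  unfolding ngon_generic_def by auto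

lemma topspace_ngon_space:
  "topspace (ngon_space N) = {v. is_ngon N v} \<inter> extensional {..<N}"
  by (auto simp: ngon_space_def PiE_def)

lemma near_ngon_openin:
  assumes "v \<in> topspace (ngon_space N)" "eventually P (near_ngon N v)"
  obtains U where "openin (ngon_space N) U" "v \<in> U" "\<And>w. w \<in> U \<Longrightarrow> P w"
proof -
  obtain e where e: "e > 0" "\<And>w. (\<forall>i<N. dist (w i) (v i) < e) \<Longrightarrow> P w"
    using assms(2) unfolding eventually_near_ngon by blast
  define W where "W = (\<Pi>\<^sub>E i\<in>{..<N}. ball (v i) e)"
  have "openin (product_topology (\<lambda>_. euclidean) {..<N}) W"
    unfolding W_def by (subst openin_PiE_gen) (auto simp: finite_subset[OF _ finite_lessThan[of N]])
  then have "openin (ngon_space N) (W \<inter> {v. is_ngon N v})"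
    unfolding ngon_space_def by (auto simp: openin_subtopology)
  moreover have "v \<in> W \<inter> {v. is_ngon N v}" using assms(1) e unfolding topspace_ngon_space W_def
    by (auto simp: PiE_def)
  moreover have "P w" if "w \<in> W \<inter> {v. is_ngon N v}" for w
  proof (rule e(2), intro allI impI)
    fix i assume "i < N"
    then show "dist (w i) (v i) < e" using that PiE_mem[of w "{..<N}" "\<lambda>i. ball (v i) e" i]
      unfolding W_def by (simp add: dist_commute)
  qed
  ultimately show ?thesis using that by blast
qed

lemma openin_ngon_space_near:
  assumes "openin (ngon_space N) U" "v \<in> U"
  obtains e where "e > 0" "\<And>w. w \<in> extensional {..<N} \<Longrightarrow> is_ngon N w \<Longrightarrow> (\<forall>i<N. dist (w i) (v i) < e) \<Longrightarrow> w \<in> U"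
proof -
  obtain T where T: "openin (product_topology (\<lambda>_. euclidean) {..<N}) T" "U = T \<inter> {v. is_ngon N v}"
    using assms(1) unfolding ngon_space_def openin_subtopology by blast
  have "v \<in> T" using assms T by blast
  then obtain X where "\<forall>i\<in>{..<N}. openin euclidean (X i)"
      and X: "v \<in> (\<Pi>\<^sub>E i\<in>{..<N}. X i)" "(\<Pi>\<^sub>E i\<in>{..<N}. X i) \<subseteq> T"
  proof -
    have "\<exists>X. finite {i \<in> {..<N}. X i \<noteq> topspace euclidean} \<and> (\<forall>i\<in>{..<N}. openin euclidean (X i)) \<and>
        v \<in> Pi\<^sub>E {..<N} X \<and> Pi\<^sub>E {..<N} X \<subseteq> T"
      by (rule bspec[OF T(1)[unfolded openin_product_topology_alt] \<open>v \<in> T\<close>])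
    then show ?thesis using that by (elim exE conjE)
  qed
  then have Xo: "open (X i)" if "i < N" for i using that open_openin by blast
  have "\<exists>e>0. ball (v i) e \<subseteq> X i" if "i < N" for i
  proof -
    have "v i \<in> X i" using PiE_mem[OF X(1), of i] that by simp
    then show ?thesis using Xo[OF that] by (simp add: open_contains_ball)
  qed
  then obtain e where e: "\<And>i. i < N \<Longrightarrow> e i > 0 \<and> ball (v i) (e i) \<subseteq> X i" by metis
  define e0 where "e0 = Min (insert 1 (e ` {..<N}))"
  have "e0 > 0" unfolding e0_def using e by (subst Min_gr_iff) auto
  moreover have "e0 \<le> e i" if "i < N" for i unfolding e0_def using that by (intro Min_le) auto
  ultimately show ?thesis
  proof (intro that[of e0])
    fix w assume w: "w \<in> extensional {..<N}" "is_ngon N w" "\<forall>i<N. dist (w i) (v i) < e0"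
      and le: "\<And>i. i < N \<Longrightarrow> e0 \<le> e i"
    have "w i \<in> X i" if "i < N" for i
    proof -
      have "dist (w i) (v i) < e i" using w(3) le[OF that] that by (meson less_le_trans)
      then have "w i \<in> ball (v i) (e i)" by (simp add: dist_commute)
      then show ?thesis using e[OF that] by blast
    qed
    then have "w \<in> (\<Pi>\<^sub>E i\<in>{..<N}. X i)" using w(1) by (simp add: PiE_iff)
    then show "w \<in> U" using X(2) w(2) T(2) by blast
  qed auto
qed

lemma ngon_generic_open_dense:
  assumes N: "N \<ge> 3" and A: "ngon_generic N A"
  shows "openin (ngon_space N) (topspace (ngon_space N) \<inter> A)"
    and "ngon_space N closure_of (topspace (ngon_space N) \<inter> A) = topspace (ngon_space N)"
proof -
  show "openin (ngon_space N) (topspace (ngon_space N) \<inter> A)"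
  proof (subst openin_subopen, intro ballI)
    fix v assume v: "v \<in> topspace (ngon_space N) \<inter> A"
    then have "eventually (\<lambda>w. w \<in> A) (near_ngon N v)"
      using A unfolding ngon_generic_def topspace_ngon_space by blast
    then obtain U where U: "openin (ngon_space N) U" "v \<in> U" "\<And>w. w \<in> U \<Longrightarrow> w \<in> A"
      using near_ngon_openin v by blast
    then show "\<exists>T. openin (ngon_space N) T \<and> v \<in> T \<and> T \<subseteq> topspace (ngon_space N) \<inter> A"
      using openin_subset by blast
  qed
  show "ngon_space N closure_of (topspace (ngon_space N) \<inter> A) = topspace (ngon_space N)"
    unfolding dense_intersects_open
  proof (intro allI impI)
    fix T assume "openin (ngon_space N) T \<and> T \<noteq> {}"
    then obtain v where v: "v \<in> T" "openin (ngon_space N) T" by auto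
    then have vt: "v \<in> topspace (ngon_space N)" using openin_subset by blast
    obtain e where e: "e > 0" "\<And>w. w \<in> extensional {..<N} \<Longrightarrow> is_ngon N w \<Longrightarrow> (\<forall>i<N. dist (w i) (v i) < e) \<Longrightarrow> w \<in> T"
      using openin_ngon_space_near[OF v(2,1)] by blast
    obtain w where w: "w \<in> A" "is_ngon N w" "\<forall>i<N. dist (w i) (v i) < e"
      using A vt e(1) unfolding ngon_generic_def topspace_ngon_space by blast
    define x where "x = restrict w {..<N}"
    have agree: "x i = w i" if "i < N" for i using that by (simp add: x_def)
    have "x \<in> A" "is_ngon N x"
    proof -
      have "eventually (\<lambda>w. w \<in> A \<and> is_ngon N w) (near_ngon N w)"
        using A w is_ngon_near[OF N w(2)] unfolding ngon_generic_def by (auto intro: eventually_conj)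
      then obtain d where "d > 0" "\<And>y. (\<forall>i<N. dist (y i) (w i) < d) \<Longrightarrow> y \<in> A \<and> is_ngon N y"
        unfolding eventually_near_ngon by blast
      then show "x \<in> A" "is_ngon N x" using agree by auto
    qed
    moreover have "x \<in> extensional {..<N}" by (simp add: x_def)
    moreover have "\<forall>i<N. dist (x i) (v i) < e" using w agree by simp
    ultimately have "x \<in> T" using e by blast
    then show "topspace (ngon_space N) \<inter> A \<inter> T \<noteq> {}"
      using \<open>x \<in> A\<close> openin_subset[OF v(2)] by blast
  qed
qed

lemma quadratic_nonzero_near_0:
  fixes \<alpha> \<beta> \<gamma> \<epsilon> :: real
  assumes "\<alpha> \<noteq> 0 \<or> \<beta> \<noteq> 0 \<or> \<gamma> \<noteq> 0" "\<epsilon> > 0"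
  obtains t where "\<bar>t\<bar> < \<epsilon>" "\<alpha> + \<beta> * t + \<gamma> * t^2 \<noteq> 0"
proof -
  have "[:\<alpha>, \<beta>, \<gamma>:] \<noteq> 0" using assms(1) by auto
  then have "finite {t. poly [:\<alpha>, \<beta>, \<gamma>:] t = 0}" by (rule poly_roots_finite)
  moreover have "infinite {0<..<\<epsilon>}" using assms(2) by simp
  ultimately obtain t where "t \<in> {0<..<\<epsilon>}" "poly [:\<alpha>, \<beta>, \<gamma>:] t \<noteq> 0"
    by (metis (mono_tags, lifting) finite_subset mem_Collect_eq subsetI)
  then show ?thesis using that[of t] by (auto simp: algebra_simps power2_eq_square)
qed

text \<open>All density arguments end here: along a deformation \<open>V\<close> the function \<open>Q\<close> is a quadratic polynomial,
  and a single nonzero coefficient provides small parameters at which it does not vanish.\<close>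

lemma perturb_quadratic:
  fixes V :: "real \<Rightarrow> nat \<Rightarrow> complex"
  assumes N: "N \<ge> 3" and v: "is_ngon N v"
    and V: "\<And>t i. i < N \<Longrightarrow> dist (V t i) (v i) \<le> C * \<bar>t\<bar>"
    and Q: "\<epsilon> > 0" "\<And>t. \<bar>t\<bar> < \<epsilon> \<Longrightarrow> Q (V t) = \<alpha> + \<beta> * t + \<gamma> * t^2"
    and nz: "\<alpha> \<noteq> 0 \<or> \<beta> \<noteq> 0 \<or> \<gamma> \<noteq> (0::real)" and e: "e > 0"
  shows "\<exists>w. Q w \<noteq> 0 \<and> is_ngon N w \<and> (\<forall>i<N. dist (w i) (v i) < e)"
proof -
  obtain d where d: "d > 0" "\<And>w. (\<forall>i<N. dist (w i) (v i) < d) \<Longrightarrow> is_ngon N w"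
    using is_ngon_near[OF N v] unfolding eventually_near_ngon by blast
  define C' where "C' = \<bar>C\<bar> + 1"
  define \<delta> where "\<delta> = min \<epsilon> (min d e / C')"
  have C': "C' > 0" unfolding C'_def by simp
  have "\<delta> > 0" unfolding \<delta>_def using Q d e C' by simp
  then obtain t where t: "\<bar>t\<bar> < \<delta>" "\<alpha> + \<beta> * t + \<gamma> * t^2 \<noteq> 0"
    using quadratic_nonzero_near_0[OF nz] by blast
  have "dist (V t i) (v i) < min d e" if "i < N" for i
  proof -
    have "dist (V t i) (v i) \<le> C * \<bar>t\<bar>" by (rule V[OF that])
    also have "\<dots> \<le> C' * \<bar>t\<bar>" unfolding C'_def by (intro mult_right_mono) auto
    also have "\<dots> < C' * (min d e / C')" using t(1) C' unfolding \<delta>_def by (intro mult_strict_left_mono) auto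
    finally show ?thesis using C' by simp
  qed
  then show ?thesis using d(2)[of "V t"] Q(2)[of t] t unfolding \<delta>_def
    by (intro exI[of _ "V t"]) auto
qed

section \<open>Generic polygons\<close>

text \<open>The determinant of two vectors in the plane.\<close>

definition cr :: "complex \<Rightarrow> complex \<Rightarrow> real" where
  "cr a b = Im (cnj a * b)"

lemma cr_Re_Im: "cr a b = Re a * Im b - Im a * Re b"
  by (simp add: cr_def)

lemma cr_self [simp]: "cr a a = 0"
  by (simp add: cr_Re_Im)

lemma cr_commute: "cr a b = - cr b a"
  by (simp add: cr_Re_Im algebra_simps)

lemma cr_bilinear [simp]:
  "cr (a + b) c = cr a c + cr b c" "cr a (b + c) = cr a b + cr a c"
  "cr (a - b) c = cr a c - cr b c" "cr a (b - c) = cr a b - cr a c"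
  "cr (r *\<^sub>R a) b = r * cr a b" "cr a (r *\<^sub>R b) = r * cr a b"
  "cr (- a) b = - cr a b" "cr a (- b) = - cr a b" "cr 0 a = 0" "cr a 0 = 0"
  by (simp_all add: cr_Re_Im algebra_simps)

lemma tendsto_cr [tendsto_intros]:
  "(f \<longlongrightarrow> a) F \<Longrightarrow> (g \<longlongrightarrow> b) F \<Longrightarrow> ((\<lambda>x. cr (f x) (g x)) \<longlongrightarrow> cr a b) F"
  unfolding cr_def by (intro tendsto_intros)

lemma continuous_on_cr [continuous_intros]:
  "continuous_on S f \<Longrightarrow> continuous_on S g \<Longrightarrow> continuous_on S (\<lambda>x. cr (f x) (g x))"
  unfolding cr_def by (intro continuous_intros)

lemma cr_inner_zero:
  assumes "cr a b = 0" "a \<bullet> b = 0" "a \<noteq> 0" shows "b = 0"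
proof -
  have "(a \<bullet> a) * (b \<bullet> b) = (cr a b)\<^sup>2 + (a \<bullet> b)\<^sup>2"
    by (simp add: cr_Re_Im inner_complex_def power2_eq_square algebra_simps)
  then show ?thesis using assms by simp
qed

lemma cr_zero_scaleR:
  assumes "cr a b = 0" "norm a = 1" shows "b = (a \<bullet> b) *\<^sub>R a"
proof -
  have "cr a (b - (a \<bullet> b) *\<^sub>R a) = 0" using assms by simp
  moreover have "a \<bullet> (b - (a \<bullet> b) *\<^sub>R a) = 0" using assms by (simp add: inner_diff_right dot_square_norm)
  ultimately have "b - (a \<bullet> b) *\<^sub>R a = 0" using cr_inner_zero assms(2) by fastforce
  then show ?thesis by simp
qed

definition nxt :: "nat \<Rightarrow> nat \<Rightarrow> nat" where "nxt N k = Suc k mod N"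
definition prv :: "nat \<Rightarrow> nat \<Rightarrow> nat" where "prv N k = (if k = 0 then N - 1 else k - 1)"

lemma nxt_prv:
  assumes "N \<ge> 3" "k < N"
  shows "nxt N k < N" "prv N k < N" "nxt N (prv N k) = k" "prv N (nxt N k) = k"
    "nxt N k \<noteq> k" "prv N k \<noteq> k" "nxt N k \<noteq> prv N k" "nxt N (nxt N k) \<noteq> k"
  using assms by (auto simp: nxt_def prv_def mod_Suc split: if_splits)

lemma nxt_eq_iff: assumes "N \<ge> 3" "k < N" "j < N" shows "nxt N k = j \<longleftrightarrow> k = prv N j"
  using nxt_prv[OF assms(1)] assms by auto

definition edir :: "nat \<Rightarrow> (nat \<Rightarrow> complex) \<Rightarrow> nat \<Rightarrow> complex" where
  "edir N v k = sgn (v (nxt N k) - v k)"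

text \<open>The signed distance between \<open>z\<close> and the line of the edge \<open>k\<close>.\<close>

definition ht :: "nat \<Rightarrow> (nat \<Rightarrow> complex) \<Rightarrow> nat \<Rightarrow> complex \<Rightarrow> real" where
  "ht N v k z = cr (edir N v k) (v k - z)"

lemma ngon_vertices_distinct:
  assumes N: "N \<ge> 3" and v: "is_ngon N v" and ij: "i < N" "j < N" "v i = v j"
  shows "i = j"
proof -
  have N0: "N > 0" using N by simp
  have "periodic_path N v (real i / real N) = v i" if "i < N" for i
    using periodic_path_edge[OF N0, of 0 v "int i"] that by (simp add: cyc_vertex_def)
  then have "frac (real i / real N) = frac (real j / real N)"
    using v simple_polygon_iff[OF N0] ij unfolding is_ngon_def by metis
  moreover have "frac (real i / real N) = real i / real N" if "i < N" for i
    using that by (simp add: frac_eq)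
  ultimately show ?thesis using ij N0 by (auto simp: field_simps)
qed

lemma norm_edir:
  assumes "N \<ge> 3" "is_ngon N v" "k < N" shows "norm (edir N v k) = 1"
  using ngon_vertices_distinct[OF assms(1,2), of "nxt N k" k] nxt_prv[OF assms(1,3)] assms(3)
  by (auto simp: edir_def norm_sgn)

lemma edge_eq_edir: "v (nxt N k) - v k = norm (v (nxt N k) - v k) *\<^sub>R edir N v k"
  by (cases "v (nxt N k) = v k") (auto simp: edir_def sgn_div_norm)

lemma tendsto_edir:
  assumes "N \<ge> 3" "is_ngon N v" "k < N"
  shows "((\<lambda>w. edir N w k) \<longlongrightarrow> edir N v k) (near_ngon N v)"
proof -
  have "v (nxt N k) - v k \<noteq> 0"
    using ngon_vertices_distinct[OF assms(1,2), of "nxt N k" k] nxt_prv[OF assms(1,3)] assms(3) by auto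
  then show ?thesis unfolding edir_def using nxt_prv[OF assms(1,3)] assms(3)
    by (intro tendsto_intros) auto
qed

text \<open>The compatibility condition of the overdetermined system \<open>cr b w = x\<close>,
  \<open>cr c (w + r\<i>w) = y\<close>, \<open>r (d \<bullet> w) = z\<close> for the side \<open>w\<close>, as a quadratic polynomial in \<open>r\<close>.\<close>

definition corner_poly :: "complex \<Rightarrow> complex \<Rightarrow> complex \<Rightarrow> real \<Rightarrow> real \<Rightarrow> real \<Rightarrow> real \<Rightarrow> real" where
  "corner_poly b c d x y z r =
     r\<^sup>2 * (x * cr c d) + r * (y * (b \<bullet> d) - x * (c \<bullet> d) - z * (b \<bullet> c)) + z * cr b c"

text \<open>The linear coefficient of \<^const>\<open>corner_poly\<close>.\<close>

definition cp_lin :: "complex \<Rightarrow> complex \<Rightarrow> complex \<Rightarrow> real \<Rightarrow> real \<Rightarrow> real \<Rightarrow> real" where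
  "cp_lin b c d x y z = y * (b \<bullet> d) - x * (c \<bullet> d) - z * (b \<bullet> c)"

text \<open>The resultant of two quadratic polynomials, given by their coefficients.\<close>

definition res2 :: "real \<Rightarrow> real \<Rightarrow> real \<Rightarrow> real \<Rightarrow> real \<Rightarrow> real \<Rightarrow> real" where
  "res2 p0 p1 p2 q0 q1 q2 = (p0 * q2 - p2 * q0)\<^sup>2 - (p0 * q1 - p1 * q0) * (p1 * q2 - p2 * q1)"

lemma res2_common_root:
  assumes "p0 + p1 * r + p2 * r\<^sup>2 = 0" "q0 + q1 * r + q2 * r\<^sup>2 = (0::real)"
  shows "res2 p0 p1 p2 q0 q1 q2 = 0"
proof -
  have p0: "p0 = - (p1 * r + p2 * r\<^sup>2)" and q0: "q0 = - (q1 * r + q2 * r\<^sup>2)" using assms by linarith+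
  show ?thesis unfolding res2_def p0 q0 by (simp add: power2_eq_square algebra_simps)
qed

text \<open>The five functions that must not vanish. For a rectangle with first vertex \<open>v i\<close> and the other
  vertices on the lines of \<open>b\<close>, \<open>c\<close>, \<open>d\<close>, the condition on the aspect ratio \<open>r\<close> is a quadratic
  equation; \<open>gdisc\<close> is its discriminant, and \<open>gsquare\<close> its value at \<open>r = 1\<close>. For rectangles on the
  lines of \<open>a\<close>, \<open>b\<close>, \<open>c\<close>, \<open>d\<close>, the determinant of the linear system is \<open>p0 + p1 r + p2 r\<^sup>2\<close>; where it
  vanishes, the system has a solution only if the polynomial \<open>q0 + q1 r + q2 r\<^sup>2\<close> vanishes as well,
  where \<open>v j\<close> is any vertex on the line of \<open>a\<close>. Their resultant is \<open>gres\<close>. If \<open>a = b\<close> or \<open>c = d\<close>, both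
  quadratic coefficients vanish, and if \<open>b = c\<close> or \<open>a = d\<close>, both constant coefficients do; then the
  resultant of the remaining linear polynomials is taken. Finally \<open>gside\<close> and \<open>gdiag\<close> vanish if \<open>v i\<close>
  and \<open>v k\<close> are the ends of a side or of a diagonal of a rectangle whose other vertices lie on
  the lines of the two given edges.\<close>

definition gdisc where
  "gdisc N v i b c d =
    (let u = edir N v; h = (\<lambda>k. ht N v k (v i)) in
     (cp_lin (u b) (u c) (u d) (h b) (h c) (h d))\<^sup>2 - 4 * (h d * cr (u b) (u c)) * (h b * cr (u c) (u d)))"

definition gsquare where
  "gsquare N v i b c d =
    (let u = edir N v; h = (\<lambda>k. ht N v k (v i)) in corner_poly (u b) (u c) (u d) (h b) (h c) (h d) 1)"

definition gres where
  "gres N v j a b c d =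
    (let u = edir N v; h = (\<lambda>k. ht N v k (v j));
         p0 = cr (u d) (u a) * cr (u b) (u c);
         p1 = cp_lin (u b) (u c) (u d) (cr (u b) (u a)) (cr (u c) (u a)) (cr (u d) (u a));
         p2 = cr (u b) (u a) * cr (u c) (u d);
         q0 = h d * cr (u b) (u c);
         q1 = cp_lin (u b) (u c) (u d) (h b) (h c) (h d);
         q2 = h b * cr (u c) (u d)
     in if a = b \<or> c = d then p0 * q1 - p1 * q0
        else if b = c \<or> a = d then p1 * q2 - p2 * q1
        else res2 p0 p1 p2 q0 q1 q2)"

definition gside where
  "gside N v i k c d =
     ht N v d (v i) * (edir N v c \<bullet> (v k - v i)) - ht N v c (v k) * (edir N v d \<bullet> (v k - v i))"

definition gdiag where
  "gdiag N v i k b d =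
    (let u = edir N v; h = (\<lambda>j. ht N v j (v i)); h' = (\<lambda>j. ht N v j (v k)) in
     if b = d then h b + h' b
     else h' d * h' b * (u b \<bullet> u d) + h' d * h d + h b * h' b + h b * h d * (u b \<bullet> u d))"

text \<open>Equivalently, at least three of the four edges are different. For inscribed rectangles this is
  the lemma \<open>on_edges_valid4\<close> below.\<close>

definition valid4 :: "nat \<Rightarrow> nat \<Rightarrow> nat \<Rightarrow> nat \<Rightarrow> bool" where
  "valid4 a b c d \<longleftrightarrow>
    \<not> (a = b \<and> c = d) \<and> \<not> (a = c \<and> b = d) \<and> \<not> (a = d \<and> b = c) \<and>
    \<not> (a = b \<and> b = c) \<and> \<not> (a = b \<and> b = d) \<and> \<not> (a = c \<and> c = d) \<and> \<not> (b = c \<and> c = d)"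

text \<open>The edge patterns of rectangles with first vertex \<open>v i\<close>, which lies on both edges \<open>i\<close> and \<open>prv N i\<close>.
  If the neighbours of that vertex were on these two edges, the edges would be perpendicular.\<close>

definition validc :: "nat \<Rightarrow> nat \<Rightarrow> nat \<Rightarrow> nat \<Rightarrow> nat \<Rightarrow> bool" where
  "validc N i b c d \<longleftrightarrow> valid4 i b c d \<and> valid4 (prv N i) b c d \<and> {b, d} \<noteq> {i, prv N i}"

definition edge_end :: "nat \<Rightarrow> nat \<Rightarrow> nat \<Rightarrow> bool" where
  "edge_end N i k \<longleftrightarrow> k = i \<or> k = prv N i"

text \<open>No edge is perpendicular to a line through two vertices; no edge is parallel to such a line,
  unless the two vertices are its own end points; and no edge direction is obtained from another one by a rotation by 45 or 225
  degrees, which matters for inscribed squares.\<close>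

definition basic_generic :: "nat \<Rightarrow> (nat \<Rightarrow> complex) \<Rightarrow> bool" where
  "basic_generic N v \<longleftrightarrow>
    (\<forall>k<N. \<forall>i<N. \<forall>j<N. i \<noteq> j \<longrightarrow> edir N v k \<bullet> (v j - v i) \<noteq> 0) \<and>
    (\<forall>k<N. \<forall>i<N. \<forall>j<N. i \<noteq> j \<longrightarrow> {i,j} \<noteq> {k, nxt N k} \<longrightarrow> cr (edir N v k) (v j - v i) \<noteq> 0) \<and>
    (\<forall>k<N. \<forall>l<N. cr (edir N v k) (edir N v l) \<noteq> edir N v k \<bullet> edir N v l)"

text \<open>In the resultant condition the base point may be either end of the edge \<open>a\<close>; the end is chosen
  so that it does not lie on the edge that is moved in the density argument.\<close>

definition res_edge :: "nat \<Rightarrow> nat \<Rightarrow> nat \<Rightarrow> nat \<Rightarrow> nat" where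
  "res_edge a b c d = (if c = a \<or> c = d then b else c)"

definition generic_ngon :: "nat \<Rightarrow> (nat \<Rightarrow> complex) \<Rightarrow> bool" where
  "generic_ngon N v \<longleftrightarrow> basic_generic N v \<and>
    (\<forall>i<N. \<forall>b<N. \<forall>c<N. \<forall>d<N. validc N i b c d \<longrightarrow> gdisc N v i b c d \<noteq> 0 \<and> gsquare N v i b c d \<noteq> 0) \<and>
    (\<forall>a<N. \<forall>b<N. \<forall>c<N. \<forall>d<N. \<forall>j<N. valid4 a b c d \<longrightarrow> j = a \<or> j = nxt N a \<longrightarrow>
        \<not> edge_end N j (res_edge a b c d) \<longrightarrow> gres N v j a b c d \<noteq> 0) \<and>
    (\<forall>i<N. \<forall>k<N. \<forall>c<N. \<forall>d<N. i \<noteq> k \<longrightarrow> c \<noteq> d \<longrightarrow> \<not> edge_end N k c \<longrightarrow> \<not> edge_end N i d \<longrightarrow>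
        \<not> (edge_end N i c \<and> edge_end N k d) \<longrightarrow> gside N v i k c d \<noteq> 0) \<and>
    (\<forall>i<N. \<forall>k<N. \<forall>b<N. \<forall>d<N. i \<noteq> k \<longrightarrow>
        \<not> edge_end N i b \<and> \<not> edge_end N k b \<or> \<not> edge_end N i d \<and> \<not> edge_end N k d \<longrightarrow>
        gdiag N v i k b d \<noteq> 0)"

lemma basic_genericD:
  assumes "basic_generic N v"
  shows "k < N \<Longrightarrow> i < N \<Longrightarrow> j < N \<Longrightarrow> i \<noteq> j \<Longrightarrow> edir N v k \<bullet> (v j - v i) \<noteq> 0"
    and "k < N \<Longrightarrow> i < N \<Longrightarrow> j < N \<Longrightarrow> i \<noteq> j \<Longrightarrow> {i,j} \<noteq> {k, nxt N k} \<Longrightarrow> cr (edir N v k) (v j - v i) \<noteq> 0"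
    and "k < N \<Longrightarrow> l < N \<Longrightarrow> cr (edir N v k) (edir N v l) \<noteq> edir N v k \<bullet> edir N v l"
  using assms unfolding basic_generic_def by simp_all

lemma basic_edges:
  assumes N: "N \<ge> 3" and v: "is_ngon N v" and g: "basic_generic N v" and kl: "k < N" "l < N"
  shows "edir N v k \<bullet> edir N v l \<noteq> 0" "k \<noteq> l \<Longrightarrow> cr (edir N v k) (edir N v l) \<noteq> 0"
proof -
  note n = nxt_prv[OF N kl(2)]
  have e: "v (nxt N l) - v l = norm (v (nxt N l) - v l) *\<^sub>R edir N v l" by (rule edge_eq_edir)
  have "edir N v k \<bullet> (v (nxt N l) - v l) \<noteq> 0" using basic_genericD(1)[OF g kl n(1)] n by auto
  then show "edir N v k \<bullet> edir N v l \<noteq> 0" by (subst (asm) e) auto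
  assume "k \<noteq> l"
  then have "{l, nxt N l} \<noteq> {k, nxt N k}"
    using n nxt_prv[OF N kl(1)] by (auto simp: doubleton_eq_iff)
  then have "cr (edir N v k) (v (nxt N l) - v l) \<noteq> 0"
    using basic_genericD(2)[OF g kl n(1)] n by auto
  then show "cr (edir N v k) (edir N v l) \<noteq> 0" by (subst (asm) e) auto
qed

lemma ht_vertex:
  assumes N: "N \<ge> 3" and v: "is_ngon N v" and ki: "k < N" "i < N"
  shows "edge_end N i k \<Longrightarrow> ht N v k (v i) = 0"
    and "basic_generic N v \<Longrightarrow> \<not> edge_end N i k \<Longrightarrow> ht N v k (v i) \<noteq> 0"
proof -
  show "ht N v k (v i) = 0" if "edge_end N i k"
  proof (cases "k = i")
    case False
    then have "i = nxt N k" using that nxt_prv[OF N ki(2)] by (auto simp: edge_end_def)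
    moreover have "cr (edir N v k) (v (nxt N k) - v k) = 0" by (subst edge_eq_edir[of v N k]) simp
    ultimately show ?thesis by (simp add: ht_def)
  qed (simp add: ht_def)
  show "ht N v k (v i) \<noteq> 0" if g: "basic_generic N v" and e: "\<not> edge_end N i k"
  proof -
    have "{i, k} \<noteq> {k, nxt N k}" using e nxt_prv[OF N ki(1)] by (auto simp: edge_end_def doubleton_eq_iff)
    then show ?thesis unfolding ht_def using basic_genericD(2)[OF g ki(1) ki(2) ki(1)] e
      by (auto simp: edge_end_def)
  qed
qed

lemma sgn_scaleR_unit: "r > 0 \<Longrightarrow> norm u = 1 \<Longrightarrow> sgn (r *\<^sub>R u) = (u::complex)"
  by (simp add: sgn_scaleR sgn_div_norm)

text \<open>Moving the line of one edge parallel to itself. The two vertices on it slide along the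
  neighbouring edges, so no edge direction changes.\<close>

lemma shift_edge:
  assumes N: "N \<ge> 3" and v: "is_ngon N v" and g: "basic_generic N v" and m: "m < N"
  obtains V C \<epsilon> where "\<epsilon> > 0" "\<And>t i. dist (V t i) (v i) \<le> C * \<bar>t\<bar>"
    "\<And>t k. \<bar>t\<bar> < \<epsilon> \<Longrightarrow> k < N \<Longrightarrow> edir N (V t) k = edir N v k"
    "\<And>t k z. \<bar>t\<bar> < \<epsilon> \<Longrightarrow> k < N \<Longrightarrow> ht N (V t) k z = ht N v k z + (if k = m then t else 0)"
    "\<And>t i. i < N \<Longrightarrow> \<not> edge_end N i m \<Longrightarrow> V t i = v i"
proof -
  define u where "u = edir N v"
  define p n where "p = prv N m" and "n = nxt N m"
  note np = nxt_prv[OF N m, folded p_def n_def]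
  have nn: "nxt N n < N" "nxt N n \<noteq> n" "nxt N n \<noteq> m"
    using nxt_prv[OF N np(1)] nxt_prv[OF N m] np by (auto simp: n_def)
  have up: "cr (u m) (u p) \<noteq> 0" "cr (u m) (u n) \<noteq> 0"
    unfolding u_def using basic_edges(2)[OF N v g m] np by metis+
  have u1: "norm (u k) = 1" if "k < N" for k unfolding u_def using norm_edir[OF N v that] .
  define x where "x = (1 / cr (u m) (u p)) *\<^sub>R u p"
  define y where "y = (1 / cr (u m) (u n)) *\<^sub>R u n"
  define V where "V = (\<lambda>t. v(m := v m + t *\<^sub>R x, n := v n + t *\<^sub>R y))"
  have Vm: "V t m = v m + t *\<^sub>R x" "V t n = v n + t *\<^sub>R y" for t using np by (auto simp: V_def)
  have Vo: "V t i = v i" if "i \<noteq> m" "i \<noteq> n" for t i using that by (simp add: V_def)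
  have crx: "cr (u m) x = 1" "cr (u m) y = 1" using up by (simp_all add: x_def y_def)
  define len where "len = (\<lambda>k. norm (v (nxt N k) - v k))"
  have len: "len k > 0" if "k < N" for k
    unfolding len_def using ngon_vertices_distinct[OF N v, of "nxt N k" k] nxt_prv[OF N that] that by auto
  have ed: "v (nxt N k) - v k = len k *\<^sub>R u k" for k unfolding len_def u_def by (rule edge_eq_edir)
  define \<mu> where "\<mu> = u m \<bullet> (y - x)"
  have yx: "y - x = \<mu> *\<^sub>R u m" unfolding \<mu>_def
    using cr_zero_scaleR[of "u m" "y - x"] crx u1[OF m] by simp
  define M where "M = \<bar>\<mu>\<bar> + \<bar>1 / cr (u m) (u p)\<bar> + \<bar>1 / cr (u m) (u n)\<bar> + 1"
  define l0 where "l0 = min (len m) (min (len p) (len n))"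
  define \<epsilon> where "\<epsilon> = l0 / M"
  have M: "M > 0" unfolding M_def by linarith
  have l0: "l0 > 0" unfolding l0_def using len np m by simp
  have \<epsilon>: "\<epsilon> > 0" unfolding \<epsilon>_def using M l0 by simp
  have small: "\<bar>t * s\<bar> < l0" if "\<bar>t\<bar> < \<epsilon>" "\<bar>s\<bar> \<le> M" for t s
  proof -
    have "\<bar>t * s\<bar> \<le> \<bar>t\<bar> * M" using that by (simp add: abs_mult mult_left_mono)
    also have "\<dots> < \<epsilon> * M" using that M by simp
    finally show ?thesis using M by (simp add: \<epsilon>_def)
  qed
  have edge: "\<exists>l>0. V t (nxt N k) - V t k = l *\<^sub>R u k" if t: "\<bar>t\<bar> < \<epsilon>" and k: "k < N" for t k
  proof -
    consider "k = m" | "k = p" | "k = n" | "k \<noteq> m" "k \<noteq> p" "k \<noteq> n" by blast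
    then show ?thesis
    proof cases
      case 1
      have "V t (nxt N k) - V t k = (v n - v m) + t *\<^sub>R (y - x)"
        using 1 Vm by (simp add: n_def[symmetric] algebra_simps)
      also have "\<dots> = (len m + t * \<mu>) *\<^sub>R u m" using ed[of m] yx by (simp add: n_def algebra_simps)
      finally have "V t (nxt N k) - V t k = (len m + t * \<mu>) *\<^sub>R u m" .
      moreover have "\<bar>t * \<mu>\<bar> < l0" by (rule small[OF t]) (auto simp: M_def)
      then have "len m + t * \<mu> > 0" unfolding l0_def by linarith
      ultimately show ?thesis using 1 by blast
    next
      case 2
      have "V t (nxt N k) - V t k = (v m - v p) + t *\<^sub>R x"
        using 2 Vm Vo[of p t] np by (simp add: algebra_simps)
      also have "\<dots> = (len p + t * (1 / cr (u m) (u p))) *\<^sub>R u p"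
        using ed[of p] np by (simp add: x_def algebra_simps)
      finally have "V t (nxt N k) - V t k = (len p + t * (1 / cr (u m) (u p))) *\<^sub>R u p" .
      moreover have "\<bar>t * (1 / cr (u m) (u p))\<bar> < l0" by (rule small[OF t]) (auto simp: M_def)
      then have "len p + t * (1 / cr (u m) (u p)) > 0" unfolding l0_def by linarith
      ultimately show ?thesis using 2 by blast
    next
      case 3
      have "V t (nxt N k) - V t k = (v (nxt N n) - v n) - t *\<^sub>R y"
        using 3 Vm Vo[of "nxt N n" t] nn by (simp add: algebra_simps)
      also have "\<dots> = (len n - t * (1 / cr (u m) (u n))) *\<^sub>R u n"
        using ed[of n] by (simp add: y_def algebra_simps)
      finally have "V t (nxt N k) - V t k = (len n - t * (1 / cr (u m) (u n))) *\<^sub>R u n" .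
      moreover have "\<bar>t * (1 / cr (u m) (u n))\<bar> < l0" by (rule small[OF t]) (auto simp: M_def)
      then have "len n - t * (1 / cr (u m) (u n)) > 0" unfolding l0_def by linarith
      ultimately show ?thesis using 3 by blast
    next
      case 4
      have "nxt N k \<noteq> m" "nxt N k \<noteq> n"
        using 4 nxt_prv[OF N k] nxt_eq_iff[OF N k m] nxt_eq_iff[OF N k np(1)] np
        by (auto simp: p_def)
      then have "V t (nxt N k) - V t k = len k *\<^sub>R u k" using 4 Vo ed by simp
      then show ?thesis using len[OF k] by blast
    qed
  qed
  have E: "edir N (V t) k = edir N v k" if t: "\<bar>t\<bar> < \<epsilon>" and k: "k < N" for t k
  proof -
    obtain l where "l > 0" "V t (nxt N k) - V t k = l *\<^sub>R u k" using edge[OF t k] by blast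
    then show ?thesis using u1[OF k] sgn_scaleR_unit[of l "u k"] by (simp add: edir_def[of N "V t"] u_def)
  qed
  have Hh: "ht N (V t) k z = ht N v k z + (if k = m then t else 0)" if t: "\<bar>t\<bar> < \<epsilon>" and k: "k < N" for t k z
  proof -
    consider "k = m" | "k = n" | "k \<noteq> m" "k \<noteq> n" by blast
    then show ?thesis
    proof cases
      case 1
      then show ?thesis unfolding ht_def E[OF t k] using Vm crx by (simp add: u_def)
    next
      case 2
      have "cr (u n) y = 0" by (simp add: y_def)
      then show ?thesis unfolding ht_def E[OF t k] using Vm 2 np by (simp add: u_def)
    next
      case 3
      then show ?thesis unfolding ht_def E[OF t k] using Vo by simp
    qed
  qed
  have D: "dist (V t i) (v i) \<le> (norm x + norm y) * \<bar>t\<bar>" for t i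
    using Vm Vo by (cases "i = m"; cases "i = n") (auto simp: dist_norm algebra_simps)
  have F: "V t i = v i" if "i < N" "\<not> edge_end N i m" for t i
    using Vo[of i t] that nxt_eq_iff[OF N m that(1)] by (auto simp: edge_end_def n_def)
  show ?thesis using that[OF \<epsilon> D E Hh F] by blast
qed

text \<open>The functions of \<^const>\<open>generic_ngon\<close> are built from edge directions, heights, and vertices that are not
  on the moved edge. So \<open>Q\<close> is all that remains to be computed for each of them.\<close>

lemma perturb_shift:
  assumes N: "N \<ge> 3" and v: "is_ngon N v" and g: "basic_generic N v" and m: "m < N"
    and Q: "\<And>v' t. (\<And>k. k < N \<Longrightarrow> edir N v' k = edir N v k) \<Longrightarrow>
       (\<And>k z. k < N \<Longrightarrow> ht N v' k z = ht N v k z + (if k = m then t else 0)) \<Longrightarrow>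
       (\<And>i. i < N \<Longrightarrow> \<not> edge_end N i m \<Longrightarrow> v' i = v i) \<Longrightarrow> Q v' = \<alpha> + \<beta> * t + \<gamma> * t\<^sup>2"
    and nz: "\<alpha> \<noteq> 0 \<or> \<beta> \<noteq> 0 \<or> \<gamma> \<noteq> (0::real)" and e: "e > 0"
  shows "\<exists>w\<in>{w. Q w \<noteq> 0}. is_ngon N w \<and> (\<forall>i<N. dist (w i) (v i) < e)"
proof -
  obtain V C \<epsilon> where V: "\<epsilon> > 0" "\<And>t i. dist (V t i) (v i) \<le> C * \<bar>t\<bar>"
    "\<And>t k. \<bar>t\<bar> < \<epsilon> \<Longrightarrow> k < N \<Longrightarrow> edir N (V t) k = edir N v k"
    "\<And>t k z. \<bar>t\<bar> < \<epsilon> \<Longrightarrow> k < N \<Longrightarrow> ht N (V t) k z = ht N v k z + (if k = m then t else 0)"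
    "\<And>t i. i < N \<Longrightarrow> \<not> edge_end N i m \<Longrightarrow> V t i = v i"
    using shift_edge[OF N v g m] by metis
  have "Q (V t) = \<alpha> + \<beta> * t + \<gamma> * t\<^sup>2" if "\<bar>t\<bar> < \<epsilon>" for t
    using V(3,4,5) that by (intro Q) auto
  then show ?thesis using perturb_quadratic[OF N v V(2) V(1) _ nz e, of Q] by auto
qed

section \<open>Density of the generic conditions\<close>

text \<open>Moving each vertex \<open>v i\<close> in the direction \<open>w i\<close> makes the condition quadratic in the displacement, with
  leading coefficient \<open>f (w a - w b) (w c - w d)\<close>. This provides the first, coarse conditions, before
  any edge can be moved parallel to itself.\<close>

lemma perturb_bilinear:
  fixes f :: "complex \<Rightarrow> complex \<Rightarrow> real"
  assumes N: "N \<ge> 3" and v: "is_ngon N v" and e: "e > 0"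
    and f: "\<And>x y x' y' t. f (x + t *\<^sub>R y) (x' + t *\<^sub>R y') = f x x' + (f x y' + f y x') * t + f y y' * t\<^sup>2"
    and w: "f (w a - w b) (w c - w d) \<noteq> 0"
  shows "\<exists>x\<in>{v. f (v a - v b) (v c - v d) \<noteq> 0}. is_ngon N x \<and> (\<forall>i<N. dist (x i) (v i) < e)"
proof -
  define V where "V = (\<lambda>t i. v i + t *\<^sub>R w i)"
  have "dist (V t i) (v i) \<le> (\<Sum>i<N. norm (w i)) * \<bar>t\<bar>" if "i < N" for t i
  proof -
    have "norm (w i) \<le> (\<Sum>i<N. norm (w i))" using that by (intro member_le_sum) auto
    then show ?thesis by (simp add: V_def dist_norm mult.commute mult_left_mono)
  qed
  moreover have "f (V t a - V t b) (V t c - V t d) = f (v a - v b) (v c - v d)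
     + (f (v a - v b) (w c - w d) + f (w a - w b) (v c - v d)) * t + f (w a - w b) (w c - w d) * t\<^sup>2" for t
    unfolding f[symmetric] V_def by (simp add: algebra_simps)
  ultimately show ?thesis
    using perturb_quadratic[OF N v, of V "\<Sum>i<N. norm (w i)" 1 "\<lambda>v. f (v a - v b) (v c - v d)"] w e by auto
qed

lemma eventually_nonzero:
  fixes Q :: "'a \<Rightarrow> real"
  assumes "(Q \<longlongrightarrow> q) F" "q \<noteq> 0" shows "eventually (\<lambda>w. w \<in> {w. Q w \<noteq> 0}) F"
  using tendsto_imp_eventually_ne[OF assms] by simp

lemma basic_generic_dense:
  assumes N: "N \<ge> 3"
  obtains A where "ngon_generic N A" "\<And>v. v \<in> A \<Longrightarrow> is_ngon N v \<Longrightarrow> basic_generic N v"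
proof -
  define T where "T = {..<N} \<times> {..<N} \<times> {..<N}"
  define A1 where "A1 = (\<lambda>(k,i,j). {v::nat\<Rightarrow>complex. (v (nxt N k) - v k) \<bullet> (v j - v i) \<noteq> 0})"
  define A2 where "A2 = (\<lambda>(k,i,j). {v::nat\<Rightarrow>complex. cr (v (nxt N k) - v k) (v j - v i) \<noteq> 0})"
  define A3 where "A3 = (\<lambda>(k,l). {v::nat\<Rightarrow>complex.
     cr (v (nxt N k) - v k) (v (nxt N l) - v l) - (v (nxt N k) - v k) \<bullet> (v (nxt N l) - v l) \<noteq> 0})"
  define E1 where "E1 = {(k,i,j). (k,i,j) \<in> T \<and> i \<noteq> j}"
  define E2 where "E2 = {(k,i,j). (k,i,j) \<in> T \<and> i \<noteq> j \<and> {i,j} \<noteq> {k, nxt N k}}"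
  define E3 where "E3 = {..<N} \<times> {..<N}"
  have T: "finite T" unfolding T_def by simp
  have fE: "finite E1" "finite E2" "finite E3"
    unfolding E1_def E2_def E3_def by (auto intro!: finite_subset[OF _ T])
  have nx: "nxt N k < N" "nxt N k \<noteq> k" if "k < N" for k using nxt_prv[OF N that] by auto
  have g1: "ngon_generic N (UNIV \<inter> (\<Inter>j\<in>E1. A1 j))"
  proof (rule ngon_generic_INT[OF N ngon_generic_UNIV fE(1)])
    fix j and v :: "nat \<Rightarrow> complex" assume "j \<in> E1" "v \<in> A1 j"
    then obtain k i l where j: "j = (k,i,l)" "k < N" "i < N" "l < N"
      "(v (nxt N k) - v k) \<bullet> (v l - v i) \<noteq> 0" unfolding E1_def T_def A1_def by auto
    show "eventually (\<lambda>w. w \<in> A1 j) (near_ngon N v)"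
      unfolding j(1) A1_def prod.case
      by (rule eventually_nonzero[OF _ j(5)]) (use j nx in \<open>auto intro!: tendsto_intros\<close>)
  next
    fix j and v :: "nat \<Rightarrow> complex" and e :: real assume je: "j \<in> E1" "is_ngon N v" "e > 0"
    then obtain k i l where j: "j = (k,i,l)" "k < N" "i < N" "l < N" "i \<noteq> l"
      unfolding E1_def T_def by auto
    show "\<exists>w\<in>A1 j. is_ngon N w \<and> (\<forall>i<N. dist (w i) (v i) < e)"
      \<comment> \<open>Distinct vertices move along the real axis with distinct velocities.\<close>
      unfolding j(1) A1_def prod.case
      by (rule perturb_bilinear[OF N je(2,3), where w = of_nat])
        (use j nx[OF j(2)] in \<open>simp add: inner_add_left inner_add_right power2_eq_square algebra_simps, simp add: inner_complex_def\<close>)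
  qed
  have g2: "ngon_generic N ((UNIV \<inter> (\<Inter>j\<in>E1. A1 j)) \<inter> (\<Inter>j\<in>E2. A2 j))"
  proof (rule ngon_generic_INT[OF N g1 fE(2)])
    fix j and v :: "nat \<Rightarrow> complex" assume "j \<in> E2" "v \<in> A2 j"
    then obtain k i l where j: "j = (k,i,l)" "k < N" "i < N" "l < N"
      "cr (v (nxt N k) - v k) (v l - v i) \<noteq> 0" unfolding E2_def T_def A2_def by auto
    show "eventually (\<lambda>w. w \<in> A2 j) (near_ngon N v)"
      unfolding j(1) A2_def prod.case
      by (rule eventually_nonzero[OF _ j(5)]) (use j nx in \<open>auto intro!: tendsto_intros\<close>)
  next
    fix j and v :: "nat \<Rightarrow> complex" and e :: real assume je: "j \<in> E2" "is_ngon N v" "e > 0"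
    then obtain k i l where j: "j = (k,i,l)" "k < N" "i < N" "l < N" "i \<noteq> l" "{i,l} \<noteq> {k, nxt N k}"
      unfolding E2_def T_def by auto
    obtain x where x: "x \<in> {i,l}" "x \<noteq> k" "x \<noteq> nxt N k" using j(5,6) by auto
    show "\<exists>w\<in>A2 j. is_ngon N w \<and> (\<forall>i<N. dist (w i) (v i) < e)"
      \<comment> \<open>One end of the edge \<open>k\<close> moves with velocity 1, and a vertex in \<open>{i, l}\<close> that is not on this edge with velocity \<open>\<i>\<close>.\<close>
      unfolding j(1) A2_def prod.case
      by (rule perturb_bilinear[OF N je(2,3), where
            w = "\<lambda>m. if m = nxt N k then 1 else if m = x then \<i> else 0"])
        (use j nx[OF j(2)] x in \<open>auto simp: cr_Re_Im algebra_simps power2_eq_square\<close>)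
  qed
  have g3: "ngon_generic N (((UNIV \<inter> (\<Inter>j\<in>E1. A1 j)) \<inter> (\<Inter>j\<in>E2. A2 j)) \<inter> (\<Inter>j\<in>E3. A3 j))"
  proof (rule ngon_generic_INT[OF N g2 fE(3)])
    fix j and v :: "nat \<Rightarrow> complex" assume "j \<in> E3" "v \<in> A3 j"
    then obtain k l where j: "j = (k,l)" "k < N" "l < N"
      "cr (v (nxt N k) - v k) (v (nxt N l) - v l) - (v (nxt N k) - v k) \<bullet> (v (nxt N l) - v l) \<noteq> 0"
      unfolding E3_def A3_def by auto
    show "eventually (\<lambda>w. w \<in> A3 j) (near_ngon N v)"
      unfolding j(1) A3_def prod.case
      by (rule eventually_nonzero[OF _ j(4)]) (use j nx in \<open>auto intro!: tendsto_intros\<close>)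
  next
    fix j and v :: "nat \<Rightarrow> complex" and e :: real assume je: "j \<in> E3" "is_ngon N v" "e > 0"
    then obtain k l where j: "j = (k,l)" "k < N" "l < N" unfolding E3_def by auto
    show "\<exists>w\<in>A3 j. is_ngon N w \<and> (\<forall>i<N. dist (w i) (v i) < e)"
      unfolding j(1) A3_def prod.case
      by (rule perturb_bilinear[OF N je(2,3), where f = "\<lambda>a b. cr a b - a \<bullet> b" and w = of_nat])
        (use j nx[OF j(2)] nx[OF j(3)] in \<open>simp add: inner_add_left inner_add_right power2_eq_square algebra_simps, simp add: cr_Re_Im inner_complex_def del: cr_bilinear\<close>)
  qed
  show ?thesis
  proof (rule that[OF g3])
    fix v assume v: "v \<in> UNIV \<inter> \<Inter> (A1 ` E1) \<inter> \<Inter> (A2 ` E2) \<inter> \<Inter> (A3 ` E3)" and ng: "is_ngon N v"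
    show "basic_generic N v" unfolding basic_generic_def
    proof (intro conjI allI impI)
      fix k i j assume k: "k < N" "i < N" "j < N" "i \<noteq> j"
      then have "(k,i,j) \<in> E1" by (auto simp: E1_def T_def)
      then have "(v (nxt N k) - v k) \<bullet> (v j - v i) \<noteq> 0" using v unfolding A1_def by auto
      then show "edir N v k \<bullet> (v j - v i) \<noteq> 0" by (subst (asm) edge_eq_edir[of v N k]) auto
    next
      fix k i j assume k: "k < N" "i < N" "j < N" "i \<noteq> j" "{i, j} \<noteq> {k, nxt N k}"
      then have "(k,i,j) \<in> E2" by (auto simp: E2_def T_def)
      then have "cr (v (nxt N k) - v k) (v j - v i) \<noteq> 0" using v unfolding A2_def by auto
      then show "cr (edir N v k) (v j - v i) \<noteq> 0" by (subst (asm) edge_eq_edir[of v N k]) auto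
    next
      fix k l assume k: "k < N" "l < N"
      then have "(k,l) \<in> E3" by (auto simp: E3_def)
      then have "cr (v (nxt N k) - v k) (v (nxt N l) - v l) - (v (nxt N k) - v k) \<bullet> (v (nxt N l) - v l) \<noteq> 0"
        using v unfolding A3_def by auto
      moreover obtain x y where "v (nxt N k) - v k = x *\<^sub>R edir N v k" "v (nxt N l) - v l = y *\<^sub>R edir N v l"
        using edge_eq_edir by blast
      ultimately show "cr (edir N v k) (edir N v l) \<noteq> edir N v k \<bullet> edir N v l" by auto
    qed
  qed
qed

lemma tendsto_ht [tendsto_intros]:
  assumes "N \<ge> 3" "is_ngon N v" "k < N" "i < N"
  shows "((\<lambda>w. ht N w k (w i)) \<longlongrightarrow> ht N v k (v i)) (near_ngon N v)"
  unfolding ht_def using assms tendsto_edir[OF assms(1-3)] by (intro tendsto_intros)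

declare tendsto_edir [tendsto_intros]

lemma tendsto_cp_lin [tendsto_intros]:
  assumes "(b \<longlongrightarrow> b') F" "(c \<longlongrightarrow> c') F" "(d \<longlongrightarrow> d') F" "(x \<longlongrightarrow> x') F" "(y \<longlongrightarrow> y') F" "(z \<longlongrightarrow> z') F"
  shows "((\<lambda>w. cp_lin (b w) (c w) (d w) (x w) (y w) (z w)) \<longlongrightarrow> cp_lin b' c' d' x' y' z') F"
  unfolding cp_lin_def by (intro tendsto_intros assms)

lemma tendsto_generic_conditions:
  assumes N: "N \<ge> 3" and v: "is_ngon N v" and i: "i < N" "j < N" "k < N" "a < N" "b < N" "c < N" "d < N"
  shows "((\<lambda>w. gdisc N w i b c d) \<longlongrightarrow> gdisc N v i b c d) (near_ngon N v)"
    "((\<lambda>w. gsquare N w i b c d) \<longlongrightarrow> gsquare N v i b c d) (near_ngon N v)"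
    "((\<lambda>w. gres N w j a b c d) \<longlongrightarrow> gres N v j a b c d) (near_ngon N v)"
    "((\<lambda>w. gside N w i k c d) \<longlongrightarrow> gside N v i k c d) (near_ngon N v)"
    "((\<lambda>w. gdiag N w i k b d) \<longlongrightarrow> gdiag N v i k b d) (near_ngon N v)"
proof -
  note t = tendsto_intros N v i
  show "((\<lambda>w. gdisc N w i b c d) \<longlongrightarrow> gdisc N v i b c d) (near_ngon N v)"
    unfolding gdisc_def Let_def by (intro t)
  show "((\<lambda>w. gsquare N w i b c d) \<longlongrightarrow> gsquare N v i b c d) (near_ngon N v)"
    unfolding gsquare_def corner_poly_def Let_def by (intro t)
  show "((\<lambda>w. gside N w i k c d) \<longlongrightarrow> gside N v i k c d) (near_ngon N v)"
    unfolding gside_def by (intro t)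
  show "((\<lambda>w. gdiag N w i k b d) \<longlongrightarrow> gdiag N v i k b d) (near_ngon N v)"
  proof (cases "b = d")
    case True
    show ?thesis unfolding gdiag_def Let_def if_P[OF True] by (intro t)
  next
    case False
    show ?thesis unfolding gdiag_def Let_def if_not_P[OF False] by (intro t)
  qed
  show "((\<lambda>w. gres N w j a b c d) \<longlongrightarrow> gres N v j a b c d) (near_ngon N v)"
  proof (cases "a = b \<or> c = d")
    case True
    show ?thesis unfolding gres_def Let_def if_P[OF True] by (intro t)
  next
    case F: False
    show ?thesis
    proof (cases "b = c \<or> a = d")
      case True
      show ?thesis unfolding gres_def Let_def if_not_P[OF F] if_P[OF True] by (intro t)
    next
      case False
      show ?thesis unfolding gres_def Let_def if_not_P[OF F] if_not_P[OF False] res2_def by (intro t)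
    qed
  qed
qed

text \<open>The rate at which the height over the edge \<open>k\<close> changes when the line of the edge \<open>m\<close> moves.\<close>

definition ind :: "nat \<Rightarrow> nat \<Rightarrow> real" where "ind m k = (if k = m then 1 else 0)"

lemma cp_lin_add:
  "cp_lin b c d (x + t * x') (y + t * y') (z + t * z') = cp_lin b c d x y z + t * cp_lin b c d x' y' z'"
  by (simp add: cp_lin_def algebra_simps)

context
  fixes N v m e
  assumes N: "N \<ge> 3" and v: "is_ngon N v" and g: "basic_generic N v" and m: "m < N" and e: "e > (0::real)"
begin

lemma ht_shift:
  assumes "\<And>k z. k < N \<Longrightarrow> ht N v' k z = ht N v k z + (if k = m then t else 0)" "k < N"
  shows "ht N v' k z = ht N v k z + t * ind m k"
  using assms by (simp add: ind_def)

text \<open>In the following lemmas the coefficient that is assumed not to vanish is the one of highest degree: it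
  arises from the condition itself by replacing each height by its rate of change.\<close>

lemma gdisc_dense:
  assumes i: "i < N" "b < N" "c < N" "d < N" "\<not> edge_end N i m"
    and nz: "(cp_lin (edir N v b) (edir N v c) (edir N v d) (ind m b) (ind m c) (ind m d))\<^sup>2
       - 4 * (ind m d * cr (edir N v b) (edir N v c)) * (ind m b * cr (edir N v c) (edir N v d)) \<noteq> 0"
  shows "\<exists>w\<in>{w. gdisc N w i b c d \<noteq> 0}. is_ngon N w \<and> (\<forall>i<N. dist (w i) (v i) < e)"
proof -
  define h where "h = (\<lambda>k. ht N v k (v i))"
  define u where "u = edir N v"
  have "gdisc N v' i b c d = gdisc N v i b c d
    + (2 * cp_lin (u b) (u c) (u d) (h b) (h c) (h d) * cp_lin (u b) (u c) (u d) (ind m b) (ind m c) (ind m d)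
        - 4 * cr (u b) (u c) * cr (u c) (u d) * (h d * ind m b + h b * ind m d)) * t
    + ((cp_lin (u b) (u c) (u d) (ind m b) (ind m c) (ind m d))\<^sup>2
       - 4 * (ind m d * cr (u b) (u c)) * (ind m b * cr (u c) (u d))) * t\<^sup>2"
    if E: "\<And>k. k < N \<Longrightarrow> edir N v' k = edir N v k"
      and H: "\<And>k z. k < N \<Longrightarrow> ht N v' k z = ht N v k z + (if k = m then t else 0)"
      and P: "\<And>i. i < N \<Longrightarrow> \<not> edge_end N i m \<Longrightarrow> v' i = v i" for v' t
    unfolding gdisc_def Let_def using i
    by (simp add: E P ht_shift[OF H] cp_lin_add flip: h_def u_def)
       (simp add: power2_eq_square algebra_simps h_def u_def)
  note Q = this
  show ?thesis by (rule perturb_shift[OF N v g m Q _ e]) (use nz in \<open>simp_all add: u_def\<close>)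
qed

lemma gsquare_dense:
  assumes i: "i < N" "b < N" "c < N" "d < N" "\<not> edge_end N i m"
    and nz: "corner_poly (edir N v b) (edir N v c) (edir N v d) (ind m b) (ind m c) (ind m d) 1 \<noteq> 0"
  shows "\<exists>w\<in>{w. gsquare N w i b c d \<noteq> 0}. is_ngon N w \<and> (\<forall>i<N. dist (w i) (v i) < e)"
proof -
  have "gsquare N v' i b c d = gsquare N v i b c d
    + corner_poly (edir N v b) (edir N v c) (edir N v d) (ind m b) (ind m c) (ind m d) 1 * t + 0 * t\<^sup>2"
    if E: "\<And>k. k < N \<Longrightarrow> edir N v' k = edir N v k"
      and H: "\<And>k z. k < N \<Longrightarrow> ht N v' k z = ht N v k z + (if k = m then t else 0)"
      and P: "\<And>i. i < N \<Longrightarrow> \<not> edge_end N i m \<Longrightarrow> v' i = v i" for v' t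
    unfolding gsquare_def Let_def using i
    by (simp add: E P ht_shift[OF H]) (simp add: corner_poly_def power2_eq_square algebra_simps)
  note Q = this
  show ?thesis by (rule perturb_shift[OF N v g m Q _ e]) (use nz in simp_all)
qed

lemma gres_dense:
  assumes i: "j < N" "a < N" "b < N" "c < N" "d < N" "\<not> edge_end N j m"
    and p: "p0 = cr (edir N v d) (edir N v a) * cr (edir N v b) (edir N v c)"
      "p1 = cp_lin (edir N v b) (edir N v c) (edir N v d) (cr (edir N v b) (edir N v a))
          (cr (edir N v c) (edir N v a)) (cr (edir N v d) (edir N v a))"
      "p2 = cr (edir N v b) (edir N v a) * cr (edir N v c) (edir N v d)"
    and q: "q0 = ind m d * cr (edir N v b) (edir N v c)"
      "q1 = cp_lin (edir N v b) (edir N v c) (edir N v d) (ind m b) (ind m c) (ind m d)"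
      "q2 = ind m b * cr (edir N v c) (edir N v d)"
    and nz: "(if a = b \<or> c = d then p0 * q1 - p1 * q0
        else if b = c \<or> a = d then p1 * q2 - p2 * q1
        else res2 p0 p1 p2 q0 q1 q2) \<noteq> 0"
  shows "\<exists>w\<in>{w. gres N w j a b c d \<noteq> 0}. is_ngon N w \<and> (\<forall>i<N. dist (w i) (v i) < e)"
proof -
  define h where "h = (\<lambda>k. ht N v k (v j))"
  define u where "u = edir N v"
  define r0 r1 r2 where "r0 = h d * cr (u b) (u c)"
    and "r1 = cp_lin (u b) (u c) (u d) (h b) (h c) (h d)" and "r2 = h b * cr (u c) (u d)"
  define G where "G = (\<lambda>t. if a = b \<or> c = d then p0 * (r1 + t * q1) - p1 * (r0 + t * q0)
        else if b = c \<or> a = d then p1 * (r2 + t * q2) - p2 * (r1 + t * q1)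
        else res2 p0 p1 p2 (r0 + t * q0) (r1 + t * q1) (r2 + t * q2))"
  have form: "gres N v' j a b c d = G t"
    if E: "\<And>k. k < N \<Longrightarrow> edir N v' k = edir N v k"
      and H: "\<And>k z. k < N \<Longrightarrow> ht N v' k z = ht N v k z + (if k = m then t else 0)"
      and P: "\<And>i. i < N \<Longrightarrow> \<not> edge_end N i m \<Longrightarrow> v' i = v i" for v' t
    unfolding gres_def Let_def G_def using i
    by (simp add: E P ht_shift[OF H] cp_lin_add p q r0_def r1_def r2_def u_def h_def distrib_right mult.assoc)
  show ?thesis
  proof (cases "(a = b \<or> c = d) \<or> b = c \<or> a = d")
    case True
    define L where "L = (\<lambda>s0 s1 s2. if a = b \<or> c = d then p0 * s1 - p1 * s0 else p1 * s2 - p2 * s1)"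
    have "gres N v' j a b c d = L r0 r1 r2 + L q0 q1 q2 * t + 0 * t\<^sup>2"
      if E: "\<And>k. k < N \<Longrightarrow> edir N v' k = edir N v k"
        and H: "\<And>k z. k < N \<Longrightarrow> ht N v' k z = ht N v k z + (if k = m then t else 0)"
        and P: "\<And>i. i < N \<Longrightarrow> \<not> edge_end N i m \<Longrightarrow> v' i = v i" for v' t
    proof -
      have "gres N v' j a b c d = G t" using E H P by (rule form)
      then show ?thesis unfolding L_def G_def using True by (cases "a = b \<or> c = d") (auto simp: algebra_simps)
    qed
    note Q = this
    have "L q0 q1 q2 \<noteq> 0" using nz True unfolding L_def by (auto split: if_splits)
    then show ?thesis by (intro perturb_shift[OF N v g m Q _ e]) simp_all
  next
    case False
    have "gres N v' j a b c d = res2 p0 p1 p2 r0 r1 r2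
      + (2 * (p0 * r2 - p2 * r0) * (p0 * q2 - p2 * q0) - (p0 * r1 - p1 * r0) * (p1 * q2 - p2 * q1)
          - (p0 * q1 - p1 * q0) * (p1 * r2 - p2 * r1)) * t + res2 p0 p1 p2 q0 q1 q2 * t\<^sup>2"
      if E: "\<And>k. k < N \<Longrightarrow> edir N v' k = edir N v k"
        and H: "\<And>k z. k < N \<Longrightarrow> ht N v' k z = ht N v k z + (if k = m then t else 0)"
        and P: "\<And>i. i < N \<Longrightarrow> \<not> edge_end N i m \<Longrightarrow> v' i = v i" for v' t
    proof -
      have "gres N v' j a b c d = G t" using E H P by (rule form)
      then show ?thesis unfolding G_def using False by (simp add: res2_def power2_eq_square algebra_simps)
    qed
    note Q = this
    show ?thesis by (rule perturb_shift[OF N v g m Q _ e]) (use nz False in simp_all)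
  qed
qed

lemma gside_dense:
  assumes i: "i < N" "k < N" "c < N" "d < N" "\<not> edge_end N i m" "\<not> edge_end N k m"
    and nz: "ind m d * (edir N v c \<bullet> (v k - v i)) - ind m c * (edir N v d \<bullet> (v k - v i)) \<noteq> 0"
  shows "\<exists>w\<in>{w. gside N w i k c d \<noteq> 0}. is_ngon N w \<and> (\<forall>i<N. dist (w i) (v i) < e)"
proof -
  have "gside N v' i k c d = gside N v i k c d
    + (ind m d * (edir N v c \<bullet> (v k - v i)) - ind m c * (edir N v d \<bullet> (v k - v i))) * t + 0 * t\<^sup>2"
    if E: "\<And>k. k < N \<Longrightarrow> edir N v' k = edir N v k"
      and H: "\<And>k z. k < N \<Longrightarrow> ht N v' k z = ht N v k z + (if k = m then t else 0)"
      and P: "\<And>i. i < N \<Longrightarrow> \<not> edge_end N i m \<Longrightarrow> v' i = v i" for v' t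
    unfolding gside_def using i by (simp add: E P ht_shift[OF H]) (simp add: algebra_simps)
  note Q = this
  show ?thesis by (rule perturb_shift[OF N v g m Q _ e]) (use nz in simp_all)
qed

text \<open>The coefficient of the highest degree is 2 or 1, independently of the polygon.\<close>

lemma gdiag_dense:
  assumes i: "i < N" "k < N" "b < N" "d < N" "\<not> edge_end N i m" "\<not> edge_end N k m" and m': "m = b \<or> m = d"
  shows "\<exists>w\<in>{w. gdiag N w i k b d \<noteq> 0}. is_ngon N w \<and> (\<forall>i<N. dist (w i) (v i) < e)"
proof (cases "b = d")
  case True
  have "gdiag N v' i k b d = gdiag N v i k b d + 2 * t + 0 * t\<^sup>2"
    if E: "\<And>k. k < N \<Longrightarrow> edir N v' k = edir N v k"
      and H: "\<And>k z. k < N \<Longrightarrow> ht N v' k z = ht N v k z + (if k = m then t else 0)"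
      and P: "\<And>i. i < N \<Longrightarrow> \<not> edge_end N i m \<Longrightarrow> v' i = v i" for v' t
    unfolding gdiag_def Let_def using i True m' by (simp add: E P H)
  note Q = this
  show ?thesis by (rule perturb_shift[OF N v g m Q _ e]) simp_all
next
  case False
  define h where "h = (\<lambda>j. ht N v j (v i))"
  define h' where "h' = (\<lambda>j. ht N v j (v k))"
  define n where "n = (if m = b then d else b)"
  have "gdiag N v' i k b d = gdiag N v i k b d
      + (h' n * (edir N v b \<bullet> edir N v d) + h' m + h m + h n * (edir N v b \<bullet> edir N v d)) * t + 1 * t\<^sup>2"
    if E: "\<And>k. k < N \<Longrightarrow> edir N v' k = edir N v k"
      and H: "\<And>k z. k < N \<Longrightarrow> ht N v' k z = ht N v k z + (if k = m then t else 0)"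
      and P: "\<And>i. i < N \<Longrightarrow> \<not> edge_end N i m \<Longrightarrow> v' i = v i" for v' t
    unfolding gdiag_def Let_def using i False m'
    by (auto simp: E P H h_def h'_def n_def power2_eq_square algebra_simps)
  note Q = this
  show ?thesis by (rule perturb_shift[OF N v g m Q _ e]) simp_all
qed

end

lemma inner_edir_self:
  assumes "N \<ge> 3" "is_ngon N v" "k < N" shows "edir N v k \<bullet> edir N v k = 1"
  using norm_edir[OF assms] by (simp add: dot_square_norm)

text \<open>With the edge \<open>b\<close> moved, the resultant in the case \<open>a = c\<close> factors, and its factors do not vanish
  for different edges of which no two are parallel or perpendicular.\<close>

lemma res2_diagonal:
  "res2 (cr d c * cr b c) (cp_lin b c d (cr b c) (cr c c) (cr d c)) (cr b c * cr c d)
      0 (- (c \<bullet> d)) (cr c d)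
   = - (c \<bullet> c) * (b \<bullet> d) * cr b c * (cr c d)^3"
  unfolding res2_def cp_lin_def cr_Re_Im inner_complex_def by simp algebra

context
  fixes N v e
  assumes N: "N \<ge> 3" and v: "is_ngon N v" and g: "basic_generic N v" and e: "e > (0::real)"
begin

lemmas dot_ne = basic_edges(1)[OF N v g]
lemmas cr_ne = basic_edges(2)[OF N v g]
lemmas dot_self = inner_edir_self[OF N v]

lemma self_dense: "Q v \<noteq> (0::real) \<Longrightarrow> \<exists>w\<in>{w. Q w \<noteq> 0}. is_ngon N w \<and> (\<forall>i<N. dist (w i) (v i) < e)"
  using v e by (intro bexI[of _ v]) auto

text \<open>The choice of the edge to be moved. It must not contain \<open>v i\<close>, so that the first vertex of the
  rectangle stays in place, and it should be one of the edges \<open>b\<close>, \<open>c\<close>, \<open>d\<close> that occurs only once.\<close>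

lemma validc_cases:
  assumes val: "validc N i b c d" and i: "i < N"
  obtains "c \<noteq> b" "c \<noteq> d" "\<not> edge_end N i c"
    | "edge_end N i c" "c \<noteq> b" "b \<noteq> d" "\<not> edge_end N i b"
    | "edge_end N i c" "c \<noteq> d" "b \<noteq> d" "\<not> edge_end N i d"
    | "c = b" "b \<noteq> d" "\<not> edge_end N i b" "\<not> edge_end N i d"
    | "c = d" "b \<noteq> d" "\<not> edge_end N i b" "\<not> edge_end N i d"
proof (cases "edge_end N i c")
  case True
  then have "valid4 c b c d" using val unfolding validc_def edge_end_def by auto
  then have ne: "b \<noteq> d" "c \<noteq> b" "c \<noteq> d" unfolding valid4_def by blast+
  have "\<not> (edge_end N i b \<and> edge_end N i d)"
  proof
    assume "edge_end N i b \<and> edge_end N i d"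
    then have bd: "b = i \<or> b = prv N i" "d = i \<or> d = prv N i" unfolding edge_end_def by blast+
    from True show False unfolding edge_end_def
    proof
      assume "c = i" then show False using bd ne by metis
    next
      assume "c = prv N i" then show False using bd ne by metis
    qed
  qed
  then show ?thesis using that(2)[OF True ne(2,1)] that(3)[OF True ne(3,1)] by blast
next
  case False
  have v1: "valid4 i b c d" and v2: "valid4 (prv N i) b c d" using val unfolding validc_def by auto
  consider "c \<noteq> b" "c \<noteq> d" | "c = b" | "c = d" by blast
  then show ?thesis
  proof cases
    case 2
    then have ne: "b \<noteq> d" "d \<noteq> i" "d \<noteq> prv N i" using v1 v2 unfolding valid4_def by metis+
    show ?thesis by (rule that(4)[OF 2 ne(1)]) (use False 2 ne in \<open>simp_all add: edge_end_def\<close>)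
  next
    case 3
    then have ne: "b \<noteq> d" "b \<noteq> i" "b \<noteq> prv N i" using v1 v2 unfolding valid4_def by metis+
    show ?thesis by (rule that(5)[OF 3 ne(1)]) (use False 3 ne in \<open>simp_all add: edge_end_def\<close>)
  next
    case 1
    show ?thesis by (rule that(1)[OF 1 False])
  qed
qed

lemma gdisc_validc_dense:
  assumes i: "i < N" "b < N" "c < N" "d < N" and val: "validc N i b c d"
  shows "\<exists>w\<in>{w. gdisc N w i b c d \<noteq> 0}. is_ngon N w \<and> (\<forall>i<N. dist (w i) (v i) < e)"
  using val i(1)
proof (cases rule: validc_cases)
  case 1
  show ?thesis by (rule gdisc_dense[OF N v g i(3) e i 1(3)])
    (use 1 dot_ne[OF i(2,4)] in \<open>auto simp: ind_def cp_lin_def\<close>)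
next
  case 2
  show ?thesis by (rule gdisc_dense[OF N v g i(2) e i 2(4)])
    (use 2 dot_ne[OF i(3,4)] in \<open>auto simp: ind_def cp_lin_def\<close>)
next
  case 3
  show ?thesis by (rule gdisc_dense[OF N v g i(4) e i 3(4)])
    (use 3 dot_ne[OF i(2,3)] in \<open>auto simp: ind_def cp_lin_def\<close>)
next
  case 4
  show ?thesis by (rule self_dense)
    (use 4 ht_vertex(2)[OF N v i(4,1) g] dot_self[OF i(2)] in \<open>auto simp: gdisc_def Let_def cp_lin_def\<close>)
next
  case 5
  show ?thesis by (rule self_dense)
    (use 5 ht_vertex(2)[OF N v i(2,1) g] dot_self[OF i(4)] in
      \<open>auto simp: gdisc_def Let_def cp_lin_def\<close>)
qed

lemma gsquare_validc_dense:
  assumes i: "i < N" "b < N" "c < N" "d < N" and val: "validc N i b c d"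
  shows "\<exists>w\<in>{w. gsquare N w i b c d \<noteq> 0}. is_ngon N w \<and> (\<forall>i<N. dist (w i) (v i) < e)"
  using val i(1)
proof (cases rule: validc_cases)
  case 1
  show ?thesis by (rule gsquare_dense[OF N v g i(3) e i 1(3)])
    (use 1 dot_ne[OF i(2,4)] in \<open>auto simp: ind_def corner_poly_def\<close>)
next
  case 2
  show ?thesis by (rule gsquare_dense[OF N v g i(2) e i 2(4)])
    (use 2 basic_genericD(3)[OF g i(3,4)] in \<open>auto simp: ind_def corner_poly_def\<close>)
next
  case 3
  show ?thesis by (rule gsquare_dense[OF N v g i(4) e i 3(4)])
    (use 3 basic_genericD(3)[OF g i(2,3)] in \<open>auto simp: ind_def corner_poly_def\<close>)
next
  case 4
  show ?thesis by (rule gsquare_dense[OF N v g i(4) e i 4(4)])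
    (use 4 dot_self[OF i(2)] in \<open>auto simp: ind_def corner_poly_def\<close>)
next
  case 5
  show ?thesis by (rule gsquare_dense[OF N v g i(2) e i 5(3)])
    (use 5 dot_self[OF i(4)] in \<open>auto simp: ind_def corner_poly_def\<close>)
qed

text \<open>Only the second of the two polynomials changes when the edge moves, and the leading coefficient is the
  resultant of the determinant with the rate of this change. If no two cyclically adjacent edges coincide
  and \<open>a \<noteq> c\<close>, the rate is \<open>(b \<bullet> d) r\<close>, and the constant and the quadratic coefficient of the determinant
  do not vanish. The case \<open>a = c\<close> is the identity \<open>res2_diagonal\<close>.\<close>

lemma gres_valid4_dense:
  assumes i: "j < N" "a < N" "b < N" "c < N" "d < N" and val: "valid4 a b c d"
    and m: "\<not> edge_end N j (res_edge a b c d)"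
  shows "\<exists>w\<in>{w. gres N w j a b c d \<noteq> 0}. is_ngon N w \<and> (\<forall>i<N. dist (w i) (v i) < e)"
proof -
  have C: "x \<noteq> y \<Longrightarrow> x < N \<Longrightarrow> y < N \<Longrightarrow> cr (edir N v x) (edir N v y) \<noteq> 0" for x y using cr_ne by blast
  note D = dot_ne dot_self
  consider "c = a" "c \<noteq> b" "c \<noteq> d" "a \<noteq> b" "a \<noteq> d" "b \<noteq> d"
    | "c = d" "c \<noteq> a" "a \<noteq> b" "c \<noteq> b"
    | "a = b" "c \<noteq> d" "c \<noteq> a" "d \<noteq> a"
    | "b = c" "c \<noteq> a" "c \<noteq> d" "a \<noteq> d"
    | "a = d" "b \<noteq> c" "b \<noteq> a" "c \<noteq> a"
    | "a \<noteq> b" "b \<noteq> c" "c \<noteq> d" "a \<noteq> d" "a \<noteq> c"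
    using val unfolding valid4_def by metis
  then show ?thesis
  proof cases
    case 1
    have m: "\<not> edge_end N j b" using m 1 by (simp add: res_edge_def)
    have "- (edir N v a \<bullet> edir N v a) * (edir N v b \<bullet> edir N v d) * cr (edir N v b) (edir N v a) * (cr (edir N v a) (edir N v d))^3 \<noteq> 0"
      using 1 C D i by simp
    then have nz: "res2 (cr (edir N v d) (edir N v a) * cr (edir N v b) (edir N v a))
       (cp_lin (edir N v b) (edir N v a) (edir N v d) (cr (edir N v b) (edir N v a))
         (cr (edir N v a) (edir N v a)) (cr (edir N v d) (edir N v a)))
       (cr (edir N v b) (edir N v a) * cr (edir N v a) (edir N v d))
      0 (- (edir N v a \<bullet> edir N v d)) (cr (edir N v a) (edir N v d)) \<noteq> 0"
      unfolding res2_diagonal .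
    show ?thesis
      by (rule gres_dense[OF N v g i(3) e i m refl refl refl refl refl refl])
        (use nz 1 in \<open>simp add: ind_def cp_lin_def\<close>)
  next
    case 2
    have m: "\<not> edge_end N j b" using m 2 by (simp add: res_edge_def)
    show ?thesis
      by (rule gres_dense[OF N v g i(3) e i m refl refl refl refl refl refl])
        (use 2 C D i in \<open>auto simp: ind_def cp_lin_def\<close>)
  next
    case 3
    have m: "\<not> edge_end N j c" using m 3 by (simp add: res_edge_def)
    show ?thesis
      by (rule gres_dense[OF N v g i(4) e i m refl refl refl refl refl refl])
        (use 3 C D i in \<open>auto simp: ind_def cp_lin_def\<close>)
  next
    case 4
    have m: "\<not> edge_end N j c" using m 4 by (simp add: res_edge_def)
    show ?thesis
      by (rule gres_dense[OF N v g i(4) e i m refl refl refl refl refl refl])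
        (use 4 C D i in \<open>auto simp: ind_def cp_lin_def\<close>)
  next
    case 5
    have m: "\<not> edge_end N j c" using m 5 by (simp add: res_edge_def)
    show ?thesis
      by (rule gres_dense[OF N v g i(4) e i m refl refl refl refl refl refl])
        (use 5 C D i in \<open>auto simp: ind_def cp_lin_def\<close>)
  next
    case 6
    have m: "\<not> edge_end N j c" using m 6 by (simp add: res_edge_def)
    show ?thesis
      by (rule gres_dense[OF N v g i(4) e i m refl refl refl refl refl refl])
        (use 6 C D i in \<open>auto simp: ind_def cp_lin_def res2_def\<close>)
  qed
qed

lemma gside_valid_dense:
  assumes i: "i < N" "k < N" "c < N" "d < N" "i \<noteq> k" "c \<noteq> d" "\<not> edge_end N k c" "\<not> edge_end N i d"
    "\<not> (edge_end N i c \<and> edge_end N k d)"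
  shows "\<exists>w\<in>{w. gside N w i k c d \<noteq> 0}. is_ngon N w \<and> (\<forall>i<N. dist (w i) (v i) < e)"
proof (cases "edge_end N i c")
  case True
  then have m: "\<not> edge_end N k d" using i by blast
  show ?thesis by (rule gside_dense[OF N v g i(4) e i(1-4) i(8) m])
    (use i basic_genericD(1)[OF g i(3,1,2,5)] in \<open>auto simp: ind_def\<close>)
next
  case False
  show ?thesis by (rule gside_dense[OF N v g i(3) e i(1-4) False i(7)])
    (use i basic_genericD(1)[OF g i(4,1,2,5)] in \<open>auto simp: ind_def\<close>)
qed

end

theorem generic_ngon_generic:
  assumes N: "N \<ge> 3"
  obtains A where "ngon_generic N A" "\<And>v. v \<in> A \<Longrightarrow> is_ngon N v \<Longrightarrow> generic_ngon N v"
proof -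
  obtain A0 where A0: "ngon_generic N A0" "\<And>v. v \<in> A0 \<Longrightarrow> is_ngon N v \<Longrightarrow> basic_generic N v"
    using basic_generic_dense[OF N] by blast
  define T where "T = {..<N} \<times> {..<N} \<times> {..<N} \<times> {..<N} \<times> {..<N}"
  have T: "finite T" unfolding T_def by simp
  define E1 where "E1 = {(i,b,c,d,x). (i,b,c,d,x) \<in> T \<and> validc N i b c d}"
  define E3 where "E3 = {(a,b,c,d,j). (a,b,c,d,j) \<in> T \<and> valid4 a b c d \<and> \<not> edge_end N j (res_edge a b c d)}"
  define E4 where "E4 = {(i,k,c,d,x). (i,k,c,d,x) \<in> T \<and> i \<noteq> k \<and> c \<noteq> d \<and> \<not> edge_end N k c \<and>
     \<not> edge_end N i d \<and> \<not> (edge_end N i c \<and> edge_end N k d)}"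
  define E5 where "E5 = {(i,k,b,d,x). (i,k,b,d,x) \<in> T \<and> i \<noteq> k \<and>
     (\<not> edge_end N i b \<and> \<not> edge_end N k b \<or> \<not> edge_end N i d \<and> \<not> edge_end N k d)}"
  have fE: "finite E1" "finite E3" "finite E4" "finite E5"
    unfolding E1_def E3_def E4_def E5_def by (auto intro!: finite_subset[OF _ T])
  define A1 where "A1 = (\<lambda>(i,b,c,d,x::nat). {v. gdisc N v i b c d \<noteq> 0})"
  define A2 where "A2 = (\<lambda>(i,b,c,d,x::nat). {v. gsquare N v i b c d \<noteq> 0})"
  define A3 where "A3 = (\<lambda>(a,b,c,d,j). {v. gres N v j a b c d \<noteq> 0})"
  define A4 where "A4 = (\<lambda>(i,k,c,d,x::nat). {v. gside N v i k c d \<noteq> 0})"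
  define A5 where "A5 = (\<lambda>(i,k,b,d,x::nat). {v. gdiag N v i k b d \<noteq> 0})"
  note t = tendsto_generic_conditions[OF N]
  define G1 where "G1 = A0 \<inter> (\<Inter>j\<in>E1. A1 j)"
  define G2 where "G2 = G1 \<inter> (\<Inter>j\<in>E1. A2 j)"
  define G3 where "G3 = G2 \<inter> (\<Inter>j\<in>E3. A3 j)"
  define G4 where "G4 = G3 \<inter> (\<Inter>j\<in>E4. A4 j)"
  define G5 where "G5 = G4 \<inter> (\<Inter>j\<in>E5. A5 j)"
  have sub: "G1 \<subseteq> A0" "G2 \<subseteq> A0" "G3 \<subseteq> A0" "G4 \<subseteq> A0"
    unfolding G4_def G3_def G2_def G1_def by auto
  have g1: "ngon_generic N G1" unfolding G1_def
  proof (rule ngon_generic_INT[OF N A0(1) fE(1)])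
    fix j v assume h: "j \<in> E1" "v \<in> A1 j" "is_ngon N v"
    obtain i b c d x where j: "j = (i,b,c,d,x)" by (metis prod_cases5)
    show "eventually (\<lambda>w. w \<in> A1 j) (near_ngon N v)"
      using h unfolding j A1_def prod.case E1_def T_def by (intro eventually_nonzero[OF t(1)]) auto
  next
    fix j v and e :: real assume h: "j \<in> E1" "v \<in> A0" "is_ngon N v" "e > 0"
    obtain i b c d x where j: "j = (i,b,c,d,x)" by (metis prod_cases5)
    show "\<exists>w\<in>A1 j. is_ngon N w \<and> (\<forall>i<N. dist (w i) (v i) < e)"
      using h A0(2) unfolding j A1_def prod.case E1_def T_def by (intro gdisc_validc_dense[OF N]) auto
  qed
  have g2: "ngon_generic N G2" unfolding G2_def
  proof (rule ngon_generic_INT[OF N g1 fE(1)])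
    fix j v assume h: "j \<in> E1" "v \<in> A2 j" "is_ngon N v"
    obtain i b c d x where j: "j = (i,b,c,d,x)" by (metis prod_cases5)
    show "eventually (\<lambda>w. w \<in> A2 j) (near_ngon N v)"
      using h unfolding j A2_def prod.case E1_def T_def by (intro eventually_nonzero[OF t(2)]) auto
  next
    fix j v and e :: real assume h: "j \<in> E1" "v \<in> G1" "is_ngon N v" "e > 0"
    obtain i b c d x where j: "j = (i,b,c,d,x)" by (metis prod_cases5)
    show "\<exists>w\<in>A2 j. is_ngon N w \<and> (\<forall>i<N. dist (w i) (v i) < e)"
      using h A0(2) sub unfolding j A2_def prod.case E1_def T_def by (intro gsquare_validc_dense[OF N]) auto
  qed
  have g3: "ngon_generic N G3" unfolding G3_def
  proof (rule ngon_generic_INT[OF N g2 fE(2)])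
    fix j v assume h: "j \<in> E3" "v \<in> A3 j" "is_ngon N v"
    obtain a b c d x where j: "j = (a,b,c,d,x)" by (metis prod_cases5)
    show "eventually (\<lambda>w. w \<in> A3 j) (near_ngon N v)"
      using h unfolding j A3_def prod.case E3_def T_def by (intro eventually_nonzero[OF t(3)]) auto
  next
    fix j v and e :: real assume h: "j \<in> E3" "v \<in> G2" "is_ngon N v" "e > 0"
    obtain a b c d x where j: "j = (a,b,c,d,x)" by (metis prod_cases5)
    show "\<exists>w\<in>A3 j. is_ngon N w \<and> (\<forall>i<N. dist (w i) (v i) < e)"
      using h A0(2) sub unfolding j A3_def prod.case E3_def T_def by (intro gres_valid4_dense[OF N]) auto
  qed
  have g4: "ngon_generic N G4" unfolding G4_def
  proof (rule ngon_generic_INT[OF N g3 fE(3)])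
    fix j v assume h: "j \<in> E4" "v \<in> A4 j" "is_ngon N v"
    obtain i k c d x where j: "j = (i,k,c,d,x)" by (metis prod_cases5)
    show "eventually (\<lambda>w. w \<in> A4 j) (near_ngon N v)"
      using h unfolding j A4_def prod.case E4_def T_def by (intro eventually_nonzero[OF t(4)]) auto
  next
    fix j v and e :: real assume h: "j \<in> E4" "v \<in> G3" "is_ngon N v" "e > 0"
    obtain i k c d x where j: "j = (i,k,c,d,x)" by (metis prod_cases5)
    show "\<exists>w\<in>A4 j. is_ngon N w \<and> (\<forall>i<N. dist (w i) (v i) < e)"
      using h A0(2) sub unfolding j A4_def prod.case E4_def T_def by (intro gside_valid_dense[OF N]) auto
  qed
  have g5: "ngon_generic N G5" unfolding G5_def
  proof (rule ngon_generic_INT[OF N g4 fE(4)])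
    fix j v assume h: "j \<in> E5" "v \<in> A5 j" "is_ngon N v"
    obtain i k b d x where j: "j = (i,k,b,d,x)" by (metis prod_cases5)
    show "eventually (\<lambda>w. w \<in> A5 j) (near_ngon N v)"
      using h unfolding j A5_def prod.case E5_def T_def by (intro eventually_nonzero[OF t(5)]) auto
  next
    fix j v and e :: real assume h: "j \<in> E5" "v \<in> G4" "is_ngon N v" "e > 0"
    obtain i k b d x where j: "j = (i,k,b,d,x)" by (metis prod_cases5)
    have jj: "i < N" "k < N" "b < N" "d < N"
      and cs: "\<not> edge_end N i b \<and> \<not> edge_end N k b \<or> \<not> edge_end N i d \<and> \<not> edge_end N k d"
      using h unfolding j E5_def T_def by auto
    have bg: "basic_generic N v" using h A0(2) sub by blast
    show "\<exists>w\<in>A5 j. is_ngon N w \<and> (\<forall>i<N. dist (w i) (v i) < e)"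
      unfolding j A5_def prod.case using cs
    proof
      assume "\<not> edge_end N i b \<and> \<not> edge_end N k b"
      then show "\<exists>w\<in>{v. gdiag N v i k b d \<noteq> 0}. is_ngon N w \<and> (\<forall>i<N. dist (w i) (v i) < e)"
        by (intro gdiag_dense[OF N h(3) bg jj(3) h(4) jj]) auto
    next
      assume "\<not> edge_end N i d \<and> \<not> edge_end N k d"
      then show "\<exists>w\<in>{v. gdiag N v i k b d \<noteq> 0}. is_ngon N w \<and> (\<forall>i<N. dist (w i) (v i) < e)"
        by (intro gdiag_dense[OF N h(3) bg jj(4) h(4) jj]) auto
    qed
  qed
  show ?thesis
  proof (rule that[OF g5])
    fix v assume v: "v \<in> G5" "is_ngon N v"
    have m: "v \<in> A0" "\<And>j. j \<in> E1 \<Longrightarrow> v \<in> A1 j" "\<And>j. j \<in> E1 \<Longrightarrow> v \<in> A2 j" "\<And>j. j \<in> E3 \<Longrightarrow> v \<in> A3 j"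
      "\<And>j. j \<in> E4 \<Longrightarrow> v \<in> A4 j" "\<And>j. j \<in> E5 \<Longrightarrow> v \<in> A5 j"
      using v(1) unfolding G5_def G4_def G3_def G2_def G1_def by auto
    show "generic_ngon N v" unfolding generic_ngon_def
    proof (intro conjI allI impI)
      show "basic_generic N v" using A0(2) m(1) v(2) by blast
    next
      fix i b c d assume "i < N" "b < N" "c < N" "d < N" "validc N i b c d"
      then have "(i,b,c,d,i) \<in> E1" unfolding E1_def T_def by auto
      then show "gdisc N v i b c d \<noteq> 0" "gsquare N v i b c d \<noteq> 0" using m(2,3) unfolding A1_def A2_def by blast+
    next
      fix a b c d j assume "a < N" "b < N" "c < N" "d < N" "j < N" "valid4 a b c d" "\<not> edge_end N j (res_edge a b c d)"
      then have "(a,b,c,d,j) \<in> E3" unfolding E3_def T_def by auto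
      then show "gres N v j a b c d \<noteq> 0" using m(4) unfolding A3_def by blast
    next
      fix i k c d assume "i < N" "k < N" "c < N" "d < N" "i \<noteq> k" "c \<noteq> d" "\<not> edge_end N k c" "\<not> edge_end N i d"
        "\<not> (edge_end N i c \<and> edge_end N k d)"
      then have "(i,k,c,d,i) \<in> E4" unfolding E4_def T_def by auto
      then show "gside N v i k c d \<noteq> 0" using m(5) unfolding A4_def by blast
    next
      fix i k b d assume "i < N" "k < N" "b < N" "d < N" "i \<noteq> k"
        "\<not> edge_end N i b \<and> \<not> edge_end N k b \<or> \<not> edge_end N i d \<and> \<not> edge_end N k d"
      then have "(i,k,b,d,i) \<in> E5" unfolding E5_def T_def by auto
      then show "gdiag N v i k b d \<noteq> 0" using m(6) unfolding A5_def by blast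
    qed
  qed
qed

section \<open>Rectangles with vertices on four lines\<close>

definition quad_of :: "complex \<Rightarrow> complex \<Rightarrow> real \<Rightarrow> quad" where
  "quad_of z w r = (z, z + w, z + w + r *\<^sub>R (\<i> * w), z + r *\<^sub>R (\<i> * w))"

lemma cr_ii [simp]: "cr a (\<i> * b) = a \<bullet> b"
  by (simp add: cr_Re_Im inner_complex_def)

lemma inner_ii [simp]: "a \<bullet> (\<i> * b) = - cr a b" "(\<i> * a) \<bullet> b = cr a b"
  by (simp_all add: cr_Re_Im inner_complex_def)

lemma rectangle_quad_of:
  assumes "w \<noteq> 0" "r > 0"
  shows "is_rectangle (quad_of z w r)" "aspect_ratio (quad_of z w r) = r"
proof -
  have "Im (cnj w * (r *\<^sub>R (\<i> * w))) = r * (w \<bullet> w)"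
    by (simp add: inner_complex_def algebra_simps)
  then have "Im (cnj w * (r *\<^sub>R (\<i> * w))) > 0" using assms by simp
  then show "is_rectangle (quad_of z w r)" by (simp add: quad_of_def)
  show "aspect_ratio (quad_of z w r) = r"
    using assms by (simp add: quad_of_def dist_norm norm_mult)
qed

lemma rectangleE:
  assumes "is_rectangle R"
  obtains z w r where "w \<noteq> 0" "r > 0" "R = quad_of z w r"
proof -
  obtain R0 R1 R2 R3 where R: "R = (R0, R1, R2, R3)" by (metis prod_cases4)
  define w q where "w = R1 - R0" and "q = R2 - R1"
  have h: "R3 - R0 = q" "w \<bullet> q = 0" "Im (cnj w * q) > 0" using assms R by (auto simp: w_def q_def)
  have w0: "w \<noteq> 0" using h by auto
  define r where "r = cr w q / (w \<bullet> w)"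
  have ww: "w \<bullet> w > 0" using w0 by simp
  have r: "r > 0" using h ww by (simp add: r_def cr_def)
  have "cr w (q - r *\<^sub>R (\<i> * w)) = 0" using w0 by (simp add: r_def)
  moreover have "w \<bullet> (q - r *\<^sub>R (\<i> * w)) = 0" using h by (simp add: inner_diff_right)
  ultimately have "q - r *\<^sub>R (\<i> * w) = 0" using cr_inner_zero w0 by blast
  then have q: "r *\<^sub>R (\<i> * w) = q" by simp
  have "R1 = R0 + w" "R2 = R0 + w + q" "R3 = R0 + q"
    using h(1) by (simp_all add: w_def q_def algebra_simps)
  then have "R = quad_of R0 w r" unfolding R quad_of_def q by simp
  then show ?thesis using that w0 r by blast
qed

lemma quad_of_aspect:
  assumes "is_rectangle R" shows "aspect_ratio R > 0"
    "R = quad_of (fst R) (fst (snd R) - fst R) (aspect_ratio R)" "fst (snd R) \<noteq> fst R"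
proof -
  obtain z w r where R: "w \<noteq> 0" "r > 0" "R = quad_of z w r" by (rule rectangleE[OF assms]) (rule that)
  have a: "aspect_ratio R = r" using rectangle_quad_of(2)[OF R(1,2)] R(3) by simp
  show "aspect_ratio R > 0" using a R by simp
  show "R = quad_of (fst R) (fst (snd R) - fst R) (aspect_ratio R)" unfolding a by (simp add: R(3) quad_of_def)
  show "fst (snd R) \<noteq> fst R" using R by (simp add: quad_of_def)
qed

lemma corner_poly_zero:
  assumes "cr b w = x" "cr c (w + r *\<^sub>R (\<i> * w)) = y" "r * (d \<bullet> w) = z"
  shows "corner_poly b c d x y z r = 0"
  unfolding corner_poly_def assms[symmetric] by (simp add: cr_Re_Im inner_complex_def) algebra

text \<open>Cramer's rule: \<open>w\<close> is recovered from its determinant with \<open>b\<close> and its inner product with \<open>d\<close>.\<close>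

lemma cr_inner_expand: "(b \<bullet> d) *\<^sub>R w = cr b w *\<^sub>R (\<i> * d) + (d \<bullet> w) *\<^sub>R b"
  by (simp add: complex_eq_iff cr_Re_Im inner_complex_def algebra_simps)

lemma corner_poly_diff:
  "corner_poly b c d (x - s * x') (y - s * y') (z - s * z') r
    = corner_poly b c d x y z r - s * corner_poly b c d x' y' z' r"
  by (simp add: corner_poly_def algebra_simps)

locale generic_polygon =
  fixes N :: nat and v :: "nat \<Rightarrow> complex"
  assumes N3: "N \<ge> 3" and ng: "is_ngon N v" and gen: "generic_ngon N v"
begin

abbreviation "u \<equiv> edir N v"
abbreviation "h \<equiv> ht N v"
abbreviation "P \<equiv> path_image (polygon_path N v)"
abbreviation "I \<equiv> inscribed (polygon_path N v)"

definition edge :: "nat \<Rightarrow> complex set" where "edge k = closed_segment (v k) (v (nxt N k))"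
definition len :: "nat \<Rightarrow> real" where "len k = norm (v (nxt N k) - v k)"
definition corners :: "complex set" where "corners = v ` {..<N}"

lemma N0: "N > 0" using N3 by simp

lemma bas: "basic_generic N v" using gen unfolding generic_ngon_def by simp

lemmas gen' = gen[unfolded generic_ngon_def]
lemmas gdisc_ne = gen'[THEN conjunct2, THEN conjunct1, rule_format, THEN conjunct1]
lemmas gsquare_ne = gen'[THEN conjunct2, THEN conjunct1, rule_format, THEN conjunct2]
lemmas gres_ne = gen'[THEN conjunct2, THEN conjunct2, THEN conjunct1, rule_format]
lemmas gside_ne = gen'[THEN conjunct2, THEN conjunct2, THEN conjunct2, THEN conjunct1, rule_format]
lemmas gdiag_ne = gen'[THEN conjunct2, THEN conjunct2, THEN conjunct2, THEN conjunct2, rule_format]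
lemmas dot_ne = basic_edges(1)[OF N3 ng bas]
lemmas cr_ne = basic_edges(2)[OF N3 ng bas]
lemmas nx = nxt_prv[OF N3]
lemmas norm_u = norm_edir[OF N3 ng]
lemmas inj_v = ngon_vertices_distinct[OF N3 ng]

lemma len_pos: "k < N \<Longrightarrow> len k > 0"
  unfolding len_def using inj_v[of "nxt N k" k] nx[of k] by auto

lemma v_nxt: "v (nxt N k) = v k + len k *\<^sub>R u k"
  using edge_eq_edir[of v N k] by (simp add: len_def algebra_simps)

lemma edge_iff: "z \<in> edge k \<longleftrightarrow> (\<exists>s. 0 \<le> s \<and> s \<le> len k \<and> z = v k + s *\<^sub>R u k)"
proof
  assume "z \<in> edge k"
  then obtain t where t: "0 \<le> t" "t \<le> 1" "z = (1 - t) *\<^sub>R v k + t *\<^sub>R v (nxt N k)"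
    by (auto simp: edge_def closed_segment_def)
  then have "z = v k + (t * len k) *\<^sub>R u k" using v_nxt[of k] by (simp add: algebra_simps)
  moreover have "0 \<le> t * len k" "t * len k \<le> len k"
    using t by (auto simp: len_def mult_left_le_one_le)
  ultimately show "\<exists>s. 0 \<le> s \<and> s \<le> len k \<and> z = v k + s *\<^sub>R u k" by blast
next
  assume "\<exists>s. 0 \<le> s \<and> s \<le> len k \<and> z = v k + s *\<^sub>R u k"
  then obtain s where s: "0 \<le> s" "s \<le> len k" "z = v k + s *\<^sub>R u k" by blast
  show "z \<in> edge k"
  proof (cases "len k = 0")
    case True
    then show ?thesis using s by (simp add: edge_def)
  next
    case False
    then have l: "len k > 0" by (simp add: len_def)
    have "z = (1 - s / len k) *\<^sub>R v k + (s / len k) *\<^sub>R v (nxt N k)"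
      unfolding v_nxt s(3) using l by (simp add: algebra_simps)
    then show ?thesis unfolding edge_def closed_segment_def using s l by (auto intro!: exI[of _ "s / len k"])
  qed
qed

lemma line_iff: "k < N \<Longrightarrow> h k z = 0 \<longleftrightarrow> (\<exists>s. z = v k + s *\<^sub>R u k)"
proof
  assume k: "k < N" and "h k z = 0"
  then have "cr (u k) (z - v k) = 0" by (simp add: ht_def)
  then have "z - v k = (u k \<bullet> (z - v k)) *\<^sub>R u k" using cr_zero_scaleR norm_u[OF k] by blast
  then show "\<exists>s. z = v k + s *\<^sub>R u k" by (metis add_diff_cancel_left' add.commute diff_add_cancel)
qed (auto simp: ht_def)

lemma edge_line: "k < N \<Longrightarrow> z \<in> edge k \<Longrightarrow> h k z = 0"
  using line_iff edge_iff by blast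

lemma closed_edge: "closed (edge k)" by (simp add: edge_def)

lemma edge_param:
  assumes "k < N" "z \<in> edge k"
  obtains x where "0 \<le> x" "x \<le> 1" "z = periodic_path N v ((real k + x) / real N)"
    "x = 0 \<Longrightarrow> z = v k" "x = 1 \<Longrightarrow> z = v (nxt N k)"
proof -
  obtain x where x: "0 \<le> x" "x \<le> 1" "z = (1 - x) *\<^sub>R v k + x *\<^sub>R v (nxt N k)"
    using assms(2) by (auto simp: edge_def closed_segment_def)
  have c: "cyc_vertex N v (int k) = v k" "cyc_vertex N v (int k + 1) = v (nxt N k)"
    using assms(1) by (auto simp: cyc_vertex_def nxt_def nat_mod_distrib nat_add_distrib)
  have "periodic_path N v ((of_int (int k) + x) / real N) = z"
    unfolding periodic_path_edge[OF N0 x(1,2)] edge_vec_def c x(3) by (simp add: algebra_simps)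
  then show ?thesis using that[of x] x by simp
qed

lemma path_image_edges: "P = (\<Union>k<N. edge k)"
proof
  show "P \<subseteq> (\<Union>k<N. edge k)"
  proof
    fix z assume "z \<in> P"
    then obtain s where z: "z = periodic_path N v s" using path_image_polygon[OF N0] by blast
    define k where "k = \<lfloor>real N * s\<rfloor>"
    define x where "x = frac (real N * s)"
    define j where "j = nat (k mod int N)"
    have j: "j < N" using N0 by (simp add: j_def nat_less_iff)
    have "nat ((k + 1) mod int N) = nxt N j"
    proof -
      have "int (nxt N j) = (int j + 1) mod int N" unfolding nxt_def by (simp add: of_nat_mod add.commute)
      also have "\<dots> = (k mod int N + 1) mod int N" using N0 by (simp add: j_def)
      also have "\<dots> = (k + 1) mod int N" by (simp add: mod_add_left_eq)
      finally show ?thesis by simp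
    qed
    then have "z = (1 - x) *\<^sub>R v j + x *\<^sub>R v (nxt N j)"
      unfolding z periodic_path_def edge_vec_def cyc_vertex_def k_def[symmetric] x_def[symmetric]
      by (simp add: j_def algebra_simps)
    moreover have "0 \<le> x" "x \<le> 1" unfolding x_def by (auto simp: frac_lt_1 less_imp_le)
    ultimately have "z \<in> edge j" unfolding edge_def closed_segment_def by blast
    then show "z \<in> (\<Union>k<N. edge k)" using j by blast
  qed
  show "(\<Union>k<N. edge k) \<subseteq> P"
    using edge_param path_image_polygon[OF N0] by (metis UN_least lessThan_iff rangeI subsetI)
qed

lemma edge_Int:
  assumes kl: "k < N" "l < N" "k \<noteq> l" and z: "z \<in> edge k" "z \<in> edge l"
  shows "z = v l \<and> l = nxt N k \<or> z = v k \<and> k = nxt N l"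
proof -
  obtain x where x: "0 \<le> x" "x \<le> 1" "z = periodic_path N v ((real k + x) / real N)"
    "x = 0 \<Longrightarrow> z = v k" "x = 1 \<Longrightarrow> z = v (nxt N k)" using edge_param[OF kl(1) z(1)] by metis
  obtain y where y: "0 \<le> y" "y \<le> 1" "z = periodic_path N v ((real l + y) / real N)"
    "y = 0 \<Longrightarrow> z = v l" "y = 1 \<Longrightarrow> z = v (nxt N l)" using edge_param[OF kl(2) z(2)] by metis
  have "frac ((real k + x) / real N) = frac ((real l + y) / real N)"
    using ng simple_polygon_iff[OF N0] x(3) y(3) unfolding is_ngon_def by metis
  then have "(real k + x) / real N - (real l + y) / real N
      = of_int (\<lfloor>(real k + x) / real N\<rfloor> - \<lfloor>(real l + y) / real N\<rfloor>)"
    unfolding frac_def of_int_diff by linarith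
  then obtain m :: int where "(real k + x) / real N - (real l + y) / real N = of_int m" by blast
  then have "(real k + x - (real l + y)) / real N = of_int m" by (simp add: diff_divide_distrib)
  then have m: "real k + x - (real l + y) = of_int m * real N" using N0 by (simp add: field_simps)
  have "\<bar>real k - real l\<bar> \<le> real N - 1" using kl by linarith
  then have b: "\<bar>of_int m * real N\<bar> \<le> real N" using m x y by linarith
  then have "\<bar>of_int m :: real\<bar> \<le> 1" using N0 by (simp add: abs_mult)
  then have "m = 0 \<or> m = 1 \<or> m = -1" by linarith
  then show ?thesis
  proof (elim disjE)
    assume "m = 0"
    then have e: "real k + x = real l + y" using m by simp
    consider "k = Suc l" "x = 0" | "l = Suc k" "y = 0"
    proof -
      have "\<bar>real k - real l\<bar> \<le> 1" using e x y by linarith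
      then have "\<bar>int k - int l\<bar> \<le> 1" by linarith
      then have "k = Suc l \<or> l = Suc k" using kl(3) by linarith
      then show ?thesis
      proof
        assume "k = Suc l"
        then have "x = 0" using e x y by simp
        then show ?thesis using that(1) \<open>k = Suc l\<close> by blast
      next
        assume "l = Suc k"
        then have "y = 0" using e x y by simp
        then show ?thesis using that(2) \<open>l = Suc k\<close> by blast
      qed
    qed
    then show ?thesis using x(4) y(4) kl by cases (auto simp: nxt_def)
  next
    assume "m = 1"
    then have e: "real k + x = real l + y + real N" using m by simp
    then have "real k \<ge> real l + real N - 1" using x y by linarith
    then have k: "k = N - 1" "l = 0" using kl by linarith+
    then have "y = 0" using e x y kl N0 by (simp add: of_nat_diff)
    then show ?thesis using y(4) k N0 by (simp add: nxt_def)
  next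
    assume "m = -1"
    then have e: "real l + y = real k + x + real N" using m by simp
    then have "real l \<ge> real k + real N - 1" using x y by linarith
    then have k: "l = N - 1" "k = 0" using kl by linarith+
    then have "x = 0" using e x y kl N0 by (simp add: of_nat_diff)
    then show ?thesis using x(4) k N0 by (simp add: nxt_def)
  qed
qed

lemma edge_unique: "k < N \<Longrightarrow> l < N \<Longrightarrow> z \<in> edge k \<Longrightarrow> z \<in> edge l \<Longrightarrow> z \<notin> corners \<Longrightarrow> k = l"
  using edge_Int[of k l z] unfolding corners_def by blast

lemma edge_at_vertex:
  assumes "i < N" "k < N" shows "v i \<in> edge k \<longleftrightarrow> edge_end N i k"
proof
  assume "v i \<in> edge k"
  then have "h k (v i) = 0" using edge_line assms by blast
  then show "edge_end N i k" using ht_vertex(2)[OF N3 ng assms(2,1) bas] by blast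
next
  assume "edge_end N i k"
  then show "v i \<in> edge k" using nx[OF assms(1)] unfolding edge_end_def edge_def by auto
qed

lemma near_edges:
  obtains \<delta> where "\<delta> > 0" "\<And>k z. k < N \<Longrightarrow> z \<in> edge k \<Longrightarrow> dist z z0 < \<delta> \<Longrightarrow> z0 \<in> edge k"
proof -
  have "\<exists>d>0. \<forall>z\<in>edge k. dist z z0 < d \<longrightarrow> z0 \<in> edge k" for k
  proof (cases "z0 \<in> edge k")
    case False
    then obtain d where "d > 0" "\<forall>z\<in>edge k. d \<le> dist z0 z"
      using separate_point_closed[OF closed_edge] by blast
    then show ?thesis by (metis dist_commute not_le)
  qed (auto intro: exI[of _ 1])
  then obtain d where d: "\<And>k. d k > 0" "\<And>k z. z \<in> edge k \<Longrightarrow> dist z z0 < d k \<Longrightarrow> z0 \<in> edge k" by metis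
  define \<delta> where "\<delta> = Min (d ` {..<N})"
  have "\<delta> > 0" unfolding \<delta>_def using d N0 by (subst Min_gr_iff) auto
  moreover have "\<delta> \<le> d k" if "k < N" for k unfolding \<delta>_def using that by (intro Min_le) auto
  ultimately show ?thesis using that[of \<delta>] d by (meson less_le_trans)
qed

lemma near_inner_edge:
  assumes k: "k < N" and z0: "z0 \<in> edge k" "z0 \<notin> corners"
  obtains \<delta> where "\<delta> > 0" "\<And>z. z \<in> P \<Longrightarrow> dist z z0 < \<delta> \<Longrightarrow> z \<in> edge k"
    "\<And>z. h k z = 0 \<Longrightarrow> dist z z0 < \<delta> \<Longrightarrow> z \<in> edge k"
proof -
  obtain d where d: "d > 0" "\<And>k z. k < N \<Longrightarrow> z \<in> edge k \<Longrightarrow> dist z z0 < d \<Longrightarrow> z0 \<in> edge k"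
    using near_edges by blast
  obtain s where s: "0 \<le> s" "s \<le> len k" "z0 = v k + s *\<^sub>R u k" using z0 edge_iff by blast
  have "z0 \<noteq> v k" "z0 \<noteq> v (nxt N k)" using z0 k nx(1)[OF k] unfolding corners_def by auto
  then have s': "0 < s" "s < len k" using s v_nxt[of k] by (auto simp: less_le)
  define \<delta> where "\<delta> = min d (min s (len k - s))"
  show ?thesis
  proof (rule that[of \<delta>])
    show "\<delta> > 0" unfolding \<delta>_def using d s' by simp
    fix z assume z: "dist z z0 < \<delta>"
    show "z \<in> edge k" if "z \<in> P"
    proof -
      obtain l where l: "l < N" "z \<in> edge l" using \<open>z \<in> P\<close> path_image_edges by auto
      then have "z0 \<in> edge l" using d(2)[of l z] z unfolding \<delta>_def by simp
      then show ?thesis using edge_unique[of k l z0] l k z0 by auto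
    qed
    show "z \<in> edge k" if "h k z = 0"
    proof -
      obtain t where t: "z = v k + t *\<^sub>R u k" using line_iff[OF k] \<open>h k z = 0\<close> by blast
      have "dist z z0 = \<bar>t - s\<bar>" unfolding t s(3) using norm_u[OF k]
        by (simp add: dist_norm flip: scaleR_diff_left)
      then have "0 \<le> t" "t \<le> len k" using z unfolding \<delta>_def by auto
      then show ?thesis using t edge_iff by blast
    qed
  qed
qed

definition on_edges :: "nat \<Rightarrow> nat \<Rightarrow> nat \<Rightarrow> nat \<Rightarrow> quad \<Rightarrow> bool" where
  "on_edges a b c d R \<longleftrightarrow> a < N \<and> b < N \<and> c < N \<and> d < N \<and>
     fst R \<in> edge a \<and> fst (snd R) \<in> edge b \<and> fst (snd (snd R)) \<in> edge c \<and> snd (snd (snd R)) \<in> edge d"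

lemma on_edgesI: assumes "R \<in> I" shows "\<exists>a b c d. on_edges a b c d R"
proof -
  obtain R0 R1 R2 R3 where R: "R = (R0, R1, R2, R3)" by (metis prod_cases4)
  have *: "\<exists>k. k < N \<and> z \<in> edge k" if "z \<in> {R0, R1, R2, R3}" for z
    using assms that unfolding inscribed_def path_image_edges R by auto
  show ?thesis unfolding on_edges_def R using *[of R0] *[of R1] *[of R2] *[of R3] by (simp, blast)
qed

lemma on_edges_inscribed: "is_rectangle R \<Longrightarrow> on_edges a b c d R \<Longrightarrow> R \<in> I"
  unfolding inscribed_def on_edges_def path_image_edges by (cases R) auto

lemma on_edges_heights:
  assumes "on_edges a b c d (quad_of z w r)"
  shows "h a z = 0" "cr (u b) w = h b z" "cr (u c) (w + r *\<^sub>R (\<i> * w)) = h c z" "r * (u d \<bullet> w) = h d z"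
proof -
  have e: "h a z = 0" "h b (z + w) = 0" "h c (z + w + r *\<^sub>R (\<i> * w)) = 0" "h d (z + r *\<^sub>R (\<i> * w)) = 0"
    using assms edge_line unfolding on_edges_def quad_of_def by auto
  show "h a z = 0" by (rule e)
  show "cr (u b) w = h b z" using e(2) by (simp add: ht_def)
  show "cr (u c) (w + r *\<^sub>R (\<i> * w)) = h c z" using e(3) by (simp add: ht_def)
  show "r * (u d \<bullet> w) = h d z" using e(4) by (simp add: ht_def)
qed

lemma parallel_zero:
  assumes "k < N" "l < N" "k \<noteq> l" "cr (u k) w = 0" "cr (u l) w = 0" shows "w = 0"
proof -
  have "w = (u k \<bullet> w) *\<^sub>R u k" using cr_zero_scaleR norm_u assms by blast
  then have "cr (u l) ((u k \<bullet> w) *\<^sub>R u k) = 0" using assms(5) by metis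
  then have "u k \<bullet> w = 0" using cr_ne[OF assms(2,1)] assms(3) by simp
  then show ?thesis using \<open>w = _\<close> by simp
qed

lemma perpendicular_zero:
  assumes "k < N" "l < N" "cr (u k) w = 0" "u l \<bullet> w = 0" shows "w = 0"
proof -
  have "w = (u k \<bullet> w) *\<^sub>R u k" using cr_zero_scaleR norm_u assms by blast
  then have "u l \<bullet> ((u k \<bullet> w) *\<^sub>R u k) = 0" using assms(4) by metis
  then have "u k \<bullet> w = 0" using dot_ne[OF assms(2,1)] by simp
  then show ?thesis using \<open>w = _\<close> by simp
qed

lemma edge_midpoint:
  assumes "k < N" "x \<in> edge k" "y \<in> edge k" "x \<noteq> y"
  shows "midpoint x y \<in> edge k" "midpoint x y \<noteq> v k" "midpoint x y \<noteq> v (nxt N k)"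
proof -
  obtain s t where st: "0 \<le> s" "s \<le> len k" "x = v k + s *\<^sub>R u k" "0 \<le> t" "t \<le> len k" "y = v k + t *\<^sub>R u k"
    using assms edge_iff by metis
  have m: "midpoint x y = v k + ((s + t) / 2) *\<^sub>R u k"
    unfolding st midpoint_def by (simp add: scaleR_add_right scaleR_add_left add_divide_distrib scaleR_2[symmetric])
  have "s \<noteq> t" using assms st by auto
  moreover have "u k \<noteq> 0" using norm_u[OF assms(1)] by auto
  ultimately show "midpoint x y \<in> edge k" "midpoint x y \<noteq> v k" "midpoint x y \<noteq> v (nxt N k)"
    unfolding m edge_iff v_nxt using st by (auto intro!: exI[of _ "(s+t)/2"])
qed

text \<open>Two adjacent vertices on the same line give it the direction of a side. With two lines, this makes
  them parallel, or three vertices are collinear. In the remaining pattern the diagonals lie on two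
  edges and meet at their common midpoint, but edges meet only at end points.\<close>

lemma on_edges_valid4:
  assumes rect: "is_rectangle R" and on: "on_edges a b c d R"
  shows "valid4 a b c d"
proof -
  obtain z w r where R: "w \<noteq> 0" "r > 0" "R = quad_of z w r" by (rule rectangleE[OF rect]) (rule that)
  note hh = on_edges_heights[OF on[unfolded R(3)]]
  have n: "a < N" "b < N" "c < N" "d < N" using on unfolding on_edges_def by auto
  have nz: "\<not> (cr (u k) w = 0 \<and> u k \<bullet> w = 0)" if "k < N" for k
  proof -
    have "u k \<noteq> 0" using norm_u[OF that] by (metis norm_zero zero_neq_one)
    then show ?thesis using cr_inner_zero[of "u k" w] R(1) by blast
  qed
  have t1: "\<not> (a = b \<and> b = c)" using hh nz[OF n(1)] R(2) by auto
  have t2: "\<not> (a = b \<and> b = d)" using hh nz[OF n(1)] R(2) by auto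
  have t3: "\<not> (a = c \<and> c = d)" using hh nz[OF n(1)] R(2) by auto
  have t4: "\<not> (b = c \<and> c = d)" using hh nz[OF n(2)] R(2) by auto
  have p1: "\<not> (a = b \<and> c = d)"
  proof
    assume "a = b \<and> c = d"
    then have "cr (u a) w = 0" "cr (u c) w = 0" using hh by auto
    then show False using parallel_zero[OF n(1,3)] t1 R(1) \<open>a = b \<and> c = d\<close> by blast
  qed
  have p2: "\<not> (a = d \<and> b = c)"
  proof
    assume e: "a = d \<and> b = c"
    then have "u a \<bullet> w = 0" "u b \<bullet> w = 0" using hh R(2) by auto
    then have "cr (u a) (\<i> * w) = 0" "cr (u b) (\<i> * w) = 0" by simp_all
    then have "\<i> * w = 0" using parallel_zero[OF n(1,2)] t2 e by blast
    then show False using R(1) by simp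
  qed
  have p3: "\<not> (a = c \<and> b = d)"
  proof
    assume e: "a = c \<and> b = d"
    then have ab: "a \<noteq> b" using t1 by blast
    let ?R0 = "z" and ?R1 = "z + w" and ?R2 = "z + w + r *\<^sub>R (\<i> * w)" and ?R3 = "z + r *\<^sub>R (\<i> * w)"
    have m: "midpoint ?R0 ?R2 = midpoint ?R1 ?R3" by (simp add: midpoint_def algebra_simps)
    have ed: "?R0 \<in> edge a" "?R2 \<in> edge a" "?R1 \<in> edge b" "?R3 \<in> edge b"
      using on e unfolding R(3) on_edges_def quad_of_def by auto
    have "cr w (w + r *\<^sub>R (\<i> * w)) \<noteq> 0" "cr w (w - r *\<^sub>R (\<i> * w)) \<noteq> 0" using R by auto
    then have "w + r *\<^sub>R (\<i> * w) \<noteq> 0" "w - r *\<^sub>R (\<i> * w) \<noteq> 0" by (metis cr_bilinear(10))+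
    then have ne: "?R0 \<noteq> ?R2" "?R1 \<noteq> ?R3" by (auto simp: add.assoc)
    note ma = edge_midpoint[OF n(1) ed(1,2) ne(1)] and mb = edge_midpoint[OF n(2) ed(3,4) ne(2)]
    show False using edge_Int[OF n(1,2) ab ma(1)] ma mb m by auto
  qed
  show ?thesis unfolding valid4_def using t1 t2 t3 t4 p1 p2 p3 by blast
qed

text \<open>The value at the point \<open>p\<close> of the condition that some rectangle of aspect ratio \<open>r\<close> with first
  vertex \<open>p\<close> has its other vertices on the lines of \<open>b\<close>, \<open>c\<close>, \<open>d\<close>; and the rate at which this
  value changes when \<open>p\<close> moves along the line of \<open>a\<close>.\<close>

definition defect :: "complex \<Rightarrow> nat \<Rightarrow> nat \<Rightarrow> nat \<Rightarrow> real \<Rightarrow> real" where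
  "defect p b c d r = corner_poly (u b) (u c) (u d) (h b p) (h c p) (h d p) r"

definition slope :: "nat \<Rightarrow> nat \<Rightarrow> nat \<Rightarrow> nat \<Rightarrow> real \<Rightarrow> real" where
  "slope a b c d r = corner_poly (u b) (u c) (u d) (cr (u b) (u a)) (cr (u c) (u a)) (cr (u d) (u a)) r"

lemma ht_move: "h k (p + s *\<^sub>R u a) = h k p - s * cr (u k) (u a)"
  by (simp add: ht_def)

lemma defect_move: "defect (p + s *\<^sub>R u a) b c d r = defect p b c d r - s * slope a b c d r"
  unfolding defect_def slope_def ht_move by (rule corner_poly_diff)

lemma defect_zero:
  assumes "on_edges a b c d (quad_of z w r)" shows "defect z b c d r = 0"
  unfolding defect_def using on_edges_heights[OF assms] by (intro corner_poly_zero) auto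

text \<open>At a zero of the determinant the compatibility condition does not depend on the point of the line of \<open>a\<close>,
  so it can be evaluated at a vertex \<open>v j\<close>. Thus the aspect ratio would be a common zero of the two
  polynomials of which \<^const>\<open>gres\<close> is the resultant.\<close>

lemma slope_ne:
  assumes rect: "is_rectangle R" and on: "on_edges a b c d R"
  shows "slope a b c d (aspect_ratio R) \<noteq> 0"
proof
  obtain z w r where R: "w \<noteq> 0" "r > 0" "R = quad_of z w r" by (rule rectangleE[OF rect]) (rule that)
  have ar: "aspect_ratio R = r" using rectangle_quad_of R by simp
  assume "slope a b c d (aspect_ratio R) = 0"
  then have S: "slope a b c d r = 0" using ar by simp
  have val: "valid4 a b c d" using on_edges_valid4[OF rect on] .
  have n: "a < N" "b < N" "c < N" "d < N" using on unfolding on_edges_def by auto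
  have F: "defect z b c d r = 0" using defect_zero on R by blast
  obtain s where s: "z = v a + s *\<^sub>R u a" using on_edges_heights(1)[OF on[unfolded R(3)]] line_iff[OF n(1)] by blast
  define m where "m = res_edge a b c d"
  have ma: "m \<noteq> a" using val unfolding m_def res_edge_def valid4_def by auto
  \<comment> \<open>One of the two end points of the edge \<open>a\<close> is not on the edge \<open>m\<close>.\<close>
  obtain j where j: "j < N" "j = a \<or> j = nxt N a" "\<not> edge_end N j m"
  proof (cases "m = prv N a")
    case True
    have "\<not> edge_end N (nxt N a) m" using True ma nx[OF n(1)] unfolding edge_end_def by metis
    then show ?thesis using that[of "nxt N a"] nx(1)[OF n(1)] by blast
  next
    case False
    then show ?thesis using that[of a] n ma unfolding edge_end_def by blast
  qed
  have "gres N v j a b c d \<noteq> 0"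
    by (rule gres_ne[OF n j(1) val j(2) j(3)[unfolded m_def]])
  moreover have "gres N v j a b c d = 0"
  proof -
    obtain s' where "v j = z + s' *\<^sub>R u a"
    proof (cases "j = a")
      case True then show ?thesis using that[of "- s"] s by simp
    next
      case False
      then have "v j = z + (len a - s) *\<^sub>R u a" using j(2) s v_nxt[of a] by (simp add: algebra_simps)
      then show ?thesis using that by blast
    qed
    then have Fj: "defect (v j) b c d r = 0" using defect_move[of z s' a b c d r] F S by simp
    define p0 p1 p2 where "p0 = cr (u d) (u a) * cr (u b) (u c)"
      and "p1 = cp_lin (u b) (u c) (u d) (cr (u b) (u a)) (cr (u c) (u a)) (cr (u d) (u a))"
      and "p2 = cr (u b) (u a) * cr (u c) (u d)"
    define q0 q1 q2 where "q0 = h d (v j) * cr (u b) (u c)"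
      and "q1 = cp_lin (u b) (u c) (u d) (h b (v j)) (h c (v j)) (h d (v j))"
      and "q2 = h b (v j) * cr (u c) (u d)"
    have P: "p0 + p1 * r + p2 * r\<^sup>2 = 0"
      using S unfolding slope_def corner_poly_def p0_def p1_def p2_def cp_lin_def by (simp add: algebra_simps)
    have Q: "q0 + q1 * r + q2 * r\<^sup>2 = 0"
      using Fj unfolding defect_def corner_poly_def q0_def q1_def q2_def cp_lin_def by (simp add: algebra_simps)
    have form: "gres N v j a b c d = (if a = b \<or> c = d then p0 * q1 - p1 * q0
        else if b = c \<or> a = d then p1 * q2 - p2 * q1 else res2 p0 p1 p2 q0 q1 q2)"
      unfolding gres_def Let_def p0_def p1_def p2_def q0_def q1_def q2_def by simp
    have ha: "h a (v j) = 0"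
      by (rule ht_vertex(1)[OF N3 ng n(1) j(1)]) (use j(2) nx[OF n(1)] in \<open>auto simp: edge_end_def\<close>)
    consider "a = b \<or> c = d" | "\<not> (a = b \<or> c = d)" "b = c \<or> a = d" | "\<not> (a = b \<or> c = d)" "\<not> (b = c \<or> a = d)"
      by blast
    then show ?thesis
    proof cases
      case 1
      then have "p2 = 0" "q2 = 0" using ha unfolding p2_def q2_def by auto
      then have "p0 = - p1 * r" "q0 = - q1 * r" using P Q by auto
      then show ?thesis using form 1 by simp
    next
      case 2
      then have "p0 = 0" "q0 = 0" using ha unfolding p0_def q0_def by auto
      then have "r * (p1 + p2 * r) = 0" "r * (q1 + q2 * r) = 0"
        using P Q by (simp_all add: algebra_simps power2_eq_square)
      then have "p1 = - p2 * r" "q1 = - q2 * r" using R(2) by (simp_all add: add_eq_0_iff)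
      then show ?thesis using form 2 by simp
    next
      case 3
      then show ?thesis using form res2_common_root[OF P Q] by simp
    qed
  qed
  ultimately show False by simp
qed

text \<open>The rectangle of aspect ratio \<open>r\<close> with vertices on the lines of \<open>a\<close>, \<open>b\<close>, \<open>c\<close>, \<open>d\<close>, by
  Cramer's rule; \<open>p\<close> is any point of the line of \<open>a\<close>.\<close>

definition line_point :: "complex \<Rightarrow> nat \<Rightarrow> nat \<Rightarrow> nat \<Rightarrow> nat \<Rightarrow> real \<Rightarrow> complex" where
  "line_point p a b c d r = p + (defect p b c d r / slope a b c d r) *\<^sub>R u a"

definition side_vec :: "nat \<Rightarrow> nat \<Rightarrow> complex \<Rightarrow> real \<Rightarrow> complex" where
  "side_vec b d z r = (h b z / (u b \<bullet> u d)) *\<^sub>R (\<i> * u d) + (h d z / (r * (u b \<bullet> u d))) *\<^sub>R u b"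

definition line_rect :: "complex \<Rightarrow> nat \<Rightarrow> nat \<Rightarrow> nat \<Rightarrow> nat \<Rightarrow> real \<Rightarrow> quad" where
  "line_rect p a b c d r = quad_of (line_point p a b c d r) (side_vec b d (line_point p a b c d r) r) r"

lemma side_vec_unique:
  assumes "b < N" "d < N" "r \<noteq> 0" "cr (u b) w = h b z" "r * (u d \<bullet> w) = h d z"
  shows "w = side_vec b d z r"
proof -
  have bd: "u b \<bullet> u d \<noteq> 0" using dot_ne assms by blast
  have "(u b \<bullet> u d) *\<^sub>R w = h b z *\<^sub>R (\<i> * u d) + (h d z / r) *\<^sub>R u b"
  proof -
    have "u d \<bullet> w = h d z / r" using assms(3,5) by (simp add: field_simps)
    then show ?thesis using cr_inner_expand[of "u b" "u d" w] assms(4) by simp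
  qed
  then have "(1 / (u b \<bullet> u d)) *\<^sub>R ((u b \<bullet> u d) *\<^sub>R w)
      = (1 / (u b \<bullet> u d)) *\<^sub>R (h b z *\<^sub>R (\<i> * u d) + (h d z / r) *\<^sub>R u b)" by (rule arg_cong)
  then have "w = (1 / (u b \<bullet> u d)) *\<^sub>R (h b z *\<^sub>R (\<i> * u d) + (h d z / r) *\<^sub>R u b)"
    using bd by simp
  then show ?thesis unfolding side_vec_def by (simp add: scaleR_add_right mult.commute)
qed

lemma side_vec_solves:
  assumes "b < N" "d < N" "r \<noteq> 0"
  shows "cr (u b) (side_vec b d z r) = h b z" "r * (u d \<bullet> side_vec b d z r) = h d z"
  using dot_ne[OF assms(1,2)] assms(3)
  by (simp_all add: side_vec_def inner_add_right inner_commute)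

lemma line_rect_unique:
  assumes on: "on_edges a b c d R" and rect: "is_rectangle R" and p: "h a p = 0"
  shows "R = line_rect p a b c d (aspect_ratio R)"
proof -
  obtain z w r where R: "w \<noteq> 0" "r > 0" "R = quad_of z w r" by (rule rectangleE[OF rect]) (rule that)
  have ar: "aspect_ratio R = r" using rectangle_quad_of R by simp
  have n: "a < N" "b < N" "c < N" "d < N" using on unfolding on_edges_def by auto
  have S: "slope a b c d r \<noteq> 0" using slope_ne[OF rect on] ar by simp
  note hh = on_edges_heights[OF on[unfolded R(3)]]
  obtain s t where st: "z = v a + s *\<^sub>R u a" "p = v a + t *\<^sub>R u a" using line_iff[OF n(1)] p hh(1) by blast
  then have z: "z = p + (s - t) *\<^sub>R u a" by (simp add: algebra_simps)
  have "defect p b c d r - (s - t) * slope a b c d r = 0"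
    using defect_zero on R(3) defect_move[of p "s - t" a b c d r] z by metis
  then have "s - t = defect p b c d r / slope a b c d r" using S by (simp add: field_simps)
  then have "z = line_point p a b c d r" using z by (simp add: line_point_def)
  moreover have "w = side_vec b d z r" using side_vec_unique n hh R(2) by simp
  ultimately show ?thesis unfolding ar line_rect_def using R(3) by simp
qed

lemma line_rect_on_lines:
  assumes n: "a < N" "b < N" "c < N" "d < N" and r: "r \<noteq> 0" and S: "slope a b c d r \<noteq> 0" and p: "h a p = 0"
    and R: "line_rect p a b c d r = (R0, R1, R2, R3)"
  shows "h a R0 = 0" "h b R1 = 0" "h c R2 = 0" "h d R3 = 0"
proof -
  define z where "z = line_point p a b c d r"
  define w where "w = side_vec b d z r"
  have RR: "R0 = z" "R1 = z + w" "R2 = z + w + r *\<^sub>R (\<i> * w)" "R3 = z + r *\<^sub>R (\<i> * w)"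
    using R unfolding line_rect_def z_def[symmetric] w_def[symmetric] quad_of_def by auto
  note sv = side_vec_solves[OF n(2,4) r, of z, folded w_def]
  have "h a z = h a p" unfolding z_def line_point_def ht_move by simp
  then show "h a R0 = 0" using RR p by simp
  show "h b R1 = 0" using RR sv by (simp add: ht_def)
  show "h d R3 = 0" using RR sv by (simp add: ht_def)
  have F: "defect z b c d r = 0" unfolding z_def line_point_def defect_move using S by simp
  define y where "y = cr (u c) (w + r *\<^sub>R (\<i> * w))"
  have "corner_poly (u b) (u c) (u d) (h b z) y (h d z) r = 0"
    by (rule corner_poly_zero) (use sv y_def in auto)
  moreover have "r * (u b \<bullet> u d) * (h c z - y)
      = defect z b c d r - corner_poly (u b) (u c) (u d) (h b z) y (h d z) r"
    unfolding defect_def corner_poly_def by (simp add: algebra_simps)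
  ultimately have "r * (u b \<bullet> u d) * (h c z - y) = 0" using F by simp
  then have "h c z = y" using r dot_ne[OF n(2,4)] by simp
  then show "h c R2 = 0" using RR by (simp add: ht_def y_def)
qed

end

section \<open>Rectangles with a vertex at a vertex of the polygon\<close>

text \<open>The elimination behind \<^const>\<open>gdiag\<close>: \<open>w\<close> and \<open>y\<close> are two perpendicular sides, and the four
  determinants are the heights of the end points of the diagonal over the lines of \<open>b\<close> and \<open>d\<close>.\<close>

lemma gdiag_identity:
  assumes "b \<bullet> b = 1" "d \<bullet> d = 1" "w \<bullet> y = 0"
  shows "cr d w * cr b y * (b \<bullet> d) - cr d w * cr d y - cr b w * cr b y + cr b w * cr d y * (b \<bullet> d) = 0"
proof -
  have "cr d w * cr b y * (b \<bullet> d) - cr d w * cr d y * (b \<bullet> b) - cr b w * cr b y * (d \<bullet> d) + cr b w * cr d y * (b \<bullet> d)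
     = - (cr b d)\<^sup>2 * (w \<bullet> y)"
    unfolding cr_Re_Im inner_complex_def by simp algebra
  then show ?thesis using assms by simp
qed

lemma relabel_quad_of: "r \<noteq> 0 \<Longrightarrow> relabel (quad_of z w r) = quad_of (z + w) (r *\<^sub>R (\<i> * w)) (1 / r)"
  by (simp add: quad_of_def complex_eq_iff)

lemma relabel_rectangle:
  assumes "is_rectangle R"
  shows "is_rectangle (relabel R)" "aspect_ratio (relabel R) = 1 / aspect_ratio R"
proof -
  obtain z w r where R: "w \<noteq> 0" "r > 0" "R = quad_of z w r" by (rule rectangleE[OF assms]) (rule that)
  have e: "relabel R = quad_of (z + w) (r *\<^sub>R (\<i> * w)) (1 / r)" using relabel_quad_of R by simp
  have "r *\<^sub>R (\<i> * w) \<noteq> 0" "1 / r > 0" using R by auto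
  note q = rectangle_quad_of[OF this, of "z + w"]
  show "is_rectangle (relabel R)" unfolding e by (rule q)
  show "aspect_ratio (relabel R) = 1 / aspect_ratio R"
    unfolding e q(2) using rectangle_quad_of(2)[OF R(1,2)] R(3) by simp
qed

lemma vertices_relabel [simp]: "vertices (relabel R) = vertices R"
  by (cases R) auto

lemma relabel_inscribed: "R \<in> inscribed \<gamma> \<Longrightarrow> relabel R \<in> inscribed \<gamma>"
  by (simp add: inscribed_def relabel_rectangle)

lemma relabel4 [simp]: "relabel (relabel (relabel (relabel R))) = R"
  by (cases R) simp

lemma continuous_on_relabel: "continuous_on S relabel"
proof -
  have e: "relabel = (\<lambda>R. (fst (snd R), fst (snd (snd R)), snd (snd (snd R)), fst R))" by (auto simp: fun_eq_iff)
  show ?thesis unfolding e by (intro continuous_intros)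
qed

lemma bounded_linear_relabel: "bounded_linear relabel"
proof -
  have e: "relabel = (\<lambda>R. (fst (snd R), fst (snd (snd R)), snd (snd (snd R)), fst R))" by (auto simp: fun_eq_iff)
  show ?thesis unfolding e
    by (intro bounded_linear_Pair bounded_linear_fst bounded_linear_snd
        bounded_linear_compose[OF bounded_linear_fst] bounded_linear_compose[OF bounded_linear_snd] bounded_linear_ident)
qed

lemma relabel_image_inscribed: "relabel ` inscribed \<gamma> = inscribed \<gamma>"
proof
  show "inscribed \<gamma> \<subseteq> relabel ` inscribed \<gamma>"
  proof
    fix R assume "R \<in> inscribed \<gamma>"
    then have "relabel (relabel (relabel R)) \<in> inscribed \<gamma>" by (intro relabel_inscribed)
    then show "R \<in> relabel ` inscribed \<gamma>" by (metis image_eqI relabel4)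
  qed
  show "relabel ` inscribed \<gamma> \<subseteq> inscribed \<gamma>" using relabel_inscribed by blast
qed

lemma relabel_homeomorphism_inscribed:
  "homeomorphism (inscribed \<gamma>) (inscribed \<gamma>) relabel (relabel \<circ> relabel \<circ> relabel)"
proof (rule homeomorphismI)
  show "relabel ` inscribed \<gamma> \<subseteq> inscribed \<gamma>" "(relabel \<circ> relabel \<circ> relabel) ` inscribed \<gamma> \<subseteq> inscribed \<gamma>"
    using relabel_inscribed by (metis image_subsetI, metis comp_apply image_subsetI)
  show "continuous_on (inscribed \<gamma>) relabel" by (rule continuous_on_relabel)
  show "continuous_on (inscribed \<gamma>) (relabel \<circ> relabel \<circ> relabel)"
    by (intro continuous_on_compose continuous_on_relabel)
  fix R show "(relabel \<circ> relabel \<circ> relabel) (relabel R) = R" "relabel ((relabel \<circ> relabel \<circ> relabel) R) = R"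
    by (cases R; simp)+
qed

context generic_polygon begin

definition has_corner :: "quad \<Rightarrow> bool" where "has_corner R \<longleftrightarrow> vertices R \<inter> corners \<noteq> {}"

lemma has_corner_relabel [simp]: "has_corner (relabel R) = has_corner R"
  by (simp add: has_corner_def)

lemma edge_end_vertex: "i < N \<Longrightarrow> k < N \<Longrightarrow> edge_end N i k \<Longrightarrow> v i \<in> edge k"
  using edge_at_vertex by blast

lemma inner_u_self: "k < N \<Longrightarrow> u k \<bullet> u k = 1" by (rule inner_edir_self[OF N3 ng])

text \<open>If \<open>v i\<close> and \<open>v k\<close> span a side \<open>w\<close>, each of the other two vertices determines the aspect ratio; \<open>gside = 0\<close>
  says that the two values agree.\<close>

lemma side_not_both_corners:
  assumes R: "quad_of (v i) w r \<in> I" "w \<noteq> 0" "r > 0" and ik: "i < N" "k < N"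
  shows "v i + w \<noteq> v k"
proof
  assume k: "v i + w = v k"
  have rect: "is_rectangle (quad_of (v i) w r)" using rectangle_quad_of R by blast
  have ne: "i \<noteq> k" using k R(2) by auto
  have w: "w = v k - v i" using k by (simp add: algebra_simps)
  obtain a b c d where on: "on_edges a b c d (quad_of (v i) w r)" using on_edgesI[OF R(1)] by blast
  have n: "c < N" "d < N" using on unfolding on_edges_def by auto
  note hh = on_edges_heights[OF on]
  have hd: "h d (v i) = r * (u d \<bullet> w)" using hh by simp
  have hc: "h c (v k) = r * (u c \<bullet> w)"
  proof -
    have "h c (v k) = h c (v i) - cr (u c) w" using k by (simp add: ht_def flip: k)
    then show ?thesis using hh(3) by simp
  qed
  have dotw: "u l \<bullet> w \<noteq> 0" if "l < N" for l
    using basic_genericD(1)[OF bas that ik ne] w by simp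
  have e1: "\<not> edge_end N k c" using ht_vertex(1)[OF N3 ng n(1) ik(2)] hc dotw[OF n(1)] R(3) by auto
  have e2: "\<not> edge_end N i d" using ht_vertex(1)[OF N3 ng n(2) ik(1)] hd dotw[OF n(2)] R(3) by auto
  have cd: "c \<noteq> d"
  proof
    assume cd: "c = d"
    have "cr (u c) w = 0" using hh(3) hd cd by simp
    then have "{i, k} = {c, nxt N c}" using basic_genericD(2)[OF bas n(1) ik ne] w by auto
    then have "k = c \<or> k = nxt N c" by (auto simp: doubleton_eq_iff)
    then have "edge_end N k c" using nx[OF n(1)] by (auto simp: edge_end_def)
    then show False using e1 by simp
  qed
  show False
  proof (cases "edge_end N i c \<and> edge_end N k d")
    case True
    then have "on_edges c d c d (quad_of (v i) w r)"
      using on edge_end_vertex ik n k unfolding on_edges_def quad_of_def by simp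
    then show False using on_edges_valid4[OF rect] unfolding valid4_def by blast
  next
    case False
    have "gside N v i k c d \<noteq> 0" by (rule gside_ne) (use ik n ne cd e1 e2 False in auto)
    moreover have "gside N v i k c d = 0" unfolding gside_def w[symmetric] hd hc by simp
    ultimately show False by simp
  qed
qed

lemma diagonal_not_both_corners:
  assumes R: "quad_of (v i) w r \<in> I" "w \<noteq> 0" "r > 0" and ik: "i < N" "k < N"
  shows "v i + w + r *\<^sub>R (\<i> * w) \<noteq> v k"
proof
  define y where "y = r *\<^sub>R (\<i> * w)"
  assume "v i + w + r *\<^sub>R (\<i> * w) = v k"
  then have k: "v k = v i + w + y" by (simp add: y_def)
  have rect: "is_rectangle (quad_of (v i) w r)" using rectangle_quad_of R by blast
  have wy: "w \<bullet> y = 0" by (simp add: y_def)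
  obtain a b c d where on: "on_edges a b c d (quad_of (v i) w r)" using on_edgesI[OF R(1)] by blast
  have n: "b < N" "d < N" using on unfolding on_edges_def by auto
  have e: "v i + w \<in> edge b" "v i + y \<in> edge d" using on by (auto simp: on_edges_def quad_of_def y_def)
  have l: "h b (v i + w) = 0" "h d (v i + y) = 0" using edge_line e n by auto
  have hb: "h b (v i) = cr (u b) w" "h b (v k) = - cr (u b) y"
    using l(1) k by (auto simp: ht_def)
  have hd: "h d (v i) = cr (u d) y" "h d (v k) = - cr (u d) w"
    using l(2) k by (auto simp: ht_def)
  have "w + y \<noteq> 0"
  proof
    assume "w + y = 0"
    then have "w \<bullet> (w + y) = 0" by simp
    then show False using wy R(2) by (simp add: inner_add_right)
  qed
  then have ne: "i \<noteq> k" using k by (auto simp: add.assoc)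
  show False
  proof (cases "\<not> edge_end N i b \<and> \<not> edge_end N k b \<or> \<not> edge_end N i d \<and> \<not> edge_end N k d")
    case True
    have "gdiag N v i k b d \<noteq> 0" by (rule gdiag_ne) (use ik n ne True in auto)
    moreover have "gdiag N v i k b d = 0"
    proof (cases "b = d")
      case True
      then show ?thesis unfolding gdiag_def Let_def using hb hd by auto
    next
      case False
      have "gdiag N v i k b d = cr (u d) w * cr (u b) y * (u b \<bullet> u d) - cr (u d) w * cr (u d) y
         - cr (u b) w * cr (u b) y + cr (u b) w * cr (u d) y * (u b \<bullet> u d)"
        unfolding gdiag_def Let_def hb hd using False by simp
      then show ?thesis using gdiag_identity[OF inner_u_self[OF n(1)] inner_u_self[OF n(2)] wy] by simp
    qed
    ultimately show False by simp
  next
    case False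
    then consider "edge_end N i b" "edge_end N k d" | "edge_end N k b" "edge_end N i d"
      | "edge_end N i b" "edge_end N i d" | "edge_end N k b" "edge_end N k d" by blast
    then show False
    proof cases
      case 1
      then have "v i \<in> edge b" "v k \<in> edge d" using edge_end_vertex ik n by auto
      then have "on_edges b b d d (quad_of (v i) w r)"
        using ik n e unfolding on_edges_def quad_of_def k y_def by simp
      then show False using on_edges_valid4[OF rect] unfolding valid4_def by blast
    next
      case 2
      then have "v i \<in> edge d" "v k \<in> edge b" using edge_end_vertex ik n by auto
      then have "on_edges d b b d (quad_of (v i) w r)"
        using ik n e unfolding on_edges_def quad_of_def k y_def by simp
      then show False using on_edges_valid4[OF rect] unfolding valid4_def by blast
    next
      case 3
      then have "cr (u b) w = 0" "cr (u d) y = 0" using ht_vertex(1)[OF N3 ng _ ik(1)] n hb hd by auto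
      then have "cr (u b) w = 0" "u d \<bullet> w = 0" using R(3) by (auto simp: y_def)
      then show False using perpendicular_zero n R(2) by blast
    next
      case 4
      then have "cr (u b) y = 0" "cr (u d) w = 0" using ht_vertex(1)[OF N3 ng _ ik(2)] n hb hd by auto
      then have "cr (u d) w = 0" "u b \<bullet> w = 0" using R(3) by (auto simp: y_def)
      then show False using perpendicular_zero n R(2) by blast
    qed
  qed
qed

lemma one_corner:
  assumes R: "R \<in> I" and c: "fst R \<in> corners"
  shows "fst (snd R) \<notin> corners" "fst (snd (snd R)) \<notin> corners" "snd (snd (snd R)) \<notin> corners"
proof -
  have rect: "is_rectangle R" using R by (simp add: inscribed_def)
  obtain z w r where q: "w \<noteq> 0" "r > 0" "R = quad_of z w r" by (rule rectangleE[OF rect]) (rule that)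
  obtain i where i: "i < N" "z = v i" using c q unfolding corners_def quad_of_def by auto
  show "fst (snd R) \<notin> corners"
    using side_not_both_corners[of i w r] R q i unfolding corners_def quad_of_def by auto
  show "fst (snd (snd R)) \<notin> corners"
    using diagonal_not_both_corners[of i w r] R q i unfolding corners_def quad_of_def by auto
  show "snd (snd (snd R)) \<notin> corners"
  proof
    assume "snd (snd (snd R)) \<in> corners"
    then obtain k where k: "k < N" "z + r *\<^sub>R (\<i> * w) = v k" using q unfolding corners_def quad_of_def by auto
    have e: "relabel (relabel (relabel R)) = quad_of (v k) (- r *\<^sub>R (\<i> * w)) (1 / r)"
      using k q by (simp add: quad_of_def complex_eq_iff)
    have "relabel (relabel (relabel R)) \<in> I" using R relabel_inscribed by blast
    moreover have "v k + (- r *\<^sub>R (\<i> * w)) = v i" unfolding k(2)[symmetric] i(2) by simp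
    moreover have "- r *\<^sub>R (\<i> * w) \<noteq> 0" "1 / r > 0" using q by auto
    ultimately show False
      using side_not_both_corners[of k "- r *\<^sub>R (\<i> * w)" "1 / r" i] i(1) k(1) unfolding e by blast
  qed
qed

lemma corner_rotate:
  assumes "R \<in> I" "has_corner R"
  obtains j where "j < 4" "fst ((relabel ^^ j) R) \<in> corners"
proof -
  obtain R0 R1 R2 R3 where R: "R = (R0, R1, R2, R3)" by (metis prod_cases4)
  then have "R0 \<in> corners \<or> R1 \<in> corners \<or> R2 \<in> corners \<or> R3 \<in> corners"
    using assms unfolding has_corner_def by auto
  then show ?thesis
    using that[of 0] that[of 1] that[of 2] that[of 3] R by (auto simp: numeral_2_eq_2 numeral_3_eq_3)
qed

lemma corner_on_edges:
  assumes R: "R \<in> I" and i: "fst R = v i" "i < N"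
  obtains b c d where "on_edges i b c d R" "on_edges (prv N i) b c d R" "validc N i b c d"
proof -
  have rect: "is_rectangle R" using R by (simp add: inscribed_def)
  obtain a b c d where on: "on_edges a b c d R" using on_edgesI[OF R] by blast
  have o1: "on_edges i b c d R" and o2: "on_edges (prv N i) b c d R"
    using on i edge_end_vertex[OF i(2)] nx[OF i(2)] unfolding on_edges_def edge_end_def by auto
  have "{b, d} \<noteq> {i, prv N i}"
  proof
    assume e: "{b, d} = {i, prv N i}"
    obtain z w r where q: "w \<noteq> 0" "r > 0" "R = quad_of z w r" by (rule rectangleE[OF rect]) (rule that)
    have z: "z = v i" using i q by (simp add: quad_of_def)
    have n: "b < N" "d < N" using on unfolding on_edges_def by auto
    have "edge_end N i b" "edge_end N i d" using e unfolding edge_end_def by (auto simp: doubleton_eq_iff)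
    then have "h b z = 0" "h d z = 0" using ht_vertex(1)[OF N3 ng _ i(2)] n z by auto
    then have "cr (u b) w = 0" "u d \<bullet> w = 0" using on_edges_heights[OF on[unfolded q(3)]] q(2) by auto
    then show False using perpendicular_zero n q(1) by blast
  qed
  then have "validc N i b c d" using on_edges_valid4[OF rect] o1 o2 unfolding validc_def by blast
  then show ?thesis using that o1 o2 by blast
qed

text \<open>At a zero \<open>r\<close> of \<open>defect\<close>, its derivative with respect to \<open>r\<close>.\<close>

definition defect_slope :: "complex \<Rightarrow> nat \<Rightarrow> nat \<Rightarrow> nat \<Rightarrow> real \<Rightarrow> real" where
  "defect_slope p b c d r =
     2 * (h b p * cr (u c) (u d)) * r + cp_lin (u b) (u c) (u d) (h b p) (h c p) (h d p)"

lemma defect_expand: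
  assumes "defect p b c d r = 0"
  shows "defect p b c d x = (x - r) * (defect_slope p b c d r + h b p * cr (u c) (u d) * (x - r))"
proof -
  have "defect p b c d x - defect p b c d r = (x - r) * (defect_slope p b c d r + h b p * cr (u c) (u d) * (x - r))"
    by (simp add: defect_def corner_poly_def defect_slope_def cp_lin_def power2_eq_square algebra_simps)
  then show ?thesis using assms by simp
qed

text \<open>At a double root the discriminant would vanish.\<close>

lemma corner_simple_root:
  assumes val: "validc N i b c d" and n: "i < N" "b < N" "c < N" "d < N"
    and F: "defect (v i) b c d r = 0"
  shows "defect_slope (v i) b c d r \<noteq> 0"
proof
  assume s: "defect_slope (v i) b c d r = 0"
  define F0 F1 F2 where "F0 = h d (v i) * cr (u b) (u c)"
    and "F1 = cp_lin (u b) (u c) (u d) (h b (v i)) (h c (v i)) (h d (v i))"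
    and "F2 = h b (v i) * cr (u c) (u d)"
  have F1: "F1 = - 2 * F2 * r" using s unfolding defect_slope_def F1_def F2_def by simp
  have "r\<^sup>2 * F2 + r * F1 + F0 = 0"
    using F unfolding defect_def corner_poly_def F0_def F1_def F2_def cp_lin_def by (simp add: algebra_simps)
  then have F0: "F0 = F2 * r\<^sup>2" using F1 by (simp add: power2_eq_square algebra_simps)
  have "gdisc N v i b c d = F1\<^sup>2 - 4 * F0 * F2" unfolding gdisc_def Let_def F0_def F1_def F2_def by simp
  also have "\<dots> = 0" unfolding F1 F0 by (simp add: power2_eq_square algebra_simps)
  finally show False using gdisc_ne[OF n val] by simp
qed

lemma corner_not_square:
  assumes R: "R \<in> I" and c: "has_corner R" shows "aspect_ratio R \<noteq> 1"
proof
  assume a: "aspect_ratio R = 1"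
  obtain j where j: "fst ((relabel ^^ j) R) \<in> corners" using corner_rotate[OF R c] by blast
  have RI: "(relabel ^^ j) R \<in> I \<and> aspect_ratio ((relabel ^^ j) R) = 1" for j
  proof (induction j)
    case (Suc j)
    then have "is_rectangle ((relabel ^^ j) R)" by (simp add: inscribed_def)
    then show ?case using Suc relabel_inscribed relabel_rectangle(2) by simp
  qed (use R a in auto)
  define S where "S = (relabel ^^ j) R"
  have S: "S \<in> I" "aspect_ratio S = 1" "fst S \<in> corners" using RI j by (auto simp: S_def)
  obtain i where i: "i < N" "fst S = v i" using S(3) by (auto simp: corners_def)
  obtain b c d where on: "on_edges i b c d S" and val: "validc N i b c d"
    using corner_on_edges[OF S(1) i(2,1)] by blast
  have n: "b < N" "c < N" "d < N" using on unfolding on_edges_def by auto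
  have "S = quad_of (v i) (fst (snd S) - fst S) 1"
    using quad_of_aspect(2)[of S] S i by (simp add: inscribed_def)
  then have "defect (v i) b c d 1 = 0" using defect_zero on by metis
  then have "gsquare N v i b c d = 0" unfolding gsquare_def Let_def defect_def by simp
  then show False using gsquare_ne[OF i(1) n val] by simp
qed

end

section \<open>Smoothness away from the vertices of the polygon\<close>

text \<open>The definition of smooth points asks for the sequence of all derivatives at once. A family that is
  closed under differentiation provides it.\<close>

lemma derivatives_of_closed_family:
  fixes C :: "(real \<Rightarrow> 'a::real_normed_vector) set"
  assumes C: "\<And>f. f \<in> C \<Longrightarrow> \<exists>f'\<in>C. \<forall>t. (f has_vector_derivative f' t) (at t)" and f: "f \<in> C"
  obtains D where "D 0 = f" "\<And>k t. (D k has_vector_derivative D (Suc k) t) (at t)"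
proof -
  obtain d where d: "\<And>f. f \<in> C \<Longrightarrow> d f \<in> C" "\<And>f t. f \<in> C \<Longrightarrow> (f has_vector_derivative d f t) (at t)"
    using C by metis
  define D where "D = (\<lambda>k. (d ^^ k) f)"
  have "D k \<in> C" for k by (induction k) (auto simp: D_def d f)
  then have "(D k has_vector_derivative D (Suc k) t) (at t)" for k t using d(2)[of "D k" t] by (simp add: D_def)
  then show ?thesis using that[of D] by (simp add: D_def)
qed

definition rational_on :: "real set \<Rightarrow> (real \<Rightarrow> real) \<Rightarrow> bool" where
  "rational_on J f \<longleftrightarrow> (\<exists>p q. \<forall>x\<in>J. poly q x \<noteq> 0 \<and> f x = poly p x / poly q x)"

named_theorems rational_intros

lemma rational_onI: "(\<And>x. x \<in> J \<Longrightarrow> poly q x \<noteq> 0) \<Longrightarrow> (\<And>x. x \<in> J \<Longrightarrow> f x = poly p x / poly q x) \<Longrightarrow> rational_on J f"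
  unfolding rational_on_def by blast

lemma rational_const [rational_intros]: "rational_on J (\<lambda>_. c)"
  by (rule rational_onI[of J 1 _ "[:c:]"]) auto

lemma rational_id [rational_intros]: "rational_on J (\<lambda>x. x)"
  by (rule rational_onI[of J 1 _ "[:0,1:]"]) auto

lemma rational_add [rational_intros]:
  assumes "rational_on J f" "rational_on J g" shows "rational_on J (\<lambda>x. f x + g x)"
proof -
  obtain p q p' q' where h: "\<And>x. x \<in> J \<Longrightarrow> poly q x \<noteq> 0 \<and> f x = poly p x / poly q x"
    "\<And>x. x \<in> J \<Longrightarrow> poly q' x \<noteq> 0 \<and> g x = poly p' x / poly q' x" using assms unfolding rational_on_def by blast
  show ?thesis by (rule rational_onI[of J "q * q'" _ "p * q' + p' * q"]) (use h in \<open>auto simp: field_simps\<close>)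
qed

lemma rational_mult [rational_intros]:
  assumes "rational_on J f" "rational_on J g" shows "rational_on J (\<lambda>x. f x * g x)"
proof -
  obtain p q p' q' where h: "\<And>x. x \<in> J \<Longrightarrow> poly q x \<noteq> 0 \<and> f x = poly p x / poly q x"
    "\<And>x. x \<in> J \<Longrightarrow> poly q' x \<noteq> 0 \<and> g x = poly p' x / poly q' x" using assms unfolding rational_on_def by blast
  show ?thesis by (rule rational_onI[of J "q * q'" _ "p * p'"]) (use h in auto)
qed

lemma rational_uminus [rational_intros]: "rational_on J f \<Longrightarrow> rational_on J (\<lambda>x. - f x)"
  using rational_mult[OF rational_const[of J "-1"]] by simp

lemma rational_diff [rational_intros]:
  "rational_on J f \<Longrightarrow> rational_on J g \<Longrightarrow> rational_on J (\<lambda>x. f x - g x)"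
  using rational_add[OF _ rational_uminus] by fastforce

lemma rational_power [rational_intros]: "rational_on J f \<Longrightarrow> rational_on J (\<lambda>x. f x ^ n)"
  by (induction n) (auto intro: rational_intros)

lemma rational_divide [rational_intros]:
  assumes "rational_on J f" "rational_on J g" "\<And>x. x \<in> J \<Longrightarrow> g x \<noteq> 0" shows "rational_on J (\<lambda>x. f x / g x)"
proof -
  obtain p q p' q' where h: "\<And>x. x \<in> J \<Longrightarrow> poly q x \<noteq> 0 \<and> f x = poly p x / poly q x"
    "\<And>x. x \<in> J \<Longrightarrow> poly q' x \<noteq> 0 \<and> g x = poly p' x / poly q' x"
    using assms(1,2) unfolding rational_on_def by blast
  show ?thesis by (rule rational_onI[of J "q * p'" _ "p * q'"]) (use h assms(3) in \<open>auto simp: field_simps\<close>)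
qed

definition rational_curve :: "real set \<Rightarrow> (real \<Rightarrow> 'a::euclidean_space) \<Rightarrow> bool" where
  "rational_curve J f \<longleftrightarrow> (\<forall>b. rational_on J (\<lambda>x. f x \<bullet> b))"

lemma rational_curve_const [rational_intros]: "rational_curve J (\<lambda>_. c)"
  unfolding rational_curve_def by (intro allI rational_intros)

lemma rational_curve_add [rational_intros]:
  "rational_curve J f \<Longrightarrow> rational_curve J g \<Longrightarrow> rational_curve J (\<lambda>x. f x + g x)"
  unfolding rational_curve_def inner_add_left by (intro allI rational_intros) auto

lemma rational_curve_scaleR [rational_intros]:
  "rational_on J f \<Longrightarrow> rational_curve J g \<Longrightarrow> rational_curve J (\<lambda>x. f x *\<^sub>R g x)"
  unfolding rational_curve_def inner_scaleR_left by (intro allI rational_intros) auto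

lemma rational_curve_Pair [rational_intros]:
  "rational_curve J f \<Longrightarrow> rational_curve J g \<Longrightarrow> rational_curve J (\<lambda>x. (f x, g x))"
  unfolding rational_curve_def inner_prod_def fst_conv snd_conv by (intro allI rational_intros) auto

lemma rational_curve_ii [rational_intros]:
  assumes "rational_curve J f" shows "rational_curve J (\<lambda>x. \<i> * f x)"
proof -
  have "rational_on J (\<lambda>x. f x \<bullet> (- \<i> * b))" for b using assms unfolding rational_curve_def by blast
  moreover have "(\<i> * f x) \<bullet> b = f x \<bullet> (- \<i> * b)" for x b by (simp add: inner_complex_def)
  ultimately show ?thesis unfolding rational_curve_def by simp
qed

text \<open>The interval of radius \<open>\<epsilon>\<close> around \<open>r\<close> is the image of the line under \<open>t \<mapsto> r + \<epsilon> tanh t\<close>, whose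
  derivative is a polynomial in its value. Hence rational functions stay rational under
  differentiation with respect to \<open>t\<close>.\<close>

lemma tanh_interval:
  fixes r \<epsilon> t :: real
  assumes "\<epsilon> > 0" shows "r + \<epsilon> * tanh t \<in> {r - \<epsilon><..<r + \<epsilon>}"
proof -
  have "\<epsilon> * (-1) < \<epsilon> * tanh t" "\<epsilon> * tanh t < \<epsilon> * 1"
    using assms tanh_real_lt_1[of t] tanh_real_gt_neg1[of t] by (intro mult_strict_left_mono; simp)+
  then show ?thesis by simp
qed

lemma in_range_tanh: "\<bar>x::real\<bar> < 1 \<Longrightarrow> x \<in> range tanh"
proof -
  assume x: "\<bar>x\<bar> < 1"
  define y where "y = (1 + x) / (1 - x)"
  have y: "y > 0" using x by (simp add: y_def)
  have "tanh (ln y / 2) = (1 - exp (- 2 * (ln y / 2))) / (1 + exp (- 2 * (ln y / 2)))" by (rule tanh_real_altdef)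
  also have "exp (- 2 * (ln y / 2)) = 1 / y" using y by (simp add: exp_minus inverse_eq_divide)
  also have "(1 - 1 / y) / (1 + 1 / y) = x" using x unfolding y_def by (simp add: field_simps)
  finally show ?thesis by (metis rangeI)
qed

lemma rational_derivative:
  assumes e: "\<epsilon> > 0" and f: "rational_on {r - \<epsilon><..<r + \<epsilon>} f"
  obtains f' where "rational_on {r - \<epsilon><..<r + \<epsilon>} f'"
    "\<And>t. ((\<lambda>t. f (r + \<epsilon> * tanh t)) has_real_derivative f' (r + \<epsilon> * tanh t)) (at t)"
proof -
  let ?J = "{r - \<epsilon><..<r + \<epsilon>}"
  obtain p q where pq: "\<And>x. x \<in> ?J \<Longrightarrow> poly q x \<noteq> 0 \<and> f x = poly p x / poly q x"
    using f unfolding rational_on_def by blast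
  define f' where "f' = (\<lambda>x. (poly (pderiv p) x * poly q x - poly p x * poly (pderiv q) x) / (poly q x)\<^sup>2
      * (\<epsilon> - (x - r)\<^sup>2 / \<epsilon>))"
  have P: "rational_on ?J (poly p)" for p by (rule rational_onI[of _ 1 _ p]) auto
  have "rational_on ?J f'" unfolding f'_def by (intro rational_intros P) (use pq e in auto)
  moreover have "((\<lambda>t. f (r + \<epsilon> * tanh t)) has_real_derivative f' (r + \<epsilon> * tanh t)) (at t)" for t
  proof -
    have ff: "(\<lambda>t. f (r + \<epsilon> * tanh t)) = (\<lambda>t. poly p (r + \<epsilon> * tanh t) / poly q (r + \<epsilon> * tanh t))"
      using pq tanh_interval[OF e] by (intro ext) auto
    have q0: "poly q (r + \<epsilon> * tanh t) \<noteq> 0" using pq tanh_interval[OF e] by blast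
    define K where "K = \<epsilon> * (1 - (tanh t)\<^sup>2)"
    have x: "((\<lambda>t. r + \<epsilon> * tanh t) has_real_derivative K) (at t)"
      by (auto intro!: derivative_eq_intros simp: K_def)
    have pp: "((\<lambda>t. poly p (r + \<epsilon> * tanh t)) has_real_derivative
        poly (pderiv p) (r + \<epsilon> * tanh t) * K) (at t)" for p
      by (rule DERIV_chain2[OF poly_DERIV x])
    have y: "\<epsilon> - (r + \<epsilon> * tanh t - r)\<^sup>2 / \<epsilon> = K"
      using e unfolding K_def by (simp add: field_simps power2_eq_square)
    show ?thesis unfolding ff f'_def y
      by (rule DERIV_cong[OF DERIV_divide[OF pp pp q0]]) (simp add: power2_eq_square algebra_simps)
  qed
  ultimately show ?thesis using that by blast
qed

lemma rational_curve_smooth: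
  fixes F :: "real \<Rightarrow> 'a::euclidean_space"
  assumes e: "\<epsilon> > 0" and F: "rational_curve {r - \<epsilon><..<r + \<epsilon>} F"
  obtains D where "D 0 = (\<lambda>t. F (r + \<epsilon> * tanh t))" "\<And>k t. (D k has_vector_derivative D (Suc k) t) (at t)"
proof -
  define C where "C = {g. \<exists>c::'a \<Rightarrow> real \<Rightarrow> real. (\<forall>b. rational_on {r - \<epsilon><..<r + \<epsilon>} (c b)) \<and>
      g = (\<lambda>t. \<Sum>b\<in>Basis. c b (r + \<epsilon> * tanh t) *\<^sub>R b)}"
  have "\<exists>g'\<in>C. \<forall>t. (g has_vector_derivative g' t) (at t)" if "g \<in> C" for g
  proof -
    obtain c where c: "\<And>b. rational_on {r - \<epsilon><..<r + \<epsilon>} (c b)"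
      and g: "g = (\<lambda>t. \<Sum>b\<in>Basis. c b (r + \<epsilon> * tanh t) *\<^sub>R b)" using \<open>g \<in> C\<close> unfolding C_def by blast
    have "\<exists>f'. rational_on {r - \<epsilon><..<r + \<epsilon>} f' \<and>
       (\<forall>t. ((\<lambda>t. c b (r + \<epsilon> * tanh t)) has_real_derivative f' (r + \<epsilon> * tanh t)) (at t))" for b
      using rational_derivative[OF e c[of b]] by metis
    then obtain c' where c': "\<And>b. rational_on {r - \<epsilon><..<r + \<epsilon>} (c' b)"
      "\<And>b t. ((\<lambda>t. c b (r + \<epsilon> * tanh t)) has_real_derivative c' b (r + \<epsilon> * tanh t)) (at t)" by metis
    define g' where "g' = (\<lambda>t. \<Sum>b\<in>Basis. c' b (r + \<epsilon> * tanh t) *\<^sub>R b)"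
    have "(g has_vector_derivative g' t) (at t)" for t
      unfolding g g'_def
    proof (rule has_vector_derivative_sum)
      fix b :: 'a
      show "((\<lambda>t. c b (r + \<epsilon> * tanh t) *\<^sub>R b) has_vector_derivative c' b (r + \<epsilon> * tanh t) *\<^sub>R b) (at t)"
        using has_vector_derivative_scaleR[OF c'(2)[of b t] has_vector_derivative_const[of b]] by simp
    qed
    moreover have "g' \<in> C" unfolding C_def g'_def using c' by blast
    ultimately show ?thesis by blast
  qed
  moreover have "(\<lambda>t. F (r + \<epsilon> * tanh t)) \<in> C" unfolding C_def
    using F unfolding rational_curve_def
    by (intro CollectI exI[of _ "\<lambda>b x. F x \<bullet> b"]) (simp add: euclidean_representation)
  ultimately show ?thesis using derivatives_of_closed_family[of C] that by metis
qed

lemma dist_quad_components: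
  fixes R S :: quad
  shows "dist (fst R) (fst S) \<le> dist R S" "dist (fst (snd R)) (fst (snd S)) \<le> dist R S"
    "dist (fst (snd (snd R))) (fst (snd (snd S))) \<le> dist R S" "dist (snd (snd (snd R))) (snd (snd (snd S))) \<le> dist R S"
  using dist_fst_le[of R S] dist_snd_le[of R S] dist_fst_le[of "snd R" "snd S"] dist_snd_le[of "snd R" "snd S"]
    dist_fst_le[of "snd (snd R)" "snd (snd S)"] dist_snd_le[of "snd (snd R)" "snd (snd S)"]
  by linarith+

lemma aspect_ratio_alt: "aspect_ratio R = dist (fst (snd (snd R))) (fst (snd R)) / dist (fst (snd R)) (fst R)"
  by (cases R) simp

lemma continuous_on_aspect: "continuous_on (inscribed \<gamma>) aspect_ratio"
proof -
  have "continuous_on (inscribed \<gamma>) (\<lambda>R. dist (fst (snd (snd R))) (fst (snd R)) / dist (fst (snd R)) (fst R))"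
  proof (intro continuous_intros ballI)
    fix R assume "R \<in> inscribed \<gamma>"
    then have "fst (snd R) \<noteq> fst R" using quad_of_aspect(3) by (simp add: inscribed_def)
    then show "dist (fst (snd R)) (fst R) \<noteq> 0" by simp
  qed
  then show ?thesis by (rule continuous_on_eq) (simp add: aspect_ratio_alt)
qed

context generic_polygon begin

lemma continuous_line_rect:
  assumes "r \<noteq> 0" "slope a b c d r \<noteq> 0" "b < N" "d < N"
  shows "isCont (line_rect p a b c d) r"
proof -
  have bd: "u b \<bullet> u d \<noteq> 0" using dot_ne assms by blast
  have D: "isCont (defect p b c d) r" unfolding defect_def corner_poly_def by (intro continuous_intros)
  have S: "isCont (slope a b c d) r" unfolding slope_def corner_poly_def by (intro continuous_intros)
  have L: "isCont (line_point p a b c d) r" unfolding line_point_def by (intro continuous_intros D S assms)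
  have Ht: "isCont (\<lambda>x. h k (line_point p a b c d x)) r" for k
    unfolding line_point_def ht_move by (intro continuous_intros D S assms)
  have W: "isCont (\<lambda>x. side_vec b d (line_point p a b c d x) x) r"
    unfolding side_vec_def by (intro continuous_intros Ht) (use assms bd in auto)
  show ?thesis unfolding line_rect_def quad_of_def by (intro continuous_intros L W)
qed

lemma rational_line_rect:
  assumes J: "\<And>r. r \<in> J \<Longrightarrow> r \<noteq> 0 \<and> slope a b c d r \<noteq> 0" and n: "b < N" "d < N"
  shows "rational_curve J (line_rect p a b c d)"
proof -
  have bd: "u b \<bullet> u d \<noteq> 0" using dot_ne n by blast
  have D: "rational_on J (defect p b c d)" unfolding defect_def corner_poly_def by (intro rational_intros)
  have S: "rational_on J (slope a b c d)" unfolding slope_def corner_poly_def by (intro rational_intros)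
  have DS: "rational_on J (\<lambda>r. defect p b c d r / slope a b c d r)" by (intro rational_intros D S) (use J in auto)
  have L: "rational_curve J (line_point p a b c d)" unfolding line_point_def by (intro rational_intros DS)
  have Ht: "rational_on J (\<lambda>x. h k (line_point p a b c d x))" for k
    unfolding line_point_def ht_move by (intro rational_intros DS)
  have W: "rational_curve J (\<lambda>x. side_vec b d (line_point p a b c d x) x)"
    unfolding side_vec_def by (intro rational_intros Ht) (use J bd in auto)
  show ?thesis unfolding line_rect_def quad_of_def by (intro rational_intros L W)
qed

lemma line_rect_near:
  assumes rect: "is_rectangle R" and on: "on_edges a b c d R" and p: "h a p = 0" and \<delta>: "\<delta> > 0"
  obtains \<epsilon> where "\<epsilon> > 0" "\<And>r. \<bar>r - aspect_ratio R\<bar> < \<epsilon> \<Longrightarrow> r > 0 \<and> slope a b c d r \<noteq> 0 \<and>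
     dist (line_rect p a b c d r) R < \<delta> \<and> is_rectangle (line_rect p a b c d r) \<and>
     aspect_ratio (line_rect p a b c d r) = r"
proof -
  define r0 where "r0 = aspect_ratio R"
  define L where "L = line_rect p a b c d"
  have n: "a < N" "b < N" "c < N" "d < N" using on unfolding on_edges_def by auto
  have r0: "r0 > 0" using quad_of_aspect(1)[OF rect] by (simp add: r0_def)
  have S: "slope a b c d r0 \<noteq> 0" using slope_ne[OF rect on] by (simp add: r0_def)
  have R: "L r0 = R" using line_rect_unique[OF on rect p] by (simp add: L_def r0_def)
  have cont: "isCont L r0" unfolding L_def using continuous_line_rect r0 S n by simp
  have "isCont (slope a b c d) r0" unfolding slope_def corner_poly_def by (intro continuous_intros)
  then have "(slope a b c d \<longlongrightarrow> slope a b c d r0) (nhds r0)"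
    unfolding isCont_def tendsto_at_iff_tendsto_nhds .
  then have 1: "eventually (\<lambda>r. slope a b c d r \<noteq> 0) (nhds r0)"
    using tendsto_imp_eventually_ne S by blast
  have 2: "eventually (\<lambda>r. r > 0) (nhds r0)" using order_tendstoD(1)[OF filterlim_ident r0] .
  have tend: "(L \<longlongrightarrow> R) (nhds r0)"
  proof -
    have "(L \<longlongrightarrow> L r0) (nhds r0)" using cont unfolding isCont_def tendsto_at_iff_tendsto_nhds .
    then show ?thesis using R by simp
  qed
  then have 3: "eventually (\<lambda>r. dist (L r) R < \<delta>) (nhds r0)" using \<delta> tendstoD by blast
  have "((\<lambda>r. fst (snd (L r)) - fst (L r)) \<longlongrightarrow> fst (snd R) - fst R) (nhds r0)"
    by (intro tendsto_intros tend)
  then have 4: "eventually (\<lambda>r. fst (snd (L r)) - fst (L r) \<noteq> 0) (nhds r0)"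
    using quad_of_aspect(3)[OF rect] by (intro tendsto_imp_eventually_ne) auto
  have "eventually (\<lambda>r. r > 0 \<and> slope a b c d r \<noteq> 0 \<and> dist (L r) R < \<delta> \<and> fst (snd (L r)) - fst (L r) \<noteq> 0) (nhds r0)"
    using 1 2 3 4 by (simp add: eventually_conj_iff)
  then obtain \<epsilon> where e: "\<epsilon> > 0" "\<And>r. dist r r0 < \<epsilon> \<Longrightarrow> r > 0 \<and> slope a b c d r \<noteq> 0 \<and> dist (L r) R < \<delta> \<and>
      fst (snd (L r)) - fst (L r) \<noteq> 0" unfolding eventually_nhds_metric by blast
  show ?thesis
  proof (rule that[OF e(1)])
    fix r assume "\<bar>r - aspect_ratio R\<bar> < \<epsilon>"
    then have h: "r > 0" "slope a b c d r \<noteq> 0" "dist (L r) R < \<delta>" "fst (snd (L r)) - fst (L r) \<noteq> 0"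
      using e(2)[of r] by (auto simp: dist_real_def r0_def)
    then have "side_vec b d (line_point p a b c d r) r \<noteq> 0" by (simp add: L_def line_rect_def quad_of_def)
    then show "r > 0 \<and> slope a b c d r \<noteq> 0 \<and> dist (line_rect p a b c d r) R < \<delta> \<and>
      is_rectangle (line_rect p a b c d r) \<and> aspect_ratio (line_rect p a b c d r) = r"
      using h rectangle_quad_of[of _ r] by (simp add: L_def line_rect_def)
  qed
qed

lemma away_from_corners:
  assumes "z0 \<notin> corners" shows "\<exists>\<delta>>0. \<forall>z\<in>corners. dist z z0 \<ge> \<delta>"
proof -
  have "closed corners" by (simp add: corners_def finite_imp_closed)
  then show ?thesis using separate_point_closed[OF _ assms] by (metis dist_commute)
qed

lemma openin_inscribed_near: "openin (top_of_set I) {R \<in> I. dist R S < \<delta> \<and> \<bar>aspect_ratio R - r\<bar> < \<epsilon>}"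
proof -
  have "openin (top_of_set I) (I \<inter> aspect_ratio -` {r - \<epsilon><..<r + \<epsilon>})"
    by (rule continuous_openin_preimage_gen[OF continuous_on_aspect]) auto
  moreover have "openin (top_of_set I) (I \<inter> ball S \<delta>)" by (simp add: openin_open_Int)
  ultimately have "openin (top_of_set I) ((I \<inter> aspect_ratio -` {r - \<epsilon><..<r + \<epsilon>}) \<inter> (I \<inter> ball S \<delta>))" by blast
  moreover have "(I \<inter> aspect_ratio -` {r - \<epsilon><..<r + \<epsilon>}) \<inter> (I \<inter> ball S \<delta>)
      = {R \<in> I. dist R S < \<delta> \<and> \<bar>aspect_ratio R - r\<bar> < \<epsilon>}" by (auto simp: dist_commute abs_less_iff)
  ultimately show ?thesis by simp
qed

text \<open>A nearby inscribed rectangle has its vertices on the same four edges, hence is \<open>line_rect\<close> at its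
  own aspect ratio; conversely these rectangles are inscribed as long as they are close to \<open>R\<close>. The
  curve \<open>t \<mapsto> line_rect (r + \<epsilon> tanh t)\<close> is regular: if all vertices had velocity zero, so would the
  aspect ratio.\<close>

lemma smooth_at_non_corner:
  assumes R: "R \<in> I" and nc: "\<not> has_corner R"
  obtains U where "openin (top_of_set I) U" "R \<in> U" "inj_on aspect_ratio U"
    "\<And>S. S \<in> U \<Longrightarrow> \<not> has_corner S" "smooth_point I R" "U homeomorphic (UNIV :: real set)"
proof -
  have rect: "is_rectangle R" using R by (simp add: inscribed_def)
  obtain a b c d where on: "on_edges a b c d R" using on_edgesI[OF R] by blast
  have n: "a < N" "b < N" "c < N" "d < N" using on unfolding on_edges_def by auto
  obtain R0 R1 R2 R3 where RR: "R = (R0, R1, R2, R3)" by (metis prod_cases4)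
  have ed: "R0 \<in> edge a" "R1 \<in> edge b" "R2 \<in> edge c" "R3 \<in> edge d" using on RR by (auto simp: on_edges_def)
  have nv: "R0 \<notin> corners" "R1 \<notin> corners" "R2 \<notin> corners" "R3 \<notin> corners" using nc RR by (auto simp: has_corner_def)
  obtain d0 where d0: "d0 > 0" "\<And>z. z \<in> P \<Longrightarrow> dist z R0 < d0 \<Longrightarrow> z \<in> edge a" "\<And>z. h a z = 0 \<Longrightarrow> dist z R0 < d0 \<Longrightarrow> z \<in> edge a"
    using near_inner_edge[OF n(1) ed(1) nv(1)] by metis
  obtain d1 where d1: "d1 > 0" "\<And>z. z \<in> P \<Longrightarrow> dist z R1 < d1 \<Longrightarrow> z \<in> edge b" "\<And>z. h b z = 0 \<Longrightarrow> dist z R1 < d1 \<Longrightarrow> z \<in> edge b"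
    using near_inner_edge[OF n(2) ed(2) nv(2)] by metis
  obtain d2 where d2: "d2 > 0" "\<And>z. z \<in> P \<Longrightarrow> dist z R2 < d2 \<Longrightarrow> z \<in> edge c" "\<And>z. h c z = 0 \<Longrightarrow> dist z R2 < d2 \<Longrightarrow> z \<in> edge c"
    using near_inner_edge[OF n(3) ed(3) nv(3)] by metis
  obtain d3 where d3: "d3 > 0" "\<And>z. z \<in> P \<Longrightarrow> dist z R3 < d3 \<Longrightarrow> z \<in> edge d" "\<And>z. h d z = 0 \<Longrightarrow> dist z R3 < d3 \<Longrightarrow> z \<in> edge d"
    using near_inner_edge[OF n(4) ed(4) nv(4)] by metis
  have "\<exists>\<delta>>0. \<forall>z\<in>corners. dist z x \<ge> \<delta>" if "x \<in> vertices R" for x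
    using away_from_corners[of x] that nc unfolding has_corner_def by blast
  then obtain d4 where d4: "\<And>x. x \<in> vertices R \<Longrightarrow> d4 x > 0" "\<And>x z. x \<in> vertices R \<Longrightarrow> z \<in> corners \<Longrightarrow> dist z x \<ge> d4 x"
    by metis
  define \<delta> where "\<delta> = Min ({d0, d1, d2, d3} \<union> d4 ` vertices R)"
  have fin: "finite ({d0, d1, d2, d3} \<union> d4 ` vertices R)" using RR by simp
  have \<delta>: "\<delta> > 0" unfolding \<delta>_def using fin d0 d1 d2 d3 d4(1) by (subst Min_gr_iff) auto
  have \<delta>le: "\<delta> \<le> x" if "x \<in> {d0, d1, d2, d3} \<union> d4 ` vertices R" for x
    unfolding \<delta>_def using fin that by (rule Min_le)
  define r0 where "r0 = aspect_ratio R"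
  define L where "L = line_rect (v a) a b c d"
  have p: "h a (v a) = 0" by (simp add: ht_def)
  obtain \<epsilon> where e: "\<epsilon> > 0" "\<And>r. \<bar>r - r0\<bar> < \<epsilon> \<Longrightarrow> r > 0 \<and> slope a b c d r \<noteq> 0 \<and>
     dist (L r) R < \<delta> \<and> is_rectangle (L r) \<and> aspect_ratio (L r) = r"
    using line_rect_near[OF rect on p \<delta>] unfolding r0_def L_def by metis
  define U where "U = {S \<in> I. dist S R < \<delta> \<and> \<bar>aspect_ratio S - r0\<bar> < \<epsilon>}"
  have comp: "dist (fst S) R0 < \<delta>" "dist (fst (snd S)) R1 < \<delta>" "dist (fst (snd (snd S))) R2 < \<delta>"
      "dist (snd (snd (snd S))) R3 < \<delta>" if "dist S R < \<delta>" for S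
    using that dist_quad_components[of S R] unfolding RR by auto
  have UL: "S = L (aspect_ratio S)" if S: "S \<in> U" for S
  proof -
    have "S \<in> I" "dist S R < \<delta>" using S by (auto simp: U_def)
    moreover have "fst S \<in> P" "fst (snd S) \<in> P" "fst (snd (snd S)) \<in> P" "snd (snd (snd S)) \<in> P"
      using \<open>S \<in> I\<close> by (cases S; simp add: inscribed_def)+
    ultimately have "on_edges a b c d S" unfolding on_edges_def using n comp[of S] \<delta>le d0 d1 d2 d3
      by (meson UnCI insertCI less_le_trans)
    then show ?thesis using line_rect_unique[OF _ _ p] \<open>S \<in> I\<close> unfolding L_def by (simp add: inscribed_def)
  qed
  have LU: "L r \<in> U" if r: "\<bar>r - r0\<bar> < \<epsilon>" for r
  proof -
    note er = e(2)[OF r]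
    obtain S0 S1 S2 S3 where SS: "L r = (S0, S1, S2, S3)" by (metis prod_cases4)
    have "r \<noteq> 0" "slope a b c d r \<noteq> 0" using er by auto
    note ll = line_rect_on_lines[OF n this p SS[unfolded L_def]]
    have "on_edges a b c d (L r)" unfolding on_edges_def
      using n comp[of "L r"] er \<delta>le d0(3) d1(3) d2(3) d3(3) ll unfolding SS fst_conv snd_conv
      by (meson UnCI insertCI less_le_trans)
    then show ?thesis unfolding U_def using on_edges_inscribed er r by auto
  qed
  have RU: "R \<in> U" unfolding U_def using R \<delta> e(1) by (simp add: r0_def)
  have op: "openin (top_of_set I) U" unfolding U_def by (rule openin_inscribed_near)
  have inj: "inj_on aspect_ratio U" using UL by (metis inj_onI)
  have ncU: "\<not> has_corner S" if "S \<in> U" for S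
  proof
    assume "has_corner S"
    then obtain z where z: "z \<in> corners" "z \<in> vertices S" unfolding has_corner_def by blast
    have "dist S R < \<delta>" using that by (simp add: U_def)
    then obtain x where "x \<in> vertices R" "dist z x < \<delta>"
      using comp[of S] z(2) RR by (cases S) auto
    then show False using d4(2)[of x z] z(1) \<delta>le[of "d4 x"] by force
  qed
  define f where "f = (\<lambda>t. L (r0 + \<epsilon> * tanh t))"
  define g where "g = (\<lambda>S. artanh ((aspect_ratio S - r0) / \<epsilon>))"
  have J: "\<bar>r0 + \<epsilon> * tanh t - r0\<bar> < \<epsilon>" for t using tanh_interval[OF e(1), of r0 t] by auto
  have asp: "aspect_ratio (f t) = r0 + \<epsilon> * tanh t" for t using e(2)[OF J] unfolding f_def by blast
  have "rational_curve {r0 - \<epsilon><..<r0 + \<epsilon>} L" unfolding L_def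
  proof (rule rational_line_rect[OF _ n(2,4)])
    fix r assume "r \<in> {r0 - \<epsilon><..<r0 + \<epsilon>}"
    then have "\<bar>r - r0\<bar> < \<epsilon>" by auto
    then show "r \<noteq> 0 \<and> slope a b c d r \<noteq> 0" using e(2)[of r] by simp
  qed
  then obtain D where D: "D 0 = f" "\<And>k t. (D k has_vector_derivative D (Suc k) t) (at t)"
    using rational_curve_smooth[OF e(1)] unfolding f_def by metis
  have contf: "continuous_on UNIV f"
    using D has_vector_derivative_continuous by (metis continuous_at_imp_continuous_on)
  have hom: "homeomorphism UNIV U f g"
  proof (rule homeomorphismI)
    show "continuous_on UNIV f" by (rule contf)
    show "f ` UNIV \<subseteq> U" using LU J unfolding f_def by blast
    show "g ` U \<subseteq> UNIV" by simp
    show "continuous_on U g" unfolding g_def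
    proof (rule continuous_on_compose2[OF continuous_on_artanh[OF order_refl]])
      have "continuous_on U aspect_ratio"
        by (rule continuous_on_subset[OF continuous_on_aspect]) (auto simp: U_def)
      then show "continuous_on U (\<lambda>S. (aspect_ratio S - r0) / \<epsilon>)"
        using e(1) by (intro continuous_intros) auto
      show "(\<lambda>S. (aspect_ratio S - r0) / \<epsilon>) ` U \<subseteq> {-1<..<1}"
      proof (rule image_subsetI)
        fix S assume "S \<in> U"
        then have "\<bar>aspect_ratio S - r0\<bar> < \<epsilon>" by (simp add: U_def)
        then show "(aspect_ratio S - r0) / \<epsilon> \<in> {-1<..<1}" using e(1) by (auto simp: field_simps)
      qed
    qed
    show "g (f t) = t" for t unfolding g_def asp using e(1) by (simp add: artanh_tanh_real)
    show "f (g S) = S" if "S \<in> U" for S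
    proof -
      define x where "x = (aspect_ratio S - r0) / \<epsilon>"
      have "\<bar>x\<bar> < 1" unfolding x_def using that e(1) by (simp add: U_def abs_divide)
      then have "x \<in> range tanh" by (rule in_range_tanh)
      then obtain t where t: "x = tanh t" by blast
      then have "g S = t" unfolding g_def x_def[symmetric] by (simp add: artanh_tanh_real)
      then have "f (g S) = L (aspect_ratio S)" unfolding f_def using t e(1) unfolding x_def by (simp add: field_simps)
      then show ?thesis using UL[OF that] by simp
    qed
  qed
  \<comment> \<open>Differentiate \<open>R\<^sub>2 - R\<^sub>1 = r\<i>(R\<^sub>1 - R\<^sub>0)\<close>.\<close>
  have D1: "D (Suc 0) t \<noteq> 0" for t
  proof
    assume z: "D (Suc 0) t = 0"
    have df: "(f has_vector_derivative 0) (at t)" using D(2)[of 0 t] z D(1) by simp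
    have bl: "bounded_linear (\<lambda>S::quad. fst (snd (snd S)) - fst (snd S))" "bounded_linear (\<lambda>S::quad. fst (snd S) - fst S)"
      by (intro bounded_linear_sub bounded_linear_fst bounded_linear_snd
        bounded_linear_compose[OF bounded_linear_fst] bounded_linear_compose[OF bounded_linear_snd] bounded_linear_ident)+
    define W where "W = (\<lambda>t. fst (snd (f t)) - fst (f t))"
    define Q where "Q = (\<lambda>t. fst (snd (snd (f t))) - fst (snd (f t)))"
    have dW: "(W has_vector_derivative 0) (at t)" "(Q has_vector_derivative 0) (at t)"
      using bounded_linear.has_vector_derivative[OF bl(2) df] bounded_linear.has_vector_derivative[OF bl(1) df]
      unfolding W_def Q_def by simp_all
    have QW: "Q = (\<lambda>t. (r0 + \<epsilon> * tanh t) *\<^sub>R (\<i> * W t))"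
      unfolding Q_def W_def f_def L_def line_rect_def quad_of_def by (simp add: fun_eq_iff)
    have tn: "((\<lambda>t. r0 + \<epsilon> * tanh t) has_real_derivative \<epsilon> * (1 - (tanh t)\<^sup>2)) (at t)"
      by (auto intro!: derivative_eq_intros)
    have "((\<lambda>t. \<i> * W t) has_vector_derivative \<i> * 0) (at t)"
      by (rule has_vector_derivative_mult_right[OF dW(1)])
    from has_vector_derivative_scaleR[OF tn this]
    have "(Q has_vector_derivative (\<epsilon> * (1 - (tanh t)\<^sup>2)) *\<^sub>R (\<i> * W t)) (at t)" unfolding QW by simp
    then have "(\<epsilon> * (1 - (tanh t)\<^sup>2)) *\<^sub>R (\<i> * W t) = 0"
      using vector_derivative_unique_at dW(2) by blast
    moreover have "W t \<noteq> 0"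
    proof -
      have "is_rectangle (f t)" using e(2)[OF J] unfolding f_def by blast
      then show ?thesis using quad_of_aspect(3) unfolding W_def by auto
    qed
    moreover have "(tanh t)\<^sup>2 < 1" using tanh_real_bounds[of t] by (simp add: abs_square_less_1 abs_less_iff)
    ultimately show False using e(1) by auto
  qed
  have "smooth_point I R" unfolding smooth_point_def using R op RU hom D D1 by blast
  moreover have "U homeomorphic (UNIV::real set)"
    using hom homeomorphic_def homeomorphic_sym by blast
  ultimately show ?thesis using that op RU inj ncU by blast
qed

end

section \<open>Local structure at the vertices of the polygon\<close>

context generic_polygon begin

lemma edges_at_vertex_Int:
  assumes i: "i < N" and z: "z \<in> edge i" "z \<in> edge (prv N i)" shows "z = v i"
  using edge_Int[OF i nx(2)[OF i] _ z] nx[OF i] by auto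

lemma edge_from_vertex:
  assumes i: "i < N"
  shows "\<bar>s\<bar> < len i \<Longrightarrow> v i + s *\<^sub>R u i \<in> edge i \<longleftrightarrow> 0 \<le> s"
    and "\<bar>s\<bar> < len (prv N i) \<Longrightarrow> v i + s *\<^sub>R u (prv N i) \<in> edge (prv N i) \<longleftrightarrow> s \<le> 0"
proof -
  have ne: "u k \<noteq> 0" if "k < N" for k using norm_u[OF that] by auto
  show "v i + s *\<^sub>R u i \<in> edge i \<longleftrightarrow> 0 \<le> s" if "\<bar>s\<bar> < len i"
    unfolding edge_iff using that ne[OF i] by auto
  let ?p = "prv N i"
  have "v i = v ?p + len ?p *\<^sub>R u ?p" using v_nxt[of ?p] nx(3)[OF i] by simp
  then have e: "v i + s *\<^sub>R u ?p = v ?p + (len ?p + s) *\<^sub>R u ?p" by (simp add: algebra_simps)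
  show "v i + s *\<^sub>R u ?p \<in> edge ?p \<longleftrightarrow> s \<le> 0" if "\<bar>s\<bar> < len ?p"
    unfolding e edge_iff using that ne[OF nx(2)[OF i]] by auto
qed

text \<open>Everything that is used about the space of inscribed rectangles near a rectangle whose first
  vertex is the polygon vertex \<open>v i\<close>: the other three vertices stay on fixed edges, and the first
  one is on one of the two edges that meet at \<open>v i\<close>.\<close>

lemma corner_neighbourhood:
  assumes R: "R \<in> I" and i: "fst R = v i" "i < N"
  obtains b c d \<delta> where "on_edges i b c d R" "on_edges (prv N i) b c d R" "validc N i b c d" "\<delta> > 0"
    "\<delta> \<le> len i" "\<delta> \<le> len (prv N i)"
    "\<And>S. S \<in> I \<Longrightarrow> dist S R < \<delta> \<Longrightarrow> on_edges i b c d S \<or> on_edges (prv N i) b c d S"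
    "\<And>S0 S1 S2 S3. dist (S0, S1, S2, S3) R < \<delta> \<Longrightarrow> h b S1 = 0 \<Longrightarrow> h c S2 = 0 \<Longrightarrow> h d S3 = 0 \<Longrightarrow>
        S1 \<in> edge b \<and> S2 \<in> edge c \<and> S3 \<in> edge d"
    "\<And>S. S \<in> I \<Longrightarrow> dist S R < \<delta> \<Longrightarrow> has_corner S \<Longrightarrow> fst S = v i"
proof -
  obtain b c d where on: "on_edges i b c d R" "on_edges (prv N i) b c d R" and val: "validc N i b c d"
    using corner_on_edges[OF R i] by blast
  have n: "b < N" "c < N" "d < N" using on unfolding on_edges_def by auto
  obtain R0 R1 R2 R3 where RR: "R = (R0, R1, R2, R3)" by (metis prod_cases4)
  have R0: "R0 = v i" using i RR by simp
  have ed: "R1 \<in> edge b" "R2 \<in> edge c" "R3 \<in> edge d" using on RR by (auto simp: on_edges_def)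
  have nv: "R1 \<notin> corners" "R2 \<notin> corners" "R3 \<notin> corners"
    using one_corner[OF R] i RR unfolding corners_def by auto
  obtain d1 where d1: "d1 > 0" "\<And>z. z \<in> P \<Longrightarrow> dist z R1 < d1 \<Longrightarrow> z \<in> edge b" "\<And>z. h b z = 0 \<Longrightarrow> dist z R1 < d1 \<Longrightarrow> z \<in> edge b"
    using near_inner_edge[OF n(1) ed(1) nv(1)] by metis
  obtain d2 where d2: "d2 > 0" "\<And>z. z \<in> P \<Longrightarrow> dist z R2 < d2 \<Longrightarrow> z \<in> edge c" "\<And>z. h c z = 0 \<Longrightarrow> dist z R2 < d2 \<Longrightarrow> z \<in> edge c"
    using near_inner_edge[OF n(2) ed(2) nv(2)] by metis
  obtain d3 where d3: "d3 > 0" "\<And>z. z \<in> P \<Longrightarrow> dist z R3 < d3 \<Longrightarrow> z \<in> edge d" "\<And>z. h d z = 0 \<Longrightarrow> dist z R3 < d3 \<Longrightarrow> z \<in> edge d"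
    using near_inner_edge[OF n(3) ed(3) nv(3)] by metis
  obtain d0 where d0: "d0 > 0" "\<And>k z. k < N \<Longrightarrow> z \<in> edge k \<Longrightarrow> dist z (v i) < d0 \<Longrightarrow> v i \<in> edge k"
    using near_edges by blast
  obtain d5 where d5: "d5 > 0" "\<And>z. z \<in> corners - {v i} \<Longrightarrow> dist z (v i) \<ge> d5"
  proof -
    have "closed (corners - {v i})" by (simp add: corners_def finite_imp_closed)
    then show ?thesis using separate_point_closed[of "corners - {v i}" "v i"] that by (metis Diff_iff dist_commute insertI1)
  qed
  obtain e1 e2 e3 where e: "e1 > 0" "e2 > 0" "e3 > 0" "\<And>z. z \<in> corners \<Longrightarrow> dist z R1 \<ge> e1"
    "\<And>z. z \<in> corners \<Longrightarrow> dist z R2 \<ge> e2" "\<And>z. z \<in> corners \<Longrightarrow> dist z R3 \<ge> e3"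
    using away_from_corners nv by metis
  define \<delta> where "\<delta> = Min {d0, d1, d2, d3, d5, e1, e2, e3, len i, len (prv N i)}"
  have \<delta>: "\<delta> > 0" unfolding \<delta>_def using d0 d1 d2 d3 d5 e len_pos[OF i(2)] len_pos[OF nx(2)[OF i(2)]]
    by (subst Min_gr_iff) auto
  have le: "\<delta> \<le> d0" "\<delta> \<le> d1" "\<delta> \<le> d2" "\<delta> \<le> d3" "\<delta> \<le> d5" "\<delta> \<le> e1" "\<delta> \<le> e2" "\<delta> \<le> e3" "\<delta> \<le> len i" "\<delta> \<le> len (prv N i)"
    unfolding \<delta>_def by (rule Min_le; simp)+
  have comp: "dist (fst S) R0 < \<delta>" "dist (fst (snd S)) R1 < \<delta>" "dist (fst (snd (snd S))) R2 < \<delta>"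
      "dist (snd (snd (snd S))) R3 < \<delta>" if "dist S R < \<delta>" for S
    using that dist_quad_components[of S R] unfolding RR by auto
  show ?thesis
  proof (rule that[OF on val \<delta> le(9,10)])
    fix S assume S: "S \<in> I" "dist S R < \<delta>"
    have SP: "fst S \<in> P" "fst (snd S) \<in> P" "fst (snd (snd S)) \<in> P" "snd (snd (snd S)) \<in> P"
      using S(1) by (cases S; simp add: inscribed_def)+
    note cp = comp[OF S(2)]
    obtain k where k: "k < N" "fst S \<in> edge k" using SP(1) path_image_edges by auto
    then have "v i \<in> edge k" using d0(2)[of k "fst S"] cp(1) le(1) R0 by simp
    then have "k = i \<or> k = prv N i" using edge_at_vertex[OF i(2) k(1)] by (simp add: edge_end_def)
    moreover have "fst (snd S) \<in> edge b" by (rule d1(2)[OF SP(2)]) (use cp le in simp)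
    moreover have "fst (snd (snd S)) \<in> edge c" by (rule d2(2)[OF SP(3)]) (use cp le in simp)
    moreover have "snd (snd (snd S)) \<in> edge d" by (rule d3(2)[OF SP(4)]) (use cp le in simp)
    ultimately show "on_edges i b c d S \<or> on_edges (prv N i) b c d S"
      unfolding on_edges_def using k n i(2) nx(2)[OF i(2)] by auto
    assume "has_corner S"
    then consider "fst S \<in> corners" | "fst (snd S) \<in> corners" | "fst (snd (snd S)) \<in> corners" | "snd (snd (snd S)) \<in> corners"
      unfolding has_corner_def by (cases S) auto
    then show "fst S = v i"
    proof cases
      case 1
      then show ?thesis using d5(2)[of "fst S"] cp(1) le(5) R0 by force
    next
      case 2 then show ?thesis using e(4) cp le by fastforce
    next
      case 3 then show ?thesis using e(5) cp le by fastforce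
    next
      case 4 then show ?thesis using e(6) cp le by fastforce
    qed
  next
    fix S0 S1 S2 S3 assume S: "dist (S0, S1, S2, S3) R < \<delta>" "h b S1 = 0" "h c S2 = 0" "h d S3 = 0"
    note cp = comp[OF S(1), unfolded fst_conv snd_conv]
    show "S1 \<in> edge b \<and> S2 \<in> edge c \<and> S3 \<in> edge d"
      using d1(3)[OF S(2)] d2(3)[OF S(3)] d3(3)[OF S(4)] cp le by simp
  qed
qed

text \<open>For \<open>a\<close> one of the two edges \<open>i\<close> and \<open>prv N i\<close> at \<open>v i\<close>, the rectangles with first vertex on the line
  of \<open>a\<close> form a curve on which the first vertex is \<open>v i + (r - r0) \<psi>(r) u a\<close> with \<open>\<psi>(r0) \<noteq> 0\<close>, since \<open>r0\<close>
  is a simple root. So this vertex is on the edge on exactly one side of \<open>r0\<close>. The two half lines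
  obtained in this way have only \<open>R\<close> in common. They are joined to a line with a parameter \<open>\<tau>\<close> that is
  negative on the edge \<open>prv N i\<close> and positive on the edge \<open>i\<close>; the signs \<open>\<kappa>\<close> account for the direction in which
  \<open>r\<close> varies.\<close>

lemma corner_local_line:
  assumes R: "R \<in> I" and i: "fst R = v i" "i < N"
  obtains U where "openin (top_of_set I) U" "R \<in> U" "U homeomorphic (UNIV :: real set)"
    "\<And>S. S \<in> U \<Longrightarrow> has_corner S \<Longrightarrow> S = R"
proof -
  define p where "p = prv N i"
  note pN = nx(2)[OF i(2), folded p_def]
  have rect: "is_rectangle R" using R by (simp add: inscribed_def)
  obtain b c d \<delta> where on: "on_edges i b c d R" "on_edges p b c d R" and val: "validc N i b c d" and \<delta>: "\<delta> > 0"
    "\<delta> \<le> len i" "\<delta> \<le> len p"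
    and near: "\<And>S. S \<in> I \<Longrightarrow> dist S R < \<delta> \<Longrightarrow> on_edges i b c d S \<or> on_edges p b c d S"
    and fwd: "\<And>S0 S1 S2 S3. dist (S0, S1, S2, S3) R < \<delta> \<Longrightarrow> h b S1 = 0 \<Longrightarrow> h c S2 = 0 \<Longrightarrow> h d S3 = 0 \<Longrightarrow>
        S1 \<in> edge b \<and> S2 \<in> edge c \<and> S3 \<in> edge d"
    and corn: "\<And>S. S \<in> I \<Longrightarrow> dist S R < \<delta> \<Longrightarrow> has_corner S \<Longrightarrow> fst S = v i"
    by (rule corner_neighbourhood[OF R i, folded p_def]) (rule that; assumption)
  have n: "b < N" "c < N" "d < N" using on unfolding on_edges_def by auto
  have hv: "h i (v i) = 0" "h p (v i) = 0"
    by (rule ht_vertex(1)[OF N3 ng]; simp add: i pN edge_end_def p_def nx(2)[OF i(2)])+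
  define r0 where "r0 = aspect_ratio R"
  have r0: "r0 > 0" using quad_of_aspect(1)[OF rect] by (simp add: r0_def)
  have F0: "defect (v i) b c d r0 = 0"
    using defect_zero[of i b c d "v i"] on(1) quad_of_aspect(2)[OF rect] i(1) unfolding r0_def by metis
  define F' where "F' = defect_slope (v i) b c d r0"
  define F2 where "F2 = h b (v i) * cr (u c) (u d)"
  have F': "F' \<noteq> 0" unfolding F'_def by (rule corner_simple_root[OF val i(2) n F0])
  define \<psi> where "\<psi> = (\<lambda>a x. (F' + F2 * (x - r0)) / slope a b c d x)"
  have Feq: "defect (v i) b c d x / slope a b c d x = (x - r0) * \<psi> a x" for a x
    unfolding defect_expand[OF F0] \<psi>_def F'_def F2_def by simp
  define L where "L = (\<lambda>a. line_rect (v i) a b c d)"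
  have Lfst: "fst (L a x) = v i + ((x - r0) * \<psi> a x) *\<^sub>R u a" for a x
    by (simp add: L_def line_rect_def quad_of_def line_point_def Feq)
  have sl: "slope a b c d r0 \<noteq> 0" if "a \<in> {i, p}" for a
    using slope_ne[OF rect] on that unfolding r0_def by auto
  have psi0: "\<psi> a r0 \<noteq> 0" if "a \<in> {i, p}" for a unfolding \<psi>_def using F' sl[OF that] by simp
  define \<kappa> where "\<kappa> = (\<lambda>a. sgn (\<psi> a r0))"
  have kk: "\<kappa> a * \<kappa> a = 1" "\<kappa> a = 1 \<or> \<kappa> a = -1" if "a \<in> {i, p}" for a
    using psi0[OF that] unfolding \<kappa>_def by (auto simp: sgn_if)
  have "\<exists>e>0. \<forall>x. \<bar>x - r0\<bar> < e \<longrightarrow> x > 0 \<and> slope a b c d x \<noteq> 0 \<and> dist (L a x) R < \<delta> \<and>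
      is_rectangle (L a x) \<and> aspect_ratio (L a x) = x \<and> \<kappa> a * \<psi> a x > 0" if a: "a \<in> {i, p}" for a
  proof -
    have onA: "on_edges a b c d R" and ha: "h a (v i) = 0" using a on hv by auto
    obtain e where e: "e > 0" "\<And>x. \<bar>x - r0\<bar> < e \<Longrightarrow> x > 0 \<and> slope a b c d x \<noteq> 0 \<and>
     dist (L a x) R < \<delta> \<and> is_rectangle (L a x) \<and> aspect_ratio (L a x) = x"
      using line_rect_near[OF rect onA ha \<delta>(1)] unfolding r0_def L_def by metis
    have "isCont (slope a b c d) r0" unfolding slope_def corner_poly_def by (intro continuous_intros)
    then have "isCont (\<lambda>x. \<kappa> a * \<psi> a x) r0" unfolding \<psi>_def by (intro continuous_intros sl a)
    then have "((\<lambda>x. \<kappa> a * \<psi> a x) \<longlongrightarrow> \<kappa> a * \<psi> a r0) (nhds r0)"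
      using tendsto_at_iff_tendsto_nhds[of "\<lambda>x. \<kappa> a * \<psi> a x" r0] unfolding isCont_def by blast
    moreover have "\<kappa> a * \<psi> a r0 > 0" unfolding \<kappa>_def using psi0[OF a] by (simp add: sgn_if)
    ultimately have "eventually (\<lambda>x. \<kappa> a * \<psi> a x > 0) (nhds r0)" by (rule order_tendstoD(1))
    then obtain e' where e': "e' > 0" "\<And>x. dist x r0 < e' \<Longrightarrow> \<kappa> a * \<psi> a x > 0"
      unfolding eventually_nhds_metric by blast
    show ?thesis by (rule exI[of _ "min e e'"]) (use e e' in \<open>auto simp: dist_real_def\<close>)
  qed
  then obtain ea where ea: "\<And>a. a \<in> {i, p} \<Longrightarrow> ea a > 0" "\<And>a x. a \<in> {i, p} \<Longrightarrow> \<bar>x - r0\<bar> < ea a \<Longrightarrow>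
     x > 0 \<and> slope a b c d x \<noteq> 0 \<and> dist (L a x) R < \<delta> \<and>
      is_rectangle (L a x) \<and> aspect_ratio (L a x) = x \<and> \<kappa> a * \<psi> a x > 0" by metis
  define \<epsilon> where "\<epsilon> = min (ea i) (ea p)"
  have \<epsilon>: "\<epsilon> > 0" unfolding \<epsilon>_def using ea(1) by simp
  have E: "x > 0 \<and> slope a b c d x \<noteq> 0 \<and> dist (L a x) R < \<delta> \<and>
      is_rectangle (L a x) \<and> aspect_ratio (L a x) = x \<and> \<kappa> a * \<psi> a x > 0" if "a \<in> {i, p}" "\<bar>x - r0\<bar> < \<epsilon>" for a x
    using ea(2)[of a x] that unfolding \<epsilon>_def by auto
  have sgn: "0 \<le> (x - r0) * \<psi> a x \<longleftrightarrow> 0 \<le> \<kappa> a * (x - r0)" "(x - r0) * \<psi> a x = 0 \<longleftrightarrow> x = r0"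
    if "a \<in> {i, p}" "\<bar>x - r0\<bar> < \<epsilon>" for a x
  proof -
    have "\<kappa> a * \<psi> a x > 0" using E[OF that] by blast
    then show "0 \<le> (x - r0) * \<psi> a x \<longleftrightarrow> 0 \<le> \<kappa> a * (x - r0)" "(x - r0) * \<psi> a x = 0 \<longleftrightarrow> x = r0"
      using kk(2)[OF that(1)] by (auto simp: zero_le_mult_iff)
  qed
  have dist0: "\<bar>(x - r0) * \<psi> a x\<bar> < \<delta>" if "a \<in> {i, p}" "\<bar>x - r0\<bar> < \<epsilon>" for a x
  proof -
    have "dist (fst (L a x)) (fst R) < \<delta>"
      using E[OF that] dist_quad_components(1)[of "L a x" R] by linarith
    moreover have "norm (u a) = 1" using norm_u that i pN by auto
    ultimately show ?thesis unfolding Lfst i(1) by (simp add: dist_norm)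
  qed
  define U where "U = {S \<in> I. dist S R < \<delta> \<and> \<bar>aspect_ratio S - r0\<bar> < \<epsilon>}"
  have LU: "L a x \<in> U" if a: "a \<in> {i, p}" and x: "\<bar>x - r0\<bar> < \<epsilon>" and f: "fst (L a x) \<in> edge a" for a x
  proof -
    note ex = E[OF a x]
    obtain S0 S1 S2 S3 where SS: "L a x = (S0, S1, S2, S3)" by (metis prod_cases4)
    have aN: "a < N" and ha: "h a (v i) = 0" using a i pN hv by auto
    have "x \<noteq> 0" "slope a b c d x \<noteq> 0" using ex by auto
    note ll = line_rect_on_lines[OF aN n this ha SS[unfolded L_def]]
    have "on_edges a b c d (L a x)"
      using fwd[of S0 S1 S2 S3] ex ll f n aN unfolding on_edges_def SS by auto
    then show ?thesis unfolding U_def using on_edges_inscribed ex x by auto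
  qed
  have UL: "S = L a (aspect_ratio S)" if "S \<in> U" "on_edges a b c d S" "a \<in> {i, p}" for S a
    using line_rect_unique[OF that(2), of "v i"] that hv unfolding L_def U_def inscribed_def by auto
  have Uon: "on_edges i b c d S \<or> on_edges p b c d S" if "S \<in> U" for S using near that unfolding U_def by blast
  have Uar: "\<bar>aspect_ratio S - r0\<bar> < \<epsilon>" if "S \<in> U" for S using that unfolding U_def by blast
  have only: "aspect_ratio S = r0" if S: "S \<in> U" "fst S = v i" for S
  proof -
    obtain a where a: "a \<in> {i, p}" "on_edges a b c d S" using Uon[OF S(1)] by blast
    have "fst (L a (aspect_ratio S)) = v i" using UL[OF S(1) a(2,1)] S(2) by simp
    moreover have "u a \<noteq> 0" using norm_u a i pN by (metis insertE norm_zero singletonD zero_neq_one)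
    ultimately show ?thesis using sgn(2)[OF a(1) Uar[OF S(1)]] unfolding Lfst by simp
  qed
  have RU: "R \<in> U" unfolding U_def using R \<delta> \<epsilon> by (simp add: r0_def)
  have LR: "L a r0 = R" if "a \<in> {i, p}" for a using UL[OF RU _ that] on that unfolding r0_def by auto
  define f where "f = (\<lambda>\<tau>. if \<tau> \<le> 0 then L p (r0 + \<kappa> p * \<tau>) else L i (r0 + \<kappa> i * \<tau>))"
  define g where "g = (\<lambda>S. if fst S \<in> edge i then \<kappa> i * (aspect_ratio S - r0) else \<kappa> p * (aspect_ratio S - r0))"
  have abs: "\<bar>r0 + \<kappa> a * \<tau> - r0\<bar> < \<epsilon>" if "a \<in> {i, p}" "\<tau> \<in> {-\<epsilon><..<\<epsilon>}" for a \<tau>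
    using kk(2)[OF that(1)] that(2) by auto
  have contL: "continuous_on {-\<epsilon><..<\<epsilon>} (\<lambda>\<tau>. L a (r0 + \<kappa> a * \<tau>))" if a: "a \<in> {i, p}" for a
  proof (rule continuous_at_imp_continuous_on, intro ballI)
    fix \<tau> assume t: "\<tau> \<in> {-\<epsilon><..<\<epsilon>}"
    have "isCont (L a) (r0 + \<kappa> a * \<tau>)" unfolding L_def
      using E[OF a abs[OF a t]] n by (intro continuous_line_rect) auto
    moreover have "isCont (\<lambda>\<tau>. r0 + \<kappa> a * \<tau>) \<tau>" by (intro continuous_intros)
    ultimately show "isCont (\<lambda>\<tau>. L a (r0 + \<kappa> a * \<tau>)) \<tau>" by (metis isCont_o2)
  qed
  have hom: "homeomorphism {-\<epsilon><..<\<epsilon>} U f g"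
  proof (rule homeomorphismI)
    show "continuous_on {-\<epsilon><..<\<epsilon>} f" unfolding f_def
    proof (rule continuous_on_cases_le)
      show "continuous_on {t \<in> {-\<epsilon><..<\<epsilon>}. t \<le> 0} (\<lambda>\<tau>. L p (r0 + \<kappa> p * \<tau>))"
        "continuous_on {t \<in> {-\<epsilon><..<\<epsilon>}. 0 \<le> t} (\<lambda>\<tau>. L i (r0 + \<kappa> i * \<tau>))"
        by (rule continuous_on_subset[OF contL]; auto)+
    next
      show "continuous_on {-\<epsilon><..<\<epsilon>} (\<lambda>t::real. t)" by (rule continuous_on_id)
    next
      fix t :: real assume "t = 0"
      then show "L p (r0 + \<kappa> p * t) = L i (r0 + \<kappa> i * t)" using LR by simp
    qed
    show fU: "f ` {-\<epsilon><..<\<epsilon>} \<subseteq> U"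
    proof (rule image_subsetI)
      fix \<tau> assume t: "\<tau> \<in> {-\<epsilon><..<\<epsilon>}"
      show "f \<tau> \<in> U"
      proof (cases "\<tau> \<le> 0")
        case True
        let ?x = "r0 + \<kappa> p * \<tau>"
        have x: "\<bar>?x - r0\<bar> < \<epsilon>" using abs t by blast
        have k: "\<kappa> p * (?x - r0) = \<tau>" using kk(1)[of p] by (simp add: mult.assoc[symmetric])
        have "(?x - r0) * \<psi> p ?x \<le> 0"
          using sgn[of p ?x] x True k by (smt (verit, best) insertCI mult_eq_0_iff)
        moreover have "\<bar>(?x - r0) * \<psi> p ?x\<bar> < len p" using dist0[OF _ x, of p] \<delta>(3) by auto
        ultimately have "fst (L p ?x) \<in> edge p" unfolding Lfst
          using edge_from_vertex(2)[OF i(2), folded p_def] by blast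
        then show ?thesis using LU[OF _ x] True unfolding f_def by simp
      next
        case False
        let ?x = "r0 + \<kappa> i * \<tau>"
        have x: "\<bar>?x - r0\<bar> < \<epsilon>" using abs t by blast
        have k: "\<kappa> i * (?x - r0) = \<tau>" using kk(1)[of i] by (simp add: mult.assoc[symmetric])
        have "0 \<le> \<kappa> i * (?x - r0)" unfolding k using False by simp
        then have "(?x - r0) * \<psi> i ?x \<ge> 0" using sgn(1)[OF _ x, of i] by blast
        moreover have "\<bar>(?x - r0) * \<psi> i ?x\<bar> < len i" using dist0[OF _ x, of i] \<delta>(2) by auto
        ultimately have "fst (L i ?x) \<in> edge i" unfolding Lfst
          using edge_from_vertex(1)[OF i(2)] by blast
        then show ?thesis using LU[OF _ x] False unfolding f_def by simp
      qed
    qed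
    show gU: "g ` U \<subseteq> {-\<epsilon><..<\<epsilon>}"
    proof (rule image_subsetI)
      fix S assume "S \<in> U"
      then show "g S \<in> {-\<epsilon><..<\<epsilon>}" using Uar[of S] kk(2)[of i] kk(2)[of p] unfolding g_def by auto
    qed
    show "continuous_on U g"
    proof -
      let ?A = "{S \<in> U. fst S \<in> edge i}" and ?B = "{S \<in> U. fst S \<in> edge p}"
      have UAB: "U = ?A \<union> ?B" using Uon unfolding on_edges_def by blast
      have cl: "closedin (top_of_set U) {S \<in> U. fst S \<in> edge k}" for k
        using continuous_closedin_preimage[of U fst "edge k"] closed_edge[of k]
        by (simp add: vimage_def Int_def continuous_on_fst conj_commute)
      have ca: "continuous_on V (\<lambda>S. c' * (aspect_ratio S - r0))" if "V \<subseteq> U" for V c'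
        by (intro continuous_intros continuous_on_subset[OF continuous_on_aspect]) (use that in \<open>auto simp: U_def\<close>)
      have "continuous_on (?A \<union> ?B) g" unfolding g_def
      proof (rule continuous_on_cases_local)
        show "closedin (top_of_set (?A \<union> ?B)) ?A" "closedin (top_of_set (?A \<union> ?B)) ?B"
          using cl UAB by auto
        show "continuous_on ?A (\<lambda>S. \<kappa> i * (aspect_ratio S - r0))" "continuous_on ?B (\<lambda>S. \<kappa> p * (aspect_ratio S - r0))"
          by (rule ca; blast)+
        fix S assume "S \<in> ?A \<and> fst S \<notin> edge i \<or> S \<in> ?B \<and> fst S \<in> edge i"
        then have "S \<in> U" "fst S = v i" using edges_at_vertex_Int[OF i(2), of "fst S"] unfolding p_def by auto
        then show "\<kappa> i * (aspect_ratio S - r0) = \<kappa> p * (aspect_ratio S - r0)" using only by simp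
      qed
      then show ?thesis using UAB by simp
    qed
    show "g (f \<tau>) = \<tau>" if t: "\<tau> \<in> {-\<epsilon><..<\<epsilon>}" for \<tau>
    proof (cases "\<tau> \<le> 0")
      case True
      let ?x = "r0 + \<kappa> p * \<tau>"
      have x: "\<bar>?x - r0\<bar> < \<epsilon>" using abs t by blast
      have ft: "f \<tau> = L p ?x" using True by (simp add: f_def)
      have ar: "aspect_ratio (f \<tau>) = ?x" using E[OF _ x, of p] ft by simp
      have k: "\<kappa> p * (?x - r0) = \<tau>" using kk(1)[of p] by (simp add: mult.assoc[symmetric])
      have fU1: "f \<tau> \<in> U" using fU t by blast
      show ?thesis
      proof (cases "fst (f \<tau>) \<in> edge i")
        case True
        have "fst (f \<tau>) \<in> edge p"
        proof -
          have "(?x - r0) * \<psi> p ?x \<le> 0"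
            using sgn[of p ?x] x \<open>\<tau> \<le> 0\<close> k by (smt (verit, best) insertCI mult_eq_0_iff)
          moreover have "\<bar>(?x - r0) * \<psi> p ?x\<bar> < len p" using dist0[OF _ x, of p] \<delta>(3) by auto
          ultimately show ?thesis unfolding ft Lfst
            using edge_from_vertex(2)[OF i(2), folded p_def] by blast
        qed
        then have "fst (f \<tau>) = v i" using edges_at_vertex_Int[OF i(2)] True unfolding p_def by blast
        then have "?x = r0" using only[OF fU1] ar by simp
        moreover from this have "?x - r0 = 0" by linarith
        then have "\<tau> = 0" using k by (metis mult_zero_right)
        ultimately show ?thesis using ar unfolding g_def by simp
      next
        case False
        then show ?thesis unfolding g_def ar using k by simp
      qed
    next
      case False
      let ?x = "r0 + \<kappa> i * \<tau>"
      have x: "\<bar>?x - r0\<bar> < \<epsilon>" using abs t by blast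
      have ft: "f \<tau> = L i ?x" using False by (simp add: f_def)
      have ar: "aspect_ratio (f \<tau>) = ?x" using E[OF _ x, of i] ft by simp
      have k: "\<kappa> i * (?x - r0) = \<tau>" using kk(1)[of i] by (simp add: mult.assoc[symmetric])
      have "0 \<le> \<kappa> i * (?x - r0)" unfolding k using False by simp
      then have "(?x - r0) * \<psi> i ?x \<ge> 0" using sgn(1)[OF _ x, of i] by blast
      moreover have "\<bar>(?x - r0) * \<psi> i ?x\<bar> < len i" using dist0[OF _ x, of i] \<delta>(2) by auto
      ultimately have "fst (f \<tau>) \<in> edge i" unfolding ft Lfst
        using edge_from_vertex(1)[OF i(2)] by blast
      then show ?thesis unfolding g_def ar using k by simp
    qed
    show "f (g S) = S" if S: "S \<in> U" for S
    proof (cases "fst S \<in> edge i")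
      case True
      then have on: "on_edges i b c d S" using Uon[OF S] i(2) unfolding on_edges_def by auto
      have SL: "S = L i (aspect_ratio S)" using UL[OF S on] by simp
      have "fst (L i (aspect_ratio S)) \<in> edge i" using True SL by simp
      moreover have "\<bar>(aspect_ratio S - r0) * \<psi> i (aspect_ratio S)\<bar> < len i"
        using dist0[OF _ Uar[OF S], of i] \<delta>(2) by auto
      ultimately have "0 \<le> (aspect_ratio S - r0) * \<psi> i (aspect_ratio S)"
        unfolding Lfst using edge_from_vertex(1)[OF i(2)] by blast
      then have pos: "0 \<le> \<kappa> i * (aspect_ratio S - r0)" using sgn(1)[OF _ Uar[OF S], of i] by simp
      have gS: "g S = \<kappa> i * (aspect_ratio S - r0)" using True by (simp add: g_def)
      have ks: "\<kappa> i * (\<kappa> i * (aspect_ratio S - r0)) = aspect_ratio S - r0"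
        using kk(1)[of i] by (simp add: mult.assoc[symmetric])
      show ?thesis
      proof (cases "g S \<le> 0")
        case True
        then have "aspect_ratio S = r0" using gS pos kk(2)[of i] by auto
        then show ?thesis using gS SL LR unfolding f_def by auto
      next
        case False
        then have "f (g S) = L i (r0 + \<kappa> i * (\<kappa> i * (aspect_ratio S - r0)))" unfolding f_def gS by simp
        then show ?thesis using SL ks by simp
      qed
    next
      case False
      then have on: "on_edges p b c d S" using Uon[OF S] unfolding on_edges_def by auto
      have SL: "S = L p (aspect_ratio S)" using UL[OF S on] by simp
      have "fst (L p (aspect_ratio S)) \<in> edge p" using on SL unfolding on_edges_def by metis
      moreover have "\<bar>(aspect_ratio S - r0) * \<psi> p (aspect_ratio S)\<bar> < len p"
        using dist0[OF _ Uar[OF S], of p] \<delta>(3) by auto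
      ultimately have le: "(aspect_ratio S - r0) * \<psi> p (aspect_ratio S) \<le> 0"
        unfolding Lfst using edge_from_vertex(2)[OF i(2), folded p_def] by blast
      then have neg: "\<kappa> p * (aspect_ratio S - r0) \<le> 0"
        using sgn[OF _ Uar[OF S], of p] by (smt (verit, best) insertCI mult_eq_0_iff)
      have gS: "g S = \<kappa> p * (aspect_ratio S - r0)" using False by (simp add: g_def)
      have ks: "\<kappa> p * (\<kappa> p * (aspect_ratio S - r0)) = aspect_ratio S - r0"
        using kk(1)[of p] by (simp add: mult.assoc[symmetric])
      have "f (g S) = L p (r0 + \<kappa> p * (\<kappa> p * (aspect_ratio S - r0)))" unfolding f_def gS using neg by simp
      then show ?thesis using SL ks by simp
    qed
  qed
  have op: "openin (top_of_set I) U" unfolding U_def by (rule openin_inscribed_near)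
  have "{-\<epsilon><..<\<epsilon>} homeomorphic (UNIV::real set)"
    using homeomorphic_ball_UNIV[OF \<epsilon>, of "0::real"] by (simp add: ball_eq_greaterThanLessThan)
  moreover have "U homeomorphic {-\<epsilon><..<\<epsilon>}" using hom homeomorphic_def homeomorphic_sym by blast
  ultimately have Uhom: "U homeomorphic (UNIV::real set)" using homeomorphic_trans by blast
  have "S = R" if S: "S \<in> U" "has_corner S" for S
  proof -
    have fS: "fst S = v i" using corn S unfolding U_def by blast
    have "aspect_ratio S = r0" using only[OF S(1) fS] .
    moreover obtain a where "a \<in> {i, p}" "on_edges a b c d S" using Uon[OF S(1)] by blast
    ultimately show ?thesis using UL[OF S(1)] LR by metis
  qed
  then show ?thesis using that op RU Uhom by blast
qed

text \<open>Along a smooth curve through \<open>R\<close> the first vertex stays on the two edges at \<open>v i\<close> and is at \<open>v i\<close> for one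
  parameter. There two independent linear functions of it have a local minimum, so its velocity
  is zero. The other three vertices move along fixed lines; the conditions for a rectangle then
  form a linear system for their velocities with determinant \<open>\<Delta>\<close>, which is nonzero because the aspect
  ratio is a simple root. So all velocities vanish, and the parametrization is not regular.\<close>

lemma corner_not_smooth:
  assumes R: "R \<in> I" and i: "fst R = v i" "i < N"
  shows "\<not> smooth_point I R"
proof
  assume "smooth_point I R"
  then obtain U f g D where U: "openin (top_of_set I) U" "R \<in> U" and hom: "homeomorphism (UNIV::real set) U f g"
    and D: "D 0 = f" "\<And>k t. (D k has_vector_derivative D (Suc k) t) (at t)" "\<And>t. D (Suc 0) t \<noteq> 0"
    unfolding smooth_point_def by blast
  define p where "p = prv N i"
  note pN = nx(2)[OF i(2), folded p_def]
  have ip: "i \<noteq> p" using nx(6)[OF i(2)] unfolding p_def by simp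
  have rect: "is_rectangle R" using R by (simp add: inscribed_def)
  obtain b c d \<delta> where on: "on_edges i b c d R" "on_edges p b c d R" and val: "validc N i b c d" and \<delta>: "\<delta> > 0"
    and near: "\<And>S. S \<in> I \<Longrightarrow> dist S R < \<delta> \<Longrightarrow> on_edges i b c d S \<or> on_edges p b c d S"
    using corner_neighbourhood[OF R i] unfolding p_def by metis
  have n: "b < N" "c < N" "d < N" using on unfolding on_edges_def by auto
  obtain t0 where t0: "f t0 = R" using hom U(2) unfolding homeomorphism_def by (metis UNIV_I)
  have fI: "f t \<in> I" for t using hom openin_imp_subset[OF U(1)] unfolding homeomorphism_def by blast
  define T where "T = D (Suc 0) t0"
  have df: "(f has_vector_derivative T) (at t0)" using D(2)[of 0 t0] D(1) by (simp add: T_def)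
  obtain T0 T1 T2 T3 where TT: "T = (T0, T1, T2, T3)" by (metis prod_cases4)
  define f0 f1 f2 f3 where "f0 = (\<lambda>t. fst (f t))" and "f1 = (\<lambda>t. fst (snd (f t)))"
    and "f2 = (\<lambda>t. fst (snd (snd (f t))))" and "f3 = (\<lambda>t. snd (snd (snd (f t))))"
  have bl: "bounded_linear (\<lambda>S::quad. fst (snd S))" "bounded_linear (\<lambda>S::quad. fst (snd (snd S)))"
    "bounded_linear (\<lambda>S::quad. snd (snd (snd S)))"
    by (intro bounded_linear_fst bounded_linear_snd
        bounded_linear_compose[OF bounded_linear_fst] bounded_linear_compose[OF bounded_linear_snd] bounded_linear_ident)+
  have d0: "(f0 has_vector_derivative T0) (at t0)" and d1: "(f1 has_vector_derivative T1) (at t0)"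
    and d2: "(f2 has_vector_derivative T2) (at t0)" and d3: "(f3 has_vector_derivative T3) (at t0)"
    using bounded_linear.has_vector_derivative[OF bounded_linear_fst df]
      bounded_linear.has_vector_derivative[OF bl(1) df] bounded_linear.has_vector_derivative[OF bl(2) df]
      bounded_linear.has_vector_derivative[OF bl(3) df] unfolding TT f0_def f1_def f2_def f3_def by simp_all
  have "isCont f t0" using has_vector_derivative_continuous[OF df] .
  then obtain e where e: "e > 0" "\<And>t. \<bar>t - t0\<bar> < e \<Longrightarrow> dist (f t) R < \<delta>"
    using \<delta> t0 unfolding continuous_at_eps_delta by (auto simp: dist_real_def)
  have near': "on_edges i b c d (f t) \<or> on_edges p b c d (f t)" if "\<bar>t - t0\<bar> < e" for t
    using near fI e(2) that by blast
  have crlin: "bounded_linear (cr w)" for w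
    unfolding cr_def using bounded_linear_compose[OF bounded_linear_Im bounded_linear_mult_right] by blast
  have dcr: "((\<lambda>t. s * cr w (F t - z)) has_real_derivative s * cr w F') (at t0)"
    if "(F has_vector_derivative F') (at t0)" for F F' w z and s :: real
  proof -
    have "((\<lambda>t. F t - z) has_vector_derivative F') (at t0)" using that by (auto intro!: derivative_eq_intros)
    from bounded_linear.has_vector_derivative[OF crlin this]
    show ?thesis unfolding has_real_derivative_iff_has_vector_derivative[symmetric] by (rule DERIV_cmult)
  qed
  have dcr0: "cr (u k) F' = 0" if "(F has_vector_derivative F') (at t0)" "\<And>t. \<bar>t - t0\<bar> < e \<Longrightarrow> F t \<in> edge k" "k < N" for F F' k
  proof -
    have "cr (u k) (F t - v k) = 0" if "\<bar>t - t0\<bar> < e" for t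
      using edge_line[OF \<open>k < N\<close>] \<open>\<And>t. _ \<Longrightarrow> F t \<in> edge k\<close> that by (force simp: ht_def)
    then have "1 * cr (u k) F' = 0"
      using DERIV_local_min[OF dcr[OF that(1), of 1 "u k" "v k"] e(1)] e(1) by (simp add: abs_minus_commute)
    then show ?thesis by simp
  qed
  define \<sigma> where "\<sigma> = cr (u p) (u i)"
  have s0: "\<sigma> \<noteq> 0" unfolding \<sigma>_def using cr_ne[OF pN i(2)] ip by simp
  have pos: "\<sigma> * cr (u p) (f0 t - v i) \<ge> 0 \<and> \<sigma> * cr (u i) (f0 t - v i) \<ge> 0" if t: "\<bar>t - t0\<bar> < e" for t
    using near'[OF t]
  proof
    assume "on_edges i b c d (f t)"
    then obtain s where "0 \<le> s" "f0 t = v i + s *\<^sub>R u i" unfolding on_edges_def edge_iff f0_def by blast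
    then show ?thesis by (simp add: \<sigma>_def mult.left_commute)
  next
    assume "on_edges p b c d (f t)"
    then obtain s where s: "s \<le> len p" "f0 t = v p + s *\<^sub>R u p" unfolding on_edges_def edge_iff f0_def by blast
    have "v i = v p + len p *\<^sub>R u p" using v_nxt[of p] nx(3)[OF i(2)] unfolding p_def by simp
    then have E: "f0 t - v i = (s - len p) *\<^sub>R u p" using s by (simp add: algebra_simps)
    moreover have "(s - len p) * (\<sigma> * cr (u i) (u p)) \<ge> 0"
      unfolding \<sigma>_def cr_commute[of "u i"] using s by (simp add: mult_nonpos_nonneg)
    ultimately show ?thesis unfolding E by (simp add: mult.left_commute)
  qed
  have f0t: "f0 t0 = v i" using t0 i by (simp add: f0_def)
  have "\<sigma> * cr (u p) T0 = 0" "\<sigma> * cr (u i) T0 = 0"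
    using DERIV_local_min[OF dcr[OF d0, of \<sigma> "u p" "v i"] e(1)] DERIV_local_min[OF dcr[OF d0, of \<sigma> "u i" "v i"] e(1)]
      pos f0t by (simp_all add: abs_minus_commute)
  then have T0: "T0 = 0" using parallel_zero[OF i(2) pN ip] s0 by simp
  have T1: "cr (u b) T1 = 0" by (rule dcr0[OF d1 _ n(1)]) (use near' in \<open>auto simp: on_edges_def f1_def\<close>)
  have T2: "cr (u c) T2 = 0" by (rule dcr0[OF d2 _ n(2)]) (use near' in \<open>auto simp: on_edges_def f2_def\<close>)
  have T3: "cr (u d) T3 = 0" by (rule dcr0[OF d3 _ n(3)]) (use near' in \<open>auto simp: on_edges_def f3_def\<close>)
  have rel: "f3 t - f0 t - (f2 t - f1 t) = 0" "(f1 t - f0 t) \<bullet> (f2 t - f1 t) = 0" for t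
    using fI[of t] unfolding f0_def f1_def f2_def f3_def by (cases "f t"; simp add: inscribed_def)+
  have "((\<lambda>t. f3 t - f0 t - (f2 t - f1 t)) has_vector_derivative (T3 - T0 - (T2 - T1))) (at t0)"
    by (intro derivative_intros d0 d1 d2 d3)
  then have par: "T3 - T0 - (T2 - T1) = 0" unfolding rel using vector_derivative_unique_at
    by (metis has_vector_derivative_const)
  have "((\<lambda>t. (f1 t - f0 t) \<bullet> (f2 t - f1 t)) has_real_derivative
      ((f1 t0 - f0 t0) \<bullet> (T2 - T1) + (T1 - T0) \<bullet> (f2 t0 - f1 t0))) (at t0)"
    unfolding has_real_derivative_iff_has_vector_derivative
    by (rule bounded_bilinear.has_vector_derivative[OF bounded_bilinear_inner]) (intro derivative_intros d0 d1 d2)+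
  then have orth: "(f1 t0 - f0 t0) \<bullet> (T2 - T1) + (T1 - T0) \<bullet> (f2 t0 - f1 t0) = 0"
    unfolding rel using DERIV_unique DERIV_const by blast
  obtain w r where q: "w \<noteq> 0" "r > 0" "R = quad_of (v i) w r"
    using rectangleE[OF rect] i(1) by (metis fst_conv quad_of_def)
  have ff: "f1 t0 - f0 t0 = w" "f2 t0 - f1 t0 = r *\<^sub>R (\<i> * w)"
    unfolding f0_def f1_def f2_def t0 q(3) quad_of_def by auto
  note hh = on_edges_heights[OF on(1)[unfolded q(3)]]
  define x y where "x = u b \<bullet> T1" and "y = u d \<bullet> T3"
  have Tx: "T1 = x *\<^sub>R u b" "T3 = y *\<^sub>R u d"
    unfolding x_def y_def using cr_zero_scaleR T1 T3 norm_u n by auto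
  have T2e: "T2 = T1 + T3" using par T0 by (simp add: algebra_simps)
  have eq2: "x * cr (u c) (u b) + y * cr (u c) (u d) = 0" using T2 unfolding T2e Tx by simp
  have "w \<bullet> T3 + T1 \<bullet> (r *\<^sub>R (\<i> * w)) = 0" using orth unfolding ff T2e T0 by simp
  then have "y * (u d \<bullet> w) - r * x * cr (u b) w = 0" unfolding Tx by (simp add: inner_commute cr_commute[of w "u b"])
  then have "r * (y * (u d \<bullet> w) - r * x * cr (u b) w) = 0" by simp
  then have eq1: "y * h d (v i) - r\<^sup>2 * x * h b (v i) = 0"
    unfolding hh(2)[symmetric] hh(4)[symmetric] by (simp add: power2_eq_square algebra_simps)
  define \<Delta> where "\<Delta> = h d (v i) * cr (u b) (u c) - r\<^sup>2 * (h b (v i) * cr (u c) (u d))"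
  have F0: "defect (v i) b c d r = 0" using defect_zero on(1) q(3) by blast
  have "\<Delta> \<noteq> 0"
  proof
    assume "\<Delta> = 0"
    then have "r * defect_slope (v i) b c d r = defect (v i) b c d r"
      unfolding \<Delta>_def defect_slope_def defect_def corner_poly_def cp_lin_def
      by (simp add: power2_eq_square algebra_simps)
    then show False using F0 corner_simple_root[OF val i(2) n F0] q(2) by simp
  qed
  moreover have "\<Delta> * x = 0" "\<Delta> * y = 0"
  proof -
    have "\<Delta> * x = cr (u c) (u d) * (y * h d (v i) - r\<^sup>2 * x * h b (v i)) - h d (v i) * (x * cr (u c) (u b) + y * cr (u c) (u d))"
      unfolding \<Delta>_def cr_commute[of "u c" "u b"] by (simp add: algebra_simps)
    then show "\<Delta> * x = 0" using eq1 eq2 by simp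
    have "\<Delta> * y = cr (u b) (u c) * (y * h d (v i) - r\<^sup>2 * x * h b (v i)) - r\<^sup>2 * h b (v i) * (x * cr (u c) (u b) + y * cr (u c) (u d))"
      unfolding \<Delta>_def cr_commute[of "u c" "u b"] by (simp add: algebra_simps)
    then show "\<Delta> * y = 0" using eq1 eq2 by simp
  qed
  ultimately have "T1 = 0" "T3 = 0" using Tx by auto
  then have "T = 0" using TT T0 T2e by (simp add: zero_prod_def)
  then show False using D(3)[of t0] unfolding T_def by simp
qed

end

section \<open>The space of inscribed rectangles is a piecewise smooth manifold\<close>

lemma relabel_funpow_inscribed: "R \<in> inscribed \<gamma> \<Longrightarrow> (relabel ^^ j) R \<in> inscribed \<gamma>"
  by (induction j) (auto intro: relabel_inscribed)

text \<open>Relabeling moves any vertex of a rectangle to the first place, where the local results apply.\<close>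

lemma smooth_point_relabel:
  assumes "smooth_point (inscribed \<gamma>) R" shows "smooth_point (inscribed \<gamma>) (relabel R)"
proof -
  let ?I = "inscribed \<gamma>"
  obtain U f g D where U: "R \<in> ?I" "openin (top_of_set ?I) U" "R \<in> U" and hom: "homeomorphism (UNIV::real set) U f g"
    and D: "D 0 = f" "\<forall>k t. (D k has_vector_derivative D (Suc k) t) (at t)" "\<forall>t. D (Suc 0) t \<noteq> 0"
    using assms unfolding smooth_point_def by blast
  have UI: "U \<subseteq> ?I" using openin_imp_subset[OF U(2)] .
  have h: "homeomorphism U (relabel ` U) relabel (relabel \<circ> relabel \<circ> relabel)"
    by (rule homeomorphism_of_subsets[OF relabel_homeomorphism_inscribed UI]) (use UI relabel_inscribed in auto)
  have op: "openin (top_of_set ?I) (relabel ` U)"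
    by (rule homeomorphism_imp_open_map[OF relabel_homeomorphism_inscribed U(2)])
  have hom': "homeomorphism UNIV (relabel ` U) (relabel \<circ> f) (g \<circ> (relabel \<circ> relabel \<circ> relabel))"
    by (rule homeomorphism_compose[OF hom h])
  have nz: "relabel x \<noteq> 0" if "x \<noteq> 0" for x :: quad
    using that by (cases x) (auto simp: zero_prod_def)
  have "(\<lambda>t. relabel (D 0 t)) = relabel \<circ> f" using D(1) by auto
  moreover have "((\<lambda>t. relabel (D k t)) has_vector_derivative relabel (D (Suc k) t)) (at t)" for k t
    using bounded_linear.has_vector_derivative[OF bounded_linear_relabel] D(2) by blast
  ultimately show ?thesis unfolding smooth_point_def
    using U op hom' nz D(3) relabel_inscribed
    by (intro conjI exI[of _ "relabel ` U"] exI[of _ "relabel \<circ> f"]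
        exI[of _ "g \<circ> (relabel \<circ> relabel \<circ> relabel)"] exI[of _ "\<lambda>k t. relabel (D k t)"]) auto
qed

lemma smooth_point_relabel_funpow:
  "smooth_point (inscribed \<gamma>) R \<Longrightarrow> smooth_point (inscribed \<gamma>) ((relabel ^^ j) R)"
  by (induction j) (auto intro: smooth_point_relabel)

context generic_polygon begin

definition isolated_line_at :: "quad \<Rightarrow> bool" where
  "isolated_line_at R \<longleftrightarrow> (\<exists>U. openin (top_of_set I) U \<and> R \<in> U \<and> U homeomorphic (UNIV :: real set) \<and>
     (\<forall>S\<in>U. has_corner S \<longrightarrow> S = R))"

lemma isolated_line_at_relabel:
  assumes "isolated_line_at (relabel R)" "R \<in> I" shows "isolated_line_at R"
proof -
  let ?h = "relabel \<circ> relabel \<circ> relabel"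
  obtain U where U: "openin (top_of_set I) U" "relabel R \<in> U" "U homeomorphic (UNIV :: real set)"
    "\<And>S. S \<in> U \<Longrightarrow> has_corner S \<Longrightarrow> S = relabel R" using assms(1) unfolding isolated_line_at_def by blast
  note H = homeomorphism_symD[OF relabel_homeomorphism_inscribed]
  have UI: "U \<subseteq> I" using openin_imp_subset[OF U(1)] .
  have "openin (top_of_set I) (?h ` U)" by (rule homeomorphism_imp_open_map[OF H U(1)])
  moreover have "R \<in> ?h ` U" using U(2) by (metis comp_apply image_eqI relabel4)
  moreover have "?h ` U homeomorphic (UNIV::real set)"
  proof -
    have "homeomorphism U (?h ` U) ?h relabel"
      by (rule homeomorphism_of_subsets[OF H UI]) (use UI relabel_inscribed in auto)
    then have "?h ` U homeomorphic U" using homeomorphic_def homeomorphic_sym by blast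
    then show ?thesis using U(3) homeomorphic_trans by blast
  qed
  moreover have "S = R" if S: "S \<in> ?h ` U" "has_corner S" for S
  proof -
    obtain T where T: "T \<in> U" "S = ?h T" using S(1) by blast
    then have "relabel S = T" by simp
    moreover have "has_corner (relabel S)" using S(2) by simp
    ultimately have "relabel S = relabel R" using U(4) T by metis
    then show ?thesis by (metis relabel4)
  qed
  ultimately show ?thesis unfolding isolated_line_at_def by blast
qed

lemma isolated_line_at_relabel_funpow:
  "isolated_line_at ((relabel ^^ j) R) \<Longrightarrow> R \<in> I \<Longrightarrow> isolated_line_at R"
proof (induction j)
  case (Suc j)
  then show ?case using isolated_line_at_relabel[of "(relabel ^^ j) R"] relabel_funpow_inscribed by simp
qed simp

lemma corner_isolated_line_at:
  assumes "R \<in> I" "has_corner R" shows "isolated_line_at R"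
proof -
  obtain j where j: "fst ((relabel ^^ j) R) \<in> corners" using corner_rotate[OF assms] by blast
  then obtain i where i: "fst ((relabel ^^ j) R) = v i" "i < N" unfolding corners_def by auto
  have "isolated_line_at ((relabel ^^ j) R)"
    using corner_local_line[OF relabel_funpow_inscribed[OF assms(1)] i] unfolding isolated_line_at_def by metis
  then show ?thesis using isolated_line_at_relabel_funpow assms(1) by blast
qed

lemma smooth_point_iff:
  assumes "R \<in> I" shows "smooth_point I R \<longleftrightarrow> \<not> has_corner R"
proof
  assume s: "smooth_point I R"
  show "\<not> has_corner R"
  proof
    assume "has_corner R"
    then obtain j where j: "fst ((relabel ^^ j) R) \<in> corners" using corner_rotate[OF assms] by blast
    then obtain i where i: "fst ((relabel ^^ j) R) = v i" "i < N" unfolding corners_def by auto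
    show False
      using corner_not_smooth[OF relabel_funpow_inscribed[OF assms] i] smooth_point_relabel_funpow[OF s] by blast
  qed
next
  assume "\<not> has_corner R"
  then show "smooth_point I R" using smooth_at_non_corner[OF assms] by metis
qed

theorem inscribed_piecewise_smooth: "piecewise_smooth_1_manifold I"
  unfolding piecewise_smooth_1_manifold_def
proof (intro conjI exI[of _ "{R \<in> I. has_corner R}"])
  show "topological_1_manifold I" unfolding topological_1_manifold_def
  proof
    fix R assume R: "R \<in> I"
    show "\<exists>U. openin (top_of_set I) U \<and> R \<in> U \<and> U homeomorphic (UNIV :: real set)"
    proof (cases "has_corner R")
      case True
      then show ?thesis using corner_isolated_line_at[OF R] unfolding isolated_line_at_def by blast
    next
      case False
      then show ?thesis using smooth_at_non_corner[OF R] by metis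
    qed
  qed
  show "\<forall>R\<in>I - {R \<in> I. has_corner R}. smooth_point I R" using smooth_point_iff by blast
  show "locally_finite_in (top_of_set I) ((\<lambda>x. {x}) ` {R \<in> I. has_corner R})"
    unfolding locally_finite_in_def
  proof (intro conjI ballI)
    fix R assume "R \<in> topspace (top_of_set I)"
    then have R: "R \<in> I" by simp
    have "\<exists>V. openin (top_of_set I) V \<and> R \<in> V \<and> (\<forall>S\<in>V. has_corner S \<longrightarrow> S = R)"
    proof (cases "has_corner R")
      case True
      then show ?thesis using corner_isolated_line_at[OF R] unfolding isolated_line_at_def by blast
    next
      case False
      then show ?thesis using smooth_at_non_corner[OF R] by metis
    qed
    then obtain V where V: "openin (top_of_set I) V" "R \<in> V" "\<And>S. S \<in> V \<Longrightarrow> has_corner S \<Longrightarrow> S = R" by blast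
    have "{U \<in> (\<lambda>x. {x}) ` {R \<in> I. has_corner R}. U \<inter> V \<noteq> {}} \<subseteq> {{R}}" using V(3) by auto
    then have "finite {U \<in> (\<lambda>x. {x}) ` {R \<in> I. has_corner R}. U \<inter> V \<noteq> {}}"
      by (rule finite_subset) simp
    then show "\<exists>V. openin (top_of_set I) V \<and> R \<in> V \<and> finite {U \<in> (\<lambda>x. {x}) ` {R \<in> I. has_corner R}. U \<inter> V \<noteq> {}}"
      using V(1,2) by blast
  qed auto
qed

theorem aspect_ratio_locally_injective:
  assumes "smooth_point I R"
  shows "\<exists>U. openin (top_of_set I) U \<and> R \<in> U \<and> inj_on aspect_ratio U"
proof -
  have R: "R \<in> I" using assms by (simp add: smooth_point_def)
  then have "\<not> has_corner R" using smooth_point_iff assms by blast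
  then show ?thesis using smooth_at_non_corner[OF R] by metis
qed

theorem square_smooth: "R \<in> I \<Longrightarrow> aspect_ratio R = 1 \<Longrightarrow> smooth_point I R"
  using smooth_point_iff corner_not_square by blast

end

section \<open>Limits at the ends of arc components\<close>

lemma inscribed_rect: "R \<in> inscribed \<gamma> \<Longrightarrow> is_rectangle R"
  by (simp add: inscribed_def del: is_rectangle.simps)

lemma relabel_funpow_free:
  assumes "is_rectangle R" "0 < j" "j < 4" shows "(relabel ^^ j) R \<noteq> R"
proof -
  obtain z w r where R: "w \<noteq> 0" "r > 0" "R = quad_of z w r" by (rule rectangleE[OF assms(1)]) (rule that)
  have 1: "r *\<^sub>R (\<i> * w) \<noteq> 0" using R by simp
  have 2: "w + r *\<^sub>R (\<i> * w) \<noteq> 0"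
  proof
    assume "w + r *\<^sub>R (\<i> * w) = 0"
    then have "cr w (w + r *\<^sub>R (\<i> * w)) = 0" by simp
    then show False using R by simp
  qed
  have "j = 1 \<or> j = 2 \<or> j = 3" using assms(2,3) by linarith
  moreover have "fst (relabel R) \<noteq> fst R" "fst (relabel (relabel R)) \<noteq> fst R" "fst (relabel (relabel (relabel R))) \<noteq> fst R"
    using R(1) 1 2 unfolding R(3) quad_of_def by (simp_all add: add.assoc)
  ultimately show ?thesis by (elim disjE) (auto simp: numeral_2_eq_2 numeral_3_eq_3 simp del: relabel.simps)
qed

lemma relabel_funpow4: "(relabel ^^ j) ((relabel ^^ j) ((relabel ^^ j) ((relabel ^^ j) R))) = R"
proof -
  have 4: "(relabel ^^ 4) = id" by (simp add: numeral_eq_Suc fun_eq_iff)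
  have "(relabel ^^ j) ((relabel ^^ j) ((relabel ^^ j) ((relabel ^^ j) R))) = (relabel ^^ (4 * j)) R"
    by (simp add: numeral_eq_Suc funpow_add)
  also have "\<dots> = ((relabel ^^ 4) ^^ j) R" by (simp add: funpow_mult mult.commute)
  also have "\<dots> = R" unfolding 4 by simp
  finally show ?thesis .
qed

lemma continuous_on_relabel_funpow: "continuous_on S (relabel ^^ j)"
proof (induction j)
  case (Suc j)
  then show ?case using continuous_on_compose[OF Suc continuous_on_relabel] by (simp add: comp_def)
qed (simp add: id_def)

text \<open>If \<open>f t - t\<close> has no zero it has constant sign, and the iterates of a point are strictly monotone.\<close>

lemma order4_fixed_point:
  fixes f :: "real \<Rightarrow> real"
  assumes cont: "continuous_on {0<..<1} f" and into: "\<And>t. t \<in> {0<..<1} \<Longrightarrow> f t \<in> {0<..<1}"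
    and four: "\<And>t. t \<in> {0<..<1} \<Longrightarrow> f (f (f (f t))) = t"
  shows "\<exists>t\<in>{0<..<1}. f t = t"
proof (rule ccontr)
  assume "\<not> ?thesis"
  then have nf: "f t \<noteq> t" if "t \<in> {0<..<1}" for t using that by blast
  have conn: "connected ((\<lambda>t. f t - t) ` {0<..<1})"
    by (intro connected_continuous_image continuous_intros cont) simp
  let ?a = "1/2 :: real"
  have a: "?a \<in> {0<..<1}" by simp
  have sg: "(f t - t) * (f ?a - ?a) > 0" if "t \<in> {0<..<1}" for t
  proof (rule ccontr)
    assume "\<not> ?thesis"
    then have "f t - t \<le> 0 \<and> 0 \<le> f ?a - ?a \<or> f ?a - ?a \<le> 0 \<and> 0 \<le> f t - t"
      by (auto simp: not_less mult_le_0_iff)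
    then have "0 \<in> (\<lambda>t. f t - t) ` {0<..<1}"
      using connectedD_interval[OF conn, of "f t - t" "f ?a - ?a" 0] connectedD_interval[OF conn, of "f ?a - ?a" "f t - t" 0]
        that a by blast
    then show False using nf by auto
  qed
  have m: "f ?a \<in> {0<..<1}" "f (f ?a) \<in> {0<..<1}" "f (f (f ?a)) \<in> {0<..<1}" using into a by blast+
  show False
  proof (cases "f ?a > ?a")
    case True
    then have "f t > t" if "t \<in> {0<..<1}" for t using sg[OF that] by (simp add: zero_less_mult_iff)
    then have "?a < f ?a" "f ?a < f (f ?a)" "f (f ?a) < f (f (f ?a))" "f (f (f ?a)) < f (f (f (f ?a)))" using m a by blast+
    then show False using four[OF a] by linarith
  next
    case False
    then have "f t < t" if "t \<in> {0<..<1}" for t using sg[OF that] by (simp add: zero_less_mult_iff)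
    then have "f ?a < ?a" "f (f ?a) < f ?a" "f (f (f ?a)) < f (f ?a)" "f (f (f (f ?a))) < f (f (f ?a))" using m a by blast+
    then show False using four[OF a] by linarith
  qed
qed

context generic_polygon begin

lemma path_P: "path (polygon_path N v)" using ng unfolding is_ngon_def by (simp add: simple_path_imp_path)

lemma closed_P: "closed P" and bounded_P: "bounded P" and compact_P: "compact P"
  using compact_path_image[OF path_P] compact_imp_closed compact_imp_bounded by auto

lemma bounded_I: "bounded I"
proof -
  have "bounded (P \<times> P \<times> P \<times> P)" by (intro bounded_Times bounded_P)
  moreover have "I \<subseteq> P \<times> P \<times> P \<times> P" unfolding inscribed_def by (rule subsetI, case_tac x) auto
  ultimately show ?thesis using bounded_subset by blast
qed

lemma closure_I:
  assumes "(A, B, C, D) \<in> closure I"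
  shows "A \<in> P" "B \<in> P" "C \<in> P" "D \<in> P" "D - A = C - B" "(B - A) \<bullet> (C - B) = 0" "cr (B - A) (C - B) \<ge> 0"
proof -
  define Z where "Z = {R::quad. fst R \<in> P \<and> fst (snd R) \<in> P \<and> fst (snd (snd R)) \<in> P \<and> snd (snd (snd R)) \<in> P \<and>
     snd (snd (snd R)) - fst R = fst (snd (snd R)) - fst (snd R) \<and>
     (fst (snd R) - fst R) \<bullet> (fst (snd (snd R)) - fst (snd R)) = 0 \<and>
     0 \<le> cr (fst (snd R) - fst R) (fst (snd (snd R)) - fst (snd R))}"
  have pre: "closed {R::quad. k R \<in> P}" if "continuous_on UNIV k" for k
    using closed_vimage[OF closed_P that] by (simp add: vimage_def)
  have "closed Z" unfolding Z_def
    by (intro closed_Collect_conj closed_Collect_eq closed_Collect_le pre continuous_intros)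
  moreover have "I \<subseteq> Z" unfolding inscribed_def Z_def cr_def
    by (rule subsetI, case_tac x) auto
  ultimately have "(A, B, C, D) \<in> Z" using closure_minimal assms by blast
  then show "A \<in> P" "B \<in> P" "C \<in> P" "D \<in> P" "D - A = C - B" "(B - A) \<bullet> (C - B) = 0" "cr (B - A) (C - B) \<ge> 0"
    unfolding Z_def by auto
qed

lemma relabel_closure_I: "L \<in> closure I \<Longrightarrow> relabel L \<in> closure I"
proof -
  assume "L \<in> closure I"
  then have "relabel L \<in> relabel ` closure I" by blast
  also have "\<dots> \<subseteq> closure (relabel ` I)"
    by (rule image_closure_subset[OF continuous_on_relabel closed_closure closure_subset])
  finally show ?thesis unfolding relabel_image_inscribed .
qed

lemma edges_through_point:
  assumes "A \<in> P"
  obtains k l where "k < N" "l < N" "\<And>a. a < N \<Longrightarrow> A \<in> edge a \<Longrightarrow> a = k \<or> a = l"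
proof (cases "A \<in> corners")
  case True
  then obtain i where "i < N" "A = v i" by (auto simp: corners_def)
  then show ?thesis using that[of i "prv N i"] edge_at_vertex nx[of i] by (auto simp: edge_end_def)
next
  case False
  obtain k where "k < N" "A \<in> edge k" using assms path_image_edges by auto
  then show ?thesis using that[of k k] edge_unique False by blast
qed

text \<open>Near a point there are at most two edges, but an inscribed rectangle meets at least three.\<close>

lemma no_small_rectangles: "(A, A, A, A) \<notin> closure I"
proof
  assume L: "(A, A, A, A) \<in> closure I"
  have "A \<in> P" using closure_I(1)[OF L] .
  then obtain k l where kl: "\<And>a. a < N \<Longrightarrow> A \<in> edge a \<Longrightarrow> a = k \<or> a = l" using edges_through_point by metis
  obtain \<delta> where d: "\<delta> > 0" "\<And>k z. k < N \<Longrightarrow> z \<in> edge k \<Longrightarrow> dist z A < \<delta> \<Longrightarrow> A \<in> edge k"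
    using near_edges by blast
  obtain R where R: "R \<in> I" "dist R (A, A, A, A) < \<delta>" using L d(1) closure_approachable by blast
  obtain a b c e where on: "on_edges a b c e R" using on_edgesI[OF R(1)] by blast
  have "A \<in> edge a" "A \<in> edge b" "A \<in> edge c" "A \<in> edge e" "a < N" "b < N" "c < N" "e < N"
    using on dist_quad_components[of R "(A, A, A, A)"] R(2) d(2) unfolding on_edges_def by fastforce+
  then have ms: "a = k \<or> a = l" "b = k \<or> b = l" "c = k \<or> c = l" "e = k \<or> e = l" using kl by blast+
  have "valid4 a b c e" using on_edges_valid4[OF inscribed_rect[OF R(1)] on] .
  then show False using ms unfolding valid4_def by metis
qed

text \<open>If \<open>A\<close> is inside an edge, the short side that shrinks to \<open>A\<close> lies on that edge, so the long sides are
  perpendicular to it.\<close>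

lemma foot_perpendicular:
  assumes L: "(A, A, B, B) \<in> closure I" and A: "A \<notin> corners"
  obtains k where "k < N" "A \<in> edge k" "u k \<bullet> (B - A) = 0"
proof -
  obtain k where k: "k < N" "A \<in> edge k" using closure_I(1)[OF L] path_image_edges by auto
  obtain \<delta> where d: "\<delta> > 0" "\<And>z. z \<in> P \<Longrightarrow> dist z A < \<delta> \<Longrightarrow> z \<in> edge k"
    using near_inner_edge[OF k A] by metis
  define Z where "Z = {R::quad. u k \<bullet> (fst (snd (snd R)) - fst (snd R)) = 0}"
  have "closed Z" unfolding Z_def by (intro closed_Collect_eq continuous_intros)
  moreover have "ball (A, A, B, B) \<delta> \<inter> I \<subseteq> Z"
  proof
    fix R assume "R \<in> ball (A, A, B, B) \<delta> \<inter> I"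
    then have R: "R \<in> I" "dist R (A, A, B, B) < \<delta>" by (auto simp: dist_commute)
    obtain z w r where q: "w \<noteq> 0" "r > 0" "R = quad_of z w r" by (rule rectangleE[OF inscribed_rect[OF R(1)]]) (rule that)
    have "z \<in> P" "z + w \<in> P" using R(1) q by (auto simp: inscribed_def quad_of_def)
    then have "z \<in> edge k" "z + w \<in> edge k"
      using d(2) dist_quad_components(1,2)[of R "(A, A, B, B)"] R(2) unfolding q(3) quad_of_def by fastforce+
    then have "h k z = 0" "h k (z + w) = 0" using edge_line k(1) by auto
    then have "cr (u k) w = 0" by (simp add: ht_def)
    then show "R \<in> Z" unfolding Z_def q(3) quad_of_def by simp
  qed
  moreover have "(A, A, B, B) \<in> closure (ball (A, A, B, B) \<delta> \<inter> I)"
    using open_Int_closure_subset[of "ball (A, A, B, B) \<delta>" I] L d(1) by auto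
  ultimately have "(A, A, B, B) \<in> Z" using closure_minimal by blast
  then show ?thesis using that k unfolding Z_def by simp
qed

text \<open>The vertices, and the feet of the perpendiculars from the vertices to the lines of the edges.\<close>

definition chord_ends :: "complex set" where
  "chord_ends = corners \<union> (\<lambda>(k, j). v j + h k (v j) *\<^sub>R (\<i> * u k)) ` ({..<N} \<times> {..<N})"

lemma finite_chord_ends: "finite chord_ends"
  unfolding chord_ends_def corners_def by simp

lemma perpendicular_chord_zero:
  assumes "k < N" "l < N" "A \<in> edge k" "B \<in> edge l" "u k \<bullet> (B - A) = 0" "u l \<bullet> (B - A) = 0"
  shows "A = B"
proof (cases "k = l")
  case True
  have "h k A = 0" "h k B = 0" using assms edge_line True by auto
  then have "cr (u k) (B - A) = 0" by (simp add: ht_def)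
  then show ?thesis using cr_inner_zero[of "u k" "B - A"] assms(5) norm_u[OF assms(1)] by fastforce
next
  case False
  have "cr (u k) (\<i> * (B - A)) = 0" "cr (u l) (\<i> * (B - A)) = 0" using assms by simp_all
  then have "\<i> * (B - A) = 0" by (rule parallel_zero[OF assms(1,2) False])
  then show ?thesis by simp
qed

text \<open>One end of the chord is a vertex, since a chord that is perpendicular to edges at both ends would
  connect two parallel edges.\<close>

lemma limit_chord:
  assumes L: "(A, A, B, B) \<in> closure I"
  shows "A \<in> chord_ends"
proof (cases "A \<in> corners")
  case False
  have L2: "(B, B, A, A) \<in> closure I" using relabel_closure_I[OF relabel_closure_I[OF L]] by simp
  have ne: "A \<noteq> B" using no_small_rectangles L by auto
  obtain k where k: "k < N" "A \<in> edge k" "u k \<bullet> (B - A) = 0" using foot_perpendicular[OF L False] by blast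
  have "B \<in> corners"
  proof (rule ccontr)
    assume "B \<notin> corners"
    then obtain l where l: "l < N" "B \<in> edge l" "u l \<bullet> (A - B) = 0" using foot_perpendicular[OF L2] by blast
    have "u l \<bullet> (B - A) = 0" using l(3) by (simp add: inner_diff_right)
    then show False using perpendicular_chord_zero[OF k(1) l(1) k(2) l(2) k(3)] ne by simp
  qed
  then obtain j where j: "j < N" "B = v j" by (auto simp: corners_def)
  have uu: "u k \<bullet> u k = 1" by (rule inner_u_self[OF k(1)])
  have "h k A = 0" using edge_line k by blast
  then have "cr (u k) (A - B) = h k (v j)" using j by (simp add: ht_def)
  moreover have "u k \<bullet> (A - B) = 0" using k(3) by (simp add: inner_diff_right)
  ultimately have "A - B = h k (v j) *\<^sub>R (\<i> * u k)" using cr_inner_expand[of "u k" "u k" "A - B"] uu by simp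
  then have "A = v j + h k (v j) *\<^sub>R (\<i> * u k)" using j by (simp add: algebra_simps)
  then show ?thesis unfolding chord_ends_def using k(1) j(1) by auto
qed (simp add: chord_ends_def)

lemma degenerate_limit:
  assumes L: "L \<in> closure I - I"
  obtains A B where "A \<noteq> B" "A \<in> P" "B \<in> P" "A \<in> chord_ends" "B \<in> chord_ends"
    "L = (A, A, B, B) \<or> L = (A, B, B, A)"
proof -
  obtain L0 L1 L2 L3 where LL: "L = (L0, L1, L2, L3)" by (metis prod_cases4)
  note c = closure_I[of L0 L1 L2 L3]
  have cl: "(L0, L1, L2, L3) \<in> closure I" using L LL by simp
  note c = closure_I[OF cl]
  have "cr (L1 - L0) (L2 - L1) = 0"
  proof (rule ccontr)
    assume "cr (L1 - L0) (L2 - L1) \<noteq> 0"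
    then have "L \<in> I" unfolding LL inscribed_def using c by (simp add: cr_def)
    then show False using L by simp
  qed
  then have or: "L1 = L0 \<or> L2 = L1" using cr_inner_zero[of "L1 - L0" "L2 - L1"] c(6) by auto
  have n: "\<not> (L1 = L0 \<and> L2 = L1)"
  proof
    assume "L1 = L0 \<and> L2 = L1"
    then have "L1 = L0" "L2 = L0" "L3 = L0" using c(5) by auto
    then show False using cl no_small_rectangles by auto
  qed
  show ?thesis
  proof (cases "L1 = L0")
    case True
    then have e: "L = (L0, L0, L2, L2)" using c(5) LL by simp
    have cl2: "(L0, L0, L2, L2) \<in> closure I" using L e by simp
    have "(L2, L2, L0, L0) \<in> closure I" using relabel_closure_I[OF relabel_closure_I[OF cl2]] by simp
    then show ?thesis using that[of L0 L2] limit_chord cl2 n True c e by metis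
  next
    case False
    then have e: "L = (L0, L1, L1, L0)" using c(5) or LL by auto
    have cl2: "(L1, L1, L0, L0) \<in> closure I" using relabel_closure_I[of L] L e by simp
    have "(L0, L0, L1, L1) \<in> closure I" using relabel_closure_I[OF relabel_closure_I[OF cl2]] by simp
    then show ?thesis using that[of L0 L1] limit_chord cl2 False c e by metis
  qed
qed

lemma finite_degenerate: "finite (closure I - I)"
proof -
  have "closure I - I \<subseteq> chord_ends \<times> chord_ends \<times> chord_ends \<times> chord_ends"
  proof
    fix L assume "L \<in> closure I - I"
    then show "L \<in> chord_ends \<times> chord_ends \<times> chord_ends \<times> chord_ends"
      by (rule degenerate_limit) auto
  qed
  then show ?thesis using finite_subset finite_chord_ends by (metis finite_cartesian_product)
qed

text \<open>The arc leaves every compact subset of its component towards an end, so it enters every neighbourhood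
  of the set of degenerate limits. This set is finite, so by connectedness the arc stays near one of
  its points.\<close>

lemma arc_end_limit:
  assumes C: "C \<in> components I" and hom: "homeomorphism {0<..<1::real} C f g"
  obtains L where "L \<in> closure I - I" "(f \<longlongrightarrow> L) (at_right 0)"
proof -
  define Dg where "Dg = closure I - I"
  have fD: "finite Dg" unfolding Dg_def by (rule finite_degenerate)
  have fC: "f t \<in> C" if "t \<in> {0<..<1}" for t using hom that unfolding homeomorphism_def by blast
  have CI: "C \<subseteq> I" using C by (rule in_components_subset)
  have esc: "\<exists>m>0. m \<le> 1 \<and> (\<forall>t. 0 < t \<and> t < m \<longrightarrow> f t \<in> W)" if W: "open W" "Dg \<subseteq> W" for W
  proof -
    define K where "K = closure I - W"
    have "compact (closure I)" using bounded_I by (simp add: compact_closure)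
    then have K: "compact K" unfolding K_def using W(1) by (rule compact_diff)
    have KI: "K \<subseteq> I" using W(2) unfolding K_def Dg_def by blast
    obtain T where T: "closed T" "C = I \<inter> T" using closedin_component[OF C] closedin_closed by metis
    have "C \<inter> K = K \<inter> T" using T KI by blast
    then have "compact (C \<inter> K)" using K T(1) by (metis compact_Int_closed)
    then have G: "compact (g ` (C \<inter> K))"
      using hom by (intro compact_continuous_image) (auto simp: homeomorphism_def elim: continuous_on_subset)
    have G01: "g ` (C \<inter> K) \<subseteq> {0<..<1}" using hom unfolding homeomorphism_def by blast
    obtain m where m: "m > 0" "m \<le> 1" "\<And>x. x \<in> g ` (C \<inter> K) \<Longrightarrow> m \<le> x"
    proof (cases "g ` (C \<inter> K) = {}")
      case True then show ?thesis using that[of 1] by auto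
    next
      case False
      then obtain m where "m \<in> g ` (C \<inter> K)" "\<forall>x\<in>g ` (C \<inter> K). m \<le> x" using compact_attains_inf[OF G] by blast
      then show ?thesis using that[of m] G01 by fastforce
    qed
    have "f t \<in> W" if t: "0 < t" "t < m" for t
    proof (rule ccontr)
      assume "f t \<notin> W"
      have t01: "t \<in> {0<..<1}" using t m(2) by simp
      then have "f t \<in> C \<inter> K" using fC CI closure_subset \<open>f t \<notin> W\<close> unfolding K_def by blast
      then have "g (f t) \<in> g ` (C \<inter> K)" by blast
      moreover have "g (f t) = t" using hom t01 unfolding homeomorphism_def by blast
      ultimately show False using m(3) t by force
    qed
    then show ?thesis using m by blast
  qed
  obtain \<delta> where \<delta>: "\<delta> > 0" "\<And>x y. x \<in> Dg \<Longrightarrow> y \<in> Dg \<Longrightarrow> x \<noteq> y \<Longrightarrow> 2 * \<delta> \<le> dist x y"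
  proof -
    have "\<exists>d>0. \<forall>y\<in>Dg. y \<noteq> x \<longrightarrow> d \<le> dist x y" for x
      using finite_set_avoid[OF fD, of x] by (metis)
    then obtain d where d: "\<And>x. d x > 0" "\<And>x y. y \<in> Dg \<Longrightarrow> y \<noteq> x \<Longrightarrow> d x \<le> dist x y" by metis
    define \<delta> where "\<delta> = Min (insert 1 (d ` Dg)) / 2"
    have "Min (insert 1 (d ` Dg)) > 0" using fD d(1) by (subst Min_gr_iff) auto
    moreover have "Min (insert 1 (d ` Dg)) \<le> d x" if "x \<in> Dg" for x using fD that by (intro Min_le) auto
    ultimately have "\<delta> > 0" and le: "\<And>x. x \<in> Dg \<Longrightarrow> 2 * \<delta> \<le> d x" unfolding \<delta>_def by auto
    show ?thesis
    proof (rule that[OF \<open>\<delta> > 0\<close>])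
      fix x y assume xy: "x \<in> Dg" "y \<in> Dg" "x \<noteq> y"
      show "2 * \<delta> \<le> dist x y" using le[OF xy(1)] d(2)[OF xy(2), of x] xy(3) by simp
    qed
  qed
  define B where "B = (\<Union>x\<in>Dg. ball x \<delta>)"
  have "open B" "Dg \<subseteq> B" unfolding B_def using \<delta>(1) by auto
  then obtain m where m: "m > 0" "m \<le> 1" "\<And>t. 0 < t \<Longrightarrow> t < m \<Longrightarrow> f t \<in> B" using esc by metis
  obtain L where L: "L \<in> Dg" "f (m/2) \<in> ball L \<delta>" using m(3)[of "m/2"] m(1) unfolding B_def by auto
  define S where "S = f ` {0<..<m}"
  define V where "V = (\<Union>x\<in>Dg - {L}. ball x \<delta>)"
  have disj: "ball L \<delta> \<inter> V = {}"
  proof (rule ccontr)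
    assume "ball L \<delta> \<inter> V \<noteq> {}"
    then obtain z where z: "z \<in> ball L \<delta>" "z \<in> V" by blast
    then obtain x where "x \<in> Dg" "x \<noteq> L" "z \<in> ball x \<delta>" unfolding V_def by blast
    then have "x \<in> Dg" "x \<noteq> L" "dist L z < \<delta>" "dist x z < \<delta>" using z by auto
    then show False using \<delta>(2)[of L x] L(1) dist_triangle[of L x z] by (simp add: dist_commute)
  qed
  have "connected S" unfolding S_def
    by (rule connected_continuous_image) (use hom m(2) in \<open>auto simp: homeomorphism_def elim!: continuous_on_subset\<close>)
  moreover have SV: "S \<subseteq> ball L \<delta> \<union> V"
  proof -
    have "B \<subseteq> ball L \<delta> \<union> V" unfolding B_def V_def by blast
    moreover have "S \<subseteq> B" unfolding S_def using m(3) by (intro image_subsetI) simp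
    ultimately show ?thesis by blast
  qed
  moreover have "ball L \<delta> \<inter> S \<noteq> {}" using L(2) m(1) unfolding S_def by auto
  ultimately have "V \<inter> S = {}"
    using connectedD[of S "ball L \<delta>" V] disj unfolding V_def by (auto simp: Int_ac)
  then have Sb: "f t \<in> ball L \<delta>" if "0 < t" "t < m" for t
  proof -
    have "f t \<in> S" unfolding S_def using that by auto
    then show ?thesis using SV \<open>V \<inter> S = {}\<close> by blast
  qed
  have "(f \<longlongrightarrow> L) (at_right 0)"
  proof (rule tendstoI)
    fix e :: real assume e: "e > 0"
    define W where "W = ball L (min e \<delta>) \<union> V"
    have "open W" "Dg \<subseteq> W" unfolding W_def V_def using e \<delta>(1) by auto
    then obtain m' where m': "m' > 0" "\<And>t. 0 < t \<Longrightarrow> t < m' \<Longrightarrow> f t \<in> W" using esc by metis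
    have "dist (f t) L < e" if "0 < t" "t < min m m'" for t
    proof -
      have "f t \<in> W" "f t \<in> ball L \<delta>" using m'(2) Sb that by auto
      then have "f t \<in> ball L (min e \<delta>)" using disj unfolding W_def by blast
      then show ?thesis by (simp add: dist_commute)
    qed
    then show "eventually (\<lambda>t. dist (f t) L < e) (at_right 0)"
      unfolding eventually_at_right_field using m(1) m'(1) by (intro exI[of _ "min m m'"]) auto
  qed
  then show ?thesis using that L(1) unfolding Dg_def by blast
qed

end

section \<open>Distinct chords at the two ends\<close>

lemma aspect_tends_to_infinity:
  assumes L: "(f \<longlongrightarrow> (A, A, B, B)) F" and ne: "A \<noteq> B" and I: "eventually (\<lambda>t. f t \<in> inscribed \<gamma>) F"
  shows "ratio_to_infinity f F"
proof -
  have 1: "((\<lambda>t. dist (fst (snd (snd (f t)))) (fst (snd (f t)))) \<longlongrightarrow> dist B A) F"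
    using tendsto_dist[OF tendsto_fst[OF tendsto_snd[OF tendsto_snd[OF L]]] tendsto_fst[OF tendsto_snd[OF L]]] by simp
  have 2: "((\<lambda>t. dist (fst (snd (f t))) (fst (f t))) \<longlongrightarrow> 0) F"
    using tendsto_dist[OF tendsto_fst[OF tendsto_snd[OF L]] tendsto_fst[OF L]] by simp
  have 3: "eventually (\<lambda>t. dist (fst (snd (f t))) (fst (f t)) > 0) F"
    using I
  proof eventually_elim
    case (elim t)
    then have "fst (snd (f t)) \<noteq> fst (f t)" by (intro quad_of_aspect(3) inscribed_rect)
    then show ?case by simp
  qed
  have "dist B A > 0" using ne by simp
  from LIM_at_top_divide[OF 1 this 2 3] show ?thesis
    unfolding ratio_to_infinity_def aspect_ratio_alt .
qed

lemma aspect_tends_to_zero: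
  assumes L: "(f \<longlongrightarrow> (A, B, B, A)) F" and ne: "A \<noteq> B"
  shows "ratio_to_zero f F"
proof -
  have 1: "((\<lambda>t. dist (fst (snd (snd (f t)))) (fst (snd (f t)))) \<longlongrightarrow> 0) F"
    using tendsto_dist[OF tendsto_fst[OF tendsto_snd[OF tendsto_snd[OF L]]] tendsto_fst[OF tendsto_snd[OF L]]] by simp
  have 2: "((\<lambda>t. dist (fst (snd (f t))) (fst (f t))) \<longlongrightarrow> dist B A) F"
    using tendsto_dist[OF tendsto_fst[OF tendsto_snd[OF L]] tendsto_fst[OF L]] by simp
  have "dist B A \<noteq> 0" using ne by simp
  from tendsto_divide[OF 1 2 this] show ?thesis
    unfolding ratio_to_zero_def aspect_ratio_alt by simp
qed

lemma at_left_1_filtermap: "at_left (1::real) = filtermap (\<lambda>t. 1 - t) (at_right 0)"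
proof (rule filter_eqI)
  fix Q
  show "eventually Q (at_left (1::real)) \<longleftrightarrow> eventually Q (filtermap (\<lambda>t. 1 - t) (at_right 0))"
    unfolding eventually_filtermap eventually_at_left_field eventually_at_right_field
  proof
    assume "\<exists>b<1. \<forall>y>b. y < 1 \<longrightarrow> Q y"
    then obtain b where "b < 1" "\<forall>y>b. y < 1 \<longrightarrow> Q y" by blast
    then show "\<exists>b>0. \<forall>y>0. y < b \<longrightarrow> Q (1 - y)" by (intro exI[of _ "1 - b"]) auto
  next
    assume "\<exists>b>0. \<forall>y>0. y < b \<longrightarrow> Q (1 - y)"
    then obtain b where b: "b > 0" "\<forall>y>0. y < b \<longrightarrow> Q (1 - y)" by blast
    have "Q y" if "y > 1 - b" "y < 1" for y using b(2)[rule_format, of "1 - y"] that by simp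
    then show "\<exists>b<1. \<forall>y>b. y < 1 \<longrightarrow> Q y" using b(1) by (intro exI[of _ "1 - b"]) auto
  qed
qed

lemma homeomorphism_reverse:
  assumes "homeomorphism {0<..<1::real} C f g"
  shows "homeomorphism {0<..<1} C (\<lambda>t. f (1 - t)) (\<lambda>x. 1 - g x)"
proof -
  have "homeomorphism {0<..<1::real} {0<..<1} (\<lambda>t. 1 - t) (\<lambda>t. 1 - t)"
    by (rule homeomorphismI) (auto intro!: continuous_intros)
  from homeomorphism_compose[OF this assms] show ?thesis by (simp add: comp_def)
qed

text \<open>Both functions take every sufficiently large value on \<open>{0<..<\<tau>}\<close>. In the application they are the aspect
  ratios along two arcs.\<close>

lemma common_large_value:
  fixes a b :: "real \<Rightarrow> real"
  assumes a: "continuous_on {0<..<1} a" "filterlim a at_top (at_right 0)"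
    and b: "continuous_on {0<..<1} b" "filterlim b at_top (at_right 0)" and \<tau>: "0 < \<tau>" "\<tau> < 1"
  obtains s t where "0 < s" "s < \<tau>" "0 < t" "t < \<tau>" "a s = b t"
proof -
  define r where "r = max (a (\<tau>/2)) (b (\<tau>/2)) + 1"
  have *: "\<exists>s. 0 < s \<and> s < \<tau> \<and> c s = r"
    if c: "continuous_on {0<..<1} c" "filterlim c at_top (at_right 0)" and le: "c (\<tau>/2) \<le> r" for c :: "real \<Rightarrow> real"
  proof -
    have "eventually (\<lambda>t. r \<le> c t) (at_right 0)" using c(2) unfolding filterlim_at_top by blast
    then obtain e where e: "e > 0" "\<And>t. 0 < t \<Longrightarrow> t < e \<Longrightarrow> r \<le> c t" unfolding eventually_at_right_field by blast
    define x where "x = min (e/2) (\<tau>/4)"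
    have x: "0 < x" "x < e" "x < \<tau>/2" unfolding x_def using e(1) \<tau> by auto
    have cont: "continuous_on {x..\<tau>/2} c" by (rule continuous_on_subset[OF c(1)]) (use x \<tau> in auto)
    obtain y where "x \<le> y" "y \<le> \<tau>/2" "c y = r"
      using IVT2'[of c "\<tau>/2" r x] le e(2)[OF x(1,2)] x(3) cont by auto
    then show ?thesis using x(1) \<tau> by (intro exI[of _ y]) auto
  qed
  have "a (\<tau>/2) \<le> r" "b (\<tau>/2) \<le> r" unfolding r_def by auto
  then obtain s t where "0 < s" "s < \<tau>" "a s = r" "0 < t" "t < \<tau>" "b t = r" using *[OF a] *[OF b] by blast
  then show ?thesis using that by simp
qed

context generic_polygon begin

text \<open>If \<open>A\<close> is a vertex of the polygon, the long side of a rectangle close to the limit is almost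
  parallel to the chord, and the sign of its product with an edge at \<open>A\<close> tells which of the two
  vertices near \<open>A\<close> lies on which edge.\<close>

lemma edges_near_chord:
  assumes L: "(A, A, B, B) \<in> closure I"
  obtains a b \<delta> where "\<delta> > 0" "a < N" "b < N"
    "\<And>R. R \<in> I \<Longrightarrow> dist R (A, A, B, B) < \<delta> \<Longrightarrow> fst R \<in> edge a \<and> fst (snd R) \<in> edge b"
proof (cases "A \<in> corners")
  case False
  obtain k where k: "k < N" "A \<in> edge k" using closure_I(1)[OF L] path_image_edges by auto
  obtain \<delta> where d: "\<delta> > 0" "\<And>z. z \<in> P \<Longrightarrow> dist z A < \<delta> \<Longrightarrow> z \<in> edge k"
    using near_inner_edge[OF k False] by metis
  have "fst R \<in> edge k \<and> fst (snd R) \<in> edge k" if R: "R \<in> I" "dist R (A, A, B, B) < \<delta>" for R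
  proof -
    have "fst R \<in> P" "fst (snd R) \<in> P" using R(1) by (cases R; simp add: inscribed_def)+
    moreover have "dist (fst R) A < \<delta>" "dist (fst (snd R)) A < \<delta>"
      using dist_quad_components(1,2)[of R "(A, A, B, B)"] R(2) by auto
    ultimately show ?thesis using d(2) by blast
  qed
  then show ?thesis using that[OF d(1) k(1) k(1)] by blast
next
  case True
  then obtain i where i: "i < N" "A = v i" by (auto simp: corners_def)
  define p where "p = prv N i"
  note pN = nx(2)[OF i(1), folded p_def]
  have ip: "i \<noteq> p" using nx(6)[OF i(1)] unfolding p_def by simp
  have L2: "(B, B, A, A) \<in> closure I" using relabel_closure_I[OF relabel_closure_I[OF L]] by simp
  have ne: "A \<noteq> B" using no_small_rectangles L by auto
  have dotne: "u k \<bullet> (B - A) \<noteq> 0" if k: "k < N" "A \<in> edge k" for k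
  proof (cases "B \<in> corners")
    case True
    then obtain j where j: "j < N" "B = v j" by (auto simp: corners_def)
    then show ?thesis using basic_genericD(1)[OF bas k(1) i(1) j(1)] ne i by auto
  next
    case False
    obtain l where l: "l < N" "B \<in> edge l" "u l \<bullet> (A - B) = 0" using foot_perpendicular[OF L2 False] by blast
    have "u l \<bullet> (B - A) = 0" using l(3) by (simp add: inner_diff_right)
    then show ?thesis using perpendicular_chord_zero[OF k(1) l(1) k(2) l(2)] ne by blast
  qed
  define \<alpha> where "\<alpha> = u i \<bullet> (B - A)"
  define \<sigma> where "\<sigma> = cr (u p) (u i)"
  have Ai: "A \<in> edge i" "A \<in> edge p"
    using edge_at_vertex[OF i(1) i(1)] edge_at_vertex[OF i(1) pN] i(2) by (auto simp: edge_end_def p_def)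
  have \<alpha>: "\<alpha> \<noteq> 0" and \<alpha>p: "u p \<bullet> (B - A) \<noteq> 0" unfolding \<alpha>_def using dotne Ai i pN by auto
  have \<sigma>: "\<sigma> \<noteq> 0" unfolding \<sigma>_def using cr_ne[OF pN i(1)] ip by simp
  obtain \<delta>1 where d1: "\<delta>1 > 0" "\<And>k z. k < N \<Longrightarrow> z \<in> edge k \<Longrightarrow> dist z A < \<delta>1 \<Longrightarrow> A \<in> edge k"
    using near_edges by blast
  define \<delta> where "\<delta> = min \<delta>1 (min (\<bar>\<alpha>\<bar> / 2) (\<bar>u p \<bullet> (B - A)\<bar> / 2))"
  have \<delta>: "\<delta> > 0" unfolding \<delta>_def using d1 \<alpha> \<alpha>p by simp
  have facts: "(fst R \<in> edge i \<or> fst R \<in> edge p) \<and> (fst (snd R) \<in> edge i \<or> fst (snd R) \<in> edge p) \<and>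
     cr (fst (snd R) - fst R) (u i) * \<alpha> > 0 \<and> cr (fst (snd R) - fst R) (u p) \<noteq> 0"
    if R: "R \<in> I" "dist R (A, A, B, B) < \<delta>" for R
  proof -
    note dq = dist_quad_components[of R "(A, A, B, B)"]
    have on: "z \<in> edge i \<or> z \<in> edge p" if z: "z \<in> P" "dist z A < \<delta>" for z
    proof -
      obtain k where k: "k < N" "z \<in> edge k" using z(1) path_image_edges by auto
      have "v i \<in> edge k" using d1(2)[OF k] z(2) i(2) unfolding \<delta>_def by simp
      then show ?thesis using edge_at_vertex[OF i(1) k(1)] k(2) by (auto simp: edge_end_def p_def)
    qed
    have "fst R \<in> P" "fst (snd R) \<in> P" using R(1) by (cases R; simp add: inscribed_def)+
    then have 1: "(fst R \<in> edge i \<or> fst R \<in> edge p) \<and> (fst (snd R) \<in> edge i \<or> fst (snd R) \<in> edge p)"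
      using on dq(1,2) R(2) by fastforce
    define X where "X = fst (snd (snd R)) - fst (snd R)"
    have Xn: "norm (X - (B - A)) < 2 * \<delta>"
    proof -
      have "X - (B - A) = (fst (snd (snd R)) - B) - (fst (snd R) - A)" by (simp add: X_def)
      then have "norm (X - (B - A)) \<le> dist (fst (snd (snd R))) B + dist (fst (snd R)) A"
        unfolding dist_norm by (metis norm_triangle_ineq4)
      then show ?thesis using dq(2,3) R(2) by simp
    qed
    have close: "\<bar>u k \<bullet> X - u k \<bullet> (B - A)\<bar> < 2 * \<delta>" if "k < N" for k
    proof -
      have "\<bar>u k \<bullet> (X - (B - A))\<bar> \<le> norm (X - (B - A))"
        using Cauchy_Schwarz_ineq2[of "u k" "X - (B - A)"] norm_u[OF that] by simp
      then show ?thesis using Xn by (simp add: inner_diff_right)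
    qed
    obtain z w r where q: "w \<noteq> 0" "r > 0" "R = quad_of z w r" by (rule rectangleE[OF inscribed_rect[OF R(1)]]) (rule that)
    have X: "X = r *\<^sub>R (\<i> * w)" and W: "fst (snd R) - fst R = w" unfolding X_def q(3) quad_of_def by auto
    have uX: "u k \<bullet> X = r * cr w (u k)" for k unfolding X by (simp add: cr_commute[of w])
    have "u p \<bullet> X \<noteq> 0" using close[OF pN] unfolding \<delta>_def by auto
    then have 2: "cr w (u p) \<noteq> 0" unfolding uX by simp
    have "\<bar>u i \<bullet> X - \<alpha>\<bar> < \<bar>\<alpha>\<bar>" using close[OF i(1)] unfolding \<alpha>_def[symmetric] \<delta>_def by auto
    then have "u i \<bullet> X * \<alpha> > 0" by (auto simp: zero_less_mult_iff abs_if split: if_splits)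
    then have "r * (cr w (u i) * \<alpha>) > 0" unfolding uX by (simp add: mult.assoc)
    then have 3: "cr w (u i) * \<alpha> > 0" using q(2) by (simp add: zero_less_mult_iff)
    show ?thesis using 1 2 3 unfolding W by blast
  qed
  have par: "cr (x - y) (u k) = 0" if "k < N" "x \<in> edge k" "y \<in> edge k" for x y k
  proof -
    have "h k x = 0" "h k y = 0" using edge_line that by auto
    then have "cr (u k) (x - y) = 0" by (simp add: ht_def)
    then show ?thesis by (simp add: cr_commute[of _ "u k"])
  qed
  have ie: "\<exists>s\<ge>0. z = A + s *\<^sub>R u i" if "z \<in> edge i" for z
    using that unfolding edge_iff i(2) by blast
  have pe: "\<exists>s\<ge>0. z = A - s *\<^sub>R u p" if z: "z \<in> edge p" for z
  proof -
    obtain s where s: "s \<le> len p" "z = v p + s *\<^sub>R u p" using z edge_iff by blast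
    have "v i = v p + len p *\<^sub>R u p" using v_nxt[of p] nx(3)[OF i(1)] unfolding p_def by simp
    then have "z = A - (len p - s) *\<^sub>R u p" using s i(2) by (simp add: algebra_simps)
    then show ?thesis using s(1) by (intro exI[of _ "len p - s"]) simp
  qed
  show ?thesis
  proof (cases "\<alpha> * \<sigma> > 0")
    case True
    have "fst R \<in> edge p \<and> fst (snd R) \<in> edge i" if R: "R \<in> I" "dist R (A, A, B, B) < \<delta>" for R
    proof (rule ccontr)
      note fR = facts[OF R]
      assume "\<not> ?thesis"
      then consider "fst R \<in> edge i" "fst (snd R) \<in> edge i" | "fst R \<in> edge p" "fst (snd R) \<in> edge p"
        | "fst R \<in> edge i" "fst (snd R) \<in> edge p" using fR by blast
      then show False
      proof cases
        case 1
        show False using par[OF i(1) 1(2,1)] fR by (metis less_irrefl mult_zero_left)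
      next
        case 2
        show False using par[OF pN 2(2,1)] fR by blast
      next
        case 3
        obtain s t where "t \<ge> 0" "fst R = A + s *\<^sub>R u i" "fst (snd R) = A - t *\<^sub>R u p" using ie pe 3 by metis
        then have W: "cr (fst (snd R) - fst R) (u i) = - t * \<sigma>" by (simp add: \<sigma>_def)
        have "cr (fst (snd R) - fst R) (u i) * \<alpha> > 0" using fR by blast
        then have "- (t * (\<alpha> * \<sigma>)) > 0" unfolding W by (simp add: algebra_simps)
        moreover have "t * (\<alpha> * \<sigma>) \<ge> 0" using mult_nonneg_nonneg[OF \<open>t \<ge> 0\<close> less_imp_le[OF True]] .
        ultimately show False by simp
      qed
    qed
    then show ?thesis using that[OF \<delta> pN i(1)] by blast
  next
    case False
    then have neg: "\<alpha> * \<sigma> < 0" using \<alpha> \<sigma> by (simp add: less_le not_less)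
    have "fst R \<in> edge i \<and> fst (snd R) \<in> edge p" if R: "R \<in> I" "dist R (A, A, B, B) < \<delta>" for R
    proof (rule ccontr)
      note fR = facts[OF R]
      assume "\<not> ?thesis"
      then consider "fst R \<in> edge i" "fst (snd R) \<in> edge i" | "fst R \<in> edge p" "fst (snd R) \<in> edge p"
        | "fst R \<in> edge p" "fst (snd R) \<in> edge i" using fR by blast
      then show False
      proof cases
        case 1
        show False using par[OF i(1) 1(2,1)] fR by (metis less_irrefl mult_zero_left)
      next
        case 2
        show False using par[OF pN 2(2,1)] fR by blast
      next
        case 3
        obtain s t where "t \<ge> 0" "fst R = A - t *\<^sub>R u p" "fst (snd R) = A + s *\<^sub>R u i" using ie pe 3 by metis
        then have W: "cr (fst (snd R) - fst R) (u i) = t * \<sigma>" by (simp add: \<sigma>_def)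
        have "cr (fst (snd R) - fst R) (u i) * \<alpha> > 0" using fR by blast
        then have "t * (\<alpha> * \<sigma>) > 0" unfolding W by (simp add: algebra_simps)
        moreover have "t * (\<alpha> * \<sigma>) \<le> 0" using mult_nonneg_nonpos[OF \<open>t \<ge> 0\<close> less_imp_le[OF neg]] .
        ultimately show False by simp
      qed
    qed
    then show ?thesis using that[OF \<delta> i(1) pN] by blast
  qed
qed

text \<open>The edges of all four vertices are determined by the chord, and a rectangle on four given lines is
  determined by its aspect ratio.\<close>

lemma end_unique:
  assumes L: "(A, A, B, B) \<in> closure I"
  obtains \<delta> where "\<delta> > 0" "\<And>R S. R \<in> I \<Longrightarrow> S \<in> I \<Longrightarrow> dist R (A, A, B, B) < \<delta> \<Longrightarrow> dist S (A, A, B, B) < \<delta> \<Longrightarrow>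
     aspect_ratio R = aspect_ratio S \<Longrightarrow> R = S"
proof -
  have L2: "(B, B, A, A) \<in> closure I" using relabel_closure_I[OF relabel_closure_I[OF L]] by simp
  obtain a b d1 where 1: "d1 > 0" "a < N" "b < N"
    "\<And>R. R \<in> I \<Longrightarrow> dist R (A, A, B, B) < d1 \<Longrightarrow> fst R \<in> edge a \<and> fst (snd R) \<in> edge b"
    using edges_near_chord[OF L] by metis
  obtain c d d2 where 2: "d2 > 0" "c < N" "d < N"
    "\<And>R. R \<in> I \<Longrightarrow> dist R (B, B, A, A) < d2 \<Longrightarrow> fst R \<in> edge c \<and> fst (snd R) \<in> edge d"
    using edges_near_chord[OF L2] by metis
  define \<delta> where "\<delta> = min d1 (d2 / 4)"
  have on: "on_edges a b c d R" if R: "R \<in> I" "dist R (A, A, B, B) < \<delta>" for R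
  proof -
    obtain R0 R1 R2 R3 where RR: "R = (R0, R1, R2, R3)" by (metis prod_cases4)
    note dq = dist_quad_components[of R "(A, A, B, B)", unfolded RR fst_conv snd_conv]
    have rr: "relabel (relabel R) = (R2, R3, R0, R1)" using RR by simp
    have tri: "dist (x, y) (x', y') \<le> dist x x' + dist y y'" for x x' :: "'x::metric_space" and y y' :: "'y::metric_space"
      unfolding dist_Pair_Pair by (rule sqrt_sum_squares_le_sum) auto
    have "dist (R2, R3, R0, R1) (B, B, A, A) \<le> dist R2 B + (dist R3 B + (dist R0 A + dist R1 A))"
      using tri[of R2 "(R3, R0, R1)" B "(B, A, A)"] tri[of R3 "(R0, R1)" B "(A, A)"] tri[of R0 R1 A A] by linarith
    also have "\<dots> < d2" using dq R(2) RR unfolding \<delta>_def by auto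
    finally have "fst (relabel (relabel R)) \<in> edge c \<and> fst (snd (relabel (relabel R))) \<in> edge d"
      using 2(4)[OF relabel_inscribed[OF relabel_inscribed[OF R(1)]]] rr by simp
    moreover have "fst R \<in> edge a \<and> fst (snd R) \<in> edge b" using 1(4)[OF R(1)] R(2) unfolding \<delta>_def by simp
    ultimately show ?thesis unfolding on_edges_def using 1 2 RR by simp
  qed
  have p: "h a (v a) = 0" by (simp add: ht_def)
  show ?thesis
  proof (rule that[of \<delta>])
    show "\<delta> > 0" unfolding \<delta>_def using 1 2 by simp
    fix R S assume h: "R \<in> I" "S \<in> I" "dist R (A, A, B, B) < \<delta>" "dist S (A, A, B, B) < \<delta>" "aspect_ratio R = aspect_ratio S"
    show "R = S"
      using line_rect_unique[OF on[OF h(1,3)] inscribed_rect[OF h(1)] p]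
        line_rect_unique[OF on[OF h(2,4)] inscribed_rect[OF h(2)] p] h(5) by simp
  qed
qed

text \<open>Along both curves the aspect ratio tends to infinity, so near the chord there are rectangles on the two
  curves with the same aspect ratio; these are equal.\<close>

lemma ends_meet:
  fixes f f' :: "real \<Rightarrow> quad"
  assumes L: "(A, A, B, B) \<in> closure I"
    and f: "continuous_on {0<..<1} f" "\<And>t. t \<in> {0<..<1} \<Longrightarrow> f t \<in> I" "(f \<longlongrightarrow> (A, A, B, B)) (at_right 0)"
    and f': "continuous_on {0<..<1} f'" "\<And>t. t \<in> {0<..<1} \<Longrightarrow> f' t \<in> I" "(f' \<longlongrightarrow> (A, A, B, B)) (at_right 0)"
  obtains s t where "0 < s" "s < 1/2" "0 < t" "t < 1/2" "f s = f' t"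
proof -
  have ne: "A \<noteq> B" using no_small_rectangles L by auto
  have ev: "eventually (\<lambda>t::real. t \<in> {0<..<1}) (at_right 0)"
    unfolding eventually_at_right_field by (intro exI[of _ 1]) auto
  obtain \<delta> where d: "\<delta> > 0" "\<And>R S. R \<in> I \<Longrightarrow> S \<in> I \<Longrightarrow> dist R (A, A, B, B) < \<delta> \<Longrightarrow> dist S (A, A, B, B) < \<delta> \<Longrightarrow>
     aspect_ratio R = aspect_ratio S \<Longrightarrow> R = S" using end_unique[OF L] by blast
  have e: "\<exists>e>0. \<forall>t. 0 < t \<longrightarrow> t < e \<longrightarrow> dist (k t) (A, A, B, B) < \<delta>" if "(k \<longlongrightarrow> (A, A, B, B)) (at_right (0::real))" for k
    using tendstoD[OF that d(1)] unfolding eventually_at_right_field by blast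
  obtain e1 where e1: "e1 > 0" "\<And>t. 0 < t \<Longrightarrow> t < e1 \<Longrightarrow> dist (f t) (A, A, B, B) < \<delta>" using e[OF f(3)] by blast
  obtain e2 where e2: "e2 > 0" "\<And>t. 0 < t \<Longrightarrow> t < e2 \<Longrightarrow> dist (f' t) (A, A, B, B) < \<delta>" using e[OF f'(3)] by blast
  define \<tau> where "\<tau> = min (1/2) (min e1 e2)"
  have \<tau>: "0 < \<tau>" "\<tau> < 1" "\<tau> \<le> e1" "\<tau> \<le> e2" "\<tau> \<le> 1/2" unfolding \<tau>_def using e1 e2 by auto
  have asp: "continuous_on {0<..<1} (\<lambda>t. aspect_ratio (k t)) \<and> filterlim (\<lambda>t. aspect_ratio (k t)) at_top (at_right 0)"
    if k: "continuous_on {0<..<1} k" "\<And>t. t \<in> {0<..<1} \<Longrightarrow> k t \<in> I" "(k \<longlongrightarrow> (A, A, B, B)) (at_right (0::real))" for k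
  proof
    show "continuous_on {0<..<1} (\<lambda>t. aspect_ratio (k t))"
      by (rule continuous_on_compose2[OF continuous_on_aspect k(1)]) (use k(2) in blast)
    have "eventually (\<lambda>t. k t \<in> I) (at_right 0)" using ev by eventually_elim (rule k(2))
    then show "filterlim (\<lambda>t. aspect_ratio (k t)) at_top (at_right 0)"
      using aspect_tends_to_infinity[OF k(3) ne] unfolding ratio_to_infinity_def by blast
  qed
  obtain s t where st: "0 < s" "s < \<tau>" "0 < t" "t < \<tau>" "aspect_ratio (f s) = aspect_ratio (f' t)"
    using common_large_value[of "\<lambda>t. aspect_ratio (f t)" "\<lambda>t. aspect_ratio (f' t)" \<tau>] asp[OF f] asp[OF f'] \<tau>(1,2) by blast
  have "f s = f' t"
    using d(2)[OF f(2) f'(2) e1(2) e2(2) st(5)] st \<tau> by auto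
  then show ?thesis using that[of s t] st \<tau>(5) by simp
qed

text \<open>If the chords at the two ends are the same segment, the limits \<open>L\<close> and \<open>M\<close> differ by a relabeling. A
  further relabeling, by \<open>m\<close> steps, brings the limit to the form \<open>(X, X, Y, Y)\<close>, where the aspect ratio is large; then a
  relabeled rectangle near one end is a rectangle near the other end. Without relabeling this
  contradicts injectivity of the parametrization, and otherwise the relabeling maps the arc to itself
  and has a fixed point.\<close>

theorem arc_component_proper:
  assumes "arc_component I C" shows "proper_arc (polygon_path N v) C"
proof -
  obtain f g where C: "C \<in> components I" and hom: "homeomorphism {0<..<1::real} C f g"
    using assms unfolding arc_component_def arc_component_param_def by blast
  define k where "k = (\<lambda>t. f (1 - t))"
  have homk: "homeomorphism {0<..<1} C k (\<lambda>x. 1 - g x)" unfolding k_def by (rule homeomorphism_reverse[OF hom])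
  obtain L where L: "L \<in> closure I - I" "(f \<longlongrightarrow> L) (at_right 0)" using arc_end_limit[OF C hom] by blast
  obtain M where M: "M \<in> closure I - I" "(k \<longlongrightarrow> M) (at_right 0)" using arc_end_limit[OF C homk] by blast
  have CI: "C \<subseteq> I" using C by (rule in_components_subset)
  have fI: "f t \<in> I" "k t \<in> I" if "t \<in> {0<..<1}" for t
    using hom homk CI that unfolding homeomorphism_def by blast+
  have cont: "continuous_on {0<..<1} f" "continuous_on {0<..<1} k" using hom homk unfolding homeomorphism_def by blast+
  have Ml: "(f \<longlongrightarrow> M) (at_left 1)" unfolding at_left_1_filtermap filterlim_filtermap using M(2) unfolding k_def .
  have ev0: "eventually (\<lambda>t. f t \<in> I) (at_right 0)"
    unfolding eventually_at_right_field using fI by (intro exI[of _ 1]) auto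
  have ev1: "eventually (\<lambda>t. f t \<in> I) (at_left 1)"
    unfolding eventually_at_left_field using fI by (intro exI[of _ 0]) auto
  obtain A B where AB: "A \<noteq> B" "A \<in> P" "B \<in> P" "L = (A, A, B, B) \<or> L = (A, B, B, A)"
    using degenerate_limit[OF L(1)] by metis
  obtain A' B' where AB': "A' \<noteq> B'" "A' \<in> P" "B' \<in> P" "M = (A', A', B', B') \<or> M = (A', B', B', A')"
    using degenerate_limit[OF M(1)] by metis
  have r0: "ratio_to_zero f (at_right 0) \<or> ratio_to_infinity f (at_right 0)"
    using aspect_tends_to_infinity[OF _ AB(1) ev0] aspect_tends_to_zero[OF _ AB(1)] L(2) AB(4) by metis
  have r1: "ratio_to_zero f (at_left 1) \<or> ratio_to_infinity f (at_left 1)"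
    using aspect_tends_to_infinity[OF _ AB'(1) ev1] aspect_tends_to_zero[OF _ AB'(1)] Ml AB'(4) by metis
  have e0: "ends_at_chord (polygon_path N v) f (at_right 0) (closed_segment A B)"
    unfolding ends_at_chord_def using AB L(2) by (intro bexI[of _ A] bexI[of _ B] conjI exI[of _ L]) auto
  have e1: "ends_at_chord (polygon_path N v) f (at_left 1) (closed_segment A' B')"
    unfolding ends_at_chord_def using AB' Ml by (intro bexI[of _ A'] bexI[of _ B'] conjI exI[of _ M]) auto
  have "closed_segment A B \<noteq> closed_segment A' B'"
  proof
    assume "closed_segment A B = closed_segment A' B'"
    then have S: "{A, B} = {A', B'}" by (simp add: closed_segment_eq)
    have "\<exists>j<4. (relabel ^^ j) L = M"
    proof -
      have "M = L \<or> M = relabel L \<or> M = relabel (relabel L) \<or> M = relabel (relabel (relabel L))"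
        using S AB(1,4) AB'(1,4) by (auto simp: doubleton_eq_iff)
      then show ?thesis
      proof (elim disjE)
        assume "M = L" then show ?thesis by (intro exI[of _ 0]) simp
      next
        assume "M = relabel L" then show ?thesis by (intro exI[of _ 1]) simp
      next
        assume "M = relabel (relabel L)" then show ?thesis by (intro exI[of _ 2]) (simp add: numeral_2_eq_2)
      next
        assume "M = relabel (relabel (relabel L))" then show ?thesis by (intro exI[of _ 3]) (simp add: numeral_3_eq_3)
      qed
    qed
    then obtain j where j: "j < 4" "(relabel ^^ j) L = M" by blast
    obtain m :: nat where m: "(relabel ^^ m) M \<in> {(X, X, Y, Y) | X Y. True}"
      using AB'(4)
    proof
      assume "M = (A', A', B', B')" then show ?thesis by (intro that[of 0]) auto
    next
      assume "M = (A', B', B', A')" then show ?thesis by (intro that[of 1]) auto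
    qed
    then obtain X Y where XY: "(relabel ^^ m) M = (X, X, Y, Y)" by blast
    have clos: "(relabel ^^ n) K \<in> closure I" if "K \<in> closure I" for n K
      using that by (induction n) (auto simp del: relabel.simps intro: relabel_closure_I)
    have XYc: "(X, X, Y, Y) \<in> closure I" using clos[of M m] M(1) XY by simp
    have lim: "((\<lambda>t. (relabel ^^ n) (q t)) \<longlongrightarrow> (relabel ^^ n) K) F" if "(q \<longlongrightarrow> K) F" for q :: "real \<Rightarrow> quad" and K n F
    proof -
      have "isCont (relabel ^^ n) K" using continuous_on_relabel_funpow[of UNIV n] unfolding continuous_on_eq_continuous_at[OF open_UNIV] by blast
      then show ?thesis using that isCont_tendsto_compose by blast
    qed
    define f1 where "f1 = (\<lambda>t. (relabel ^^ m) ((relabel ^^ j) (f t)))"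
    define k1 where "k1 = (\<lambda>t. (relabel ^^ m) (k t))"
    have contR: "continuous_on T (\<lambda>t. (relabel ^^ n) (q t))" if "continuous_on T q" for n T and q :: "real \<Rightarrow> quad"
      by (rule continuous_on_compose2[OF continuous_on_relabel_funpow[of UNIV n] that]) auto
    have c1: "continuous_on {0<..<1} f1" "continuous_on {0<..<1} k1"
      unfolding f1_def k1_def by (intro contR cont)+
    have in1: "f1 t \<in> I" "k1 t \<in> I" if "t \<in> {0<..<1}" for t
      unfolding f1_def k1_def using fI[OF that] by (intro relabel_funpow_inscribed; simp)+
    have l1: "(f1 \<longlongrightarrow> (X, X, Y, Y)) (at_right 0)"
      using lim[OF lim[OF L(2), of j], of m] unfolding f1_def j(2) XY .
    have l2: "(k1 \<longlongrightarrow> (X, X, Y, Y)) (at_right 0)"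
      using lim[OF M(2), of m] unfolding k1_def XY .
    obtain s t where st: "0 < s" "s < 1/2" "0 < t" "t < 1/2" "f1 s = k1 t"
      by (rule ends_meet[OF XYc c1(1) in1(1) l1 c1(2) in1(2) l2], assumption, assumption) (rule that)
    have inj: "inj (relabel ^^ m)"
    proof (rule injI)
      fix x y assume "(relabel ^^ m) x = (relabel ^^ m) y"
      then have "(relabel ^^ m) ((relabel ^^ m) ((relabel ^^ m) ((relabel ^^ m) x)))
        = (relabel ^^ m) ((relabel ^^ m) ((relabel ^^ m) ((relabel ^^ m) y)))" by simp
      then show "x = y" unfolding relabel_funpow4 .
    qed
    have eq: "(relabel ^^ j) (f s) = f (1 - t)" using st(5) unfolding f1_def k1_def k_def by (rule injD[OF inj])
    have gf: "g (f x) = x" if "x \<in> {0<..<1}" for x using hom that unfolding homeomorphism_def by blast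
    have s01: "s \<in> {0<..<1}" "1 - t \<in> {0<..<1}" using st by auto
    show False
    proof (cases "j = 0")
      case True
      then have "f s = f (1 - t)" using eq by simp
      then have "g (f s) = g (f (1 - t))" by (rule arg_cong)
      then have "s = 1 - t" unfolding gf[OF s01(1)] gf[OF s01(2)] .
      then show False using st by simp
    next
      case False
      have fC: "f x \<in> C" if "x \<in> {0<..<1}" for x using hom that unfolding homeomorphism_def by blast
      have "(relabel ^^ j) ` C \<subseteq> C"
      proof (rule components_maximal[OF C])
        show "connected ((relabel ^^ j) ` C)"
          by (rule connected_continuous_image[OF continuous_on_relabel_funpow in_components_connected[OF C]])
        show "(relabel ^^ j) ` C \<subseteq> I" using CI relabel_funpow_inscribed by blast
        show "C \<inter> (relabel ^^ j) ` C \<noteq> {}" using eq fC[OF s01(1)] fC[OF s01(2)] by (metis disjoint_iff image_eqI)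
      qed
      then have into: "(relabel ^^ j) (f x) \<in> C" if "x \<in> {0<..<1}" for x using fC[OF that] by blast
      have fg: "f (g x) = x" "g x \<in> {0<..<1}" if "x \<in> C" for x using hom that unfolding homeomorphism_def by blast+
      define \<phi> where "\<phi> = (\<lambda>t. g ((relabel ^^ j) (f t)))"
      have "continuous_on {0<..<1} \<phi>" unfolding \<phi>_def
        by (rule continuous_on_compose2[of C g]) (use hom contR[OF cont(1)] into in \<open>auto simp: homeomorphism_def\<close>)
      moreover have \<phi>01: "\<phi> x \<in> {0<..<1}" if "x \<in> {0<..<1}" for x unfolding \<phi>_def using fg(2) into that by blast
      moreover have f\<phi>: "f (\<phi> x) = (relabel ^^ j) (f x)" if "x \<in> {0<..<1}" for x unfolding \<phi>_def using fg(1) into that by blast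
      moreover have "\<phi> (\<phi> (\<phi> (\<phi> x))) = x" if x: "x \<in> {0<..<1}" for x
      proof -
        have "f (\<phi> (\<phi> (\<phi> (\<phi> x)))) = f x" using f\<phi> \<phi>01 x relabel_funpow4 by metis
        then show ?thesis using gf \<phi>01 x by metis
      qed
      ultimately obtain x where x: "x \<in> {0<..<1}" "\<phi> x = x" using order4_fixed_point by blast
      then have "(relabel ^^ j) (f x) = f x" using f\<phi> by metis
      then show False using relabel_funpow_free[of "f x" j] inscribed_rect[OF fI(1)[OF x(1)]] False j(1) by simp
    qed
  qed
  then show ?thesis unfolding proper_arc_def arc_component_param_def
    using C hom r0 r1 e0 e1 by blast
qed

end

section \<open>The continuous argument of the chords of a polygon\<close>

text \<open>Two logarithms of the same number differ by a multiple of \<open>2\<pi>\<i>\<close>.\<close>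

lemma exp_constant_imp_constant:
  fixes F :: "'a::topological_space \<Rightarrow> complex"
  assumes S: "connected S" and F: "continuous_on S F" and k: "\<And>x. x \<in> S \<Longrightarrow> exp (F x) = k"
    and xy: "x \<in> S" "y \<in> S"
  shows "F x = F y"
proof -
  have "F constant_on S"
  proof (rule continuous_discrete_range_constant[OF S F])
    fix x assume x: "x \<in> S"
    have "2 * pi \<le> norm (F y - F x)" if "y \<in> S" "F y \<noteq> F x" for y
    proof (rule ccontr)
      assume "\<not> ?thesis"
      then have "\<bar>Im (F y) - Im (F x)\<bar> < 2 * pi" using abs_Im_le_cmod[of "F y - F x"] by simp
      moreover have "exp (F y) = exp (F x)" using k that x by simp
      ultimately show False using exp_complex_eqI that(2) by blast
    qed
    then show "\<exists>e>0. \<forall>y. y \<in> S \<and> F y \<noteq> F x \<longrightarrow> e \<le> norm (F y - F x)"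
      by (intro exI[of _ "2 * pi"]) auto
  qed
  then show ?thesis using xy unfolding constant_on_def by metis
qed

locale ngon_loop =
  fixes N :: nat and v :: "nat \<Rightarrow> complex"
  assumes N3: "N \<ge> 3" and ng: "is_ngon N v"
begin

abbreviation "q \<equiv> periodic_path N v"

lemma N0: "N > 0" using N3 by simp

lemma simple: "simple_path (polygon_path N v)" using ng by (simp add: is_ngon_def)

lemma q_frac: "q s = q t \<Longrightarrow> frac s = frac t" using simple simple_polygon_iff[OF N0] by blast

lemma q_inj:
  assumes "s \<le> t" "t < s + 1" "q s = q t" shows "s = t"
proof -
  have e: "t - s = of_int (\<lfloor>t\<rfloor> - \<lfloor>s\<rfloor>)" using q_frac[OF assms(3)] by (simp add: frac_def)
  have "\<not> s < t"
  proof
    assume "s < t"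
    then have "0 < (of_int (\<lfloor>t\<rfloor> - \<lfloor>s\<rfloor>) :: real)" "(of_int (\<lfloor>t\<rfloor> - \<lfloor>s\<rfloor>) :: real) < 1"
      using e assms(2) by linarith+
    then have "0 < \<lfloor>t\<rfloor> - \<lfloor>s\<rfloor>" "\<lfloor>t\<rfloor> - \<lfloor>s\<rfloor> < 1" by linarith+
    then show False by linarith
  qed
  then show ?thesis using assms(1) by linarith
qed

lemma continuous_q: "continuous_on S f \<Longrightarrow> continuous_on S (\<lambda>x. q (f x))"
  by (rule continuous_on_periodic_path_compose[OF N0])

text \<open>The pairs of parameters of the chords. Every chord with distinct end points occurs, once from each end
  in each period.\<close>

definition strip :: "(real \<times> real) set" where "strip = {(s, t). s < t \<and> t < s + 1}"

lemma convex_strip: "convex strip"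
proof -
  have eq: "strip = {x. (1, -1) \<bullet> x < 0} \<inter> {x. (-1, 1) \<bullet> x < 1}"
    unfolding strip_def by (auto simp: inner_prod_def)
  show ?thesis by (subst eq) (intro convex_Int convex_halfspace_lt)
qed

text \<open>Some continuous logarithm of the chord vector; it exists because the strip is contractible.\<close>

definition log_dir :: "real \<times> real \<Rightarrow> complex" where
  "log_dir = (SOME g. continuous_on strip g \<and> (\<forall>s t. s < t \<longrightarrow> t < s + 1 \<longrightarrow> q t - q s = exp (g (s, t))))"

lemma log_dir: "continuous_on strip log_dir"
  "s < t \<Longrightarrow> t < s + 1 \<Longrightarrow> q t - q s = exp (log_dir (s, t))"
proof -
  have c: "continuous_on strip (\<lambda>x. q (snd x) - q (fst x))" by (intro continuous_intros continuous_q)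
  have "q (snd x) - q (fst x) \<noteq> 0" if "x \<in> strip" for x
    using that q_inj[of "fst x" "snd x"] unfolding strip_def by auto
  then obtain g where "continuous_on strip g" "\<And>x. x \<in> strip \<Longrightarrow> q (snd x) - q (fst x) = exp (g x)"
    using continuous_logarithm_on_contractible[OF c convex_imp_contractible[OF convex_strip]] by metis
  then have "\<exists>g. continuous_on strip g \<and> (\<forall>s t. s < t \<longrightarrow> t < s + 1 \<longrightarrow> q t - q s = exp (g (s, t)))"
    unfolding strip_def by (intro exI[of _ g]) auto
  from someI_ex[OF this] show "continuous_on strip log_dir" "s < t \<Longrightarrow> t < s + 1 \<Longrightarrow> q t - q s = exp (log_dir (s, t))"
    unfolding log_dir_def by auto
qed

lemma continuous_log_dir:
  assumes "continuous_on S f" "continuous_on S g" "\<And>x. x \<in> S \<Longrightarrow> f x < g x \<and> g x < f x + 1"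
  shows "continuous_on S (\<lambda>x. log_dir (f x, g x))"
  by (rule continuous_on_compose2[OF log_dir(1)]) (use assms in \<open>auto simp: strip_def intro!: continuous_intros\<close>)

definition angle :: "real \<Rightarrow> real \<Rightarrow> real" where "angle s t = Im (log_dir (s, t))"

text \<open>At a vertex of maximal norm, the tangent of the circle around the origin through this vertex
  meets the polygon only there.\<close>

lemma extreme_vertex:
  obtains j where "j < N" "\<And>s. cmod (q s) \<le> cmod (v j)"
    "\<And>s. q s \<noteq> v j \<Longrightarrow> 0 < Re (- cnj (v j) * (q s - v j))"
proof -
  obtain j where j: "j < N" "\<And>i. i < N \<Longrightarrow> cmod (v i) \<le> cmod (v j)"
  proof -
    have "Max ((\<lambda>i. cmod (v i)) ` {..<N}) \<in> (\<lambda>i. cmod (v i)) ` {..<N}" using N0 by (intro Max_in) auto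
    then obtain j where "j < N" "cmod (v j) = Max ((\<lambda>i. cmod (v i)) ` {..<N})" by auto
    then show ?thesis using that[of j] by (metis (no_types, lifting) Max_ge finite_imageI finite_lessThan imageI lessThan_iff)
  qed
  have le: "cmod (q s) \<le> cmod (v j)" for s
    by (rule norm_periodic_path_le[OF _ N0], rule cyc_vertex_bound[OF N0]) (rule j(2))
  have "0 < Re (- cnj (v j) * (q s - v j))" if ne: "q s \<noteq> v j" for s
  proof -
    have "(cmod (q s - v j))\<^sup>2 = (cmod (q s))\<^sup>2 + (cmod (v j))\<^sup>2 - 2 * Re (cnj (v j) * q s)"
      unfolding cmod_power2 by (simp add: power2_eq_square algebra_simps)
    moreover have "(cmod (q s))\<^sup>2 \<le> (cmod (v j))\<^sup>2" using le[of s] by (simp add: power_mono)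
    moreover have "(cmod (q s - v j))\<^sup>2 > 0" using ne by simp
    moreover have "Re (- cnj (v j) * (q s - v j)) = (cmod (v j))\<^sup>2 - Re (cnj (v j) * q s)"
      unfolding cmod_power2 by (simp add: power2_eq_square algebra_simps)
    ultimately show ?thesis by linarith
  qed
  then show ?thesis using that j(1) le by blast
qed

lemma q_around_vertex:
  assumes j: "j < N" and x: "0 \<le> x" "x \<le> 1"
  shows "q (real j / real N + x * (1 / real N)) = v j + x *\<^sub>R edge_vec N v (int j)"
    "q (real j / real N - x * (1 / real N)) = v j - x *\<^sub>R edge_vec N v (int j - 1)"
proof -
  have cv: "cyc_vertex N v (int j) = v j" using j by (simp add: cyc_vertex_def)
  have "real j / real N + x * (1 / real N) = (of_int (int j) + x) / real N" by (simp add: add_divide_distrib)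
  then show "q (real j / real N + x * (1 / real N)) = v j + x *\<^sub>R edge_vec N v (int j)"
    using periodic_path_edge[OF N0 x, of v "int j"] cv by simp
  have "real j / real N - x * (1 / real N) = (of_int (int j - 1) + (1 - x)) / real N"
    by (simp add: diff_divide_distrib add_divide_distrib)
  then have "q (real j / real N - x * (1 / real N)) = cyc_vertex N v (int j - 1) + (1 - x) *\<^sub>R edge_vec N v (int j - 1)"
    using periodic_path_edge[OF N0, of "1 - x" v "int j - 1"] x by simp
  also have "cyc_vertex N v (int j - 1) = v j - edge_vec N v (int j - 1)" unfolding edge_vec_def using cv by simp
  finally show "q (real j / real N - x * (1 / real N)) = v j - x *\<^sub>R edge_vec N v (int j - 1)" by (simp add: algebra_simps)
qed

text \<open>The orientation enters here. Let \<open>A\<close>, \<open>p\<close>, \<open>B\<close> be the extreme vertex \<open>p\<close> with its neighbours. The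
  winding number of the polygon is the sum of those of the triangle \<open>A p B\<close> and of the polygon with
  the vertex \<open>p\<close> cut off. The latter is zero near \<open>p\<close>: it is locally constant
  there, and the other two winding numbers vanish outside the disc that contains the polygon. So just inside \<open>p\<close> the winding number of
  the polygon, which is 1, is that of the triangle.\<close>

lemma extreme_vertex_turns_left:
  assumes j: "j < N" "\<And>s. cmod (q s) \<le> cmod (v j)"
    "\<And>s. q s \<noteq> v j \<Longrightarrow> 0 < Re (- cnj (v j) * (q s - v j))"
  shows "cr (edge_vec N v (int j - 1)) (edge_vec N v (int j)) > 0"
proof -
  define p where "p = v j"
  define s0 where "s0 = real j / real N"
  define \<eta> where "\<eta> = 1 / real N"
  define e0 e1 where "e0 = edge_vec N v (int j - 1)" and "e1 = edge_vec N v (int j)"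
  have \<eta>: "0 < \<eta>" "3 * \<eta> \<le> 1" unfolding \<eta>_def using N3 N0 by (auto simp: field_simps)
  have qp: "q (s0 + x * \<eta>) = p + x *\<^sub>R e1" if "0 \<le> x" "x \<le> 1" for x
    unfolding s0_def \<eta>_def p_def e1_def by (rule q_around_vertex(1)[OF j(1) that])
  have qm: "q (s0 - x * \<eta>) = p - x *\<^sub>R e0" if "0 \<le> x" "x \<le> 1" for x
    unfolding s0_def \<eta>_def p_def e0_def by (rule q_around_vertex(2)[OF j(1) that])
  define A B where "A = q (s0 - \<eta>)" and "B = q (s0 + \<eta>)"
  have AB: "A = p - e0" "B = p + e1" unfolding A_def B_def using qm[of 1] qp[of 1] by auto
  have qs0: "q s0 = p" using qp[of 0] by simp
  define Hp where "Hp = {z. 0 < Re (- cnj p * (z - p))}"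
  have AH: "A \<noteq> p" "B \<noteq> p"
    using q_inj[of "s0 - \<eta>" s0] q_inj[of s0 "s0 + \<eta>"] qs0 \<eta> unfolding A_def B_def by auto
  then have ABH: "A \<in> Hp" "B \<in> Hp" using j(3) unfolding Hp_def A_def B_def p_def by auto
  define X Y where "X = Re (- cnj p * e1)" and "Y = Re (- cnj p * (- e0))"
  have XY: "X > 0" "Y > 0" using ABH unfolding Hp_def AB X_def Y_def by auto
  define D where "D = cr e0 e1"
  have D0: "D \<noteq> 0"
  proof
    assume d: "D = 0"
    have z: "X *\<^sub>R e0 + Y *\<^sub>R e1 = 0"
    proof (rule cr_inner_zero[of p])
      show "p \<bullet> (X *\<^sub>R e0 + Y *\<^sub>R e1) = 0" unfolding X_def Y_def by (simp add: inner_complex_def algebra_simps)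
      have "cr p (X *\<^sub>R e0 + Y *\<^sub>R e1) = (p \<bullet> p) * D"
        unfolding X_def Y_def D_def by (simp add: inner_complex_def cr_Re_Im algebra_simps)
      then show "cr p (X *\<^sub>R e0 + Y *\<^sub>R e1) = 0" using d by simp
      show "p \<noteq> 0" using XY(1) unfolding X_def by auto
    qed
    have "0 \<in> closed_segment e0 e1" unfolding closed_segment_def
    proof (intro CollectI exI[of _ "Y / (X + Y)"] conjI)
      have "(1 - Y / (X + Y)) *\<^sub>R e0 + (Y / (X + Y)) *\<^sub>R e1 = (1 / (X + Y)) *\<^sub>R (X *\<^sub>R e0 + Y *\<^sub>R e1)"
        using XY by (simp add: scaleR_add_right field_simps)
      then show "0 = (1 - Y / (X + Y)) *\<^sub>R e0 + (Y / (X + Y)) *\<^sub>R e1" unfolding z by simp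
    qed (use XY in auto)
    then show False using consecutive_edges_not_opposite[OF N3 simple, of "int j - 1"] unfolding e0_def e1_def by simp
  qed
  define m where "m = e1 - e0"
  define \<Gamma> where "\<Gamma> = (\<lambda>t. q (s0 - \<eta> + t))"
  have path\<Gamma>: "path \<Gamma>" unfolding path_def \<Gamma>_def by (intro continuous_q continuous_intros)
  have loop\<Gamma>: "pathfinish \<Gamma> = pathstart \<Gamma>"
    unfolding pathfinish_def pathstart_def \<Gamma>_def using periodic_path_add_1[OF N0, of v "s0 - \<eta>"] by simp
  have wn\<Gamma>: "winding_number (polygon_path N v) z = winding_number \<Gamma> z" if "z \<notin> path_image (polygon_path N v)" for z
  proof -
    define a where "a = frac (s0 - \<eta>)"
    have a: "a \<in> {0..1}" unfolding a_def by (auto simp: frac_lt_1 less_imp_le)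
    have "shiftpath a (polygon_path N v) t = \<Gamma> t" if t: "0 \<le> t" "t \<le> 1" for t
    proof -
      have "\<Gamma> t = q (a + t)"
        using periodic_path_add_int[OF N0, of v "a + t" "\<lfloor>s0 - \<eta>\<rfloor>"] unfolding \<Gamma>_def a_def frac_def
        by (simp add: algebra_simps)
      moreover have "shiftpath a (polygon_path N v) t = q (a + t)"
      proof (cases "a + t \<le> 1")
        case True
        then show ?thesis using a t polygon_path_eq_periodic[OF N0, of "a + t"] by (simp add: shiftpath_def)
      next
        case False
        then have "shiftpath a (polygon_path N v) t = q (a + t - 1)"
          using a t polygon_path_eq_periodic[OF N0, of "a + t - 1"] by (simp add: shiftpath_def algebra_simps)
        then show ?thesis using periodic_path_add_1[OF N0, of v "a + t - 1"] by simp
      qed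
      ultimately show ?thesis by simp
    qed
    then have "winding_number (shiftpath a (polygon_path N v)) z = winding_number \<Gamma> z"
      by (rule winding_number_cong)
    moreover have "pathfinish (polygon_path N v) = pathstart (polygon_path N v)"
      using polygon_path_eq_periodic[OF N0, of 0 v] polygon_path_eq_periodic[OF N0, of 1 v]
        periodic_path_add_1[OF N0, of v 0] by (simp add: pathfinish_def pathstart_def)
    ultimately show ?thesis
      using winding_number_shiftpath[OF simple_path_imp_path[OF simple] that _ a] by simp
  qed
  have pi\<Gamma>: "path_image \<Gamma> = path_image (polygon_path N v)"
    unfolding path_image_polygon[OF N0] unfolding path_image_def
  proof
    show "range q \<subseteq> \<Gamma> ` {0..1}"
    proof
      fix z assume "z \<in> range q"
      then obtain s where z: "z = q s" by blast
      have "q (s0 - \<eta> + frac (s - (s0 - \<eta>))) = q s"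
        using periodic_path_add_int[OF N0, of v "s0 - \<eta> + frac (s - (s0 - \<eta>))" "\<lfloor>s - (s0 - \<eta>)\<rfloor>"] by (simp add: frac_def)
      then show "z \<in> \<Gamma> ` {0..1}" unfolding \<Gamma>_def z
        by (intro image_eqI[of _ _ "frac (s - (s0 - \<eta>))"]) (auto simp: frac_lt_1 less_imp_le)
    qed
  qed (auto simp: \<Gamma>_def)
  define long where "long = subpath (2 * \<eta>) 1 \<Gamma>"
  define T where "T = linepath A p +++ linepath p B +++ linepath B A"
  define loop2 where "loop2 = long +++ linepath A B"
  have \<Gamma>v: "\<Gamma> 0 = A" "\<Gamma> \<eta> = p" "\<Gamma> (2*\<eta>) = B" "\<Gamma> 1 = A"
  proof -
    have "s0 - \<eta> + 2 * \<eta> = s0 + \<eta>" by simp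
    then show "\<Gamma> 0 = A" "\<Gamma> \<eta> = p" "\<Gamma> (2*\<eta>) = B" unfolding \<Gamma>_def A_def B_def using qs0 by (auto simp: add.commute)
    show "\<Gamma> 1 = A" unfolding \<Gamma>_def A_def using periodic_path_add_1[OF N0, of v "s0 - \<eta>"] by simp
  qed
  have sp1: "subpath 0 \<eta> \<Gamma> x = linepath A p x" if "0 \<le> x" "x \<le> 1" for x
  proof -
    have "subpath 0 \<eta> \<Gamma> x = q (s0 - (1 - x) * \<eta>)" unfolding subpath_def \<Gamma>_def by (simp add: algebra_simps)
    also have "\<dots> = p - (1 - x) *\<^sub>R e0" using qm[of "1 - x"] that by simp
    finally show ?thesis by (simp add: linepath_def AB algebra_simps)
  qed
  have sp2: "subpath \<eta> (2*\<eta>) \<Gamma> x = linepath p B x" if "0 \<le> x" "x \<le> 1" for x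
  proof -
    have "subpath \<eta> (2*\<eta>) \<Gamma> x = q (s0 + x * \<eta>)" unfolding subpath_def \<Gamma>_def by (simp add: algebra_simps)
    also have "\<dots> = p + x *\<^sub>R e1" using qp[of x] that by simp
    finally show ?thesis by (simp add: linepath_def AB algebra_simps)
  qed
  have plong: "path long" "pathstart long = B" "pathfinish long = A"
    unfolding long_def using path\<Gamma> \<eta> \<Gamma>v by auto
  have ploop: "path loop2" "pathfinish loop2 = pathstart loop2"
    unfolding loop2_def using plong by auto
  have wn: "winding_number \<Gamma> z = winding_number T z + winding_number loop2 z"
    if z: "z \<notin> path_image \<Gamma>" "z \<notin> closed_segment A B" for z
  proof -
    have img: "path_image (subpath a b \<Gamma>) \<subseteq> path_image \<Gamma>" if "a \<in> {0..1}" "b \<in> {0..1}" for a b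
      using path_image_subpath_subset that by blast
    have u: "0 \<in> {0..1::real}" "\<eta> \<in> {0..1}" "2 * \<eta> \<in> {0..1}" "1 \<in> {0..1::real}" using \<eta> by auto
    have c1: "winding_number (subpath 0 \<eta> \<Gamma>) z = winding_number (linepath A p) z"
      by (rule winding_number_cong) (rule sp1)
    have c2: "winding_number (subpath \<eta> (2*\<eta>) \<Gamma>) z = winding_number (linepath p B) z"
      by (rule winding_number_cong) (rule sp2)
    have i1: "z \<notin> closed_segment A p"
    proof
      assume "z \<in> closed_segment A p"
      then obtain x where "0 \<le> x" "x \<le> 1" "z = linepath A p x" by (auto simp: closed_segment_def linepath_def)
      then have "z = subpath 0 \<eta> \<Gamma> x" "x \<in> {0..1}" using sp1 by auto
      then have "z \<in> path_image (subpath 0 \<eta> \<Gamma>)" unfolding path_image_def by blast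
      then show False using img[OF u(1,2)] z by blast
    qed
    have i2: "z \<notin> closed_segment p B"
    proof
      assume "z \<in> closed_segment p B"
      then obtain x where "0 \<le> x" "x \<le> 1" "z = linepath p B x" by (auto simp: closed_segment_def linepath_def)
      then have "z = subpath \<eta> (2*\<eta>) \<Gamma> x" "x \<in> {0..1}" using sp2 by auto
      then have "z \<in> path_image (subpath \<eta> (2*\<eta>) \<Gamma>)" unfolding path_image_def by blast
      then show False using img[OF u(2,3)] z by blast
    qed
    have il: "z \<notin> path_image long" using img[OF u(3,4)] z unfolding long_def by blast
    have "winding_number \<Gamma> z = winding_number (subpath 0 (2*\<eta>) \<Gamma>) z + winding_number long z"
      using winding_number_subpath_combine[OF path\<Gamma> z(1) u(1,3,4)] unfolding long_def by simp
    also have "winding_number (subpath 0 (2*\<eta>) \<Gamma>) z = winding_number (linepath A p) z + winding_number (linepath p B) z"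
      using winding_number_subpath_combine[OF path\<Gamma> z(1) u(1,2,3)] c1 c2 by simp
    finally have w: "winding_number \<Gamma> z = winding_number (linepath A p) z + winding_number (linepath p B) z + winding_number long z" .
    have zBA: "z \<notin> closed_segment B A" using z(2) by (simp add: closed_segment_commute)
    have r: "winding_number (linepath B A) z = - winding_number (linepath A B) z"
      using winding_number_reversepath[of "linepath A B" z] z(2) by simp
    have "winding_number T z = winding_number (linepath A p) z + (winding_number (linepath p B) z + winding_number (linepath B A) z)"
      unfolding T_def using i1 i2 zBA by (subst winding_number_join; simp add: path_image_join winding_number_join)
    moreover have "winding_number loop2 z = winding_number long z + winding_number (linepath A B) z"
      unfolding loop2_def using plong il z(2) by (subst winding_number_join) auto
    ultimately show ?thesis using w r by simp
  qed
  have convH: "convex Hp"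
  proof -
    have "Hp = {z. (- p) \<bullet> z > (- p) \<bullet> p}" unfolding Hp_def by (auto simp: inner_complex_def algebra_simps)
    then show ?thesis by (simp add: convex_halfspace_gt convex_halfspace_lt)
  qed
  have "p \<notin> Hp" by (simp add: Hp_def)
  have segH: "closed_segment A B \<subseteq> Hp" using ABH convH by (simp add: closed_segment_subset)
  have longH: "path_image long \<subseteq> Hp"
  proof
    fix z assume "z \<in> path_image long"
    then obtain t where t: "2 * \<eta> \<le> t" "t \<le> 1" "z = \<Gamma> t"
      unfolding long_def path_image_subpath using \<eta> by (auto split: if_splits)
    have "z \<noteq> p" using t \<eta> qs0 q_inj[of s0 "s0 - \<eta> + t"] unfolding \<Gamma>_def by auto
    then show "z \<in> Hp" using j(3) t unfolding Hp_def p_def \<Gamma>_def by auto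
  qed
  have "p \<notin> path_image loop2" using segH longH \<open>p \<notin> Hp\<close> plong unfolding loop2_def by (auto simp: path_image_join)
  then obtain d where d: "d > 0" "\<And>z. z \<in> path_image loop2 \<Longrightarrow> d \<le> dist p z"
    using separate_point_closed[OF closed_path_image[OF ploop(1)]] by blast
  define \<epsilon> where "\<epsilon> = min (1/4) (d / (2 * (cmod m + 1)))"
  have m1: "cmod m + 1 > 0" using norm_ge_zero[of m] by linarith
  have \<epsilon>: "0 < \<epsilon>" "\<epsilon> \<le> 1/4" unfolding \<epsilon>_def min_def using d(1) m1 by auto
  have \<epsilon>m: "\<epsilon> * cmod m < d"
  proof -
    have "\<epsilon> * cmod m \<le> d / (2 * (cmod m + 1)) * (cmod m + 1)" unfolding \<epsilon>_def min_def using d(1) m1 by (intro mult_mono) auto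
    also have "\<dots> = d / 2" using m1 by (simp add: field_simps)
    finally show ?thesis using d(1) by linarith
  qed
  define z z' where "z = p + \<epsilon> *\<^sub>R m" and "z' = p - \<epsilon> *\<^sub>R m"
  have ball: "z \<in> ball p d" "z' \<in> ball p d" unfolding z_def z'_def using \<epsilon>m \<epsilon>(1) by (auto simp: dist_norm)
  have disj: "ball p d \<inter> path_image loop2 = {}" using d(2) by force
  have wl: "winding_number loop2 z = winding_number loop2 z'"
    by (rule winding_number_eq[OF ploop ball _ disj]) (rule convex_connected[OF convex_ball])
  have imB: "path_image \<Gamma> \<subseteq> cball 0 (cmod p)" unfolding pi\<Gamma> path_image_polygon[OF N0] using j(2) by (auto simp: p_def)
  have z'o: "z' \<notin> cball 0 (cmod p)"
  proof -
    have "(cmod z')\<^sup>2 = (cmod p)\<^sup>2 + 2 * \<epsilon> * Re (- cnj p * m) + \<epsilon>\<^sup>2 * (cmod m)\<^sup>2"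
      unfolding z'_def cmod_power2 by (simp add: power2_eq_square algebra_simps)
    moreover have "Re (- cnj p * m) = X + Y" unfolding X_def Y_def m_def by (simp add: algebra_simps)
    ultimately have "(cmod z')\<^sup>2 = (cmod p)\<^sup>2 + 2 * \<epsilon> * (X + Y) + \<epsilon>\<^sup>2 * (cmod m)\<^sup>2" by simp
    moreover have "2 * \<epsilon> * (X + Y) > 0" using \<epsilon> XY by simp
    moreover have "0 \<le> \<epsilon>\<^sup>2 * (cmod m)\<^sup>2" by simp
    ultimately have "(cmod z')\<^sup>2 > (cmod p)\<^sup>2" by linarith
    then have "cmod z' > cmod p" using power2_less_imp_less[of "cmod p" "cmod z'"] by simp
    then show ?thesis by simp
  qed
  have ABc: "A \<in> cball 0 (cmod p)" "B \<in> cball 0 (cmod p)" unfolding A_def B_def using j(2) by (auto simp: p_def)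
  then have segB: "closed_segment A B \<subseteq> cball 0 (cmod p)" "closed_segment A p \<subseteq> cball 0 (cmod p)"
     "closed_segment p B \<subseteq> cball 0 (cmod p)" "closed_segment B A \<subseteq> cball 0 (cmod p)"
    by (simp_all add: closed_segment_subset)
  have "winding_number \<Gamma> z' = 0" by (rule winding_number_zero_outside[OF path\<Gamma> convex_cball loop\<Gamma> z'o imB])
  moreover have "winding_number T z' = 0"
    by (rule winding_number_zero_outside[OF _ convex_cball _ z'o]) (use segB in \<open>auto simp: T_def path_image_join\<close>)
  moreover have "z' \<notin> path_image \<Gamma>" "z' \<notin> closed_segment A B" using z'o imB segB(1) by auto
  ultimately have "winding_number loop2 z' = 0" using wn[of z'] by simp
  then have wz: "winding_number loop2 z = 0" using wl by simp
  have ncol: "\<not> collinear {A, p, B}"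
  proof
    assume "collinear {A, p, B}"
    then have "collinear {0, A - p, B - p}"
      using collinear_3[of A p B] by (simp add: insert_commute)
    then have "(B - p) / (A - p) \<in> \<real>" using collinear_iff_Reals by blast
    then obtain c where c: "(B - p) / (A - p) = of_real c" by (auto elim: Reals_cases)
    have "A - p \<noteq> 0" using AH by simp
    then have "B - p = of_real c * (A - p)" using c by (simp add: field_simps)
    then have "e1 = c *\<^sub>R (- e0)" unfolding AB by (simp add: scaleR_conv_of_real)
    then have "D = 0" unfolding D_def by simp
    then show False using D0 by simp
  qed
  have zint: "z \<in> interior (convex hull {A, p, B})"
  proof -
    have "\<epsilon> *\<^sub>R A + (1 - 2 * \<epsilon>) *\<^sub>R p + \<epsilon> *\<^sub>R B = z" unfolding AB z_def m_def by (simp add: scaleR_conv_of_real algebra_simps)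
    moreover have "0 < 1 - 2 * \<epsilon>" "\<epsilon> + (1 - 2 * \<epsilon>) + \<epsilon> = 1" using \<epsilon> by auto
    ultimately show ?thesis
      unfolding interior_convex_hull_3_minimal[OF ncol DIM_complex] using \<epsilon>(1) by blast
  qed
  have "winding_number T z = (if 0 < Im ((p - A) * cnj (p - z)) then 1 else -1)"
    unfolding T_def by (rule winding_number_triangle[OF zint])
  moreover have "Im ((p - A) * cnj (p - z)) = \<epsilon> * D"
    unfolding AB z_def m_def D_def cr_Re_Im by (simp add: algebra_simps)
  ultimately have wT: "winding_number T z = (if 0 < D then 1 else -1)" using \<epsilon>(1) by (simp add: zero_less_mult_iff)
  have znot: "z \<notin> frontier (convex hull {A, p, B})" using zint by (simp add: frontier_def)
  have fr: "frontier (convex hull {A, p, B}) = closed_segment A p \<union> closed_segment p B \<union> closed_segment B A"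
    by (rule frontier_of_triangle[OF DIM_complex])
  have zseg: "z \<notin> closed_segment A p" "z \<notin> closed_segment p B" "z \<notin> closed_segment A B"
    using znot unfolding fr by (auto simp: closed_segment_commute)
  have zlong: "z \<notin> path_image long" using disj ball(1) plong unfolding loop2_def by (auto simp: path_image_join)
  have zG: "z \<notin> path_image \<Gamma>"
  proof
    assume "z \<in> path_image \<Gamma>"
    then obtain t where t: "0 \<le> t" "t \<le> 1" "z = \<Gamma> t" unfolding path_image_def by auto
    consider "t \<le> \<eta>" | "\<eta> \<le> t" "t \<le> 2*\<eta>" | "2*\<eta> \<le> t" by linarith
    then show False
    proof cases
      case 1
      have "subpath 0 \<eta> \<Gamma> (t/\<eta>) = \<Gamma> t" using \<eta> by (simp add: subpath_def)
      moreover have "0 \<le> t/\<eta>" "t/\<eta> \<le> 1" using 1 t \<eta> by auto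
      ultimately have "z = linepath A p (t/\<eta>)" using sp1 t by metis
      then show False using zseg(1) \<open>0 \<le> t/\<eta>\<close> \<open>t/\<eta> \<le> 1\<close> by (auto simp: linepath_in_path)
    next
      case 2
      have "subpath \<eta> (2*\<eta>) \<Gamma> ((t-\<eta>)/\<eta>) = \<Gamma> t" using \<eta> by (simp add: subpath_def)
      moreover have "0 \<le> (t-\<eta>)/\<eta>" "(t-\<eta>)/\<eta> \<le> 1" using 2 t \<eta> by (auto simp: field_simps)
      ultimately have "z = linepath p B ((t-\<eta>)/\<eta>)" using sp2 t by metis
      then show False using zseg(2) \<open>0 \<le> (t-\<eta>)/\<eta>\<close> \<open>(t-\<eta>)/\<eta> \<le> 1\<close> by (auto simp: linepath_in_path)
    next
      case 3
      then have "z \<in> path_image long" unfolding long_def path_image_subpath using t \<eta> by auto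
      then show False using zlong by simp
    qed
  qed
  have wG: "winding_number \<Gamma> z = (if 0 < D then 1 else -1)" using wn[OF zG zseg(3)] wz wT by simp
  have "winding_number (polygon_path N v) z = 1"
  proof -
    have "z \<notin> outside (path_image \<Gamma>)"
    proof
      assume "z \<in> outside (path_image \<Gamma>)"
      then have "winding_number \<Gamma> z = 0" by (rule winding_number_zero_in_outside[OF path\<Gamma> loop\<Gamma>])
      then show False using wG by (simp split: if_splits)
    qed
    then have "z \<in> inside (path_image (polygon_path N v))"
      using zG inside_Un_outside[of "path_image \<Gamma>"] unfolding pi\<Gamma> by blast
    then show ?thesis using ng unfolding is_ngon_def by blast
  qed
  then have "D > 0" using wn\<Gamma>[of z] wG zG unfolding pi\<Gamma> by (auto split: if_splits)
  then show ?thesis unfolding D_def e0_def e1_def .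
qed

end

context ngon_loop begin

text \<open>The vectors \<open>q (s + 1) - q t\<close> and \<open>q t - q s\<close> are opposite, so the difference of the angles is the same odd multiple of
  \<open>\<pi>\<close> for all \<open>s < t < s + 1\<close>. It is evaluated for the chord from the predecessor of an extreme vertex \<open>p\<close> to
  \<open>p\<close>: the argument changes by an explicit amount while the second end of a chord from \<open>p\<close> runs
  around the polygon, because all directions from \<open>p\<close> lie in a half plane, and while a chord slides
  across \<open>p\<close>, where the polygon turns left.\<close>

lemma angle_swap:
  assumes "s < t" "t < s + 1"
  shows "angle t (s + 1) = angle s t + pi"
proof -
  obtain j where j: "j < N" "\<And>s. cmod (q s) \<le> cmod (v j)"
    "\<And>s. q s \<noteq> v j \<Longrightarrow> 0 < Re (- cnj (v j) * (q s - v j))" by (rule extreme_vertex) (rule that)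
  define p where "p = v j"
  define s0 where "s0 = real j / real N"
  define \<eta> where "\<eta> = 1 / real N"
  define e0 e1 where "e0 = edge_vec N v (int j - 1)" and "e1 = edge_vec N v (int j)"
  have turn: "cr e0 e1 > 0" unfolding e0_def e1_def by (rule extreme_vertex_turns_left[OF j])
  have \<eta>: "0 < \<eta>" "3 * \<eta> \<le> 1" unfolding \<eta>_def using N3 N0 by (auto simp: field_simps)
  have qp: "q (s0 + x * \<eta>) = p + x *\<^sub>R e1" if "0 \<le> x" "x \<le> 1" for x
    unfolding s0_def \<eta>_def p_def e1_def by (rule q_around_vertex(1)[OF j(1) that])
  have qm: "q (s0 - x * \<eta>) = p - x *\<^sub>R e0" if "0 \<le> x" "x \<le> 1" for x
    unfolding s0_def \<eta>_def p_def e0_def by (rule q_around_vertex(2)[OF j(1) that])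
  have qs0: "q s0 = p" using qp[of 0] by simp
  define x y where "x = - cnj p * e1" and "y = cnj p * e0"
  have pos: "0 < Re (- cnj p * (q t - p))" if "s0 < t" "t < s0 + 1" for t
  proof -
    have "q t \<noteq> v j" using q_inj[of s0 t] that qs0 unfolding p_def by auto
    then show ?thesis unfolding p_def by (rule j(3))
  qed
  have x: "Re x > 0" using pos[of "s0 + \<eta>"] qp[of 1] \<eta> unfolding x_def by simp
  have qA: "q (s0 + 1 - \<eta>) = p - e0"
    using qm[of 1] periodic_path_add_1[OF N0, of v "s0 - \<eta>"] by (simp add: algebra_simps)
  have y: "Re y > 0" using pos[of "s0 + 1 - \<eta>"] qA \<eta> unfolding y_def by simp
  have xy0: "x \<noteq> 0" "y \<noteq> 0" using x y by auto
  have p0: "p \<noteq> 0" using x unfolding x_def by auto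

  \<comment> \<open>Turning around the extreme vertex: seen from it, all directions lie in a half plane.\<close>
  have 1: "log_dir (s0, s0 + 1 - \<eta>) - Ln y = log_dir (s0, s0 + \<eta>) - Ln x"
  proof -
    let ?G = "\<lambda>t. log_dir (s0, t) - Ln (- cnj p * (q t - p))"
    have "?G (s0 + 1 - \<eta>) = ?G (s0 + \<eta>)"
    proof (rule exp_constant_imp_constant[of "{s0<..<s0+1}" ?G "- (1 / cnj p)"])
      have np: "- cnj p * (q t - p) \<notin> \<real>\<^sub>\<le>\<^sub>0" if "t \<in> {s0<..<s0+1}" for t
      proof -
        have "0 < Re (- cnj p * (q t - p))" using that by (intro pos) auto
        then show ?thesis by (meson complex_nonpos_Reals_iff not_le)
      qed
      have cq: "continuous_on {s0<..<s0+1} (\<lambda>t. - cnj p * (q t - p))"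
        by (intro continuous_on_mult continuous_on_diff continuous_on_const continuous_q continuous_on_id)
      have "continuous_on {s0<..<s0+1} (\<lambda>t. log_dir (s0, t))"
        by (rule continuous_log_dir[OF continuous_on_const continuous_on_id]) simp
      then show "continuous_on {s0<..<s0+1} ?G"
        by (rule continuous_on_diff) (rule continuous_on_Ln'[OF cq np])
      fix t assume t: "t \<in> {s0<..<s0+1}"
      have "q t - p \<noteq> 0" using pos[of t] t by auto
      then have "exp (?G t) = (q t - p) / (- cnj p * (q t - p))"
        using log_dir(2)[of s0 t] t qs0 p0 by (simp add: exp_diff)
      then show "exp (?G t) = - (1 / cnj p)" using \<open>q t - p \<noteq> 0\<close> by (simp add: divide_simps)
    qed (use \<eta> in auto)
    then show ?thesis using qp[of 1] qA by (simp add: x_def y_def)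
  qed

  \<comment> \<open>Moving the two endpoints across the extreme vertex: the direction turns from the outgoing
    edge back to the incoming one.\<close>
  have Imyx: "Im (y / x) > 0"
  proof -
    have "Im (y / x) = Im (y * cnj x) / (cmod x)\<^sup>2" by (subst complex_div_cnj) (simp flip: of_real_power)
    moreover have "Im (y * cnj x) = (cmod p)\<^sup>2 * cr e0 e1"
      unfolding x_def y_def cr_Re_Im cmod_power2 by (simp add: algebra_simps power2_eq_square)
    ultimately show ?thesis using turn p0 xy0 by simp
  qed
  have 2: "log_dir (s0 - \<eta>, s0) - Ln (- (y / x)) = log_dir (s0, s0 + \<eta>)"
  proof -
    let ?w = "\<lambda>\<tau>. of_real (1 - \<tau>) - of_real \<tau> * (y / x)"
    let ?H = "\<lambda>\<tau>. log_dir (s0 - \<tau> * \<eta>, s0 + (1 - \<tau>) * \<eta>) - Ln (?w \<tau>)"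
    have "?H 1 = ?H 0"
    proof (rule exp_constant_imp_constant[of "{0..1}" ?H "- (x / cnj p)"])
      have w: "?w \<tau> \<notin> \<real>\<^sub>\<le>\<^sub>0" if "\<tau> \<in> {0..1}" for \<tau>
      proof (cases "\<tau> = 0")
        case False
        have "Im (?w \<tau>) = - (\<tau> * Im (y / x))" by (simp del: times_divide_eq_right)
        then have "Im (?w \<tau>) \<noteq> 0" using Imyx False by (simp del: times_divide_eq_right)
        then show ?thesis by (simp only: complex_nonpos_Reals_iff) blast
      qed simp
      have st: "s0 - \<tau> * \<eta> < s0 + (1 - \<tau>) * \<eta> \<and> s0 + (1 - \<tau>) * \<eta> < s0 - \<tau> * \<eta> + 1" for \<tau>
        using \<eta> by (simp add: algebra_simps)
      have "continuous_on {0..1} (\<lambda>\<tau>. log_dir (s0 - \<tau> * \<eta>, s0 + (1 - \<tau>) * \<eta>))"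
        by (rule continuous_log_dir[OF _ _ st]) (intro continuous_intros)+
      moreover have "continuous_on {0..1} (\<lambda>\<tau>. Ln (?w \<tau>))"
      proof (rule continuous_on_Ln')
        show "continuous_on {0..1} ?w"
          by (intro continuous_on_diff continuous_on_mult continuous_on_const continuous_on_of_real continuous_on_id)
      qed (rule w)
      ultimately show "continuous_on {0..1} ?H" by (rule continuous_on_diff)
      fix \<tau> :: real assume t: "\<tau> \<in> {0..1}"
      have "q (s0 + (1 - \<tau>) * \<eta>) - q (s0 - \<tau> * \<eta>) = (1 - \<tau>) *\<^sub>R e1 + \<tau> *\<^sub>R e0"
        using qp[of "1 - \<tau>"] qm[of \<tau>] t by simp
      moreover have "?w \<tau> * x = - cnj p * ((1 - \<tau>) *\<^sub>R e1 + \<tau> *\<^sub>R e0)"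
        using xy0 by (simp add: x_def y_def scaleR_conv_of_real algebra_simps)
      moreover have w0: "?w \<tau> \<noteq> 0" using w[OF t] by auto
      ultimately have "exp (?H \<tau>) = (?w \<tau> * x / (- cnj p)) / ?w \<tau>"
        using log_dir(2)[OF st[THEN conjunct1] st[THEN conjunct2], of \<tau>] p0 by (simp add: exp_diff)
      also have "\<dots> = - (x / cnj p)" using w0 by simp
      finally show "exp (?H \<tau>) = - (x / cnj p)" .
    qed auto
    then show ?thesis by simp
  qed

  have Lnyx: "Ln (y / x) = Ln y - Ln x"
  proof (rule Ln_unique)
    have "\<bar>Im (Ln x)\<bar> < pi / 2" "\<bar>Im (Ln y)\<bar> < pi / 2" using Re_Ln_pos_lt xy0 x y by blast+
    then show "- pi < Im (Ln y - Ln x)" "Im (Ln y - Ln x) \<le> pi" by auto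
    show "exp (Ln y - Ln x) = y / x" using xy0 by (simp add: exp_diff)
  qed
  \<comment> \<open>Here \<open>y / x\<close> is in the upper half plane, which makes the sum \<open>\<pi>\<close> and not \<open>-\<pi>\<close>.\<close>
  have "Ln (- (y / x)) = Ln (y / x) - \<i> * pi"
    using Ln_minus[of "y / x"] Imyx xy0 by simp
  then have base: "Im (log_dir (s0, s0 - \<eta> + 1) - log_dir (s0 - \<eta>, s0)) = pi"
    using 1 2 Lnyx by (simp add: algebra_simps complex_eq_iff)

  let ?F = "\<lambda>x. log_dir (snd x, fst x + 1) - log_dir (fst x, snd x)"
  have "?F (s, t) = ?F (s0 - \<eta>, s0)"
  proof (rule exp_constant_imp_constant[of strip ?F "-1"])
    show "connected strip" by (rule convex_connected[OF convex_strip])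
    show "continuous_on strip ?F"
    proof (rule continuous_on_diff)
      show "continuous_on strip (\<lambda>x. log_dir (snd x, fst x + 1))"
        by (rule continuous_log_dir) (auto simp: strip_def intro!: continuous_intros)
      show "continuous_on strip (\<lambda>x. log_dir (fst x, snd x))"
        by (rule continuous_log_dir) (auto simp: strip_def intro!: continuous_intros)
    qed
    fix x assume "x \<in> strip"
    then have x: "fst x < snd x" "snd x < fst x + 1" by (auto simp: strip_def)
    have ne: "q (snd x) - q (fst x) \<noteq> 0" using log_dir(2)[OF x] by simp
    have "q (fst x) - q (snd x) = exp (log_dir (snd x, fst x + 1))"
      using log_dir(2)[of "snd x" "fst x + 1"] x by (simp add: N0)
    then have "exp (?F x) = (q (fst x) - q (snd x)) / (q (snd x) - q (fst x))"
      using log_dir(2)[OF x] by (simp add: exp_diff)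
    also have "\<dots> = -1" using ne by (simp add: divide_eq_eq)
    finally show "exp (?F x) = -1" .
  qed (use assms \<eta> in \<open>auto simp: strip_def\<close>)
  then show ?thesis using base unfolding angle_def by (simp add: algebra_simps complex_eq_iff)
qed

lemma angle_shift:
  assumes "s < t" "t < s + 1"
  shows "angle (s + of_int k) (t + of_int k) = angle s t + 2 * pi * of_int k"
proof -
  have step: "angle (s + 1) (t + 1) = angle s t + 2 * pi" if "s < t" "t < s + 1" for s t
    using angle_swap[OF that] angle_swap[of t "s + 1"] that by simp
  show ?thesis
  proof (induction k rule: int_induct[where k = 0])
    case (step1 i)
    then show ?case using step[of "s + of_int i" "t + of_int i"] assms by (simp add: algebra_simps)
  next
    case (step2 i)
    then show ?case using step[of "s + of_int (i - 1)" "t + of_int (i - 1)"] assms by (simp add: algebra_simps)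
  qed simp
qed

end

section \<open>Cyclic order and turning angles\<close>

context ngon_loop begin

definition lifts :: "complex \<Rightarrow> complex \<Rightarrow> complex \<Rightarrow> real \<Rightarrow> real \<Rightarrow> real \<Rightarrow> bool" where
  "lifts x y z a b d \<longleftrightarrow> a < b \<and> b < d \<and> d < a + 1 \<and> q a = x \<and> q b = y \<and> q d = z"

definition cyc3 :: "complex \<Rightarrow> complex \<Rightarrow> complex \<Rightarrow> bool" where
  "cyc3 x y z \<longleftrightarrow> (\<exists>a b d. lifts x y z a b d)"

lemma q_eq_imp_shift: "q s = q t \<Longrightarrow> \<exists>k::int. t = s + of_int k"
proof -
  assume "q s = q t"
  then have "frac s = frac t" by (rule q_frac)
  then have "t = s + of_int (\<lfloor>t\<rfloor> - \<lfloor>s\<rfloor>)" by (simp add: frac_def)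
  then show ?thesis by blast
qed

lemma q_shift: "q (s + of_int k) = q s" by (rule periodic_path_add_int[OF N0])

lemma q_eq_in_period:
  assumes "q s = q t" "a < s" "s < a + 1" "a < t" "t < a + 1" shows "s = t"
  using q_inj[of s t] q_inj[of t s] assms by (cases "s \<le> t") auto

lemma point_lift:
  assumes "y \<in> range q" "y \<noteq> q a"
  obtains b where "a < b" "b < a + 1" "q b = y"
proof -
  obtain s where s: "y = q s" using assms(1) by blast
  define b where "b = s + of_int (- \<lfloor>s - a\<rfloor>)"
  have qb: "q b = y" unfolding b_def s by (rule q_shift)
  then have "b \<noteq> a" using assms(2) by blast
  moreover have "a \<le> b" "b < a + 1" unfolding b_def by linarith+
  ultimately show ?thesis using that[of b] qb by linarith
qed

lemma lifts_shift: "lifts x y z a b d \<Longrightarrow> lifts x y z (a + of_int k) (b + of_int k) (d + of_int k)"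
  by (simp add: lifts_def N0)

lemma lifts_unique:
  assumes "lifts x y z a b d" "lifts x y z a' b' d'"
  obtains k :: int where "a' = a + of_int k" "b' = b + of_int k" "d' = d + of_int k"
proof -
  have "q a = q a'" using assms by (simp add: lifts_def)
  then obtain k :: int where k: "a' = a + of_int k" using q_eq_imp_shift by blast
  have l: "lifts x y z a' (b + of_int k) (d + of_int k)" using lifts_shift[OF assms(1), of k] k by simp
  have "b' = b + of_int k"
    by (rule q_eq_in_period[of _ _ a']) (use l assms(2) in \<open>auto simp: lifts_def\<close>)
  moreover have "d' = d + of_int k"
    by (rule q_eq_in_period[of _ _ a']) (use l assms(2) in \<open>auto simp: lifts_def\<close>)
  ultimately show ?thesis using that k by blast
qed

lemma lifts_rotate: "lifts x y z a b d \<Longrightarrow> lifts y z x b d (a + 1)"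
  by (auto simp: lifts_def N0)

lemma cyc3_rotate: "cyc3 x y z \<Longrightarrow> cyc3 y z x"
  unfolding cyc3_def using lifts_rotate by blast

lemma cyc3_from:
  assumes "cyc3 x y z" "q a = x"
  obtains b d where "lifts x y z a b d"
proof -
  obtain a' b d where l: "lifts x y z a' b d" using assms(1) unfolding cyc3_def by blast
  then have "q a' = q a" using assms(2) by (simp add: lifts_def)
  then obtain k :: int where "a = a' + of_int k" using q_eq_imp_shift by blast
  then show ?thesis using that lifts_shift[OF l, of k] by blast
qed

lemma cyc3_total:
  assumes "x \<in> range q" "y \<in> range q" "z \<in> range q" "x \<noteq> y" "y \<noteq> z" "x \<noteq> z"
  shows "cyc3 x y z \<or> cyc3 x z y"
proof -
  obtain a where a: "x = q a" using assms(1) by blast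
  obtain b where b: "a < b" "b < a + 1" "q b = y" by (rule point_lift[OF assms(2), of a]) (use a assms in auto)
  obtain d where d: "a < d" "d < a + 1" "q d = z" by (rule point_lift[OF assms(3), of a]) (use a assms in auto)
  have "b \<noteq> d" using b d assms by auto
  then have "lifts x y z a b d \<or> lifts x z y a d b" using a b d unfolding lifts_def by auto
  then show ?thesis unfolding cyc3_def by blast
qed

lemma cyc3_asym: "cyc3 x y z \<Longrightarrow> \<not> cyc3 x z y"
proof
  assume "cyc3 x y z" "cyc3 x z y"
  then obtain a b d where l: "lifts x y z a b d" unfolding cyc3_def by blast
  obtain d' b' where l': "lifts x z y a d' b'"
    by (rule cyc3_from[OF \<open>cyc3 x z y\<close>, of a]) (use l in \<open>auto simp: lifts_def\<close>)
  have "b = b'" by (rule q_eq_in_period[of _ _ a]) (use l l' in \<open>auto simp: lifts_def\<close>)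
  moreover have "d = d'" by (rule q_eq_in_period[of _ _ a]) (use l l' in \<open>auto simp: lifts_def\<close>)
  ultimately show False using l l' by (simp add: lifts_def)
qed

lemma cyc3_range: "cyc3 x y z \<Longrightarrow> x \<in> range q \<and> y \<in> range q \<and> z \<in> range q"
  by (auto simp: cyc3_def lifts_def)

text \<open>The constants \<open>c\<close> and \<open>L\<close> translate between distances of points and distances of parameters.\<close>

lemma bi_Lipschitz:
  obtains c L where "c > 0" "L > 0" "\<And>s t. cmod (q t - q s) \<le> L * \<bar>t - s\<bar>"
    "\<And>s t. s \<le> t \<Longrightarrow> t \<le> s + 1 \<Longrightarrow> c * min (t - s) (1 - (t - s)) \<le> cmod (q t - q s)"
proof -
  obtain c where c: "c > 0"
    "\<And>s t. s \<le> t \<Longrightarrow> t \<le> s + 1 \<Longrightarrow> c * min (t - s) (1 - (t - s)) \<le> cmod (q t - q s)"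
    by (rule periodic_path_lower_bound[OF N3 simple]) (rule that)
  obtain M where M: "\<And>k. cmod (cyc_vertex N v k) \<le> M" using cyc_vertex_bounded[OF N0] by metis
  have "cmod (q t - q s) \<le> (\<bar>2 * M * real N\<bar> + 1) * \<bar>t - s\<bar>" for s t
  proof -
    have "cmod (q t - q s) \<le> 2 * M * real N * \<bar>t - s\<bar>" by (rule periodic_path_Lipschitz[OF M N0])
    also have "\<dots> \<le> (\<bar>2 * M * real N\<bar> + 1) * \<bar>t - s\<bar>" by (rule mult_right_mono) auto
    finally show ?thesis .
  qed
  then show ?thesis using that[OF c(1) _ _ c(2), of "\<bar>2 * M * real N\<bar> + 1"] by simp
qed

lemma near_param:
  assumes c: "c > 0" "\<And>s t. s \<le> t \<Longrightarrow> t \<le> s + 1 \<Longrightarrow> c * min (t - s) (1 - (t - s)) \<le> cmod (q t - q s)"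
    and z: "z \<in> range q"
  obtains t where "q t = z" "c * \<bar>t - b\<bar> \<le> cmod (z - q b)"
proof (cases "z = q b")
  case True
  then show ?thesis using that[of b] by simp
next
  case False
  obtain t where t: "b < t" "t < b + 1" "q t = z" by (rule point_lift[OF z False])
  have le: "c * min (t - b) (1 - (t - b)) \<le> cmod (z - q b)" using c(2)[of b t] t by simp
  show ?thesis
  proof (cases "t - b \<le> 1 - (t - b)")
    case True
    then show ?thesis using that[of t] le t by (simp add: min_def)
  next
    case False
    then have "min (t - b) (1 - (t - b)) = \<bar>(t - 1) - b\<bar>" using t by linarith
    moreover have "q (t - 1) = z" using periodic_path_add_1[OF N0, of v "t - 1"] t by simp
    ultimately show ?thesis using that[of "t - 1"] le by simp
  qed
qed

text \<open>The parameters of \<open>z\<close> and \<open>w\<close> are so close that neither \<open>x\<close> nor \<open>y\<close> is passed between them.\<close>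

lemma cyc3_perturb:
  assumes c: "c > 0" "\<And>s t. s \<le> t \<Longrightarrow> t \<le> s + 1 \<Longrightarrow> c * min (t - s) (1 - (t - s)) \<le> cmod (q t - q s)"
    and L: "L > 0" "\<And>s t. cmod (q t - q s) \<le> L * \<bar>t - s\<bar>"
    and xyz: "cyc3 x y z" and w: "w \<in> range q"
    and near: "L * cmod (w - z) < c * cmod (z - y)" "L * cmod (w - z) < c * cmod (x - z)"
  shows "cyc3 x y w"
proof -
  obtain a b d where l: "lifts x y z a b d" using xyz unfolding cyc3_def by blast
  obtain d' where d': "q d' = w" "c * \<bar>d' - d\<bar> \<le> cmod (w - z)"
    by (rule near_param[OF c w, of d]) (use l that in \<open>auto simp: lifts_def\<close>)
  have d'': "c * L * \<bar>d' - d\<bar> \<le> L * cmod (w - z)" using mult_left_mono[OF d'(2), of L] L(1) by (simp add: ac_simps)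
  have 1: "cmod (z - y) \<le> L * (d - b)" using L(2)[of d b] l by (simp add: lifts_def)
  have 2: "cmod (x - z) \<le> L * (a + 1 - d)" using L(2)[of "a + 1" d] l by (simp add: lifts_def N0)
  have "c * cmod (z - y) \<le> c * L * (d - b)" using mult_left_mono[OF 1, of c] c(1) by (simp add: mult.assoc)
  then have "c * L * \<bar>d' - d\<bar> < c * L * (d - b)" using d'' near(1) by linarith
  then have "\<bar>d' - d\<bar> < d - b" using c(1) L(1) by simp
  moreover have "c * cmod (x - z) \<le> c * L * (a + 1 - d)" using mult_left_mono[OF 2, of c] c(1) by (simp add: mult.assoc)
  then have "c * L * \<bar>d' - d\<bar> < c * L * (a + 1 - d)" using d'' near(2) by linarith
  then have "\<bar>d' - d\<bar> < a + 1 - d" using c(1) L(1) by simp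
  ultimately have "lifts x y w a b d'" using l d'(1) unfolding lifts_def by linarith
  then show ?thesis unfolding cyc3_def by blast
qed

text \<open>For points \<open>x\<close>, \<open>y\<close>, \<open>z\<close> passed in this order, the change of direction from \<open>y - x\<close> to \<open>z - y\<close> is split
  at the diagonal \<open>z - x\<close>: first the target moves from \<open>y\<close> to \<open>z\<close>, then the source from \<open>x\<close> to \<open>y\<close>.
  Neither part depends on the choice of the parameters.\<close>

definition bend1 :: "complex \<Rightarrow> complex \<Rightarrow> complex \<Rightarrow> real" where
  "bend1 x y z = (SOME \<beta>. \<exists>a b d. lifts x y z a b d \<and> \<beta> = angle a d - angle a b)"

definition bend2 :: "complex \<Rightarrow> complex \<Rightarrow> complex \<Rightarrow> real" where
  "bend2 x y z = (SOME \<beta>. \<exists>a b d. lifts x y z a b d \<and> \<beta> = angle b d - angle a d)"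

lemma angle_shift_lifts:
  assumes "lifts x y z a b d"
  shows "angle (a + of_int k) (b + of_int k) = angle a b + 2 * pi * of_int k"
    "angle (a + of_int k) (d + of_int k) = angle a d + 2 * pi * of_int k"
    "angle (b + of_int k) (d + of_int k) = angle b d + 2 * pi * of_int k"
  using assms by (auto intro!: angle_shift simp: lifts_def)

lemma bend_lifts:
  assumes l: "lifts x y z a b d"
  shows "bend1 x y z = angle a d - angle a b" "bend2 x y z = angle b d - angle a d"
proof -
  have "\<exists>\<beta>. \<exists>a b d. lifts x y z a b d \<and> \<beta> = angle a d - angle a b" using l by blast
  from someI_ex[OF this] obtain a' b' d' where l': "lifts x y z a' b' d'" and e: "bend1 x y z = angle a' d' - angle a' b'"
    unfolding bend1_def by blast
  obtain k :: int where "a' = a + of_int k" "b' = b + of_int k" "d' = d + of_int k" by (rule lifts_unique[OF l l'])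
  then show "bend1 x y z = angle a d - angle a b" using e angle_shift_lifts[OF l, of k] by simp
next
  have "\<exists>\<beta>. \<exists>a b d. lifts x y z a b d \<and> \<beta> = angle b d - angle a d" using l by blast
  from someI_ex[OF this] obtain a' b' d' where l': "lifts x y z a' b' d'" and e: "bend2 x y z = angle b' d' - angle a' d'"
    unfolding bend2_def by blast
  obtain k :: int where "a' = a + of_int k" "b' = b + of_int k" "d' = d + of_int k" by (rule lifts_unique[OF l l'])
  then show "bend2 x y z = angle b d - angle a d" using e angle_shift_lifts[OF l, of k] by simp
qed

lemma isCont_angle_diff:
  assumes "a < b" "b < d" "d < a + 1"
  shows "isCont (\<lambda>p. angle (fst p) (snd (snd p)) - angle (fst p) (fst (snd p))) (a, b, d)"
    "isCont (\<lambda>p. angle (fst (snd p)) (snd (snd p)) - angle (fst p) (snd (snd p))) (a, b, d)"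
proof -
  define T :: "(real \<times> real \<times> real) set" where
    "T = {p. fst p < fst (snd p) \<and> fst (snd p) < snd (snd p) \<and> snd (snd p) < fst p + 1}"
  have o: "open T" unfolding T_def
    by (intro open_Collect_conj open_Collect_less continuous_on_fst continuous_on_snd continuous_on_id continuous_on_add continuous_on_const)
  have m: "(a, b, d) \<in> T" using assms by (simp add: T_def)
  have A: "continuous_on T (\<lambda>p. angle (f p) (g p))"
    if "continuous_on T f" "continuous_on T g" "\<And>p. p \<in> T \<Longrightarrow> f p < g p \<and> g p < f p + 1" for f g
    unfolding angle_def by (rule continuous_on_Im) (rule continuous_log_dir[OF that])
  have "continuous_on T (\<lambda>p. angle (fst p) (snd (snd p)) - angle (fst p) (fst (snd p)))"
    by (intro continuous_on_diff A continuous_intros) (auto simp: T_def)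
  then show "isCont (\<lambda>p. angle (fst p) (snd (snd p)) - angle (fst p) (fst (snd p))) (a, b, d)"
    using o m by (simp add: continuous_on_eq_continuous_at)
  have "continuous_on T (\<lambda>p. angle (fst (snd p)) (snd (snd p)) - angle (fst p) (snd (snd p)))"
    by (intro continuous_on_diff A continuous_intros) (auto simp: T_def)
  then show "isCont (\<lambda>p. angle (fst (snd p)) (snd (snd p)) - angle (fst p) (snd (snd p))) (a, b, d)"
    using o m by (simp add: continuous_on_eq_continuous_at)
qed

text \<open>Nearby points have nearby parameters, in the same cyclic order.\<close>

lemma bend_near:
  assumes l: "cyc3 x y z" and e: "\<epsilon> > 0"
  obtains \<delta> where "\<delta> > 0"
    "\<And>x' y' z'. x' \<in> range q \<Longrightarrow> y' \<in> range q \<Longrightarrow> z' \<in> range q \<Longrightarrow>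
      cmod (x' - x) < \<delta> \<Longrightarrow> cmod (y' - y) < \<delta> \<Longrightarrow> cmod (z' - z) < \<delta> \<Longrightarrow>
      cyc3 x' y' z' \<and> \<bar>bend1 x' y' z' - bend1 x y z\<bar> < \<epsilon> \<and> \<bar>bend2 x' y' z' - bend2 x y z\<bar> < \<epsilon>"
proof -
  obtain a b d where l: "lifts x y z a b d" using l unfolding cyc3_def by blast
  then have abd: "a < b" "b < d" "d < a + 1" "q a = x" "q b = y" "q d = z" by (auto simp: lifts_def)
  obtain c L where c: "c > 0"
    "\<And>s t. s \<le> t \<Longrightarrow> t \<le> s + 1 \<Longrightarrow> c * min (t - s) (1 - (t - s)) \<le> cmod (q t - q s)"
    using bi_Lipschitz by metis
  obtain \<eta>1 where \<eta>1: "\<eta>1 > 0" "\<And>p. dist p (a, b, d) < \<eta>1 \<Longrightarrow>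
    \<bar>(angle (fst p) (snd (snd p)) - angle (fst p) (fst (snd p))) - (angle a d - angle a b)\<bar> < \<epsilon>"
    using isCont_angle_diff(1)[OF abd(1-3)] e unfolding continuous_at_eps_delta dist_real_def fst_conv snd_conv
    by (metis dist_commute)
  obtain \<eta>2 where \<eta>2: "\<eta>2 > 0" "\<And>p. dist p (a, b, d) < \<eta>2 \<Longrightarrow>
    \<bar>(angle (fst (snd p)) (snd (snd p)) - angle (fst p) (snd (snd p))) - (angle b d - angle a d)\<bar> < \<epsilon>"
    using isCont_angle_diff(2)[OF abd(1-3)] e unfolding continuous_at_eps_delta dist_real_def fst_conv snd_conv
    by (metis dist_commute)
  define \<eta> where "\<eta> = min (min \<eta>1 \<eta>2) (min (b - a) (min (d - b) (a + 1 - d)))"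
  have \<eta>: "\<eta> > 0" unfolding \<eta>_def using abd \<eta>1 \<eta>2 by simp
  show ?thesis
  proof (rule that[of "c * \<eta> / 4"])
    show "c * \<eta> / 4 > 0" using c \<eta> by simp
    fix x' y' z' assume r: "x' \<in> range q" "y' \<in> range q" "z' \<in> range q"
      and n: "cmod (x' - x) < c * \<eta> / 4" "cmod (y' - y) < c * \<eta> / 4" "cmod (z' - z) < c * \<eta> / 4"
    obtain a' where a': "q a' = x'" "c * \<bar>a' - a\<bar> \<le> cmod (x' - q a)" by (rule near_param[OF c r(1)])
    obtain b' where b': "q b' = y'" "c * \<bar>b' - b\<bar> \<le> cmod (y' - q b)" by (rule near_param[OF c r(2)])
    obtain d' where d': "q d' = z'" "c * \<bar>d' - d\<bar> \<le> cmod (z' - q d)" by (rule near_param[OF c r(3)])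
    have "c * \<bar>a' - a\<bar> < c * (\<eta> / 4)" "c * \<bar>b' - b\<bar> < c * (\<eta> / 4)" "c * \<bar>d' - d\<bar> < c * (\<eta> / 4)"
      using a' b' d' n abd by auto
    then have cl: "\<bar>a' - a\<bar> < \<eta> / 4" "\<bar>b' - b\<bar> < \<eta> / 4" "\<bar>d' - d\<bar> < \<eta> / 4" using c(1) by auto
    have ab: "\<eta> \<le> b - a" "\<eta> \<le> d - b" "\<eta> \<le> a + 1 - d" "\<eta> \<le> \<eta>1" "\<eta> \<le> \<eta>2" unfolding \<eta>_def by auto
    have "a' < b'" "b' < d'" "d' < a' + 1" using cl ab \<eta> by linarith+
    then have l': "lifts x' y' z' a' b' d'" unfolding lifts_def using a' b' d' by simp
    have "dist (a', b', d') (a, b, d) \<le> \<bar>a' - a\<bar> + (\<bar>b' - b\<bar> + \<bar>d' - d\<bar>)"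
    proof -
      have "dist (a', b', d') (a, b, d) \<le> dist a' a + dist (b', d') (b, d)"
        unfolding dist_Pair_Pair[of a' "(b', d')"] by (rule sqrt_sum_squares_le_sum) auto
      also have "dist (b', d') (b, d) \<le> dist b' b + dist d' d"
        unfolding dist_Pair_Pair[of b' d'] by (rule sqrt_sum_squares_le_sum) auto
      finally show ?thesis by (simp add: dist_real_def)
    qed
    then have "dist (a', b', d') (a, b, d) < \<eta>1" "dist (a', b', d') (a, b, d) < \<eta>2" using cl ab \<eta> by linarith+
    from \<eta>1(2)[OF this(1)] \<eta>2(2)[OF this(2)] l'
    show "cyc3 x' y' z' \<and> \<bar>bend1 x' y' z' - bend1 x y z\<bar> < \<epsilon> \<and> \<bar>bend2 x' y' z' - bend2 x y z\<bar> < \<epsilon>"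
      unfolding bend_lifts[OF l] bend_lifts[OF l'] cyc3_def by auto
  qed
qed

lemma exp_bend:
  assumes l: "lifts x y z a b d"
  shows "exp (log_dir (a, d) - log_dir (a, b)) = (z - x) / (y - x)"
    "exp (log_dir (b, d) - log_dir (a, d)) = (z - y) / (z - x)"
    "exp (log_dir (b, d) - log_dir (a, b)) = (z - y) / (y - x)"
  using log_dir(2)[of a b] log_dir(2)[of a d] log_dir(2)[of b d] l by (auto simp: exp_diff lifts_def)

text \<open>If \<open>y\<close> and \<open>z\<close> are close compared to \<open>x\<close>, the polygon between them stays close to \<open>y\<close>, and seen from \<open>x\<close>
  the direction never deviates from \<open>y - x\<close> by a right angle.\<close>

lemma bend1_near:
  assumes c: "c > 0" "\<And>s t. s \<le> t \<Longrightarrow> t \<le> s + 1 \<Longrightarrow> c * min (t - s) (1 - (t - s)) \<le> cmod (q t - q s)"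
    and L: "L > 0" "\<And>s t. cmod (q t - q s) \<le> L * \<bar>t - s\<bar>"
    and xyz: "cyc3 x y z" and near: "L * cmod (z - y) < c * cmod (y - x)"
  shows "\<bar>bend1 x y z\<bar> < pi / 2"
proof -
  obtain a b d where l: "lifts x y z a b d" using xyz unfolding cyc3_def by blast
  then have abd: "a < b" "b < d" "d < a + 1" "q a = x" "q b = y" "q d = z" by (auto simp: lifts_def)
  have "0 < c * cmod (y - x)" by (rule le_less_trans[OF _ near]) (use L(1) in simp)
  then have ne: "y - x \<noteq> 0" by auto
  have yx: "cmod (y - x) \<le> L * (b - a)" using L(2)[of b a] abd by simp
  have db: "c * (d - b) \<le> cmod (z - y)"
  proof (rule ccontr)
    assume "\<not> ?thesis"
    moreover have "c * min (d - b) (1 - (d - b)) \<le> cmod (z - y)" using c(2)[of b d] abd by simp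
    ultimately have "c * (1 - (d - b)) \<le> cmod (z - y)" by (auto simp: min_def split: if_splits)
    moreover have "c * (b - a) \<le> c * (1 - (d - b))" using abd c(1) by (intro mult_left_mono) auto
    ultimately have "c * (b - a) \<le> cmod (z - y)" by linarith
    then have "L * (c * (b - a)) \<le> L * cmod (z - y)" by (rule mult_left_mono) (use L(1) in simp)
    moreover have "c * cmod (y - x) \<le> c * (L * (b - a))" by (rule mult_left_mono[OF yx]) (use c(1) in simp)
    moreover have "L * (c * (b - a)) = c * (L * (b - a))" by (simp only: ac_simps)
    ultimately show False using near by linarith
  qed
  have pos: "0 < Re ((q t - x) / (y - x))" if t: "t \<in> {b..d}" for t
  proof -
    have "c * cmod (q t - y) \<le> c * (L * (d - b))"
      using L(2)[of t b] t abd L(1) c(1) by (intro mult_left_mono order_trans[OF L(2)[of t b, unfolded abd]]) auto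
    also have "\<dots> \<le> L * cmod (z - y)" using mult_left_mono[OF db, of L] L(1) by (simp add: ac_simps)
    also note near
    finally have "cmod (q t - y) < cmod (y - x)" using c(1) by simp
    then have "cmod ((q t - y) / (y - x)) < 1" using ne by (simp add: norm_divide)
    moreover have "(q t - x) / (y - x) = 1 + (q t - y) / (y - x)" using ne by (simp add: field_simps)
    ultimately show ?thesis using abs_Re_le_cmod[of "(q t - y) / (y - x)"] by simp
  qed
  let ?G = "\<lambda>t. log_dir (a, t) - Ln ((q t - x) / (y - x))"
  have "?G d = ?G b"
  proof (rule exp_constant_imp_constant[of "{b..d}" ?G "y - x"])
    have np: "(q t - x) / (y - x) \<notin> \<real>\<^sub>\<le>\<^sub>0" if "t \<in> {b..d}" for t
      using pos[OF that] by (meson complex_nonpos_Reals_iff not_le)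
    have "continuous_on {b..d} (\<lambda>t. log_dir (a, t))"
      by (rule continuous_log_dir[OF continuous_on_const continuous_on_id]) (use abd in auto)
    moreover have "continuous_on {b..d} (\<lambda>t. (q t - x) / (y - x))"
      by (intro continuous_on_divide continuous_on_diff continuous_on_const continuous_q continuous_on_id) (use ne in auto)
    ultimately show "continuous_on {b..d} ?G" by (intro continuous_on_diff continuous_on_Ln' np)
    fix t assume t: "t \<in> {b..d}"
    have "(q t - x) / (y - x) \<noteq> 0" using pos[OF t] by auto
    then have "exp (?G t) = (q t - x) / ((q t - x) / (y - x))"
      using log_dir(2)[of a t] t abd by (simp add: exp_diff)
    then show "exp (?G t) = y - x" using \<open>(q t - x) / (y - x) \<noteq> 0\<close> by simp
  qed (use abd in auto)
  then have "log_dir (a, d) - log_dir (a, b) = Ln ((z - x) / (y - x))" using ne abd by (simp add: algebra_simps)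
  then have "bend1 x y z = Im (Ln ((z - x) / (y - x)))"
    unfolding bend_lifts(1)[OF l] angle_def by (metis minus_complex.sel(2))
  moreover have "0 < Re ((z - x) / (y - x))" using pos[of d] abd by simp
  moreover from this have "(z - x) / (y - x) \<noteq> 0" by auto
  ultimately show ?thesis using Re_Ln_pos_lt by metis
qed

lemma bend2_near:
  assumes c: "c > 0" "\<And>s t. s \<le> t \<Longrightarrow> t \<le> s + 1 \<Longrightarrow> c * min (t - s) (1 - (t - s)) \<le> cmod (q t - q s)"
    and L: "L > 0" "\<And>s t. cmod (q t - q s) \<le> L * \<bar>t - s\<bar>"
    and xyz: "cyc3 x y z" and near: "L * cmod (y - x) < c * cmod (z - y)"
  shows "\<bar>bend2 x y z\<bar> < pi / 2"
proof -
  obtain a b d where l: "lifts x y z a b d" using xyz unfolding cyc3_def by blast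
  then have abd: "a < b" "b < d" "d < a + 1" "q a = x" "q b = y" "q d = z" by (auto simp: lifts_def)
  have "0 < c * cmod (z - y)" by (rule le_less_trans[OF _ near]) (use L(1) in simp)
  then have ne: "z - y \<noteq> 0" by auto
  have zy: "cmod (z - y) \<le> L * (d - b)" using L(2)[of d b] abd by simp
  have ba: "c * (b - a) \<le> cmod (y - x)"
  proof (rule ccontr)
    assume "\<not> ?thesis"
    moreover have "c * min (b - a) (1 - (b - a)) \<le> cmod (y - x)" using c(2)[of a b] abd by simp
    ultimately have "c * (1 - (b - a)) \<le> cmod (y - x)" by (auto simp: min_def split: if_splits)
    moreover have "c * (d - b) \<le> c * (1 - (b - a))" using abd c(1) by (intro mult_left_mono) auto
    ultimately have "c * (d - b) \<le> cmod (y - x)" by linarith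
    then have "L * (c * (d - b)) \<le> L * cmod (y - x)" by (rule mult_left_mono) (use L(1) in simp)
    moreover have "c * cmod (z - y) \<le> c * (L * (d - b))" by (rule mult_left_mono[OF zy]) (use c(1) in simp)
    moreover have "L * (c * (d - b)) = c * (L * (d - b))" by (simp only: ac_simps)
    ultimately show False using near by linarith
  qed
  have pos: "0 < Re ((z - q t) / (z - y))" if t: "t \<in> {a..b}" for t
  proof -
    have "c * cmod (q t - y) \<le> c * (L * (b - a))"
      using L(2)[of t b] t abd L(1) c(1) by (intro mult_left_mono order_trans[OF L(2)[of t b, unfolded abd]]) auto
    also have "\<dots> \<le> L * cmod (y - x)" using mult_left_mono[OF ba, of L] L(1) by (simp add: ac_simps)
    also note near
    finally have "cmod (q t - y) < cmod (z - y)" using c(1) by simp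
    then have "cmod ((q t - y) / (z - y)) < 1" using ne by (simp add: norm_divide)
    moreover have "(z - q t) / (z - y) = 1 - (q t - y) / (z - y)" using ne by (simp add: field_simps)
    ultimately show ?thesis using abs_Re_le_cmod[of "(q t - y) / (z - y)"] by simp
  qed
  let ?G = "\<lambda>t. log_dir (t, d) - Ln ((z - q t) / (z - y))"
  have "?G b = ?G a"
  proof (rule exp_constant_imp_constant[of "{a..b}" ?G "z - y"])
    have np: "(z - q t) / (z - y) \<notin> \<real>\<^sub>\<le>\<^sub>0" if "t \<in> {a..b}" for t
      using pos[OF that] by (meson complex_nonpos_Reals_iff not_le)
    have "continuous_on {a..b} (\<lambda>t. log_dir (t, d))"
      by (rule continuous_log_dir[OF continuous_on_id continuous_on_const]) (use abd in auto)
    moreover have "continuous_on {a..b} (\<lambda>t. (z - q t) / (z - y))"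
      by (intro continuous_on_divide continuous_on_diff continuous_on_const continuous_q continuous_on_id) (use ne in auto)
    ultimately show "continuous_on {a..b} ?G" by (intro continuous_on_diff continuous_on_Ln' np)
    fix t assume t: "t \<in> {a..b}"
    have "(z - q t) / (z - y) \<noteq> 0" using pos[OF t] by auto
    then have "exp (?G t) = (z - q t) / ((z - q t) / (z - y))"
      using log_dir(2)[of t d] t abd by (simp add: exp_diff)
    then show "exp (?G t) = z - y" using \<open>(z - q t) / (z - y) \<noteq> 0\<close> by simp
  qed (use abd in auto)
  then have "log_dir (b, d) - log_dir (a, d) = - Ln ((z - x) / (z - y))" using ne abd by (simp add: algebra_simps)
  then have "bend2 x y z = - Im (Ln ((z - x) / (z - y)))"
    unfolding bend_lifts(2)[OF l] angle_def by (metis minus_complex.sel(2) uminus_complex.sel(2))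
  moreover have "0 < Re ((z - x) / (z - y))" using pos[of a] abd by simp
  moreover from this have "(z - x) / (z - y) \<noteq> 0" by auto
  ultimately show ?thesis using Re_Ln_pos_lt by (metis abs_minus_cancel)
qed

end

section \<open>Global components are graceful\<close>

lemma sin_neg_constant_sign:
  fixes f :: "'a::topological_space \<Rightarrow> real"
  assumes "connected D" "continuous_on D f" "\<And>p. p \<in> D \<Longrightarrow> sin (f p) < 0"
    and p0: "p0 \<in> D" "\<bar>f p0\<bar> < pi / 2" and p: "p \<in> D"
  shows "f p < 0"
proof (rule ccontr)
  assume "\<not> f p < 0"
  have "f p0 < 0"
  proof (rule ccontr)
    assume "\<not> f p0 < 0"
    then have "sin (f p0) \<ge> 0" using p0(2) pi_gt_zero by (intro sin_ge_zero) auto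
    then show False using assms(3)[OF p0(1)] by simp
  qed
  have "{f p0..f p} \<subseteq> f ` D"
    by (rule connected_contains_Icc[OF connected_continuous_image[OF assms(2,1)]]) (use p0 p in auto)
  then have "0 \<in> f ` D" using \<open>f p0 < 0\<close> \<open>\<not> f p < 0\<close> by (meson atLeastAtMost_iff less_imp_le not_le subsetD)
  then show False using assms(3) by force
qed

context ngon_loop begin

abbreviation "Ins \<equiv> inscribed (polygon_path N v)"

lemma cyc3_constant:
  fixes x y z :: "'a::topological_space \<Rightarrow> complex"
  assumes C: "connected C" and cont: "continuous_on C x" "continuous_on C y" "continuous_on C z"
    and rng: "\<And>p. p \<in> C \<Longrightarrow> x p \<in> range q \<and> y p \<in> range q \<and> z p \<in> range q"
    and dist: "\<And>p. p \<in> C \<Longrightarrow> x p \<noteq> y p \<and> y p \<noteq> z p \<and> x p \<noteq> z p"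
    and pp: "p \<in> C" "p' \<in> C" and cyc: "cyc3 (x p) (y p) (z p)"
  shows "cyc3 (x p') (y p') (z p')"
proof (rule connected_induction_simple[OF C pp, where P = "\<lambda>p. cyc3 (x p) (y p) (z p)"])
  fix a assume a: "a \<in> C"
  define nb where "nb = (\<lambda>\<delta>. (C \<inter> x -` ball (x a) \<delta>) \<inter> (C \<inter> y -` ball (y a) \<delta>) \<inter> (C \<inter> z -` ball (z a) \<delta>))"
  have nb: "openin (top_of_set C) (nb \<delta>)" for \<delta>
    unfolding nb_def by (intro openin_Int continuous_openin_preimage_gen cont open_ball)
  have anb: "a \<in> nb \<delta>" if "\<delta> > 0" for \<delta> using a that by (simp add: nb_def)
  have nbD: "p \<in> C \<and> cmod (x p - x a) < \<delta> \<and> cmod (y p - y a) < \<delta> \<and> cmod (z p - z a) < \<delta>" if "p \<in> nb \<delta>" for p \<delta>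
    using that by (auto simp: nb_def dist_norm norm_minus_commute)
  show "\<exists>T. openin (top_of_set C) T \<and> a \<in> T \<and>
      (\<forall>p\<in>T. \<forall>p'\<in>T. cyc3 (x p) (y p) (z p) \<longrightarrow> cyc3 (x p') (y p') (z p'))"
  proof (cases "cyc3 (x a) (y a) (z a)")
    case True
    obtain \<delta> where \<delta>: "\<delta> > 0" "\<And>x' y' z'. x' \<in> range q \<Longrightarrow> y' \<in> range q \<Longrightarrow> z' \<in> range q \<Longrightarrow>
      cmod (x' - x a) < \<delta> \<Longrightarrow> cmod (y' - y a) < \<delta> \<Longrightarrow> cmod (z' - z a) < \<delta> \<Longrightarrow> cyc3 x' y' z'"
      by (rule bend_near[OF True zero_less_one]) blast
    have "cyc3 (x p) (y p) (z p)" if "p \<in> nb \<delta>" for p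
      using nbD[OF that] rng by (intro \<delta>(2)) auto
    then show ?thesis using nb anb[OF \<delta>(1)] by blast
  next
    case False
    then have F: "cyc3 (x a) (z a) (y a)" using cyc3_total rng[OF a] dist[OF a] by blast
    obtain \<delta> where \<delta>: "\<delta> > 0" "\<And>x' y' z'. x' \<in> range q \<Longrightarrow> y' \<in> range q \<Longrightarrow> z' \<in> range q \<Longrightarrow>
      cmod (x' - x a) < \<delta> \<Longrightarrow> cmod (y' - z a) < \<delta> \<Longrightarrow> cmod (z' - y a) < \<delta> \<Longrightarrow> cyc3 x' y' z'"
      by (rule bend_near[OF F zero_less_one]) blast
    have "\<not> cyc3 (x p) (y p) (z p)" if "p \<in> nb \<delta>" for p
    proof -
      have "cyc3 (x p) (z p) (y p)" using nbD[OF that] rng by (intro \<delta>(2)) auto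
      then show ?thesis by (rule cyc3_asym)
    qed
    then show ?thesis using nb anb[OF \<delta>(1)] by blast
  qed
qed (rule cyc)

lemma continuous_on_bend:
  fixes x y z :: "'a::topological_space \<Rightarrow> complex"
  assumes cont: "continuous_on C x" "continuous_on C y" "continuous_on C z"
    and cyc: "\<And>p. p \<in> C \<Longrightarrow> cyc3 (x p) (y p) (z p)"
  shows "continuous_on C (\<lambda>p. bend1 (x p) (y p) (z p))" "continuous_on C (\<lambda>p. bend2 (x p) (y p) (z p))"
proof -
  have "\<forall>\<^sub>F p' in at p within C. \<bar>bend1 (x p') (y p') (z p') - bend1 (x p) (y p) (z p)\<bar> < \<epsilon> \<and>
      \<bar>bend2 (x p') (y p') (z p') - bend2 (x p) (y p) (z p)\<bar> < \<epsilon>" if p: "p \<in> C" and e: "\<epsilon> > 0" for p \<epsilon>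
  proof -
    obtain \<delta> where \<delta>: "\<delta> > 0" "\<And>x' y' z'. x' \<in> range q \<Longrightarrow> y' \<in> range q \<Longrightarrow> z' \<in> range q \<Longrightarrow>
      cmod (x' - x p) < \<delta> \<Longrightarrow> cmod (y' - y p) < \<delta> \<Longrightarrow> cmod (z' - z p) < \<delta> \<Longrightarrow>
      cyc3 x' y' z' \<and> \<bar>bend1 x' y' z' - bend1 (x p) (y p) (z p)\<bar> < \<epsilon> \<and> \<bar>bend2 x' y' z' - bend2 (x p) (y p) (z p)\<bar> < \<epsilon>"
      by (rule bend_near[OF cyc[OF p] e]) (rule that)
    have n: "\<forall>\<^sub>F p' in at p within C. cmod (f p' - f p) < \<delta>" if "continuous_on C f" for f
      using tendstoD[OF that[unfolded continuous_on_def, rule_format, OF p] \<delta>(1)] by (simp add: dist_norm)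
    have m: "\<forall>\<^sub>F p' in at p within C. p' \<in> C" by (simp add: eventually_at_filter)
    show ?thesis
      using n[OF cont(1)] n[OF cont(2)] n[OF cont(3)] m
    proof eventually_elim
      case (elim p')
      then show ?case using \<delta>(2)[of "x p'" "y p'" "z p'"] cyc3_range[OF cyc, of p'] by simp
    qed
  qed note ev = this
  show "continuous_on C (\<lambda>p. bend1 (x p) (y p) (z p))" unfolding continuous_on_def
  proof (intro ballI tendstoI)
    fix p \<epsilon> assume "p \<in> C" "(\<epsilon>::real) > 0"
    from ev[OF this] show "\<forall>\<^sub>F p' in at p within C. dist (bend1 (x p') (y p') (z p')) (bend1 (x p) (y p) (z p)) < \<epsilon>"
      by eventually_elim (simp add: dist_real_def)
  qed
  show "continuous_on C (\<lambda>p. bend2 (x p) (y p) (z p))" unfolding continuous_on_def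
  proof (intro ballI tendstoI)
    fix p \<epsilon> assume "p \<in> C" "(\<epsilon>::real) > 0"
    from ev[OF this] show "\<forall>\<^sub>F p' in at p within C. dist (bend2 (x p') (y p') (z p')) (bend2 (x p) (y p) (z p)) < \<epsilon>"
      by eventually_elim (simp add: dist_real_def)
  qed
qed

abbreviation v0 :: "quad \<Rightarrow> complex" where "v0 R \<equiv> fst R"
abbreviation v1 :: "quad \<Rightarrow> complex" where "v1 R \<equiv> fst (snd R)"
abbreviation v2 :: "quad \<Rightarrow> complex" where "v2 R \<equiv> fst (snd (snd R))"
abbreviation v3 :: "quad \<Rightarrow> complex" where "v3 R \<equiv> snd (snd (snd R))"

text \<open>Only the first three vertices are recorded; the other triples of consecutive vertices arise by
  relabeling.\<close>

definition forward :: "quad \<Rightarrow> bool" where "forward R \<longleftrightarrow> cyc3 (v0 R) (v1 R) (v2 R)"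
definition backward :: "quad \<Rightarrow> bool" where "backward R \<longleftrightarrow> cyc3 (v2 R) (v1 R) (v0 R)"
text \<open>The turning angle of the polygon \<open>R\<^sub>3 R\<^sub>2 R\<^sub>1 R\<^sub>0\<close> at \<open>R\<^sub>1\<close>.\<close>

definition turn :: "quad \<Rightarrow> real" where
  "turn R = bend1 (v2 R) (v1 R) (v0 R) + bend2 (v2 R) (v1 R) (v0 R)"

lemma inscribed_quad_of:
  assumes "R \<in> Ins"
  obtains z w r where "w \<noteq> 0" "r > 0" "R = quad_of z w r" "aspect_ratio R = r"
proof -
  obtain z w r where R: "w \<noteq> 0" "r > 0" "R = quad_of z w r"
    by (rule rectangleE[OF inscribed_rect[OF assms]]) (rule that)
  then show ?thesis using that rectangle_quad_of(2)[OF R(1,2)] by simp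
qed

lemma vertices_in_range:
  assumes "R \<in> Ins" shows "v0 R \<in> range q" "v1 R \<in> range q" "v2 R \<in> range q" "v3 R \<in> range q"
proof -
  obtain R0 R1 R2 R3 where R: "R = (R0, R1, R2, R3)" by (metis prod_cases4)
  have "vertices R \<subseteq> range q" using assms unfolding inscribed_def path_image_polygon[OF N0] by simp
  then show "v0 R \<in> range q" "v1 R \<in> range q" "v2 R \<in> range q" "v3 R \<in> range q" unfolding R by auto
qed

lemma vertices_distinct:
  assumes "R \<in> Ins" shows "v0 R \<noteq> v1 R" "v1 R \<noteq> v2 R" "v0 R \<noteq> v2 R"
proof -
  obtain z w r where R: "w \<noteq> 0" "r > 0" "R = quad_of z w r" by (rule inscribed_quad_of[OF assms])
  have "w + r *\<^sub>R (\<i> * w) = (1 + r *\<^sub>R \<i>) * w" by (simp add: algebra_simps scaleR_conv_of_real)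
  moreover have "1 + r *\<^sub>R \<i> \<noteq> 0" by (simp add: complex_eq_iff)
  ultimately have "w + r *\<^sub>R (\<i> * w) \<noteq> 0" using R by simp
  then show "v0 R \<noteq> v1 R" "v1 R \<noteq> v2 R" "v0 R \<noteq> v2 R" using R by (auto simp: quad_of_def add.assoc)
qed

lemma backward_iff:
  assumes "R \<in> Ins" shows "backward R \<longleftrightarrow> \<not> forward R"
proof
  assume "backward R"
  then have "cyc3 (v0 R) (v2 R) (v1 R)" unfolding backward_def by (rule cyc3_rotate[OF cyc3_rotate])
  then show "\<not> forward R" unfolding forward_def by (rule cyc3_asym)
next
  assume "\<not> forward R"
  then have "cyc3 (v0 R) (v2 R) (v1 R)"
    unfolding forward_def using cyc3_total[OF vertices_in_range(1-3)[OF assms] vertices_distinct[OF assms]] by simp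
  then show "backward R" unfolding backward_def by (rule cyc3_rotate)
qed

lemma continuous_on_vertices: "continuous_on S v0" "continuous_on S v1" "continuous_on S v2" "continuous_on S v3"
  by (intro continuous_intros)+

lemma forward_constant:
  assumes "connected C" "C \<subseteq> Ins" "R \<in> C" "S \<in> C" "forward R" shows "forward S"
  using assms(5) unfolding forward_def
  by (rule cyc3_constant[OF assms(1) continuous_on_vertices(1-3) _ _ assms(3,4), rotated -1])
     (use assms(2) vertices_in_range vertices_distinct in auto)

lemma forward_iff: "connected C \<Longrightarrow> C \<subseteq> Ins \<Longrightarrow> R \<in> C \<Longrightarrow> S \<in> C \<Longrightarrow> forward R \<longleftrightarrow> forward S"
  using forward_constant by blast

lemma forward_imp_cyclically_ordered:
  assumes "forward R" "forward (relabel (relabel R))"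
  shows "cyclically_ordered (polygon_path N v) R"
proof -
  obtain R0 R1 R2 R3 where R: "R = (R0, R1, R2, R3)" by (metis prod_cases4)
  obtain s0 s1 s2 where s: "lifts R0 R1 R2 s0 s1 s2" using assms(1) unfolding forward_def cyc3_def R by auto
  have "cyc3 R2 R3 R0" using assms(2) unfolding forward_def R by simp
  then obtain s3 e where e: "lifts R2 R3 R0 s2 s3 e" by (rule cyc3_from[of _ _ _ s2]) (use s in \<open>auto simp: lifts_def\<close>)
  have "e = s0 + 1" by (rule q_eq_in_period[of _ _ s2]) (use s e in \<open>auto simp: lifts_def N0\<close>)
  then show ?thesis unfolding R cyclically_ordered.simps polygon_path_frac[OF N0]
    using s e unfolding lifts_def by blast
qed

lemma turn_lifts: "lifts (v2 R) (v1 R) (v0 R) a b d \<Longrightarrow> turn R = angle b d - angle a b"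
  unfolding turn_def by (simp add: bend_lifts)

text \<open>The lifts are \<open>s0 < s3 < s2 < s1 < s0 + 1\<close>. The sum of the turning angles telescopes, and once around the
  polygon the angle increases by \<open>2\<pi>\<close>.\<close>

lemma backward_total_turn:
  assumes "backward R" "backward (relabel (relabel R))"
  shows "turn R + turn (relabel R) + turn (relabel (relabel R)) + turn (relabel (relabel (relabel R))) = 2 * pi"
proof -
  obtain R0 R1 R2 R3 where R: "R = (R0, R1, R2, R3)" by (metis prod_cases4)
  have "cyc3 R0 R2 R1" using assms(1) cyc3_rotate unfolding backward_def R by simp
  then obtain s0 s2 s1 where s: "lifts R0 R2 R1 s0 s2 s1" unfolding cyc3_def by blast
  have "cyc3 R0 R3 R2" using assms(2) unfolding backward_def R by simp
  then obtain s3 e where e: "lifts R0 R3 R2 s0 s3 e" by (rule cyc3_from[of _ _ _ s0]) (use s in \<open>auto simp: lifts_def\<close>)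
  have es: "e = s2" by (rule q_eq_in_period[of _ _ s0]) (use s e in \<open>auto simp: lifts_def\<close>)
  note se = s e[unfolded es]
  have "turn R = angle s1 (s0 + 1) - angle s2 s1"
    by (rule turn_lifts) (use se in \<open>auto simp: R lifts_def N0\<close>)
  moreover have "turn (relabel R) = angle s2 s1 - angle s3 s2"
    by (rule turn_lifts) (use se in \<open>auto simp: R lifts_def N0\<close>)
  moreover have "turn (relabel (relabel R)) = angle s3 s2 - angle s0 s3"
    by (rule turn_lifts) (use se in \<open>auto simp: R lifts_def N0\<close>)
  moreover have "turn (relabel (relabel (relabel R))) = angle (s0 + 1) (s3 + 1) - angle s1 (s0 + 1)"
    by (rule turn_lifts) (use se in \<open>auto simp: R lifts_def N0\<close>)
  moreover have "angle (s0 + 1) (s3 + 1) = angle s0 s3 + 2 * pi"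
    using angle_shift[of s0 s3 1] se by (simp add: lifts_def)
  ultimately show ?thesis by simp
qed

text \<open>The quotients of the sides and the diagonal of the rectangle are explicit complex numbers. With the order
  reversed the rectangle turns to the right.\<close>

lemma backward_signs:
  assumes R: "R \<in> Ins" and b: "backward R"
  shows "sin (bend1 (v2 R) (v1 R) (v0 R)) < 0" "sin (bend2 (v2 R) (v1 R) (v0 R)) < 0"
    "sin (turn R) = -1" "cos (turn R) = 0"
proof -
  obtain z w r where q: "w \<noteq> 0" "r > 0" "R = quad_of z w r" by (rule inscribed_quad_of[OF R])
  obtain a b d where l: "lifts (v2 R) (v1 R) (v0 R) a b d" using b unfolding backward_def cyc3_def by blast
  have ri: "of_real r * \<i> \<noteq> 0" "1 + of_real r * \<i> \<noteq> 0" using q(2) by (auto simp: complex_eq_iff)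
  have e: "v1 R - v2 R = - (of_real r * \<i>) * w" "v0 R - v1 R = - w" "v0 R - v2 R = - (1 + of_real r * \<i>) * w"
    unfolding q(3) quad_of_def by (simp_all add: scaleR_conv_of_real algebra_simps)
  have quot: "(v0 R - v2 R) / (v1 R - v2 R) = Complex 1 (- 1 / r)" "(v0 R - v1 R) / (v0 R - v2 R) = 1 / (1 + of_real r * \<i>)"
    "(v0 R - v1 R) / (v1 R - v2 R) = Complex 0 (- 1 / r)"
  proof -
    define k where "k = of_real r * \<i>"
    have k: "k \<noteq> 0" "1 + k \<noteq> 0" using ri unfolding k_def by auto
    have m: "- w = (- 1) * w" by simp
    have "(- (1 + k) * w) / (- k * w) = (1 + k) / k" "(- 1 * w) / (- (1 + k) * w) = 1 / (1 + k)" "(- 1 * w) / (- k * w) = 1 / k"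
      unfolding mult_divide_mult_cancel_right[OF q(1)] by (simp_all only: minus_divide_divide)
    moreover have "(1 + k) / k = Complex 1 (- 1 / r)" "1 / k = Complex 0 (- 1 / r)"
      unfolding k_def using q(2) by (simp_all add: complex_eq_iff Re_divide Im_divide power2_eq_square)
    ultimately show "(v0 R - v2 R) / (v1 R - v2 R) = Complex 1 (- 1 / r)" "(v0 R - v1 R) / (v0 R - v2 R) = 1 / (1 + of_real r * \<i>)"
      "(v0 R - v1 R) / (v1 R - v2 R) = Complex 0 (- 1 / r)"
      unfolding e k_def[symmetric] m by simp_all
  qed
  have sgn: "sin (Im F) < 0" if "exp F = c" "Im c < 0" for F c
  proof -
    have "exp (Re F) * sin (Im F) < 0" using that Im_exp[of F] by simp
    then show ?thesis by (simp add: mult_less_0_iff)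
  qed
  have 1: "Im (Complex 1 (- 1 / r)) < 0" "Im (Complex 0 (- 1 / r)) < 0" using q by auto
  have 2: "Im (1 / (1 + of_real r * \<i>)) < 0"
  proof -
    have "0 < 1 + r\<^sup>2" by (simp add: add_pos_nonneg)
    then show ?thesis using q(2) by (simp add: Im_divide divide_less_0_iff)
  qed
  show "sin (bend1 (v2 R) (v1 R) (v0 R)) < 0"
    using sgn[OF exp_bend(1)[OF l, unfolded quot] 1(1)] unfolding bend_lifts(1)[OF l] angle_def by simp
  show "sin (bend2 (v2 R) (v1 R) (v0 R)) < 0"
    using sgn[OF exp_bend(2)[OF l, unfolded quot] 2] unfolding bend_lifts(2)[OF l] angle_def by simp
  have n: "sin (turn R) < 0"
    using sgn[OF exp_bend(3)[OF l, unfolded quot] 1(2)] unfolding turn_lifts[OF l] angle_def by simp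
  show c: "cos (turn R) = 0"
    using arg_cong[OF exp_bend(3)[OF l, unfolded quot], of Re] unfolding turn_lifts[OF l] angle_def
    by (simp add: Re_exp)
  have "(sin (turn R))\<^sup>2 = 1" using sin_cos_squared_add[of "turn R"] c by simp
  then show "sin (turn R) = -1" using n by (simp add: power2_eq_1_iff)
qed

lemma continuous_on_bends:
  assumes "C \<subseteq> Ins" "\<And>R. R \<in> C \<Longrightarrow> backward R"
  shows "continuous_on C (\<lambda>R. bend1 (v2 R) (v1 R) (v0 R))" "continuous_on C (\<lambda>R. bend2 (v2 R) (v1 R) (v0 R))"
  using continuous_on_bend[OF continuous_on_vertices(3,2,1)] assms(2) unfolding backward_def by blast+

lemma turn_constant:
  assumes "connected C" "C \<subseteq> Ins" "\<And>R. R \<in> C \<Longrightarrow> backward R" "R \<in> C" "S \<in> C"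
  shows "turn R = turn S"
proof -
  have ct: "continuous_on C turn" unfolding turn_def by (intro continuous_on_add continuous_on_bends assms(2,3))
  have "\<i> * of_real (turn R) = \<i> * of_real (turn S)"
  proof (rule exp_constant_imp_constant[of C "\<lambda>R. \<i> * of_real (turn R)" "- \<i>"])
    show "continuous_on C (\<lambda>R. \<i> * complex_of_real (turn R))" by (intro continuous_intros ct)
    fix R assume R: "R \<in> C"
    then have "R \<in> Ins" "backward R" using assms by auto
    note b = backward_signs(3,4)[OF this]
    show "exp (\<i> * complex_of_real (turn R)) = - \<i>" unfolding cis_conv_exp[symmetric] using b by (simp add: complex_eq_iff)
  qed (use assms in auto)
  then show ?thesis by simp
qed

text \<open>Relabeling permutes the four turning angles, so they are equal on an elliptic component.\<close>

lemma elliptic_graceful: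
  assumes "elliptic (polygon_path N v) C" "R \<in> C" shows "cyclically_ordered (polygon_path N v) R"
proof -
  have C: "connected C" "C \<subseteq> Ins" "relabel ` C = C"
    using assms in_components_connected in_components_subset unfolding elliptic_def by blast+
  have rel: "relabel S \<in> C" if "S \<in> C" for S using C(3) that by blast
  have "forward R"
  proof (rule ccontr)
    assume "\<not> forward R"
    then have b: "backward S" if "S \<in> C" for S
      using forward_iff[OF C(1,2) that assms(2)] backward_iff C(2) that by blast
    have "turn (relabel R) = turn R" "turn (relabel (relabel R)) = turn R" "turn (relabel (relabel (relabel R))) = turn R"
      by (intro turn_constant[OF C(1,2) b] rel assms(2); assumption)+
    then have "turn R = pi / 2"
      using backward_total_turn[of R] b rel assms(2) by simp
    then have "sin (turn R) = 1" by (simp only: sin_pi_half)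
    moreover have "sin (turn R) = -1" using backward_signs(3)[OF _ b[OF assms(2)]] assms(2) C(2) by blast
    ultimately show False by simp
  qed
  moreover have "forward (relabel (relabel R))"
    using forward_constant[OF C(1,2) assms(2) _ calculation] rel assms(2) by blast
  ultimately show ?thesis by (rule forward_imp_cyclically_ordered)
qed

text \<open>The properties of hyperbolic components that are needed. They are inherited by relabeled copies, on
  which the roles of aspect ratios near \<open>0\<close> and near \<open>\<infinity>\<close> are exchanged.\<close>

definition spread :: "quad set \<Rightarrow> bool" where
  "spread D \<longleftrightarrow> connected D \<and> D \<subseteq> Ins \<and> (\<forall>K. \<exists>R\<in>D. aspect_ratio R > K) \<and> (\<forall>K>0. \<exists>R\<in>D. aspect_ratio R < K)"

lemma spread_relabel:
  assumes "spread D" shows "spread (relabel ` D)"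
proof -
  have D: "connected D" "D \<subseteq> Ins" "\<And>K. \<exists>R\<in>D. aspect_ratio R > K" "\<And>K. K > 0 \<Longrightarrow> \<exists>R\<in>D. aspect_ratio R < K"
    using assms unfolding spread_def by auto
  have a: "aspect_ratio (relabel R) = 1 / aspect_ratio R" "aspect_ratio R > 0" if "R \<in> D" for R
    using that D(2) relabel_rectangle(2) quad_of_aspect(1) inscribed_rect by blast+
  show ?thesis unfolding spread_def
  proof (intro conjI allI impI)
    show "connected (relabel ` D)" by (rule connected_continuous_image[OF continuous_on_relabel D(1)])
    show "relabel ` D \<subseteq> Ins" using D(2) relabel_inscribed by blast
    fix K :: real
    have "1 / (\<bar>K\<bar> + 1) > 0" by (simp add: add_nonneg_pos)
    then obtain R where R: "R \<in> D" "aspect_ratio R < 1 / (\<bar>K\<bar> + 1)" using D(4) by blast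
    have "K < 1 / aspect_ratio R"
    proof -
      have "aspect_ratio R * (\<bar>K\<bar> + 1) < 1" using R(2) by (simp add: less_divide_eq)
      then have "\<bar>K\<bar> + 1 < 1 / aspect_ratio R" using a(2)[OF R(1)] by (simp add: less_divide_eq mult.commute)
      then show ?thesis by linarith
    qed
    then show "\<exists>R\<in>relabel ` D. K < aspect_ratio R" using a(1)[OF R(1)] R(1) by force
  next
    fix K :: real assume K: "0 < K"
    obtain R where R: "R \<in> D" "aspect_ratio R > 1 / K" using D(3)[of "1 / K"] by auto
    have "1 / aspect_ratio R < K" using R(2) K a(2)[OF R(1)] by (simp add: divide_less_eq mult.commute)
    then show "\<exists>R\<in>relabel ` D. aspect_ratio R < K" using a(1)[OF R(1)] R(1) by force
  qed
qed

text \<open>The two triples differ by the exchange of \<open>R\<^sub>0\<close> and \<open>R\<^sub>3\<close>, which are close to each other compared to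
  the other distances.\<close>

lemma forward_relabel_of_flat:
  assumes c: "c > 0" "\<And>s t. s \<le> t \<Longrightarrow> t \<le> s + 1 \<Longrightarrow> c * min (t - s) (1 - (t - s)) \<le> cmod (q t - q s)"
    and L: "L > 0" "\<And>s t. cmod (q t - q s) \<le> L * \<bar>t - s\<bar>"
    and R: "R \<in> Ins" and flat: "aspect_ratio R < c / L"
  shows "forward R \<longleftrightarrow> forward (relabel R)"
proof -
  obtain z w r where Q: "w \<noteq> 0" "r > 0" "R = quad_of z w r" "aspect_ratio R = r" by (rule inscribed_quad_of[OF R])
  have Lr: "L * r < c" using flat L(1) unfolding Q(4) by (simp add: less_divide_eq mult.commute)
  have w: "cmod w > 0" using Q(1) by simp
  \<comment> \<open>The short sides are \<open>R\<^sub>1 R\<^sub>2\<close> and \<open>R\<^sub>3 R\<^sub>0\<close>.\<close>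
  have big: "cmod w \<le> cmod ((1 + r *\<^sub>R \<i>) * w)" "cmod w \<le> cmod ((- 1 + r *\<^sub>R \<i>) * w)"
    using abs_Re_le_cmod[of "1 + r *\<^sub>R \<i>"] abs_Re_le_cmod[of "- 1 + r *\<^sub>R \<i>"] w by (simp_all add: norm_mult)
  have short: "L * (r * cmod w) < c * cmod w" using Lr w by (simp flip: mult.assoc)
  have sh: "cmod (v3 R - v0 R) = r * cmod w" "cmod (v0 R - v3 R) = r * cmod w"
    unfolding Q(3) quad_of_def using Q(2) by (simp_all add: norm_mult)
  have eq: "v0 R - v1 R = - w" "v0 R - v2 R = - ((1 + r *\<^sub>R \<i>) * w)"
    "v3 R - v1 R = (- 1 + r *\<^sub>R \<i>) * w" "v3 R - v2 R = - w"
    "v2 R - v0 R = (1 + r *\<^sub>R \<i>) * w" "v1 R - v3 R = - ((- 1 + r *\<^sub>R \<i>) * w)"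
    "v1 R - v0 R = w" "v2 R - v3 R = w"
    unfolding Q(3) quad_of_def by (simp_all add: algebra_simps scaleR_conv_of_real)
  have B: "L * (r * cmod w) < c * cmod ((1 + r *\<^sub>R \<i>) * w)" "L * (r * cmod w) < c * cmod ((- 1 + r *\<^sub>R \<i>) * w)"
    using short mult_left_mono[OF big(1), of c] mult_left_mono[OF big(2), of c] c(1) by linarith+
  have "cyc3 (v1 R) (v2 R) (v0 R) \<longleftrightarrow> cyc3 (v1 R) (v2 R) (v3 R)"
  proof
    assume h: "cyc3 (v1 R) (v2 R) (v0 R)"
    have n: "L * cmod (v3 R - v0 R) < c * cmod (v0 R - v2 R)" "L * cmod (v3 R - v0 R) < c * cmod (v1 R - v0 R)"
      unfolding sh eq norm_minus_cancel by (rule B short)+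
    show "cyc3 (v1 R) (v2 R) (v3 R)"
      by (rule cyc3_perturb[OF c L h vertices_in_range(4)[OF R] n])
  next
    assume h: "cyc3 (v1 R) (v2 R) (v3 R)"
    have n: "L * cmod (v0 R - v3 R) < c * cmod (v3 R - v2 R)" "L * cmod (v0 R - v3 R) < c * cmod (v1 R - v3 R)"
      unfolding sh eq norm_minus_cancel by (rule B short)+
    show "cyc3 (v1 R) (v2 R) (v0 R)"
      by (rule cyc3_perturb[OF c L h vertices_in_range(1)[OF R] n])
  qed
  moreover have "forward R \<longleftrightarrow> cyc3 (v1 R) (v2 R) (v0 R)" unfolding forward_def using cyc3_rotate by blast
  moreover have "forward (relabel R) \<longleftrightarrow> cyc3 (v1 R) (v2 R) (v3 R)" unfolding forward_def Q(3) quad_of_def by simp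
  ultimately show ?thesis by simp
qed

lemma spread_forward_relabel:
  assumes D: "spread D" and R: "R \<in> D"
  shows "forward R \<longleftrightarrow> forward (relabel R)"
proof -
  obtain c L where cL: "c > 0" "L > 0" "\<And>s t. cmod (q t - q s) \<le> L * \<bar>t - s\<bar>"
    "\<And>s t. s \<le> t \<Longrightarrow> t \<le> s + 1 \<Longrightarrow> c * min (t - s) (1 - (t - s)) \<le> cmod (q t - q s)" by (rule bi_Lipschitz) (rule that)
  obtain S where S: "S \<in> D" "aspect_ratio S < c / L" using D cL(1,2) divide_pos_pos[of c L] unfolding spread_def by blast
  have SI: "S \<in> Ins" using S(1) D unfolding spread_def by blast
  have "forward S \<longleftrightarrow> forward (relabel S)" by (rule forward_relabel_of_flat[OF cL(1,4,2,3) SI S(2)])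
  moreover have "forward R \<longleftrightarrow> forward S" using forward_iff D R S unfolding spread_def by blast
  moreover have "forward (relabel R) \<longleftrightarrow> forward (relabel S)"
    using forward_iff[of "relabel ` D"] spread_relabel[OF D] R S unfolding spread_def by blast
  ultimately show ?thesis by simp
qed

text \<open>With negative sine throughout, each of the two parts of the turning angle stays in one interval of
  length \<open>\<pi>\<close>. Where \<open>R\<^sub>0 R\<^sub>1\<close> is the short side the first part is between \<open>-\<pi>/2\<close> and \<open>0\<close>, and where \<open>R\<^sub>1 R\<^sub>2\<close> is
  the short side the second one is.\<close>

lemma spread_turn_neg:
  assumes D: "spread D" and b: "\<And>R. R \<in> D \<Longrightarrow> backward R" and R: "R \<in> D"
  shows "turn R < 0"
proof -
  obtain c L where cL: "c > 0" "L > 0" "\<And>s t. cmod (q t - q s) \<le> L * \<bar>t - s\<bar>"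
    "\<And>s t. s \<le> t \<Longrightarrow> t \<le> s + 1 \<Longrightarrow> c * min (t - s) (1 - (t - s)) \<le> cmod (q t - q s)" by (rule bi_Lipschitz) (rule that)
  have D': "connected D" "D \<subseteq> Ins" "\<exists>R\<in>D. aspect_ratio R > L / c" "\<exists>R\<in>D. aspect_ratio R < c / L"
    using D cL(1,2) divide_pos_pos[of c L] unfolding spread_def by auto
  have sides: "cmod (v1 R - v2 R) = aspect_ratio R * cmod (v0 R - v1 R) \<and> cmod (v0 R - v1 R) > 0" if RD: "R \<in> D" for R
  proof -
    have "R \<in> Ins" using RD D'(2) by blast
    then obtain z w r where Q: "w \<noteq> 0" "r > 0" "R = quad_of z w r" "aspect_ratio R = r" by (rule inscribed_quad_of)
    then show ?thesis unfolding Q(4) unfolding Q(3) quad_of_def by (simp add: norm_mult)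
  qed
  obtain S where S: "S \<in> D" "aspect_ratio S > L / c" using D'(3) by blast
  obtain S' where S': "S' \<in> D" "aspect_ratio S' < c / L" using D'(4) by blast
  have "L < c * aspect_ratio S" using S(2) cL(1) by (simp add: divide_less_eq mult.commute)
  then have n1: "L * cmod (v0 S - v1 S) < c * cmod (v1 S - v2 S)" using sides[OF S(1)] by (simp flip: mult.assoc)
  have "L * aspect_ratio S' < c" using S'(2) cL(2) by (simp add: less_divide_eq mult.commute)
  then have n2: "L * cmod (v1 S' - v2 S') < c * cmod (v0 S' - v1 S')" using sides[OF S'(1)] by (simp flip: mult.assoc)
  have "bend1 (v2 R) (v1 R) (v0 R) < 0"
  proof (rule sin_neg_constant_sign[OF D'(1) continuous_on_bends(1)[OF D'(2) b] _ S(1) _ R])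
    show "sin (bend1 (v2 p) (v1 p) (v0 p)) < 0" if "p \<in> D" for p using backward_signs(1) b that D'(2) by blast
    show "\<bar>bend1 (v2 S) (v1 S) (v0 S)\<bar> < pi / 2"
      by (rule bend1_near[OF cL(1,4,2,3) b[OF S(1), unfolded backward_def] n1])
  qed
  moreover have "bend2 (v2 R) (v1 R) (v0 R) < 0"
  proof (rule sin_neg_constant_sign[OF D'(1) continuous_on_bends(2)[OF D'(2) b] _ S'(1) _ R])
    show "sin (bend2 (v2 p) (v1 p) (v0 p)) < 0" if "p \<in> D" for p using backward_signs(2) b that D'(2) by blast
    show "\<bar>bend2 (v2 S') (v1 S') (v0 S')\<bar> < pi / 2"
      by (rule bend2_near[OF cL(1,4,2,3) b[OF S'(1), unfolded backward_def] n2])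
  qed
  ultimately show ?thesis unfolding turn_def by simp
qed

lemma spread_graceful:
  assumes D: "spread D" and R: "R \<in> D" shows "cyclically_ordered (polygon_path N v) R"
proof -
  define Ds where "Ds = (\<lambda>j. (relabel ^^ j) ` D)"
  have Ds: "spread (Ds j)" for j
  proof (induction j)
    case (Suc j)
    have "Ds (Suc j) = relabel ` Ds j" unfolding Ds_def by (simp add: image_comp)
    then show ?case using spread_relabel[OF Suc] by simp
  qed (use D in \<open>simp add: Ds_def\<close>)
  have fw: "forward ((relabel ^^ j) S) \<longleftrightarrow> forward S" if "S \<in> D" for j S
  proof (induction j)
    case (Suc j)
    have "(relabel ^^ j) S \<in> Ds j" using that unfolding Ds_def by blast
    then show ?case using spread_forward_relabel[OF Ds] Suc by simp
  qed simp
  have "forward R"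
  proof (rule ccontr)
    assume n: "\<not> forward R"
    have bw: "backward S" if S: "S \<in> Ds j" for S j
    proof -
      obtain S' where S': "S' \<in> D" "S = (relabel ^^ j) S'" using S unfolding Ds_def by blast
      have "forward S' \<longleftrightarrow> forward R" using forward_iff D S'(1) R unfolding spread_def by blast
      then have "\<not> forward S" using n fw[OF S'(1)] S'(2) by simp
      moreover have "S \<in> Ins" using S Ds[of j] unfolding spread_def by blast
      ultimately show ?thesis using backward_iff by blast
    qed
    have m: "(relabel ^^ j) R \<in> Ds j" for j using R unfolding Ds_def by blast
    have neg: "turn ((relabel ^^ j) R) < 0" for j by (rule spread_turn_neg[OF Ds bw m])
    have "turn R + turn (relabel R) + turn (relabel (relabel R)) + turn (relabel (relabel (relabel R))) = 2 * pi"
      using backward_total_turn[of R] bw[OF m[of 0]] bw[OF m[of 2]] by (simp add: numeral_2_eq_2)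
    moreover have "turn R < 0" "turn (relabel R) < 0" "turn (relabel (relabel R)) < 0" "turn (relabel (relabel (relabel R))) < 0"
      using neg[of 0] neg[of 1] neg[of 2] neg[of 3] by (simp_all add: numeral_2_eq_2 numeral_3_eq_3)
    ultimately show False using pi_gt_zero by linarith
  qed
  moreover have "forward (relabel (relabel R))" using fw[OF R, of 2] calculation by (simp add: numeral_2_eq_2)
  ultimately show ?thesis by (rule forward_imp_cyclically_ordered)
qed

lemma hyperbolic_spread:
  assumes "hyperbolic (polygon_path N v) C" shows "spread C"
proof -
  obtain f where f0: "arc_component_param Ins C f" "ratio_to_zero f (at_right 0)" "ratio_to_infinity f (at_left 1)"
    using assms unfolding hyperbolic_def by blast
  then obtain g where g: "homeomorphism {0<..<1} C f g" unfolding arc_component_param_def by blast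
  have f: "C \<in> components Ins" "homeomorphism {0<..<1} C f g"
    "((\<lambda>t. aspect_ratio (f t)) \<longlongrightarrow> 0) (at_right 0)" "filterlim (\<lambda>t. aspect_ratio (f t)) at_top (at_left 1)"
    using f0 g unfolding arc_component_param_def ratio_to_zero_def ratio_to_infinity_def by auto
  have fC: "f t \<in> C" if "t \<in> {0<..<1::real}" for t using homeomorphism_image1[OF f(2)] that by blast
  have "\<exists>R\<in>C. aspect_ratio R < K" if "K > 0" for K
  proof -
    have "\<forall>\<^sub>F t in at_right 0. aspect_ratio (f t) < K" by (rule order_tendstoD(2)[OF f(3) that])
    moreover have "\<forall>\<^sub>F t in at_right 0. t \<in> {0<..<1::real}" by (rule eventually_at_right_real) simp
    ultimately have "\<forall>\<^sub>F t in at_right 0. t \<in> {0<..<1::real} \<and> aspect_ratio (f t) < K" by eventually_elim simp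
    then obtain t where "t \<in> {0<..<1::real}" "aspect_ratio (f t) < K"
      using eventually_happens'[OF trivial_limit_at_right_real] by blast
    then show ?thesis using fC by blast
  qed
  moreover have "\<exists>R\<in>C. aspect_ratio R > K" for K
  proof -
    have "\<forall>\<^sub>F t in at_left 1. aspect_ratio (f t) > K" using f(4) unfolding filterlim_at_top_dense by blast
    moreover have "\<forall>\<^sub>F t in at_left 1. t \<in> {0<..<1::real}" by (rule eventually_at_left_real) simp
    ultimately have "\<forall>\<^sub>F t in at_left 1. t \<in> {0<..<1::real} \<and> aspect_ratio (f t) > K" by eventually_elim simp
    then obtain t where "t \<in> {0<..<1::real}" "aspect_ratio (f t) > K"
      using eventually_happens'[OF trivial_limit_at_left_real] by blast
    then show ?thesis using fC by blast
  qed
  ultimately show ?thesis unfolding spread_def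
    using in_components_connected[OF f(1)] in_components_subset[OF f(1)] by blast
qed

theorem global_component_graceful:
  assumes "global_component (polygon_path N v) C"
  shows "C \<subseteq> gracefully_inscribed (polygon_path N v)"
proof
  fix R assume R: "R \<in> C"
  have "C \<in> components Ins"
    using assms unfolding global_component_def hyperbolic_def elliptic_def arc_component_param_def by blast
  then have "R \<in> Ins" using R in_components_subset by blast
  moreover have "cyclically_ordered (polygon_path N v) R"
    using assms unfolding global_component_def
  proof
    assume "hyperbolic (polygon_path N v) C"
    then show ?thesis by (rule spread_graceful[OF hyperbolic_spread R])
  next
    assume "elliptic (polygon_path N v) C"
    then show ?thesis by (rule elliptic_graceful[OF _ R])
  qed
  ultimately show "R \<in> gracefully_inscribed (polygon_path N v)" unfolding gracefully_inscribed_def by simp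
qed

end

section \<open>Inscribed rectangles of generic polygons\<close>

theorem theorem1p6:
  shows "\<exists>P :: nat \<Rightarrow> (nat \<Rightarrow> complex) set. \<forall>N\<ge>3.
     openin (ngon_space N) (P N) \<and>
     ngon_space N closure_of P N = topspace (ngon_space N) \<and>
     (\<forall>v \<in> P N. \<forall>\<gamma>. \<gamma> = polygon_path N v \<longrightarrow>
        (piecewise_smooth_1_manifold (inscribed \<gamma>) \<and>
         (\<forall>C. arc_component (inscribed \<gamma>) C \<longrightarrow> proper_arc \<gamma> C) \<and>
         (\<forall>x. smooth_point (inscribed \<gamma>) x \<longrightarrow>
            (\<exists>U. openin (top_of_set (inscribed \<gamma>)) U \<and> x \<in> U \<and> inj_on aspect_ratio U)) \<and>
         (\<forall>x \<in> inscribed \<gamma>. aspect_ratio x = 1 \<longrightarrow> smooth_point (inscribed \<gamma>) x)) \<and>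
        (\<forall>C. global_component \<gamma> C \<longrightarrow> C \<subseteq> gracefully_inscribed \<gamma>))"
proof -
  have "\<exists>A. ngon_generic N A \<and> (\<forall>v\<in>A. is_ngon N v \<longrightarrow> generic_ngon N v)" if "N \<ge> 3" for N
    by (rule generic_ngon_generic[OF that]) blast
  then obtain A where A: "\<And>N. N \<ge> 3 \<Longrightarrow> ngon_generic N (A N)"
    "\<And>N v. N \<ge> 3 \<Longrightarrow> v \<in> A N \<Longrightarrow> is_ngon N v \<Longrightarrow> generic_ngon N v"
    by metis
  define P where "P N = topspace (ngon_space N) \<inter> A N" for N
  show ?thesis
  proof (intro exI[of _ P] allI impI)
    fix N :: nat assume N: "3 \<le> N"
    have main: "(piecewise_smooth_1_manifold (inscribed \<gamma>) \<and>
         (\<forall>C. arc_component (inscribed \<gamma>) C \<longrightarrow> proper_arc \<gamma> C) \<and>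
         (\<forall>x. smooth_point (inscribed \<gamma>) x \<longrightarrow>
            (\<exists>U. openin (top_of_set (inscribed \<gamma>)) U \<and> x \<in> U \<and> inj_on aspect_ratio U)) \<and>
         (\<forall>x \<in> inscribed \<gamma>. aspect_ratio x = 1 \<longrightarrow> smooth_point (inscribed \<gamma>) x)) \<and>
        (\<forall>C. global_component \<gamma> C \<longrightarrow> C \<subseteq> gracefully_inscribed \<gamma>)"
      if v: "v \<in> P N" and \<gamma>: "\<gamma> = polygon_path N v" for v \<gamma>
    proof -
      have ng: "is_ngon N v" using v unfolding P_def topspace_ngon_space by blast
      then interpret generic_polygon N v
        using N v A(2) unfolding P_def by unfold_locales auto
      interpret ngon_loop N v using N ng by unfold_locales
      show ?thesis unfolding \<gamma>
        using inscribed_piecewise_smooth arc_component_proper aspect_ratio_locally_injective square_smooth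
          global_component_graceful by blast
    qed
    show "openin (ngon_space N) (P N) \<and>
     ngon_space N closure_of P N = topspace (ngon_space N) \<and>
     (\<forall>v \<in> P N. \<forall>\<gamma>. \<gamma> = polygon_path N v \<longrightarrow>
        (piecewise_smooth_1_manifold (inscribed \<gamma>) \<and>
         (\<forall>C. arc_component (inscribed \<gamma>) C \<longrightarrow> proper_arc \<gamma> C) \<and>
         (\<forall>x. smooth_point (inscribed \<gamma>) x \<longrightarrow>
            (\<exists>U. openin (top_of_set (inscribed \<gamma>)) U \<and> x \<in> U \<and> inj_on aspect_ratio U)) \<and>
         (\<forall>x \<in> inscribed \<gamma>. aspect_ratio x = 1 \<longrightarrow> smooth_point (inscribed \<gamma>) x)) \<and>
        (\<forall>C. global_component \<gamma> C \<longrightarrow> C \<subseteq> gracefully_inscribed \<gamma>))"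
      using ngon_generic_open_dense[OF N A(1)[OF N]] main unfolding P_def by blast
  qed
qed

end
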